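(* Let $\mathcal B$ be (the algebra of) a quantum projective space, with first order differential calculus $\Omega=\Omega_+\oplus\Omega_-$, and let $$g:=g_{+-}+g_{-+}\in\Omega\otimes_{\mathcal B}\Omega,\qquad g_{+-}=\mathsf E'_{12}\mathsf E_{23}\,\partial p\otimes\bar\partial p,\qquad g_{-+}=\mathsf E'_{12}\mathsf E_{23}\,\bar\partial p\otimes\partial p .$$ Let $(\cdot,\cdot):\Omega\otimes_{\mathcal B}\Omega\to\mathcal B$ be the $\mathcal B$-bimodule map which vanishes on $\Omega_+\otimes_{\mathcal B}\Omega_+$ and on $\Omega_-\otimes_{\mathcal B}\Omega_-$ and satisfies $$(\bar\partial p,\partial p)=\mathsf C'_2\,p-q^{-(\omega_s,2\rho)}\,p\,p,\qquad (\partial p,\bar\partial p)=q^{(\alpha_s,\alpha_s)}q^{-(\omega_s,\omega_s+2\rho)}\,\mathsf S_{123}\mathsf C_3\,p-q^{(\alpha_s,\alpha_s)}q^{-(\omega_s,2\rho)}\,p\,p .$$ Write $g=g^{(1)}\otimes g^{(2)}$ (summation understood). Then for every $\omega\in\Omega$ $$g^{(1)}\,(g^{(2)},\omega)=\omega=(\omega,g^{(1)})\,g^{(2)} .$$ Hence $g$ is a quantum metric. Moreover, in the classical limit $g$ reduces to the Fubini--Study metric.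
   Context: Quantum group. $0<q<1$ is real, $\mathfrak g=\mathfrak{sl}_{r+1}(\mathbb C)$ with $r\ge 1$, simple roots $\alpha_1,\dots,\alpha_r$, fundamental weights $\omega_i$, $\rho$ the half-sum of positive roots, $w_0$ the longest Weyl group element, $(\cdot,\cdot)$ (on weights) the standard symmetric bilinear form with $(\alpha_i,\alpha_i)=2$. $U_q(\mathfrak g)$ has generators $K_i^{\pm1},E_i,F_i$ with the standard (Klimyk--Schmüdgen) relations, and $\Delta(K_i)=K_i\otimes K_i$, $\Delta(E_i)=E_i\otimes K_i+1\otimes E_i$, $\Delta(F_i)=F_i\otimes 1+K_i^{-1}\otimes F_i$, $S(K_i)=K_i^{-1}$, $S(E_i)=-E_iK_i^{-1}$, $S(F_i)=-K_iF_i$. $V(\lambda)$ is the simple (type 1) module of highest weight $\lambda$; duals carry $(Xf)(v)=f(S(X)v)$. $\hat R_{V,W}:V\otimes W\to W\otimes V$ is the braiding of the category of finite-dimensional (type 1) modules determined on simple modules by $\hat R_{V(\lambda),V(\mu)}(v_\lambda\otimes v_{w_0\mu})=q^{(\lambda,w_0\mu)}v_{w_0\mu}\otimes v_\lambda$ for $v_\lambda$ a highest weight vector and $v_{w_0\mu}$ a lowest weight vector. Choose $\omega_s=\omega_1$ or $\omega_s=\omega_r$ (with $\alpha_s$ the corresponding simple root) and $V=V(\omega_s)$, $N=\dim V$, weight basis $\{e_i\}$ of $V$ with $\lambda_i$ the weight of $e_i$, dual basis $\{e^i\}$ of $V^*$. Put $\mathsf E(e^i\otimes e_j)=\delta_{ij}$,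 $\mathsf E'(e_i\otimes e^j)=q^{(2\rho,\lambda_i)}\delta_{ij}$, $\mathsf C=\sum_i e_i\otimes e^i\in V\otimes V^*$, $\mathsf C'=\sum_i q^{-(2\rho,\lambda_i)}e^i\otimes e_i\in V^*\otimes V$. Index-free notation. Families of elements with several indices are regarded as elements of (module)$\otimes$(tensor product of copies of $V,V^*$): $f=\sum_i f^i\otimes e_i$, $v=\sum_i v^i\otimes e^i$, $p=\sum_{i,j}p^{ij}\otimes e_i\otimes e^j$, $\partial p=\sum\partial p^{ij}\otimes e_i\otimes e^j$, similarly $\bar\partial p$; products and tensor products multiply the module components and concatenate the legs, e.g. $p\,\partial p=\sum p^{ij}\partial p^{kl}\otimes e_i\otimes e^j\otimes e_k\otimes e^l$. Maps on modules act on components. Operators with subscripts act on the legs in the indicated positions, composed right to left; $\mathsf E_{i,i+1},\mathsf E'_{i,i+1}$ contract legs $i,i+1$; $\mathsf C_i,\mathsf C'_i$ insert $\mathsf C,\mathsf C'$ immediately before leg $i$ (at the end if there is no leg $i$). Thus $g_{+-}=\sum_{i,j}q^{(2\rho,\lambda_i)}\partial p^{ij}\otimes\bar\partial p^{ji}$, etc. Algebra. $\mathcal A$ is the algebra with generators $f^i,v^i$ ($1\le i\le N$) and relations $ff=q^{-(\omega_s,\omega_s)}(\hat R_{V,V})_{12}ff$, $vv=q^{-(\omega_s,\omega_s)}(\hat R_{V^*,V^*})_{12}vv$, $vf=q^{(\omega_s,\omega_s)}(\hat R_{V,V^*})_{12}fv$, $\mathsf E_{12}vf=1$; it is graded by $\deg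 f^i=1$, $\deg v^i=-1$. The quantum projective space is the degree-zero subalgebra $\mathcal B\subset\mathcal A$, generated by $p^{ij}=f^iv^j$. Calculus. Put $\mathsf S_{123}=(\hat R_{V,V^*})_{23}(\hat R_{V,V})_{12}(\hat R_{V,V^*}^{-1})_{23}$, $\tilde{\mathsf S}_{234}=(\hat R_{V,V^*})_{23}(\hat R^{-1}_{V^*,V^*})_{34}(\hat R^{-1}_{V,V^*})_{23}$, $\mathsf T_{1234}=\mathsf S_{123}\tilde{\mathsf S}_{234}$ (and shifted versions). $\Omega_+$ is the left $\mathcal B$-module generated by the $\partial p^{ij}$ with relations $(\tilde{\mathsf S}_{234}-q^{-(\omega_s,\omega_s)})p\,\partial p=0$, $\mathsf E'_{12}\partial p=0$, and $\Omega_-$ the left $\mathcal B$-module generated by the $\bar\partial p^{ij}$ with relations $(\mathsf S_{123}-q^{(\omega_s,\omega_s)})p\,\bar\partial p=0$, $\mathsf E'_{12}\bar\partial p=0$. They are $\mathcal B$-bimodules via $\partial p\,p=q^{(\alpha_s,\alpha_s)}\mathsf T_{1234}\,p\,\partial p$, $\bar\partial p\,p=q^{-(\alpha_s,\alpha_s)}\mathsf T_{1234}\,p\,\bar\partial p$. $\Omega=\Omega_+\oplus\Omega_-$ with $d=\partial+\bar\partial$, where $\partial:\mathcal B\to\Omega_+$, $\bar\partial:\mathcal B\to\Omega_-$ are the derivations sending $p^{ij}$ to $\partial p^{ij}$, $\bar\partial p^{ij}$. Quantum metric. An element $g\in\Omega\otimes_{\mathcal B}\Omega$ is a quantum metric if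 there is a $\mathcal B$-bimodule map $(\cdot,\cdot):\Omega\otimes_{\mathcal B}\Omega\to\mathcal B$ with $(\omega,g^{(1)})g^{(2)}=\omega=g^{(1)}(g^{(2)},\omega)$ for all $\omega\in\Omega$. Classical limit. This means setting $q=1$ in the formula for $g$ and replacing $p^{ij}$ by the functions $p^{ij}=Z^i\bar Z^j/\|Z\|^2$ on $\mathbb CP^r$ ($Z$ homogeneous coordinates, $1\le i,j\le r+1$) and $\partial,\bar\partial$ by the Dolbeault operators, so that $g$ becomes $\sum_{i,j}(\partial p^{ij}\otimes\bar\partial p^{ji}+\bar\partial p^{ij}\otimes\partial p^{ji})$. The Fubini--Study metric is, in the coordinates $z^i=Z^i/Z^{r+1}$, $\sum_{i,j=1}^r\frac{(1+\|z\|^2)\delta_{ij}-\bar z^iz^j}{(1+\|z\|^2)^2}(dz^i\otimes d\bar z^j+d\bar z^j\otimes dz^i)$. *)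

theory Defs
  imports "HOL-Analysis.Analysis" "HOL-Library.Poly_Mapping" "HOL-Library.Function_Algebras"
begin

section \<open>Complex vector spaces and algebras\<close>

class complex_vector = ab_group_add +
  fixes scaleC :: "complex \<Rightarrow> 'a \<Rightarrow> 'a"  (infixr \<open>*C\<close> 75)
  assumes scaleC_add_right: "c *C (x + y) = c *C x + c *C y"
    and scaleC_add_left: "(c + d) *C x = c *C x + d *C x"
    and scaleC_scaleC: "c *C d *C x = (c * d) *C x"
    and scaleC_one: "1 *C x = x"

class complex_algebra = complex_vector + ring_1 +
  assumes mult_scaleC_left: "(c *C x) * y = c *C (x * y)"
    and mult_scaleC_right: "x * (c *C y) = c *C (x * y)"

lemma scaleC_zero_right [simp]: "c *C (0 :: 'a :: complex_vector) = 0"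
  using scaleC_add_right[of c 0 "0 :: 'a"] by simp

lemma scaleC_zero_left [simp]: "0 *C (x :: 'a :: complex_vector) = 0"
  using scaleC_add_left[of 0 0 x] by simp

instantiation complex :: complex_algebra
begin
definition "c *C x = c * (x :: complex)"
instance by standard (simp_all add: scaleC_complex_def algebra_simps)
end

instantiation "fun" :: (type, complex_vector) complex_vector
begin
definition "c *C f = (\<lambda>x. c *C f x)"
instance
  by standard (simp_all add: scaleC_fun_def fun_eq_iff scaleC_add_right scaleC_add_left
      scaleC_scaleC scaleC_one)
end

instantiation prod :: (complex_vector, complex_vector) complex_vector
begin
definition "c *C x = (c *C fst x, c *C snd x)"
instance
  by standard (simp_all add: scaleC_prod_def prod_eq_iff scaleC_add_right scaleC_add_left
      scaleC_scaleC scaleC_one)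
end

instantiation vec :: (complex_vector, finite) complex_vector
begin
definition "c *C x = (\<chi> i. c *C (x $ i))"
instance
  by standard (simp_all add: scaleC_vec_def vec_eq_iff scaleC_add_right scaleC_add_left
      scaleC_scaleC scaleC_one)
end

instantiation poly_mapping :: (type, complex_vector) complex_vector
begin
definition "c *C p = Poly_Mapping.map (scaleC c) p"

lemma lookup_scaleC:
  "Poly_Mapping.lookup (c *C p) k = c *C Poly_Mapping.lookup (p :: 'a \<Rightarrow>\<^sub>0 'b) k"
  by (simp add: scaleC_poly_mapping_def map.rep_eq when_def)

instance
  by standard (simp_all add: poly_mapping_eq_iff fun_eq_iff lookup_scaleC lookup_add
      scaleC_add_right scaleC_add_left scaleC_scaleC scaleC_one)
end

lemma Sum_any_scaleC:
  fixes F :: "'b \<Rightarrow> 'a :: complex_vector"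
  assumes "finite {x. F x \<noteq> 0}"
  shows "Sum_any (\<lambda>x. c *C F x) = c *C Sum_any F"
proof -
  have *: "c *C (\<Sum>x\<in>A. F x) = (\<Sum>x\<in>A. c *C F x)" for A
    by (induction A rule: infinite_finite_induct) (simp_all add: scaleC_add_right)
  have "Sum_any (\<lambda>x. c *C F x) = (\<Sum>x\<in>{x. F x \<noteq> 0}. c *C F x)"
    using assms by (intro Sum_any.expand_superset) auto
  also have "\<dots> = c *C Sum_any F"
    by (simp add: * Sum_any.expand_set)
  finally show ?thesis .
qed

instance poly_mapping :: (monoid_add, complex_algebra) complex_algebra
proof
  fix c :: complex and x y :: "'a \<Rightarrow>\<^sub>0 'b"
  have fin: "finite {q. Poly_Mapping.lookup y q \<noteq> 0}" for y :: "'a \<Rightarrow>\<^sub>0 'b"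
    by simp
  have fin1: "finite {l. Poly_Mapping.lookup x l * z l \<noteq> 0}" for z and x :: "'a \<Rightarrow>\<^sub>0 'b"
    by (rule finite_subset[OF _ fin[of x]]) auto
  have fin2: "finite {q. (Poly_Mapping.lookup y q when k = l + q) \<noteq> 0}" for k l and y :: "'a \<Rightarrow>\<^sub>0 'b"
    by (rule finite_subset[OF _ fin[of y]]) (auto simp: when_def)
  show "(c *C x) * y = c *C (x * y)"
    by (rule poly_mapping_eqI)
      (simp add: lookup_mult lookup_scaleC mult_scaleC_left Sum_any_scaleC fin1)
  have w: "(c *C a when P) = c *C (a when P)" for a :: 'b and P
    by (simp add: when_def)
  show "x * (c *C y) = c *C (x * y)"
    by (rule poly_mapping_eqI)
      (simp add: lookup_mult lookup_scaleC w Sum_any_scaleC[OF fin2] mult_scaleC_right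
        Sum_any_scaleC[OF fin1])
qed

definition complex_subspace :: "'a :: complex_vector set \<Rightarrow> bool" where
  "complex_subspace W \<longleftrightarrow>
     0 \<in> W \<and> (\<forall>x\<in>W. \<forall>y\<in>W. x + y \<in> W) \<and> (\<forall>c. \<forall>x\<in>W. c *C x \<in> W)"

definition two_sided_ideal :: "'a :: ring_1 set \<Rightarrow> bool" where
  "two_sided_ideal J \<longleftrightarrow>
     0 \<in> J \<and> (\<forall>x\<in>J. \<forall>y\<in>J. x + y \<in> J) \<and> (\<forall>x\<in>J. \<forall>a. a * x \<in> J \<and> x * a \<in> J)"


section \<open>Weights of the special linear Lie algebra of rank r\<close>

text \<open>
  Weights are written in the standard coordinates \<open>\<epsilon>\<^sub>1, \<dots>, \<epsilon>\<^sub>r\<^sub>+\<^sub>1\<close> with coordinate sum zero, so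
  that the form with \<open>(\<alpha>\<^sub>i, \<alpha>\<^sub>i) = 2\<close> is the dot product and the Weyl group permutes the
  coordinates.
\<close>

type_synonym weight = "nat \<Rightarrow> real"

definition wform :: "nat \<Rightarrow> weight \<Rightarrow> weight \<Rightarrow> real" where
  "wform r \<mu> \<nu> = (\<Sum>k=1..r+1. \<mu> k * \<nu> k)"

definition pos_root :: "nat \<Rightarrow> nat \<Rightarrow> weight" where
  "pos_root a b k = (if k = a then 1 else 0) - (if k = b then 1 else 0)"

definition simple_root :: "nat \<Rightarrow> weight" where
  "simple_root i = pos_root i (i + 1)"

definition fund_weight :: "nat \<Rightarrow> nat \<Rightarrow> weight" where
  "fund_weight r i k =
     (if k \<in> {1..r+1} then (if k \<le> i then 1 else 0) - real i / real (r + 1) else 0)"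

definition weight_lattice :: "nat \<Rightarrow> weight set" where
  "weight_lattice r =
     {\<mu>. \<exists>c :: nat \<Rightarrow> int. \<mu> = (\<lambda>k. \<Sum>i=1..r. of_int (c i) * fund_weight r i k)}"

text \<open>\<open>2\<rho>\<close>, the sum of the positive roots.\<close>
definition two_rho :: "nat \<Rightarrow> weight" where
  "two_rho r k = (\<Sum>a=1..r+1. \<Sum>b\<in>{a<..r+1}. pos_root a b k)"

text \<open>The longest Weyl group element is the order-reversing permutation of the coordinates.\<close>
definition longest_weyl :: "nat \<Rightarrow> weight \<Rightarrow> weight" where
  "longest_weyl r \<mu> k = (if k \<in> {1..r+1} then \<mu> (r + 2 - k) else 0)"


section \<open>Modules over the quantized enveloping algebra\<close>

definition qpow :: "real \<Rightarrow> real \<Rightarrow> complex" where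
  "qpow q x = complex_of_real (q powr x)"

text \<open>The generators \<open>K\<^sub>i\<close>, their inverses, \<open>E\<^sub>i\<close> and \<open>F\<^sub>i\<close>; only indices in \<open>{1..r}\<close> matter.\<close>
datatype uq_gen = gK nat | gKinv nat | gE nat | gF nat

definition uq_gens :: "nat \<Rightarrow> uq_gen set" where
  "uq_gens r = gK ` {1..r} \<union> gKinv ` {1..r} \<union> gE ` {1..r} \<union> gF ` {1..r}"

text \<open>
  A finite-dimensional module with a basis indexed by a finite type is given by the matrices of
  the generators (columns are the images of basis vectors).
\<close>
type_synonym 'n uq_rep = "uq_gen \<Rightarrow> complex^'n^'n"

definition uq_module :: "real \<Rightarrow> nat \<Rightarrow> 'n::finite uq_rep \<Rightarrow> bool" where
  "uq_module q r M \<longleftrightarrow> (\<forall>i\<in>{1..r}. \<forall>j\<in>{1..r}.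
     let a = wform r (simple_root i) (simple_root j);
         E = \<lambda>k. M (gE k); F = \<lambda>k. M (gF k); K = \<lambda>k. M (gK k); Ki = \<lambda>k. M (gKinv k);
         serre = \<lambda>A B :: complex^'n^'n.
           A ** A ** B - (qpow q 1 + qpow q (- 1)) *C (A ** B ** A) + B ** A ** A
     in K i ** Ki i = mat 1 \<and> Ki i ** K i = mat 1 \<and> K i ** K j = K j ** K i \<and>
        K i ** E j ** Ki i = qpow q a *C E j \<and>
        K i ** F j ** Ki i = qpow q (- a) *C F j \<and>
        E i ** F j - F j ** E i =
          (if i = j then inverse (qpow q 1 - qpow q (- 1)) *C (K i - Ki i) else 0) \<and>
        (i = j + 1 \<or> j = i + 1 \<longrightarrow> serre (E i) (E j) = 0 \<and> serre (F i) (F j) = 0) \<and>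
        (i > j + 1 \<or> j > i + 1 \<longrightarrow> E i ** E j = E j ** E i \<and> F i ** F j = F j ** F i))"

definition simple_module :: "nat \<Rightarrow> 'n::finite uq_rep \<Rightarrow> bool" where
  "simple_module r M \<longleftrightarrow> (\<forall>W :: (complex^'n) set.
     complex_subspace W \<and> (\<forall>X\<in>uq_gens r. \<forall>x\<in>W. M X *v x \<in> W) \<longrightarrow> W = {0} \<or> W = UNIV)"

definition weight_vector :: "real \<Rightarrow> nat \<Rightarrow> 'n::finite uq_rep \<Rightarrow> weight \<Rightarrow> complex^'n \<Rightarrow> bool" where
  "weight_vector q r M \<mu> x \<longleftrightarrow>
     x \<noteq> 0 \<and> (\<forall>k\<in>{1..r}. M (gK k) *v x = qpow q (wform r (simple_root k) \<mu>) *C x)"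

definition highest_weight_vector ::
    "real \<Rightarrow> nat \<Rightarrow> 'n::finite uq_rep \<Rightarrow> weight \<Rightarrow> complex^'n \<Rightarrow> bool" where
  "highest_weight_vector q r M \<mu> x \<longleftrightarrow>
     weight_vector q r M \<mu> x \<and> (\<forall>k\<in>{1..r}. M (gE k) *v x = 0)"

definition lowest_weight_vector ::
    "real \<Rightarrow> nat \<Rightarrow> 'n::finite uq_rep \<Rightarrow> weight \<Rightarrow> complex^'n \<Rightarrow> bool" where
  "lowest_weight_vector q r M \<mu> x \<longleftrightarrow>
     weight_vector q r M \<mu> x \<and> (\<forall>k\<in>{1..r}. M (gF k) *v x = 0)"

definition simple_highest_weight_module ::
    "real \<Rightarrow> nat \<Rightarrow> weight \<Rightarrow> 'n::finite uq_rep \<Rightarrow> bool" where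
  "simple_highest_weight_module q r \<mu> M \<longleftrightarrow>
     uq_module q r M \<and> simple_module r M \<and> (\<exists>x. highest_weight_vector q r M \<mu> x)"

definition kron :: "complex^'a^'a \<Rightarrow> complex^'b^'b \<Rightarrow> complex^('a::finite \<times> 'b::finite)^('a \<times> 'b)" where
  "kron A B = (\<chi> i j. A $ fst i $ fst j * B $ snd i $ snd j)"

definition tens_vec :: "complex^'a \<Rightarrow> complex^'b \<Rightarrow> complex^('a::finite \<times> 'b::finite)" where
  "tens_vec x y = (\<chi> i. x $ fst i * y $ snd i)"

text \<open>The coproduct acting on a tensor product.\<close>
fun tensor_rep :: "'a::finite uq_rep \<Rightarrow> 'b::finite uq_rep \<Rightarrow> ('a \<times> 'b) uq_rep" where
  "tensor_rep M N (gK k) = kron (M (gK k)) (N (gK k))"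
| "tensor_rep M N (gKinv k) = kron (M (gKinv k)) (N (gKinv k))"
| "tensor_rep M N (gE k) = kron (M (gE k)) (N (gK k)) + kron (mat 1) (N (gE k))"
| "tensor_rep M N (gF k) = kron (M (gF k)) (mat 1) + kron (M (gKinv k)) (N (gF k))"

text \<open>The dual module in the dual basis: the transposed matrices of the antipodes.\<close>
fun dual_rep :: "'n::finite uq_rep \<Rightarrow> 'n uq_rep" where
  "dual_rep M (gK k) = transpose (M (gKinv k))"
| "dual_rep M (gKinv k) = transpose (M (gK k))"
| "dual_rep M (gE k) = transpose (- (M (gE k) ** M (gKinv k)))"
| "dual_rep M (gF k) = transpose (- (M (gK k) ** M (gF k)))"

text \<open>
  The braiding of two simple modules. The vector \<open>v\<^sub>\<lambda> \<otimes> v\<^sub>w\<^sub>0\<^sub>\<mu>\<close> generates the tensor product, so the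
  conditions determine the module map uniquely.
\<close>
definition braiding ::
    "real \<Rightarrow> nat \<Rightarrow> 'a::finite uq_rep \<Rightarrow> 'b::finite uq_rep \<Rightarrow> complex^('a \<times> 'b)^('b \<times> 'a)" where
  "braiding q r M N = (THE R.
     (\<forall>X\<in>uq_gens r. R ** tensor_rep M N X = tensor_rep N M X ** R) \<and>
     (\<forall>\<mu>\<in>weight_lattice r. \<forall>\<nu>\<in>weight_lattice r. \<forall>x y.
        highest_weight_vector q r M \<mu> x \<and> lowest_weight_vector q r N (longest_weyl r \<nu>) y \<longrightarrow>
        R *v tens_vec x y = qpow q (wform r \<mu> (longest_weyl r \<nu>)) *C tens_vec y x))"


section \<open>Index-free notation\<close>

text \<open>
  An element of \<open>M \<otimes> W\<^sub>1 \<otimes> \<dots> \<otimes> W\<^sub>n\<close>, each \<open>W\<^sub>k\<close> being \<open>V\<close> or its dual, is encoded by its family of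
  components, a function on lists of basis indices; only lists of length \<open>n\<close> are meaningful.
  The bases \<open>e\<^sub>i\<close> and \<open>e\<^sup>i\<close> share one index type. Legs are counted from 1, list positions from 0.
\<close>

type_synonym ('n, 'm) legs = "'n list \<Rightarrow> 'm"

definition leg1 :: "('n \<Rightarrow> 'm) \<Rightarrow> ('n, 'm) legs" where
  "leg1 x I = x (I ! 0)"

definition leg2 :: "('n \<Rightarrow> 'n \<Rightarrow> 'm) \<Rightarrow> ('n, 'm) legs" where
  "leg2 x I = x (I ! 0) (I ! 1)"

text \<open>The product of a family with \<open>m\<close> legs and another family.\<close>
definition leg_prod :: "('x \<Rightarrow> 'y \<Rightarrow> 'z) \<Rightarrow> nat \<Rightarrow> ('n, 'x) legs \<Rightarrow> ('n, 'y) legs \<Rightarrow> ('n, 'z) legs" where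
  "leg_prod m_op m x y I = m_op (x (take m I)) (y (drop m I))"

text \<open>A matrix acting on the legs \<open>k\<close> and \<open>k + 1\<close>.\<close>
definition leg_op ::
    "complex^('n \<times> 'n)^('n \<times> 'n) \<Rightarrow> nat \<Rightarrow> ('n::finite, 'm::complex_vector) legs \<Rightarrow> ('n, 'm) legs" where
  "leg_op R k x I =
     (\<Sum>a\<in>UNIV. \<Sum>b\<in>UNIV. (R $ (I ! (k - 1), I ! k) $ (a, b)) *C x (I[k - 1 := a, k := b]))"

text \<open>Contraction of the legs \<open>k\<close> and \<open>k + 1\<close> with a bilinear form.\<close>
definition leg_contract ::
    "('n \<Rightarrow> 'n \<Rightarrow> complex) \<Rightarrow> nat \<Rightarrow> ('n::finite, 'm::complex_vector) legs \<Rightarrow> ('n, 'm) legs" where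
  "leg_contract e k x I =
     (\<Sum>a\<in>UNIV. \<Sum>b\<in>UNIV. e a b *C x (take (k - 1) I @ [a, b] @ drop (k - 1) I))"

text \<open>Insertion of a 2-tensor immediately before leg \<open>k\<close>.\<close>
definition leg_insert ::
    "('n \<Rightarrow> 'n \<Rightarrow> complex) \<Rightarrow> nat \<Rightarrow> ('n, 'm::complex_vector) legs \<Rightarrow> ('n, 'm) legs" where
  "leg_insert c k x I = c (I ! (k - 1)) (I ! k) *C x (take (k - 1) I @ drop (k + 1) I)"

definition leg_components :: "nat \<Rightarrow> ('n, 'm) legs \<Rightarrow> 'm set" where
  "leg_components n x = x ` {I. length I = n}"

definition ev :: "'n \<Rightarrow> 'n \<Rightarrow> complex" where
  "ev i j = (if i = j then 1 else 0)"

definition ev' :: "real \<Rightarrow> nat \<Rightarrow> ('n \<Rightarrow> weight) \<Rightarrow> 'n \<Rightarrow> 'n \<Rightarrow> complex" where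
  "ev' q r wt i j = (if i = j then qpow q (wform r (two_rho r) (wt i)) else 0)"

definition coev :: "'n \<Rightarrow> 'n \<Rightarrow> complex" where
  "coev i j = (if i = j then 1 else 0)"

definition coev' :: "real \<Rightarrow> nat \<Rightarrow> ('n \<Rightarrow> weight) \<Rightarrow> 'n \<Rightarrow> 'n \<Rightarrow> complex" where
  "coev' q r wt i j = (if i = j then qpow q (- wform r (two_rho r) (wt i)) else 0)"

text \<open>\<open>S\<close> on the legs \<open>k, k+1, k+2\<close> of type \<open>V \<otimes> V\<^sup>* \<otimes> V\<close>.\<close>
definition S_op ::
    "real \<Rightarrow> nat \<Rightarrow> 'n uq_rep \<Rightarrow> nat \<Rightarrow> ('n::finite, 'm::complex_vector) legs \<Rightarrow> ('n, 'm) legs" where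
  "S_op q r V k x =
     leg_op (braiding q r V (dual_rep V)) (k + 1)
       (leg_op (braiding q r V V) k
         (leg_op (matrix_inv (braiding q r V (dual_rep V))) (k + 1) x))"

text \<open>\<open>S\<close> with a tilde, on the legs \<open>k, k+1, k+2\<close> of type \<open>V\<^sup>* \<otimes> V \<otimes> V\<^sup>*\<close>.\<close>
definition St_op ::
    "real \<Rightarrow> nat \<Rightarrow> 'n uq_rep \<Rightarrow> nat \<Rightarrow> ('n::finite, 'm::complex_vector) legs \<Rightarrow> ('n, 'm) legs" where
  "St_op q r V k x =
     leg_op (braiding q r V (dual_rep V)) k
       (leg_op (matrix_inv (braiding q r (dual_rep V) (dual_rep V))) (k + 1)
         (leg_op (matrix_inv (braiding q r V (dual_rep V))) k x))"

definition T_op ::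
    "real \<Rightarrow> nat \<Rightarrow> 'n uq_rep \<Rightarrow> nat \<Rightarrow> ('n::finite, 'm::complex_vector) legs \<Rightarrow> ('n, 'm) legs" where
  "T_op q r V k x = S_op q r V k (St_op q r V (k + 1) x)"


section \<open>The algebra and the quantum projective space\<close>

text \<open>Words form a monoid, written additively as required by the library's monoid algebras.\<close>
datatype 'g word = Word (letters: "'g list")

instantiation word :: (type) monoid_add
begin
definition "0 = Word []"
definition "u + w = Word (letters u @ letters w)"
instance by standard (simp_all add: zero_word_def plus_word_def)
end

datatype 'n gen = gen_f 'n | gen_v 'n

type_synonym 'n free_alg = "'n gen word \<Rightarrow>\<^sub>0 complex"

definition free_f :: "'n \<Rightarrow> 'n free_alg" where
  "free_f i = Poly_Mapping.single (Word [gen_f i]) 1"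

definition free_v :: "'n \<Rightarrow> 'n free_alg" where
  "free_v i = Poly_Mapping.single (Word [gen_v i]) 1"

text \<open>The algebra homomorphism from the free algebra determined by the images of the generators.\<close>
definition free_eval :: "('n \<Rightarrow> 'a) \<Rightarrow> ('n \<Rightarrow> 'a) \<Rightarrow> 'n free_alg \<Rightarrow> 'a :: complex_algebra" where
  "free_eval f v z =
     (\<Sum>w\<in>Poly_Mapping.keys z. Poly_Mapping.lookup z w *C prod_list (map (case_gen f v) (letters w)))"

fun gen_degree :: "'n gen \<Rightarrow> int" where
  "gen_degree (gen_f i) = 1"
| "gen_degree (gen_v i) = - 1"

definition word_degree :: "'n gen word \<Rightarrow> int" where
  "word_degree w = sum_list (map gen_degree (letters w))"

text \<open>The elements of \<open>f\<close>s and \<open>v\<close>s which the defining relations set to zero.\<close>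
definition alg_relations ::
    "real \<Rightarrow> nat \<Rightarrow> nat \<Rightarrow> 'n uq_rep \<Rightarrow> ('n::finite \<Rightarrow> 'a) \<Rightarrow> ('n \<Rightarrow> 'a) \<Rightarrow> 'a :: complex_algebra set" where
  "alg_relations q r s V f v =
     (let \<omega> = fund_weight r s; qs = wform r \<omega> \<omega>;
          ff = leg_prod (*) 1 (leg1 f) (leg1 f);
          vv = leg_prod (*) 1 (leg1 v) (leg1 v);
          fv = leg_prod (*) 1 (leg1 f) (leg1 v);
          vf = leg_prod (*) 1 (leg1 v) (leg1 f)
      in leg_components 2 (\<lambda>I. ff I - qpow q (- qs) *C leg_op (braiding q r V V) 1 ff I) \<union>
         leg_components 2 (\<lambda>I. vv I - qpow q (- qs) *C leg_op (braiding q r (dual_rep V) (dual_rep V)) 1 vv I) \<union>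
         leg_components 2 (\<lambda>I. vf I - qpow q qs *C leg_op (braiding q r V (dual_rep V)) 1 fv I) \<union>
         leg_components 0 (\<lambda>I. leg_contract ev 1 vf I - 1))"

definition presents_alg ::
    "real \<Rightarrow> nat \<Rightarrow> nat \<Rightarrow> 'n uq_rep \<Rightarrow> ('n::finite \<Rightarrow> 'a) \<Rightarrow> ('n \<Rightarrow> 'a :: complex_algebra) \<Rightarrow> bool" where
  "presents_alg q r s V f v \<longleftrightarrow>
     surj (free_eval f v) \<and>
     (\<forall>z. free_eval f v z = 0 \<longleftrightarrow> z \<in> two_sided_ideal hull alg_relations q r s V free_f free_v)"

definition proj_space :: "('n \<Rightarrow> 'a) \<Rightarrow> ('n \<Rightarrow> 'a) \<Rightarrow> 'a :: complex_algebra set" where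
  "proj_space f v = free_eval f v ` {z. \<forall>w\<in>Poly_Mapping.keys z. word_degree w = 0}"

definition pp :: "('n \<Rightarrow> 'a) \<Rightarrow> ('n \<Rightarrow> 'a) \<Rightarrow> 'n \<Rightarrow> 'n \<Rightarrow> 'a :: complex_algebra" where
  "pp f v i j = f i * v j"


section \<open>Bimodules over a subalgebra\<close>

record ('a, 'm) bimod =
  lact :: "'a \<Rightarrow> 'm \<Rightarrow> 'm"
  ract :: "'m \<Rightarrow> 'a \<Rightarrow> 'm"

definition bimodule :: "'a :: complex_algebra set \<Rightarrow> ('a, 'm :: complex_vector) bimod \<Rightarrow> bool" where
  "bimodule B M \<longleftrightarrow> (\<forall>b\<in>B. \<forall>c\<in>B. \<forall>x y. \<forall>z.
     lact M b (x + y) = lact M b x + lact M b y \<and>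
     lact M (b + c) x = lact M b x + lact M c x \<and>
     lact M (b * c) x = lact M b (lact M c x) \<and>
     lact M (z *C 1) x = z *C x \<and>
     ract M (x + y) b = ract M x b + ract M y b \<and>
     ract M x (b + c) = ract M x b + ract M x c \<and>
     ract M x (b * c) = ract M (ract M x b) c \<and>
     ract M x (z *C 1) = z *C x \<and>
     lact M b (ract M x c) = ract M (lact M b x) c)"

definition direct_sum :: "('a, 'm) bimod \<Rightarrow> ('a, 'k) bimod \<Rightarrow> ('a, 'm \<times> 'k) bimod" where
  "direct_sum M N =
     \<lparr>lact = (\<lambda>b x. (lact M b (fst x), lact N b (snd x))),
      ract = (\<lambda>x b. (ract M (fst x) b, ract N (snd x) b))\<rparr>"

text \<open>
  \<open>T\<close>, with the pure tensors \<open>tens x y\<close>, is the tensor product over \<open>B\<close>: the quotient of the space of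
  formal combinations of pairs by the linearity and balancing relations.
\<close>

definition tensor_relations ::
    "'a :: complex_algebra set \<Rightarrow> ('a, 'm :: complex_vector) bimod \<Rightarrow> ('a, 'k :: complex_vector) bimod \<Rightarrow>
     ('m \<times> 'k \<Rightarrow>\<^sub>0 complex) set" where
  "tensor_relations B M N =
     (let pair = \<lambda>x y. Poly_Mapping.single (x, y) 1
      in {pair (x + x') y - pair x y - pair x' y | x x' y. True} \<union>
         {pair x (y + y') - pair x y - pair x y' | x y y'. True} \<union>
         {pair (c *C x) y - c *C pair x y | c x y. True} \<union>
         {pair (ract M x b) y - pair x (lact N b y) | x b y. b \<in> B})"

definition tensor_eval ::
    "('m \<Rightarrow> 'k \<Rightarrow> 't) \<Rightarrow> ('m \<times> 'k \<Rightarrow>\<^sub>0 complex) \<Rightarrow> 't :: complex_vector" where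
  "tensor_eval tens z = (\<Sum>(x, y)\<in>Poly_Mapping.keys z. Poly_Mapping.lookup z (x, y) *C tens x y)"

definition tensor_product ::
    "'a :: complex_algebra set \<Rightarrow> ('a, 'm :: complex_vector) bimod \<Rightarrow> ('a, 'k :: complex_vector) bimod \<Rightarrow>
     ('a, 't :: complex_vector) bimod \<Rightarrow> ('m \<Rightarrow> 'k \<Rightarrow> 't) \<Rightarrow> bool" where
  "tensor_product B M N T tens \<longleftrightarrow>
     surj (tensor_eval tens) \<and>
     (\<forall>z. tensor_eval tens z = 0 \<longleftrightarrow> z \<in> complex_subspace hull tensor_relations B M N) \<and>
     bimodule B T \<and>
     (\<forall>b\<in>B. \<forall>x y. lact T b (tens x y) = tens (lact M b x) y \<and>
                   ract T (tens x y) b = tens x (ract N y b))"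

text \<open>Bimodule maps to \<open>B\<close>; linearity over the complex numbers follows from linearity over \<open>B\<close>.\<close>
definition bimodule_map_to :: "'a :: complex_algebra set \<Rightarrow> ('a, 't :: complex_vector) bimod \<Rightarrow> ('t \<Rightarrow> 'a) \<Rightarrow> bool" where
  "bimodule_map_to B T \<phi> \<longleftrightarrow>
     range \<phi> \<subseteq> B \<and> (\<forall>x y. \<phi> (x + y) = \<phi> x + \<phi> y) \<and>
     (\<forall>b\<in>B. \<forall>x. \<phi> (lact T b x) = b * \<phi> x \<and> \<phi> (ract T x b) = \<phi> x * b)"

text \<open>
  \<open>g\<^sup>(\<^sup>1\<^sup>) (g\<^sup>(\<^sup>2\<^sup>), \<omega>) = \<omega> = (\<omega>, g\<^sup>(\<^sup>1\<^sup>)) g\<^sup>(\<^sup>2\<^sup>)\<close> for all \<open>\<omega>\<close>, where \<open>\<phi> (tens x y)\<close> is \<open>(x, y)\<close> and the equations are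
  required for every way of writing \<open>g\<close> as a sum of pure tensors.
\<close>
definition inverts ::
    "('a, 'm :: complex_vector) bimod \<Rightarrow> ('m \<Rightarrow> 'm \<Rightarrow> 't) \<Rightarrow> ('t \<Rightarrow> 'a) \<Rightarrow> 't :: complex_vector \<Rightarrow> bool"
  where
  "inverts M tens \<phi> g \<longleftrightarrow>
     (\<forall>\<omega> gs. g = (\<Sum>(x, y)\<leftarrow>gs. tens x y) \<longrightarrow>
        (\<Sum>(x, y)\<leftarrow>gs. ract M x (\<phi> (tens y \<omega>))) = \<omega> \<and>
        (\<Sum>(x, y)\<leftarrow>gs. lact M (\<phi> (tens \<omega> x)) y) = \<omega>)"

definition quantum_metric ::
    "'a :: complex_algebra set \<Rightarrow> ('a, 'm :: complex_vector) bimod \<Rightarrow> ('a, 't :: complex_vector) bimod \<Rightarrow>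
     ('m \<Rightarrow> 'm \<Rightarrow> 't) \<Rightarrow> 't \<Rightarrow> bool" where
  "quantum_metric B M T tens g \<longleftrightarrow> (\<exists>\<phi>. bimodule_map_to B T \<phi> \<and> inverts M tens \<phi> g)"


section \<open>The calculus\<close>

text \<open>
  A left \<open>B\<close>-module generated by \<open>dp i j\<close> with prescribed relations: the quotient of the free left
  module, whose elements are families of coefficients in \<open>B\<close>.
\<close>

definition free_act :: "'a \<Rightarrow> ('n \<Rightarrow> 'n \<Rightarrow> 'a) \<Rightarrow> ('n \<Rightarrow> 'n \<Rightarrow> 'a :: complex_algebra)" where
  "free_act b c = (\<lambda>i j. b * c i j)"

definition free_gen :: "'n \<Rightarrow> 'n \<Rightarrow> ('n \<Rightarrow> 'n \<Rightarrow> 'a :: complex_algebra)" where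
  "free_gen i j = (\<lambda>k l. if k = i \<and> l = j then 1 else 0)"

definition left_submodule ::
    "'a :: complex_algebra set \<Rightarrow> ('n \<Rightarrow> 'n \<Rightarrow> 'a) set \<Rightarrow> bool" where
  "left_submodule B W \<longleftrightarrow>
     0 \<in> W \<and> (\<forall>x\<in>W. \<forall>y\<in>W. x + y \<in> W) \<and> (\<forall>b\<in>B. \<forall>x\<in>W. free_act b x \<in> W)"

definition presents_left_module ::
    "'a :: complex_algebra set \<Rightarrow> ('a \<Rightarrow> 'm \<Rightarrow> 'm) \<Rightarrow> ('n::finite \<Rightarrow> 'n \<Rightarrow> 'm :: complex_vector) \<Rightarrow>
     ('n \<Rightarrow> 'n \<Rightarrow> 'a) set \<Rightarrow> bool" where
  "presents_left_module B act dp rels \<longleftrightarrow>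
     (let coeffs = {c. \<forall>i j. c i j \<in> B};
          val = \<lambda>c. \<Sum>i\<in>UNIV. \<Sum>j\<in>UNIV. act (c i j) (dp i j)
      in val ` coeffs = UNIV \<and>
         (\<forall>c\<in>coeffs. val c = 0 \<longleftrightarrow> c \<in> left_submodule B hull rels))"

definition plus_relations ::
    "real \<Rightarrow> nat \<Rightarrow> nat \<Rightarrow> 'n uq_rep \<Rightarrow> ('n \<Rightarrow> weight) \<Rightarrow> ('a \<Rightarrow> 'm \<Rightarrow> 'm) \<Rightarrow>
     ('n::finite \<Rightarrow> 'n \<Rightarrow> 'a) \<Rightarrow> ('n \<Rightarrow> 'n \<Rightarrow> 'm) \<Rightarrow> 'm :: complex_vector set" where
  "plus_relations q r s V wt act p dp =
     (let \<omega> = fund_weight r s; pdp = leg_prod act 2 (leg2 p) (leg2 dp)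
      in leg_components 4 (\<lambda>I. St_op q r V 2 pdp I - qpow q (- wform r \<omega> \<omega>) *C pdp I) \<union>
         leg_components 0 (leg_contract (ev' q r wt) 1 (leg2 dp)))"

definition minus_relations ::
    "real \<Rightarrow> nat \<Rightarrow> nat \<Rightarrow> 'n uq_rep \<Rightarrow> ('n \<Rightarrow> weight) \<Rightarrow> ('a \<Rightarrow> 'm \<Rightarrow> 'm) \<Rightarrow>
     ('n::finite \<Rightarrow> 'n \<Rightarrow> 'a) \<Rightarrow> ('n \<Rightarrow> 'n \<Rightarrow> 'm) \<Rightarrow> 'm :: complex_vector set" where
  "minus_relations q r s V wt act p dp =
     (let \<omega> = fund_weight r s; pdp = leg_prod act 2 (leg2 p) (leg2 dp)
      in leg_components 4 (\<lambda>I. S_op q r V 1 pdp I - qpow q (wform r \<omega> \<omega>) *C pdp I) \<union>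
         leg_components 0 (leg_contract (ev' q r wt) 1 (leg2 dp)))"

definition derivation_on ::
    "'a :: complex_algebra set \<Rightarrow> ('a, 'm :: complex_vector) bimod \<Rightarrow> ('a \<Rightarrow> 'm) \<Rightarrow> bool" where
  "derivation_on B M \<delta> \<longleftrightarrow>
     (\<forall>b\<in>B. \<forall>c\<in>B. \<delta> (b + c) = \<delta> b + \<delta> c \<and> \<delta> (b * c) = ract M (\<delta> b) c + lact M b (\<delta> c)) \<and>
     (\<forall>z. \<forall>b\<in>B. \<delta> (z *C b) = z *C \<delta> b)"

text \<open>The basis of \<open>V\<close>, indexed by the type \<open>'n\<close>, is any basis of weight vectors.\<close>
locale quantum_fundamental_module =
  fixes q :: real and r s :: nat and V :: "'n::finite uq_rep" and wt :: "'n \<Rightarrow> weight"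
  assumes q: "0 < q" "q < 1"
    and rank: "1 \<le> r"
    and s: "s = 1 \<or> s = r"
    and V: "simple_highest_weight_module q r (fund_weight r s) V"
    and wt_lattice: "wt i \<in> weight_lattice r"
    and wt: "weight_vector q r V (wt i) (axis i 1)"

locale quantum_projective_space = quantum_fundamental_module q r s V wt
  for q r s and V :: "'n::finite uq_rep" and wt +
  fixes f v :: "'n \<Rightarrow> 'a :: complex_algebra"
  assumes presents: "presents_alg q r s V f v"

text \<open>
  The left modules \<open>\<Omega>\<^sub>+\<close>, \<open>\<Omega>\<^sub>-\<close> are presented by generators and relations. The right actions and the
  derivations are uniquely determined by the conditions imposed on them.
\<close>
locale quantum_projective_calculus = quantum_projective_space q r s V wt f v
  for q r s and V :: "'n::finite uq_rep" and wt and f v :: "'n \<Rightarrow> 'a :: complex_algebra" +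
  fixes Om_p :: "('a, 'p :: complex_vector) bimod" and del :: "'a \<Rightarrow> 'p"
    and Om_m :: "('a, 'm :: complex_vector) bimod" and delbar :: "'a \<Rightarrow> 'm"
  assumes bimodule: "bimodule (proj_space f v) Om_p" "bimodule (proj_space f v) Om_m"
    and derivation: "derivation_on (proj_space f v) Om_p del" "derivation_on (proj_space f v) Om_m delbar"
    and presents_plus:
      "presents_left_module (proj_space f v) (lact Om_p) (\<lambda>i j. del (pp f v i j))
         (plus_relations q r s V wt free_act (pp f v) free_gen)"
    and presents_minus:
      "presents_left_module (proj_space f v) (lact Om_m) (\<lambda>i j. delbar (pp f v i j))
         (minus_relations q r s V wt free_act (pp f v) free_gen)"
    and right_plus: "length I = 4 \<Longrightarrow>
      leg_prod (ract Om_p) 2 (leg2 (\<lambda>i j. del (pp f v i j))) (leg2 (pp f v)) I =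
      qpow q (wform r (simple_root s) (simple_root s)) *C
        T_op q r V 1 (leg_prod (lact Om_p) 2 (leg2 (pp f v)) (leg2 (\<lambda>i j. del (pp f v i j)))) I"
    and right_minus: "length I = 4 \<Longrightarrow>
      leg_prod (ract Om_m) 2 (leg2 (\<lambda>i j. delbar (pp f v i j))) (leg2 (pp f v)) I =
      qpow q (- wform r (simple_root s) (simple_root s)) *C
        T_op q r V 1 (leg_prod (lact Om_m) 2 (leg2 (pp f v)) (leg2 (\<lambda>i j. delbar (pp f v i j)))) I"


section \<open>The metric\<close>

text \<open>
  The formula for \<open>g\<close>, for arbitrary families \<open>dp\<close>, \<open>dbp\<close> in place of the differentials of the \<open>p\<^sup>i\<^sup>j\<close>
  and an arbitrary tensor operation, so that it can also be evaluated classically.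
\<close>

definition metric_part ::
    "real \<Rightarrow> nat \<Rightarrow> ('n \<Rightarrow> weight) \<Rightarrow> ('x \<Rightarrow> 'x \<Rightarrow> 't) \<Rightarrow>
     ('n::finite \<Rightarrow> 'n \<Rightarrow> 'x) \<Rightarrow> ('n \<Rightarrow> 'n \<Rightarrow> 'x) \<Rightarrow> 't :: complex_vector" where
  "metric_part q r wt tens x y =
     leg_contract (ev' q r wt) 1 (leg_contract ev 2 (leg_prod tens 2 (leg2 x) (leg2 y))) []"

definition metric_formula ::
    "real \<Rightarrow> nat \<Rightarrow> ('n \<Rightarrow> weight) \<Rightarrow> ('x \<Rightarrow> 'x \<Rightarrow> 't) \<Rightarrow>
     ('n::finite \<Rightarrow> 'n \<Rightarrow> 'x) \<Rightarrow> ('n \<Rightarrow> 'n \<Rightarrow> 'x) \<Rightarrow> 't :: complex_vector" where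
  "metric_formula q r wt tens dp dbp = metric_part q r wt tens dp dbp + metric_part q r wt tens dbp dp"

text \<open>The differentials of the \<open>p\<^sup>i\<^sup>j\<close> as elements of the direct sum \<open>\<Omega>\<close>.\<close>

definition dp_plus ::
    "('n \<Rightarrow> 'a) \<Rightarrow> ('n \<Rightarrow> 'a) \<Rightarrow> ('a :: complex_algebra \<Rightarrow> 'p) \<Rightarrow> 'n \<Rightarrow> 'n \<Rightarrow> 'p \<times> 'm :: zero" where
  "dp_plus f v del i j = (del (pp f v i j), 0)"

definition dp_minus ::
    "('n \<Rightarrow> 'a) \<Rightarrow> ('n \<Rightarrow> 'a) \<Rightarrow> ('a :: complex_algebra \<Rightarrow> 'm) \<Rightarrow> 'n \<Rightarrow> 'n \<Rightarrow> 'p :: zero \<times> 'm" where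
  "dp_minus f v delbar i j = (0, delbar (pp f v i j))"

text \<open>The conditions characterizing the pairing \<open>(x, y) = \<phi> (tens x y)\<close>.\<close>
definition inverse_metric ::
    "real \<Rightarrow> nat \<Rightarrow> nat \<Rightarrow> 'n uq_rep \<Rightarrow> ('n \<Rightarrow> weight) \<Rightarrow>
     ('n::finite \<Rightarrow> 'a) \<Rightarrow> ('n \<Rightarrow> 'a :: complex_algebra) \<Rightarrow>
     ('a \<Rightarrow> 'p) \<Rightarrow> ('a \<Rightarrow> 'm) \<Rightarrow> ('a, 't) bimod \<Rightarrow>
     ('p :: complex_vector \<times> 'm :: complex_vector \<Rightarrow> 'p \<times> 'm \<Rightarrow> 't :: complex_vector) \<Rightarrow> ('t \<Rightarrow> 'a) \<Rightarrow> bool" where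
  "inverse_metric q r s V wt f v del delbar T tens \<phi> \<longleftrightarrow>
     (let \<omega> = fund_weight r s; \<alpha> = simple_root s;
          p = leg2 (pp f v); dp = leg2 (dp_plus f v del); dbp = leg2 (dp_minus f v delbar);
          pairing = (\<lambda>x y. \<phi> (tens x y));
          c = qpow q (- wform r \<omega> (two_rho r)); a = qpow q (wform r \<alpha> \<alpha>)
      in bimodule_map_to (proj_space f v) T \<phi> \<and>
         (\<forall>x y. pairing (x, 0) (y, 0) = 0) \<and>
         (\<forall>x y. pairing (0, x) (0, y) = 0) \<and>
         (\<forall>I. length I = 4 \<longrightarrow>
            leg_prod pairing 2 dbp dp I =
              leg_insert (coev' q r wt) 2 p I - c *C leg_prod (*) 2 p p I) \<and>
         (\<forall>I. length I = 4 \<longrightarrow>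
            leg_prod pairing 2 dp dbp I =
              (a * qpow q (- wform r \<omega> (\<lambda>k. \<omega> k + two_rho r k))) *C S_op q r V 1 (leg_insert coev 3 p) I
              - (a * c) *C leg_prod (*) 2 p p I))"


section \<open>The classical limit\<close>

text \<open>
  The affine chart \<open>z\<^sup>i = Z\<^sup>i / Z\<^sup>r\<^sup>+\<^sup>1\<close> of the projective space is \<open>complex^'k\<close>. A bijection from
  \<open>'k option\<close> to the index type of the homogeneous coordinates labels them, with \<open>None\<close> for the
  coordinate normalized to 1. Complex one-forms at a point are functions on the tangent space,
  covariant 2-tensors are functions of two tangent vectors.
\<close>

definition hom_coord :: "('k option \<Rightarrow> 'n) \<Rightarrow> complex^'k::finite \<Rightarrow> 'n \<Rightarrow> complex" where
  "hom_coord h z i = (case inv h i of None \<Rightarrow> 1 | Some k \<Rightarrow> z $ k)"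

definition classical_p :: "('k option \<Rightarrow> 'n::finite) \<Rightarrow> 'n \<Rightarrow> 'n \<Rightarrow> complex^'k::finite \<Rightarrow> complex" where
  "classical_p h i j z =
     hom_coord h z i * cnj (hom_coord h z j) / of_real (\<Sum>k\<in>UNIV. (cmod (hom_coord h z k))\<^sup>2)"

text \<open>The parts of the real differential which are linear and antilinear over the complex numbers.\<close>

definition dolbeault :: "(complex^'k::finite \<Rightarrow> complex) \<Rightarrow> complex^'k \<Rightarrow> complex^'k \<Rightarrow> complex" where
  "dolbeault F z u =
     (frechet_derivative F (at z) u - \<i> * frechet_derivative F (at z) (\<i> *C u)) / 2"

definition dolbeault_bar :: "(complex^'k::finite \<Rightarrow> complex) \<Rightarrow> complex^'k \<Rightarrow> complex^'k \<Rightarrow> complex" where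
  "dolbeault_bar F z u =
     (frechet_derivative F (at z) u + \<i> * frechet_derivative F (at z) (\<i> *C u)) / 2"

definition form_tensor :: "('x \<Rightarrow> complex) \<Rightarrow> ('x \<Rightarrow> complex) \<Rightarrow> 'x \<Rightarrow> 'x \<Rightarrow> complex" where
  "form_tensor \<theta> \<eta> = (\<lambda>u w. \<theta> u * \<eta> w)"

definition dz :: "'k::finite \<Rightarrow> complex^'k \<Rightarrow> complex" where
  "dz i u = u $ i"

definition dzbar :: "'k::finite \<Rightarrow> complex^'k \<Rightarrow> complex" where
  "dzbar i u = cnj (u $ i)"

definition fubini_study :: "complex^'k::finite \<Rightarrow> complex^'k \<Rightarrow> complex^'k \<Rightarrow> complex" where
  "fubini_study z =
     (\<Sum>i\<in>UNIV. \<Sum>j\<in>UNIV.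
        ((of_real (1 + (norm z)\<^sup>2) * (if i = j then 1 else 0) - cnj (z $ i) * z $ j)
          / of_real ((1 + (norm z)\<^sup>2)\<^sup>2)) *C
        (form_tensor (dz i) (dzbar j) + form_tensor (dzbar j) (dz i)))"

end

theory Submission
  imports Defs
begin

text \<open>
  The module \<open>V\<close> is a chain of one-dimensional weight spaces. The tensor product of a highest and a lowest
  weight vector is cyclic, so intertwiners are determined by their value there, and this identifies the
  braidings of \<open>V\<close> and its dual with explicit matrices of Hecke type. All identities between \<open>S\<close>, \<open>S\<close> with a
  tilde and \<open>T\<close> follow from the braid relations, the Hecke relation and the naturality of the braidings with
  respect to evaluation and coevaluation.

  Expressing the prescribed values of the pairing as words in \<open>f\<close>, \<open>v\<close> and the coevaluations, one verifies
  that they satisfy the relations of \<open>\<Omega>\<^sub>+\<close> and \<open>\<Omega>\<^sub>-\<close> in both arguments and are compatible with right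
  multiplication by \<open>p\<close>; as the \<open>p\<^sup>i\<^sup>j\<close> generate \<open>\<B>\<close>, this gives the bimodule map. Contracting the middle legs
  of \<open>\<partial>p p\<close> gives \<open>\<partial>p\<close> and contracting those of \<open>p \<partial>p\<close> gives 0, with the roles of the two products exchanged in
  \<open>\<Omega>\<^sub>-\<close>. After substituting the pairing into \<open>g\<close>, only such contractions remain.
\<close>

text \<open>The pairing is prescribed on generators only, while \<Omega>_+ and \<Omega>_- are
  presented as left modules. Left linearity extends it in the first argument. In the second argument
  balancing forces (x, b y) = (x b, y), so the relations of the second module become conditions on T
  applied to p times the pairing, and right linearity becomes an identity for T applied twice. The
  factors q^2 and q^-2 of the two right actions cancel there, which is why opposite halves are
  paired. The coefficients of the p p terms are forced by E' \<partial>p = 0 and its conjugate.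

  Fractional powers of q enter only as overall scalars of the braidings. Once these are split off,
  every eigenvalue is an integer power of q, and in T the scalars cancel.

  One half of the inversion identity is right linear in \<omega>, so the differentials must also
  generate \<Omega> as a right module; this rests on the invertibility of T. The inversion property
  allows every expression of g as a sum of pure tensors, so both sides have to be factored through
  the tensor product over \<B>.\<close>

lemma scaleC_sum_right: "c *C (\<Sum>x\<in>A. g x) = (\<Sum>x\<in>A. c *C (g x :: 'm::complex_vector))"
  by (induction A rule: infinite_finite_induct) (simp_all add: scaleC_add_right)

lemma scaleC_sum_left: "(\<Sum>x\<in>A. g x) *C (m :: 'm::complex_vector) = (\<Sum>x\<in>A. g x *C m)"
  by (induction A rule: infinite_finite_induct) (simp_all add: scaleC_add_left)

lemma scaleC_minus_right: "c *C (- x) = - (c *C (x :: 'm::complex_vector))"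
  by (metis add.right_inverse minus_unique scaleC_add_right scaleC_zero_right)

lemma scaleC_diff_right: "c *C (x - y) = c *C x - c *C (y :: 'm::complex_vector)"
  by (simp add: scaleC_add_right scaleC_minus_right flip: add_uminus_conv_diff)

lemma scaleC_minus_left: "(- c) *C x = - (c *C (x :: 'm::complex_vector))"
  by (metis add.right_inverse minus_unique scaleC_add_left scaleC_zero_left)

lemma scaleC_diff_left: "(c - d) *C x = c *C x - d *C (x :: 'm::complex_vector)"
  by (simp add: scaleC_add_left scaleC_minus_left flip: add_uminus_conv_diff)

lemma scaleC_left_commute: "c *C d *C x = d *C c *C (x :: 'm::complex_vector)"
  by (simp add: scaleC_scaleC mult.commute)

lemma scaleC_eq_0_iff: "c *C x = 0 \<longleftrightarrow> c = 0 \<or> x = (0 :: 'm::complex_vector)"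
proof -
  have "x = 0" if "c *C x = 0" "c \<noteq> 0"
  proof -
    have "x = (inverse c * c) *C x"
      using that by (simp add: scaleC_one)
    also have "\<dots> = inverse c *C c *C x"
      by (simp add: scaleC_scaleC)
    finally show ?thesis
      using that by simp
  qed
  then show ?thesis
    by auto
qed

lemma scaleC_if: "(if P then c else 0) *C x = (if P then c *C x else (0 :: 'm::complex_vector))"
  by simp

section \<open>Families indexed by sequences\<close>

text \<open>
  Infinite sequences of indices replace the lists of legs, so that an operator acting at a position is
  defined by recursion on the position. Leg \<open>k\<close> corresponds to position \<open>k - 1\<close>.
\<close>

abbreviation (input) scons :: "'n \<Rightarrow> (nat \<Rightarrow> 'n) \<Rightarrow> (nat \<Rightarrow> 'n)" (infixr "##" 65) where
  "a ## \<phi> \<equiv> case_nat a \<phi>"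

abbreviation (input) stl :: "(nat \<Rightarrow> 'n) \<Rightarrow> (nat \<Rightarrow> 'n)" where
  "stl \<phi> \<equiv> (\<lambda>m. \<phi> (Suc m))"

type_synonym ('n, 'm) fam = "(nat \<Rightarrow> 'n) \<Rightarrow> 'm"

lemma scons_eta: "\<phi> 0 ## stl \<phi> = \<phi>"
  by (auto simp: fun_eq_iff split: nat.split)

lemma stream_cases: obtains a \<psi> where "\<phi> = a ## \<psi>"
  using scons_eta by metis

lemma fam_eqI: "(\<And>a \<psi>. x (a ## \<psi>) = y (a ## \<psi>)) \<Longrightarrow> x = y"
  by (metis ext scons_eta)

primrec op :: "complex^('n \<times> 'n)^('n \<times> 'n) \<Rightarrow> nat \<Rightarrow> ('n::finite, 'm::complex_vector) fam \<Rightarrow> ('n, 'm) fam"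
  where
  "op R 0 = (\<lambda>x \<phi>. \<Sum>a\<in>UNIV. \<Sum>b\<in>UNIV. (R $ (\<phi> 0, \<phi> 1) $ (a, b)) *C x (a ## b ## stl (stl \<phi>)))"
| "op R (Suc k) = (\<lambda>x \<phi>. op R k (\<lambda>\<psi>. x (\<phi> 0 ## \<psi>)) (stl \<phi>))"

text \<open>Every contraction and insertion that occurs is diagonal in the weight basis, so a
  function of one index replaces a bilinear form: the constant 1 for E and C, \<open>wq\<close> for
  E', and the inverse of \<open>wq\<close> for C'.\<close>

primrec con :: "('n \<Rightarrow> complex) \<Rightarrow> nat \<Rightarrow> ('n::finite, 'm::complex_vector) fam \<Rightarrow> ('n, 'm) fam"
  where
  "con w 0 = (\<lambda>x \<phi>. \<Sum>a\<in>UNIV. w a *C x (a ## a ## \<phi>))"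
| "con w (Suc k) = (\<lambda>x \<phi>. con w k (\<lambda>\<psi>. x (\<phi> 0 ## \<psi>)) (stl \<phi>))"

primrec ins :: "('n \<Rightarrow> complex) \<Rightarrow> nat \<Rightarrow> ('n::finite, 'm::complex_vector) fam \<Rightarrow> ('n, 'm) fam"
  where
  "ins w 0 = (\<lambda>x \<phi>. (if \<phi> 0 = \<phi> 1 then w (\<phi> 0) else 0) *C x (stl (stl \<phi>)))"
| "ins w (Suc k) = (\<lambda>x \<phi>. ins w k (\<lambda>\<psi>. x (\<phi> 0 ## \<psi>)) (stl \<phi>))"

text \<open>A word in f and v is a nest of \<open>pre\<close>, whose innermost family carries the
  remaining legs. An operator at position \<open>Suc k\<close> then passes the outermost letter and
  acts at position \<open>k\<close>.\<close>

definition pre :: "('n \<Rightarrow> 'a) \<Rightarrow> ('n, 'a) fam \<Rightarrow> ('n, 'a::complex_algebra) fam" where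
  "pre u x = (\<lambda>\<phi>. u (\<phi> 0) * x (stl \<phi>))"

lemma op_0_scons: "op R 0 x (i ## j ## \<phi>) =
    (\<Sum>a\<in>UNIV. \<Sum>b\<in>UNIV. (R $ (i, j) $ (a, b)) *C x (a ## b ## \<phi>))"
  by simp

lemma op_Suc_scons: "op R (Suc k) x (i ## \<phi>) = op R k (\<lambda>\<psi>. x (i ## \<psi>)) \<phi>"
  by simp

lemma con_Suc_scons: "con w (Suc k) x (i ## \<phi>) = con w k (\<lambda>\<psi>. x (i ## \<psi>)) \<phi>"
  by simp

lemma ins_0_scons: "ins w 0 x (i ## j ## \<phi>) = (if i = j then w i else 0) *C x \<phi>"
  by simp

lemma ins_Suc_scons: "ins w (Suc k) x (i ## \<phi>) = ins w k (\<lambda>\<psi>. x (i ## \<psi>)) \<phi>"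
  by simp

lemma con_0: "con w 0 x \<phi> = (\<Sum>a\<in>UNIV. w a *C x (a ## a ## \<phi>))"
  by simp

lemma pre_scons: "pre u x (i ## \<phi>) = u i * x \<phi>"
  by (simp add: pre_def)

declare op.simps [simp del] con.simps [simp del] ins.simps [simp del]

lemmas fam_simps = op_0_scons op_Suc_scons con_0 con_Suc_scons ins_0_scons ins_Suc_scons pre_scons

subsection \<open>Linearity\<close>

lemma op_add: "op R k (\<lambda>\<phi>. x \<phi> + y \<phi>) = (\<lambda>\<phi>. op R k x \<phi> + op R k y \<phi>)"
proof (induction k arbitrary: x y)
  case 0
  then show ?case
    by (intro ext) (simp add: op.simps scaleC_add_right sum.distrib)
qed (simp add: op.simps)

lemma op_scale: "op R k (\<lambda>\<phi>. c *C x \<phi>) = (\<lambda>\<phi>. c *C op R k x \<phi>)"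
proof (induction k arbitrary: x)
  case 0
  then show ?case
    by (intro ext) (simp add: op.simps scaleC_sum_right scaleC_scaleC mult.commute)
qed (simp add: op.simps)

lemma op_diff: "op R k (\<lambda>\<phi>. x \<phi> - y \<phi>) = (\<lambda>\<phi>. op R k x \<phi> - op R k y \<phi>)"
proof (induction k arbitrary: x y)
  case 0
  then show ?case
    by (intro ext) (simp add: op.simps scaleC_diff_right sum_subtractf)
qed (simp add: op.simps)

lemma op_zero: "op R k (\<lambda>\<phi>. 0) = (\<lambda>\<phi>. 0)"
  using op_diff[of R k "\<lambda>\<phi>. 0" "\<lambda>\<phi>. 0"] by simp

lemma op_sum: "op R k (\<lambda>\<phi>. \<Sum>s\<in>A. y s \<phi>) = (\<lambda>\<phi>. \<Sum>s\<in>A. op R k (y s) \<phi>)"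
  by (induction A rule: infinite_finite_induct) (simp_all add: op_zero op_add)

lemma op_mat_scale: "op (c *C R) k x = (\<lambda>\<phi>. c *C op R k x \<phi>)"
proof (induction k arbitrary: x)
  case 0
  then show ?case
    by (intro ext) (simp add: op.simps scaleC_sum_right scaleC_scaleC scaleC_vec_def scaleC_complex_def)
qed (simp add: op.simps)

lemma sum_prod_UNIV: "(\<Sum>a\<in>UNIV. \<Sum>b\<in>UNIV. g (a, b)) = (\<Sum>p\<in>UNIV. g p)"
  by (simp add: sum.cartesian_product flip: UNIV_Times_UNIV)

lemma op_mat_mult: "op (A ** B) k x = op A k (op B k x)"
proof (induction k arbitrary: x)
  case 0
  show ?case
  proof (rule fam_eqI)
    fix i and \<psi> :: "nat \<Rightarrow> 'a"
    obtain j \<phi> where [simp]: "\<psi> = j ## \<phi>" by (rule stream_cases)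
    define g where "g p = x (fst p ## snd p ## \<phi>)" for p
    have "op (A ** B) 0 x (i ## j ## \<phi>) = (\<Sum>p\<in>UNIV. (\<Sum>s\<in>UNIV. A $ (i, j) $ s * B $ s $ p) *C g p)"
      unfolding op_0_scons by (simp add: g_def matrix_matrix_mult_def flip: sum_prod_UNIV)
    also have "\<dots> = (\<Sum>s\<in>UNIV. \<Sum>p\<in>UNIV. (A $ (i, j) $ s * B $ s $ p) *C g p)"
      by (subst sum.swap) (simp add: scaleC_sum_left)
    also have "\<dots> = (\<Sum>s\<in>UNIV. A $ (i, j) $ s *C (\<Sum>p\<in>UNIV. B $ s $ p *C g p))"
      by (simp add: scaleC_sum_right scaleC_scaleC)
    also have "\<dots> = op A 0 (op B 0 x) (i ## j ## \<phi>)"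
      unfolding op_0_scons by (simp add: g_def flip: sum_prod_UNIV)
    finally show "op (A ** B) 0 x (i ## \<psi>) = op A 0 (op B 0 x) (i ## \<psi>)" by simp
  qed
next
  case (Suc k)
  then show ?case
    by (intro fam_eqI) (simp add: fam_simps)
qed

lemma op_mat_1: "op (mat 1) k x = x"
proof (induction k arbitrary: x)
  case 0
  show ?case
  proof (rule fam_eqI)
    fix i and \<psi> :: "nat \<Rightarrow> 'a"
    obtain j \<phi> where [simp]: "\<psi> = j ## \<phi>" by (rule stream_cases)
    have "op (mat 1) 0 x (i ## j ## \<phi>) = (\<Sum>p\<in>UNIV. (if (i, j) = p then 1 else 0) *C x (fst p ## snd p ## \<phi>))"
      unfolding op_0_scons by (simp add: mat_def flip: sum_prod_UNIV)
    also have "\<dots> = x (i ## j ## \<phi>)"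
      by (simp add: scaleC_if scaleC_one cong: if_cong)
    finally show "op (mat 1) 0 x (i ## \<psi>) = x (i ## \<psi>)" by simp
  qed
next
  case (Suc k)
  then show ?case
    by (intro fam_eqI) (simp add: fam_simps)
qed

lemma op_cong_scons: "(\<And>a. (\<lambda>\<psi>. x (a ## \<psi>)) = (\<lambda>\<psi>. y (a ## \<psi>))) \<Longrightarrow> x = y"
  by (rule fam_eqI) metis

text \<open>All operators commute with freezing the leg in front of them, so an identity between
  them has to be checked at position 0 only. Every relation valid at all positions is obtained this
  way.\<close>

lemma op_shift:
  assumes "\<And>k x a. (\<lambda>\<psi>. L (Suc k) x (a ## \<psi>)) = L k (\<lambda>\<psi>. x (a ## \<psi>))"
    and "\<And>k x a. (\<lambda>\<psi>. L' (Suc k) x (a ## \<psi>)) = L' k (\<lambda>\<psi>. x (a ## \<psi>))"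
    and "\<And>x. L 0 x = L' (0::nat) (x :: ('n, 'm) fam)"
  shows "L k x = (L' k x :: ('n, 'k) fam)"
proof (induction k arbitrary: x)
  case (Suc k)
  show ?case
    by (rule op_cong_scons) (simp add: assms Suc)
qed (rule assms)

lemma op_op_commute:
  assumes "k + 2 \<le> l"
  shows "op A k (op B l x) = op B l (op A k x)"
proof -
  obtain m where m: "l = m + 2 + k" using assms by (metis add.commute add.assoc le_add_diff_inverse)
  have "op A k (op B (m + 2 + k) x) = op B (m + 2 + k) (op A k x)"
  proof (rule op_shift[where L = "\<lambda>k x. op A k (op B (m + 2 + k) x)"])
    fix x :: "('a, 'b) fam"
    show "op A 0 (op B (m + 2 + 0) x) = op B (m + 2 + 0) (op A 0 x)"
    proof (rule fam_eqI)
      fix i and \<psi> :: "nat \<Rightarrow> 'a"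
      obtain j \<phi> where [simp]: "\<psi> = j ## \<phi>" by (rule stream_cases)
      have *: "op B m (\<lambda>\<psi>. \<Sum>a\<in>S. \<Sum>b\<in>S'. c a b *C y a b \<psi>) \<phi> = (\<Sum>a\<in>S. \<Sum>b\<in>S'. c a b *C op B m (y a b) \<phi>)"
        for c S S' and y :: "'a \<Rightarrow> 'a \<Rightarrow> ('a, 'b) fam"
        by (simp add: op_sum op_scale)
      show "op A 0 (op B (m + 2 + 0) x) (i ## \<psi>) = op B (m + 2 + 0) (op A 0 x) (i ## \<psi>)"
        by (simp add: fam_simps *)
    qed
  qed (simp_all add: fam_simps)
  then show ?thesis by (simp add: m)
qed

lemma ins_op_commute:
  assumes "l \<le> k"
  shows "op A (Suc (Suc k)) (ins w l x) = ins w l (op A k x)"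
proof -
  obtain m where m: "k = m + l" using assms by (metis add.commute le_add_diff_inverse)
  have "op A (Suc (Suc (m + l))) (ins w l x) = ins w l (op A (m + l) x)"
  proof (rule op_shift[where L = "\<lambda>l x. op A (Suc (Suc (m + l))) (ins w l x)"])
    fix x :: "('a, 'b) fam"
    show "op A (Suc (Suc (m + 0))) (ins w 0 x) = ins w 0 (op A (m + 0) x)"
    proof (rule fam_eqI)
      fix i and \<psi> :: "nat \<Rightarrow> 'a"
      obtain j \<phi> where [simp]: "\<psi> = j ## \<phi>" by (rule stream_cases)
      show "op A (Suc (Suc (m + 0))) (ins w 0 x) (i ## \<psi>) = ins w 0 (op A (m + 0) x) (i ## \<psi>)"
        by (simp add: fam_simps op_scale op_zero)
    qed
  qed (simp_all add: fam_simps)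
  then show ?thesis by (simp add: m)
qed

lemma op_pre: "op R (Suc k) (pre u x) = pre u (op R k x)"
proof -
  have *: "op R k (\<lambda>\<psi>. a * x \<psi>) = (\<lambda>\<phi>. a * op R k x \<phi>)" for a
  proof (induction k arbitrary: x)
    case 0
    then show ?case by (intro ext) (simp add: op.simps sum_distrib_left mult_scaleC_right)
  qed (simp add: op.simps)
  show ?thesis
    by (rule fam_eqI) (simp add: fam_simps *)
qed

lemma ins_pre: "ins w (Suc k) (pre u x) = pre u (ins w k x)"
proof -
  have *: "ins w k (\<lambda>\<psi>. a * x \<psi>) = (\<lambda>\<phi>. a * ins w k x \<phi>)" for a
  proof (induction k arbitrary: x)
    case 0
    then show ?case by (intro ext) (simp add: ins.simps mult_scaleC_right)
  qed (simp add: ins.simps)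
  show ?thesis
    by (rule fam_eqI) (simp add: fam_simps *)
qed

section \<open>The braid matrices of the vector representation\<close>

lemma sum_rotate: "(\<Sum>x\<in>A. \<Sum>y\<in>B. \<Sum>z\<in>C. g x y z) = (\<Sum>y\<in>B. \<Sum>z\<in>C. \<Sum>x\<in>A. g x y z)"
proof -
  have "(\<Sum>x\<in>A. \<Sum>y\<in>B. \<Sum>z\<in>C. g x y z) = (\<Sum>y\<in>B. \<Sum>x\<in>A. \<Sum>z\<in>C. g x y z)"
    by (rule sum.swap)
  also have "\<dots> = (\<Sum>y\<in>B. \<Sum>z\<in>C. \<Sum>x\<in>A. g x y z)"
    by (intro sum.cong refl sum.swap)
  finally show ?thesis .
qed

lemma sum_rotate4: "(\<Sum>x\<in>A. \<Sum>y\<in>B. \<Sum>z\<in>C. \<Sum>u\<in>D. g x y z u) = (\<Sum>y\<in>B. \<Sum>z\<in>C. \<Sum>u\<in>D. \<Sum>x\<in>A. g x y z u)"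
proof -
  have "(\<Sum>x\<in>A. \<Sum>y\<in>B. \<Sum>z\<in>C. \<Sum>u\<in>D. g x y z u) = (\<Sum>y\<in>B. \<Sum>x\<in>A. \<Sum>z\<in>C. \<Sum>u\<in>D. g x y z u)"
    by (rule sum.swap)
  also have "\<dots> = (\<Sum>y\<in>B. \<Sum>z\<in>C. \<Sum>u\<in>D. \<Sum>x\<in>A. g x y z u)"
    by (intro sum.cong refl sum_rotate)
  finally show ?thesis .
qed

lemma sum_swap33:
  "(\<Sum>x\<in>A. \<Sum>y\<in>B. \<Sum>z\<in>C. \<Sum>a\<in>A'. \<Sum>b\<in>B'. \<Sum>c\<in>C'. g x y z a b c) =
   (\<Sum>a\<in>A'. \<Sum>b\<in>B'. \<Sum>c\<in>C'. \<Sum>x\<in>A. \<Sum>y\<in>B. \<Sum>z\<in>C. g x y z a b c)"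
proof -
  have "(\<Sum>x\<in>A. \<Sum>y\<in>B. \<Sum>z\<in>C. \<Sum>a\<in>A'. \<Sum>b\<in>B'. \<Sum>c\<in>C'. g x y z a b c) =
    (\<Sum>x\<in>A. \<Sum>y\<in>B. \<Sum>a\<in>A'. \<Sum>b\<in>B'. \<Sum>c\<in>C'. \<Sum>z\<in>C. g x y z a b c)"
    by (intro sum.cong refl sum_rotate4)
  also have "\<dots> = (\<Sum>x\<in>A. \<Sum>a\<in>A'. \<Sum>b\<in>B'. \<Sum>c\<in>C'. \<Sum>y\<in>B. \<Sum>z\<in>C. g x y z a b c)"
    by (intro sum.cong refl sum_rotate4)
  also have "\<dots> = (\<Sum>a\<in>A'. \<Sum>b\<in>B'. \<Sum>c\<in>C'. \<Sum>x\<in>A. \<Sum>y\<in>B. \<Sum>z\<in>C. g x y z a b c)"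
    by (rule sum_rotate4)
  finally show ?thesis .
qed

lemma sum_delta2: "(\<Sum>a\<in>UNIV. \<Sum>b\<in>UNIV. if a = j \<and> b = i then g a b else 0) = g (j::'n::finite) (i::'k::finite)"
proof -
  have "(\<Sum>a\<in>UNIV. \<Sum>b\<in>UNIV. if a = j \<and> b = i then g a b else 0) =
    (\<Sum>a\<in>UNIV. if a = j then \<Sum>b\<in>UNIV. if b = i then g a b else 0 else 0)"
    by (intro sum.cong refl) auto
  then show ?thesis by simp
qed

lemma sum_delta3: "(\<Sum>a\<in>UNIV. \<Sum>b\<in>UNIV. \<Sum>c\<in>UNIV. if a = j \<and> b = i \<and> c = k then g a b c else 0) =
   g (j::'n::finite) (i::'k::finite) (k::'l::finite)"
proof -
  have "(\<Sum>a\<in>UNIV. \<Sum>b\<in>UNIV. \<Sum>c\<in>UNIV. if a = j \<and> b = i \<and> c = k then g a b c else 0) =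
    (\<Sum>a\<in>UNIV. if a = j then \<Sum>b\<in>UNIV. \<Sum>c\<in>UNIV. if b = i \<and> c = k then g a b c else 0 else 0)"
    by (intro sum.cong refl) auto
  then show ?thesis by (simp add: sum_delta2)
qed

text \<open>The coefficients of \<open>A\<^sub>1\<^sub>2 B\<^sub>2\<^sub>3 C\<^sub>1\<^sub>2\<close> and \<open>A\<^sub>2\<^sub>3 B\<^sub>1\<^sub>2 C\<^sub>2\<^sub>3\<close>.\<close>

lemma op_121:
  "op A 0 (op B (Suc 0) (op C 0 x)) (i ## j ## k ## \<phi>) =
   (\<Sum>a\<in>UNIV. \<Sum>b\<in>UNIV. \<Sum>c\<in>UNIV. (\<Sum>i'\<in>UNIV. \<Sum>j'\<in>UNIV. \<Sum>b'\<in>UNIV.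
      A$(i,j)$(i',j') * B$(j',k)$(b',c) * C$(i',b')$(a,b)) *C x (a ## b ## c ## \<phi>))"
proof -
  have "op A 0 (op B (Suc 0) (op C 0 x)) (i ## j ## k ## \<phi>) =
    (\<Sum>i'\<in>UNIV. \<Sum>j'\<in>UNIV. \<Sum>b'\<in>UNIV. \<Sum>c\<in>UNIV. \<Sum>a\<in>UNIV. \<Sum>b\<in>UNIV.
      (A$(i,j)$(i',j') * B$(j',k)$(b',c) * C$(i',b')$(a,b)) *C x (a ## b ## c ## \<phi>))"
    by (simp add: fam_simps scaleC_sum_right scaleC_scaleC mult.assoc)
  also have "\<dots> = (\<Sum>i'\<in>UNIV. \<Sum>j'\<in>UNIV. \<Sum>b'\<in>UNIV. \<Sum>a\<in>UNIV. \<Sum>b\<in>UNIV. \<Sum>c\<in>UNIV.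
      (A$(i,j)$(i',j') * B$(j',k)$(b',c) * C$(i',b')$(a,b)) *C x (a ## b ## c ## \<phi>))"
    by (intro sum.cong refl sum_rotate)
  also have "\<dots> = (\<Sum>a\<in>UNIV. \<Sum>b\<in>UNIV. \<Sum>c\<in>UNIV. \<Sum>i'\<in>UNIV. \<Sum>j'\<in>UNIV. \<Sum>b'\<in>UNIV.
      (A$(i,j)$(i',j') * B$(j',k)$(b',c) * C$(i',b')$(a,b)) *C x (a ## b ## c ## \<phi>))"
    by (rule sum_swap33)
  finally show ?thesis
    by (simp add: scaleC_sum_left)
qed

lemma op_212:
  "op A (Suc 0) (op B 0 (op C (Suc 0) x)) (i ## j ## k ## \<phi>) =
   (\<Sum>a\<in>UNIV. \<Sum>b\<in>UNIV. \<Sum>c\<in>UNIV. (\<Sum>j'\<in>UNIV. \<Sum>k'\<in>UNIV. \<Sum>b'\<in>UNIV.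
      A$(j,k)$(j',k') * B$(i,j')$(a,b') * C$(b',k')$(b,c)) *C x (a ## b ## c ## \<phi>))"
proof -
  have "op A (Suc 0) (op B 0 (op C (Suc 0) x)) (i ## j ## k ## \<phi>) =
    (\<Sum>j'\<in>UNIV. \<Sum>k'\<in>UNIV. \<Sum>a\<in>UNIV. \<Sum>b'\<in>UNIV. \<Sum>b\<in>UNIV. \<Sum>c\<in>UNIV.
      (A$(j,k)$(j',k') * B$(i,j')$(a,b') * C$(b',k')$(b,c)) *C x (a ## b ## c ## \<phi>))"
    by (simp add: fam_simps scaleC_sum_right scaleC_scaleC mult.assoc)
  also have "\<dots> = (\<Sum>j'\<in>UNIV. \<Sum>k'\<in>UNIV. \<Sum>b'\<in>UNIV. \<Sum>a\<in>UNIV. \<Sum>b\<in>UNIV. \<Sum>c\<in>UNIV.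
      (A$(j,k)$(j',k') * B$(i,j')$(a,b') * C$(b',k')$(b,c)) *C x (a ## b ## c ## \<phi>))"
    by (intro sum.cong refl sum.swap)
  also have "\<dots> = (\<Sum>a\<in>UNIV. \<Sum>b\<in>UNIV. \<Sum>c\<in>UNIV. \<Sum>j'\<in>UNIV. \<Sum>k'\<in>UNIV. \<Sum>b'\<in>UNIV.
      (A$(j,k)$(j',k') * B$(i,j')$(a,b') * C$(b',k')$(b,c)) *C x (a ## b ## c ## \<phi>))"
    by (rule sum_swap33)
  finally show ?thesis
    by (simp add: scaleC_sum_left)
qed

text \<open>Six independent matrices are allowed so that one lemma yields the braid relation for V
  and for its dual as well as the mixed ones, in which the types of the legs change along the
  way.\<close>

lemma op_braid:
  fixes A B C A' B' C' :: "complex^('n::finite \<times> 'n)^('n \<times> 'n)" and x :: "('n, 'b::complex_vector) fam"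
  assumes "\<And>i j k a b c.
     (\<Sum>i'\<in>UNIV. \<Sum>j'\<in>UNIV. \<Sum>b'\<in>UNIV. A$(i,j)$(i',j') * B$(j',k)$(b',c) * C$(i',b')$(a,b)) =
     (\<Sum>j'\<in>UNIV. \<Sum>k'\<in>UNIV. \<Sum>b'\<in>UNIV. A'$(j,k)$(j',k') * B'$(i,j')$(a,b') * C'$(b',k')$(b,c))"
  shows "op A k (op B (Suc k) (op C k x)) = op A' (Suc k) (op B' k (op C' (Suc k) x))"
proof (rule op_shift[where L = "\<lambda>k x. op A k (op B (Suc k) (op C k x))"])
  fix x :: "('n, 'b) fam"
  show "op A 0 (op B (Suc 0) (op C 0 x)) = op A' (Suc 0) (op B' 0 (op C' (Suc 0) x))"
  proof (rule fam_eqI)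
    fix i and \<psi> :: "nat \<Rightarrow> 'n"
    obtain j k \<phi> where [simp]: "\<psi> = j ## k ## \<phi>" by (metis stream_cases)
    show "op A 0 (op B (Suc 0) (op C 0 x)) (i ## \<psi>) = op A' (Suc 0) (op B' 0 (op C' (Suc 0) x)) (i ## \<psi>)"
      by (simp add: op_121 op_212 assms)
  qed
qed (simp_all add: fam_simps)

locale braid_matrices =
  fixes q :: real and N :: nat and pos :: "'n::finite \<Rightarrow> nat"
  assumes q_pos: "0 < q"
    and pos: "bij_betw pos UNIV {..<N}"
begin

text \<open>
  \<open>pos\<close> numbers the weight basis, starting with the highest weight. Up to powers of \<open>q\<^sup>1\<^sup>/\<^sup>N\<close>, the matrices
  \<open>Rm\<close>, \<open>Rs\<close> and \<open>Xm\<close> are the braidings of \<open>V \<otimes> V\<close>, \<open>V\<^sup>* \<otimes> V\<^sup>*\<close> and \<open>V \<otimes> V\<^sup>*\<close>, and \<open>Ri\<close>, \<open>Rsi\<close> and \<open>Ym\<close> are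
  their inverses.
\<close>

definition qc :: complex where "qc = complex_of_real q"
definition hc :: complex where "hc = qc - inverse qc"
definition kap :: "'n \<Rightarrow> 'n \<Rightarrow> complex" where "kap i j = (if i = j then qc else 1)"

definition Rm :: "complex^('n \<times> 'n)^('n \<times> 'n)" where
  "Rm = (\<chi> i j. (if fst j = snd i \<and> snd j = fst i then kap (fst i) (snd i) else 0) +
                 (if j = i \<and> pos (snd i) < pos (fst i) then hc else 0))"

definition Ri :: "complex^('n \<times> 'n)^('n \<times> 'n)" where
  "Ri = Rm - hc *C mat 1"

definition Rs :: "complex^('n \<times> 'n)^('n \<times> 'n)" where
  "Rs = (\<chi> i j. Rm $ (snd j, fst j) $ (snd i, fst i))"

definition Rsi :: "complex^('n \<times> 'n)^('n \<times> 'n)" where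
  "Rsi = Rs - hc *C mat 1"

text \<open>This is q to the power (2\<rho>, \<lambda>_j): along the chain the pairing with 2\<rho>
  falls in steps of 2 from N - 1 to 1 - N.\<close>

definition wq :: "'n \<Rightarrow> complex" where
  "wq j = qc powi (int N - 1 - 2 * int (pos j))"

text \<open>A partial transpose of \<open>Rm\<close>. Bending one strand with the unweighted E and C
  turns the braiding of V with itself into a module map from (dual of V) \<otimes> V to V \<otimes>
  (dual of V).\<close>

definition Ym :: "complex^('n \<times> 'n)^('n \<times> 'n)" where
  "Ym = (\<chi> i j. Rm $ (fst j, fst i) $ (snd j, snd i))"

text \<open>The strand of \<open>Ri\<close> is bent the other way, with E' and C', and these
  contribute the quotient of weights.\<close>

definition Xm :: "complex^('n \<times> 'n)^('n \<times> 'n)" where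
  "Xm = (\<chi> i j. wq (snd j) / wq (fst i) * Ri $ (snd i, snd j) $ (fst i, fst j))"

lemma qc_nz [simp]: "qc \<noteq> 0"
  using q_pos by (simp add: qc_def)

lemma wq_nz [simp]: "wq j \<noteq> 0"
  by (simp add: wq_def)

lemma pos_inj: "pos i = pos j \<longleftrightarrow> i = j"
  using bij_betw_imp_inj_on[OF pos] by (blast dest: injD)

lemma pos_less: "pos i < N"
  using bij_betwE[OF pos] by blast

lemma Rm_nth: "Rm $ (i, j) $ (a, b) = (if a = j \<and> b = i then kap i j else 0) +
                 (if a = i \<and> b = j \<and> pos j < pos i then hc else 0)"
  by (simp add: Rm_def)

lemma diff_mat_nth: "(M - c *C mat 1 :: complex^('n \<times> 'n)^('n \<times> 'n)) $ (i, j) $ (a, b) =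
    M $ (i, j) $ (a, b) - (if a = i \<and> b = j then c else 0)"
  unfolding mat_def scaleC_vec_def scaleC_complex_def by simp

text \<open>Subtracting \<open>hc\<close> on the diagonal turns q into its inverse and moves the
  triangular part, with a sign, to the opposite order of positions.\<close>

lemma Ri_nth: "Ri $ (i, j) $ (a, b) = (if a = j \<and> b = i then inverse (kap i j) else 0) -
                 (if a = i \<and> b = j \<and> pos i < pos j then hc else 0)"
  unfolding Ri_def diff_mat_nth Rm_nth kap_def hc_def
  by (cases "pos i" "pos j" rule: linorder_cases) (auto simp: pos_inj)

lemma Rs_nth: "Rs $ (i, j) $ (a, b) = (if a = j \<and> b = i then kap i j else 0) +
                 (if a = i \<and> b = j \<and> pos i < pos j then hc else 0)"
proof -
  have "Rs $ (i, j) $ (a, b) = Rm $ (b, a) $ (j, i)"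
    by (simp add: Rs_def)
  also have "\<dots> = (if a = j \<and> b = i then kap i j else 0) + (if a = i \<and> b = j \<and> pos i < pos j then hc else 0)"
    unfolding Rm_nth kap_def by (rule arg_cong2[where f = "(+)"]) auto
  finally show ?thesis .
qed

lemma Rsi_nth: "Rsi $ (i, j) $ (a, b) = (if a = j \<and> b = i then inverse (kap i j) else 0) -
                 (if a = i \<and> b = j \<and> pos j < pos i then hc else 0)"
  unfolding Rsi_def diff_mat_nth Rs_nth kap_def hc_def
  by (cases "pos i" "pos j" rule: linorder_cases) (auto simp: pos_inj)

lemma Ym_nth: "Ym $ (i, j) $ (a, b) = Rm $ (a, i) $ (b, j)"
  by (simp add: Ym_def)

lemma Xm_nth: "Xm $ (i, j) $ (a, b) = wq b / wq i * Ri $ (j, b) $ (i, a)"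
  by (simp add: Xm_def)

lemma Rs_eq: "Rs $ (i, j) $ (a, b) = Rm $ (b, a) $ (j, i)"
  by (simp add: Rs_def)

lemma Rsi_eq: "Rsi $ (i, j) $ (a, b) = Ri $ (b, a) $ (j, i)"
  unfolding Rsi_nth Ri_nth kap_def by (rule arg_cong2[where f = "(-)"]) auto

lemma scaleC_if3: "(if P \<and> Q \<and> L then c else 0) *C x =
    (if P \<and> Q then (if L then c else 0) *C x else (0 :: 'm::complex_vector))"
  by simp

lemma op_Rm: "op Rm 0 x (i ## j ## \<phi>) =
    kap i j *C x (j ## i ## \<phi>) + (if pos j < pos i then hc else 0) *C x (i ## j ## \<phi>)"
proof -
  have "op Rm 0 x (i ## j ## \<phi>) = (\<Sum>a\<in>UNIV. \<Sum>b\<in>UNIV.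
      (if a = j \<and> b = i then kap i j *C x (a ## b ## \<phi>) else 0) +
      (if a = i \<and> b = j then (if pos j < pos i then hc else 0) *C x (a ## b ## \<phi>) else 0))"
    unfolding op_0_scons Rm_nth scaleC_add_left scaleC_if3 scaleC_if[of "_ \<and> _ = _"] ..
  also have "\<dots> = kap i j *C x (j ## i ## \<phi>) + (if pos j < pos i then hc else 0) *C x (i ## j ## \<phi>)"
    by (simp only: sum.distrib sum_delta2)
  finally show ?thesis .
qed

text \<open>A case distinction over the relative order of the three positions; \<open>h\<close> is
  the quadratic relation, which is what remains when indices coincide. Scalar-valued families are
  enough, because coefficients can be read off from them.\<close>

lemma op_Rm_braid_complex:
  fixes x :: "('n, complex) fam"
  shows "op Rm 0 (op Rm (Suc 0) (op Rm 0 x)) (i ## j ## k ## \<phi>) = op Rm (Suc 0) (op Rm 0 (op Rm (Suc 0) x)) (i ## j ## k ## \<phi>)"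
proof -
  have e: "op Rm 0 x (i ## j ## \<phi>) = kap i j * x (j ## i ## \<phi>) + (if pos j < pos i then hc * x (i ## j ## \<phi>) else 0)"
    for x :: "('n, complex) fam" and i j \<phi>
    by (simp add: op_Rm scaleC_complex_def)
  have h: "qc * (qc * z) = hc * (qc * z) + z" for z by (simp add: hc_def algebra_simps)
  have o: "i = j \<or> i \<noteq> j \<and> pos i < pos j \<and> \<not> pos j < pos i \<or> i \<noteq> j \<and> pos j < pos i \<and> \<not> pos i < pos j" for i j
    by (cases "pos i" "pos j" rule: linorder_cases) (auto simp: pos_inj)
  show ?thesis
    using o[of i j] o[of i k] o[of k j]
    by (elim disjE conjE; simp add: op_Suc_scons e kap_def; (simp add: distrib_left mult.left_commute[of qc hc] h add_ac; fail)?)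
qed

lemma Rm_braid:
  "(\<Sum>i'\<in>UNIV. \<Sum>j'\<in>UNIV. \<Sum>b'\<in>UNIV. Rm$(i,j)$(i',j') * Rm$(j',k)$(b',c) * Rm$(i',b')$(a,b)) =
   (\<Sum>j'\<in>UNIV. \<Sum>k'\<in>UNIV. \<Sum>b'\<in>UNIV. Rm$(j,k)$(j',k') * Rm$(i,j')$(a,b') * Rm$(b',k')$(b,c))"
proof -
  \<comment> \<open>Testing on the indicator of one index triple extracts one matrix coefficient
    from the operator identity.\<close>
  define x :: "('n, complex) fam" where
    "x \<phi> = (if \<phi> 0 = a \<and> \<phi> (Suc 0) = b \<and> \<phi> (Suc (Suc 0)) = c then 1 else 0)" for \<phi>
  have s: "(\<Sum>a'\<in>UNIV. \<Sum>b'\<in>UNIV. \<Sum>c'\<in>UNIV. K a' b' c' *C x (a' ## b' ## c' ## \<phi>)) = K a b c" for K \<phi>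
  proof -
    have "(\<Sum>a'\<in>UNIV. \<Sum>b'\<in>UNIV. \<Sum>c'\<in>UNIV. K a' b' c' *C x (a' ## b' ## c' ## \<phi>)) =
      (\<Sum>a'\<in>UNIV. \<Sum>b'\<in>UNIV. \<Sum>c'\<in>UNIV. if a' = a \<and> b' = b \<and> c' = c then K a' b' c' else 0)"
      apply (rule sum.cong[OF refl])
      apply (rule sum.cong[OF refl])
      apply (rule sum.cong[OF refl])
      apply (subst x_def)
      apply (simp add: scaleC_complex_def)
      done
    then show ?thesis by (simp only: sum_delta3)
  qed
  show ?thesis
    using op_Rm_braid_complex[of x i j k "undefined :: nat \<Rightarrow> 'n"] by (simp only: op_121 op_212 s)
qed

lemmas op_Rm_braid = op_braid[OF Rm_braid]

text \<open>\<open>Rs\<close> is \<open>Rm\<close> with rows and columns exchanged and the two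
  factors reversed, so this is \<open>Rm_braid\<close> read backwards, up to the order of
  summation.\<close>

lemma Rs_braid:
  "(\<Sum>i'\<in>UNIV. \<Sum>j'\<in>UNIV. \<Sum>b'\<in>UNIV. Rs$(i,j)$(i',j') * Rs$(j',k)$(b',c) * Rs$(i',b')$(a,b)) =
   (\<Sum>j'\<in>UNIV. \<Sum>k'\<in>UNIV. \<Sum>b'\<in>UNIV. Rs$(j,k)$(j',k') * Rs$(i,j')$(a,b') * Rs$(b',k')$(b,c))"
proof -
  have 1: "(\<Sum>i'\<in>UNIV. \<Sum>j'\<in>UNIV. \<Sum>b'\<in>UNIV. Rs$(i,j)$(i',j') * Rs$(j',k)$(b',c) * Rs$(i',b')$(a,b)) =
    (\<Sum>b'\<in>UNIV. \<Sum>i'\<in>UNIV. \<Sum>j'\<in>UNIV. Rm$(b,a)$(b',i') * Rm$(c,b')$(k,j') * Rm$(j',i')$(j,i))"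
    by (rule sum_rotate[symmetric, THEN trans]) (intro sum.cong refl, simp only: Rs_eq mult_ac)
  have 2: "(\<Sum>b'\<in>UNIV. \<Sum>i'\<in>UNIV. \<Sum>j'\<in>UNIV. Rm$(b,a)$(b',i') * Rm$(c,b')$(k,j') * Rm$(j',i')$(j,i)) = (\<Sum>k'\<in>UNIV. \<Sum>b'\<in>UNIV. \<Sum>j'\<in>UNIV. Rm$(c,b)$(k',b') * Rm$(b',a)$(j',i) * Rm$(k',j')$(k,j))"
    by (rule Rm_braid[symmetric])
  have 3: "(\<Sum>k'\<in>UNIV. \<Sum>b'\<in>UNIV. \<Sum>j'\<in>UNIV. Rm$(c,b)$(k',b') * Rm$(b',a)$(j',i) * Rm$(k',j')$(k,j)) = (\<Sum>j'\<in>UNIV. \<Sum>k'\<in>UNIV. \<Sum>b'\<in>UNIV. Rs$(j,k)$(j',k') * Rs$(i,j')$(a,b') * Rs$(b',k')$(b,c))"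
    by (rule sum_rotate[symmetric, THEN trans]) (intro sum.cong refl, simp only: Rs_eq mult_ac)
  show ?thesis
    by (simp only: 1 2 3)
qed

lemmas op_Rs_braid = op_braid[OF Rs_braid]

text \<open>Undoing the partial transposes leaves \<open>Rm_braid\<close> with outer indices moved
  between rows and columns: bending a strand preserves the braid relation. The same holds for
  \<open>Ym_Rs_braid\<close> below.\<close>

lemma Rm_Ym_braid:
  "(\<Sum>i'\<in>UNIV. \<Sum>j'\<in>UNIV. \<Sum>b'\<in>UNIV. Rm$(i,j)$(i',j') * Ym$(j',k)$(b',c) * Ym$(i',b')$(a,b)) =
   (\<Sum>j'\<in>UNIV. \<Sum>k'\<in>UNIV. \<Sum>b'\<in>UNIV. Ym$(j,k)$(j',k') * Ym$(i,j')$(a,b') * Rm$(b',k')$(b,c))"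
proof -
  have 1: "(\<Sum>i'\<in>UNIV. \<Sum>j'\<in>UNIV. \<Sum>b'\<in>UNIV. Rm$(i,j)$(i',j') * Ym$(j',k)$(b',c) * Ym$(i',b')$(a,b)) =
    (\<Sum>i'\<in>UNIV. \<Sum>j'\<in>UNIV. \<Sum>b'\<in>UNIV. Rm$(i,j)$(i',j') * Rm$(a,i')$(b,b') * Rm$(b',j')$(c,k))"
    by (intro sum.cong refl, simp only: Ym_nth mult_ac)
  have 2: "(\<Sum>i'\<in>UNIV. \<Sum>j'\<in>UNIV. \<Sum>b'\<in>UNIV. Rm$(i,j)$(i',j') * Rm$(a,i')$(b,b') * Rm$(b',j')$(c,k)) = (\<Sum>b'\<in>UNIV. \<Sum>j'\<in>UNIV. \<Sum>k'\<in>UNIV. Rm$(a,i)$(b',j') * Rm$(j',j)$(k',k) * Rm$(b',k')$(b,c))"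
    by (rule Rm_braid[symmetric])
  have 3: "(\<Sum>b'\<in>UNIV. \<Sum>j'\<in>UNIV. \<Sum>k'\<in>UNIV. Rm$(a,i)$(b',j') * Rm$(j',j)$(k',k) * Rm$(b',k')$(b,c)) = (\<Sum>j'\<in>UNIV. \<Sum>k'\<in>UNIV. \<Sum>b'\<in>UNIV. Ym$(j,k)$(j',k') * Ym$(i,j')$(a,b') * Rm$(b',k')$(b,c))"
    by (rule sum_rotate[THEN trans]) (intro sum.cong refl, simp only: Ym_nth mult_ac)
  show ?thesis
    by (simp only: 1 2 3)
qed

lemmas op_Rm_Ym_braid = op_braid[OF Rm_Ym_braid]

lemma Ym_Rs_braid:
  "(\<Sum>i'\<in>UNIV. \<Sum>j'\<in>UNIV. \<Sum>b'\<in>UNIV. Ym$(i,j)$(i',j') * Ym$(j',k)$(b',c) * Rs$(i',b')$(a,b)) =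
   (\<Sum>j'\<in>UNIV. \<Sum>k'\<in>UNIV. \<Sum>b'\<in>UNIV. Rs$(j,k)$(j',k') * Ym$(i,j')$(a,b') * Ym$(b',k')$(b,c))"
proof -
  have 1: "(\<Sum>i'\<in>UNIV. \<Sum>j'\<in>UNIV. \<Sum>b'\<in>UNIV. Ym$(i,j)$(i',j') * Ym$(j',k)$(b',c) * Rs$(i',b')$(a,b)) =
    (\<Sum>b'\<in>UNIV. \<Sum>i'\<in>UNIV. \<Sum>j'\<in>UNIV. Rm$(b,a)$(b',i') * Rm$(i',i)$(j',j) * Rm$(b',j')$(c,k))"
    by (rule sum_rotate[symmetric, THEN trans]) (intro sum.cong refl, simp only: Ym_nth Rs_eq mult_ac)
  have 2: "(\<Sum>b'\<in>UNIV. \<Sum>i'\<in>UNIV. \<Sum>j'\<in>UNIV. Rm$(b,a)$(b',i') * Rm$(i',i)$(j',j) * Rm$(b',j')$(c,k)) = (\<Sum>b'\<in>UNIV. \<Sum>j'\<in>UNIV. \<Sum>k'\<in>UNIV. Rm$(a,i)$(b',j') * Rm$(b,b')$(c,k') * Rm$(k',j')$(k,j))"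
    by (rule Rm_braid)
  have 3: "(\<Sum>b'\<in>UNIV. \<Sum>j'\<in>UNIV. \<Sum>k'\<in>UNIV. Rm$(a,i)$(b',j') * Rm$(b,b')$(c,k') * Rm$(k',j')$(k,j)) = (\<Sum>j'\<in>UNIV. \<Sum>k'\<in>UNIV. \<Sum>b'\<in>UNIV. Rs$(j,k)$(j',k') * Ym$(i,j')$(a,b') * Ym$(b',k')$(b,c))"
    by (rule sum_rotate[THEN trans]) (intro sum.cong refl, simp only: Ym_nth Rs_eq mult_ac)
  show ?thesis
    by (simp only: 1 2 3)
qed

lemmas op_Ym_Rs_braid = op_braid[OF Ym_Rs_braid]

end

lemma op_mat_diff: "op (A - B) k x = (\<lambda>\<phi>. op A k x \<phi> - op B k x \<phi>)"
proof (induction k arbitrary: x)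
  case 0
  then show ?case
    by (intro ext) (simp add: op.simps scaleC_diff_left sum_subtractf)
qed (simp add: op.simps)

lemma op_eq_imp_mat_eq:
  fixes A B :: "complex^('n::finite \<times> 'n)^('n \<times> 'n)"
  assumes "\<And>x :: ('n, complex) fam. op A 0 x = op B 0 x"
  shows "A = B"
proof -
  have s: "M $ (i, j) $ (a, b) = op M 0 (\<lambda>\<phi>. if \<phi> 0 = a \<and> \<phi> (Suc 0) = b then 1 else 0) (i ## j ## undefined)"
    for M :: "complex^('n \<times> 'n)^('n \<times> 'n)" and i j a b
  proof -
    have "(\<Sum>a'\<in>UNIV. \<Sum>b'\<in>UNIV. M $ (i, j) $ (a', b') *C (if a' = a \<and> b' = b then 1 else 0)) =
      (\<Sum>a'\<in>UNIV. \<Sum>b'\<in>UNIV. if a' = a \<and> b' = b then M $ (i, j) $ (a', b') else 0)"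
      by (rule sum.cong[OF refl])+ (simp add: scaleC_complex_def)
    then show ?thesis
      unfolding op_0_scons by (simp only: nat.case sum_delta2)
  qed
  have "A $ (i, j) $ (a, b) = B $ (i, j) $ (a, b)" for i j a b
    by (simp only: s assms)
  then show ?thesis
    by (simp add: vec_eq_iff)
qed

lemma scaleC_scaleC_if: "c *C (if P then d else 0) *C x = (if P then (c * d) *C x else (0 :: 'm::complex_vector))"
  by (simp add: scaleC_scaleC)

lemma op_0_ins_1:
  "op A 0 (ins w (Suc 0) x) (i ## j ## k ## \<phi>) = (\<Sum>a\<in>UNIV. (A $ (i, j) $ (a, k) * w k) *C x (a ## \<phi>))"
proof -
  have "op A 0 (ins w (Suc 0) x) (i ## j ## k ## \<phi>) =
      (\<Sum>a\<in>UNIV. \<Sum>b\<in>UNIV. if b = k then (A $ (i, j) $ (a, b) * w b) *C x (a ## \<phi>) else 0)"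
    by (simp add: fam_simps scaleC_scaleC_if)
  then show ?thesis
    by simp
qed

lemma op_1_ins_0:
  "op A (Suc 0) (ins w 0 x) (i ## j ## k ## \<phi>) = (\<Sum>b\<in>UNIV. (A $ (j, k) $ (i, b) * w i) *C x (b ## \<phi>))"
proof -
  have "op A (Suc 0) (ins w 0 x) (i ## j ## k ## \<phi>) =
      (\<Sum>a\<in>UNIV. \<Sum>b\<in>UNIV. if i = a then (A $ (j, k) $ (a, b) * w i) *C x (b ## \<phi>) else 0)"
    by (simp add: fam_simps scaleC_scaleC_if)
  also have "\<dots> = (\<Sum>b\<in>UNIV. (A $ (j, k) $ (i, b) * w i) *C x (b ## \<phi>))"
    by (subst sum.swap) simp
  finally show ?thesis .
qed

text \<open>Naturality with respect to a coevaluation: a strand that crosses one leg of an inserted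
  pair may cross the other leg instead, with the correspondingly bent matrix.\<close>

lemma op_ins_shift:
  assumes "\<And>i j k a. A $ (i, j) $ (a, k) * w k = B $ (j, k) $ (i, a) * w i"
  shows "op A k (ins w (Suc k) x) = op B (Suc k) (ins w k (x :: ('n::finite, 'm::complex_vector) fam))"
proof (rule op_shift[where L = "\<lambda>k x. op A k (ins w (Suc k) x)"])
  fix x :: "('n, 'm) fam"
  show "op A 0 (ins w (Suc 0) x) = op B (Suc 0) (ins w 0 x)"
  proof (rule fam_eqI)
    fix i and \<psi> :: "nat \<Rightarrow> 'n"
    obtain j k \<phi> where [simp]: "\<psi> = j ## k ## \<phi>" by (metis stream_cases)
    show "op A 0 (ins w (Suc 0) x) (i ## \<psi>) = op B (Suc 0) (ins w 0 x) (i ## \<psi>)"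
      by (simp add: op_0_ins_1 op_1_ins_0 assms)
  qed
qed (simp_all add: fam_simps)

text \<open>The dual statement: a crossing below one leg of a contracted pair is traded for a
  crossing with the other leg. The primed variant moves it in the opposite direction.\<close>

lemma con_op_shift:
  assumes "\<And>i j a b. w j * A $ (j, i) $ (a, b) = w b * B $ (i, b) $ (j, a)"
  shows "con w k (op A (Suc k) x) = con w (Suc k) (op B k (x :: ('n::finite, 'm::complex_vector) fam))"
proof (rule op_shift[where L = "\<lambda>k x. con w k (op A (Suc k) x)"])
  fix x :: "('n, 'm) fam"
  show "con w 0 (op A (Suc 0) x) = con w (Suc 0) (op B 0 x)"
  proof (rule fam_eqI)
    fix i and \<phi> :: "nat \<Rightarrow> 'n"
    have "con w 0 (op A (Suc 0) x) (i ## \<phi>) =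
        (\<Sum>j\<in>UNIV. \<Sum>a\<in>UNIV. \<Sum>b\<in>UNIV. (w j * A $ (j, i) $ (a, b)) *C x (j ## a ## b ## \<phi>))"
      by (simp add: fam_simps scaleC_sum_right scaleC_scaleC)
    also have "\<dots> = (\<Sum>b\<in>UNIV. \<Sum>j\<in>UNIV. \<Sum>a\<in>UNIV. (w b * B $ (i, b) $ (j, a)) *C x (j ## a ## b ## \<phi>))"
      unfolding assms by (rule sum_rotate[symmetric])
    also have "\<dots> = con w (Suc 0) (op B 0 x) (i ## \<phi>)"
      by (simp add: fam_simps scaleC_sum_right scaleC_scaleC)
    finally show "con w 0 (op A (Suc 0) x) (i ## \<phi>) = con w (Suc 0) (op B 0 x) (i ## \<phi>)" .
  qed
qed (simp_all add: fam_simps)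

lemma con_op_shift':
  assumes "\<And>i j a b. w i * A $ (j, i) $ (a, b) = w a * B $ (a, j) $ (b, i)"
  shows "con w (Suc k) (op A k x) = con w k (op B (Suc k) (x :: ('n::finite, 'm::complex_vector) fam))"
proof (rule op_shift[where L = "\<lambda>k x. con w (Suc k) (op A k x)"])
  fix x :: "('n, 'm) fam"
  show "con w (Suc 0) (op A 0 x) = con w 0 (op B (Suc 0) x)"
  proof (rule fam_eqI)
    fix j and \<phi> :: "nat \<Rightarrow> 'n"
    have "con w (Suc 0) (op A 0 x) (j ## \<phi>) =
        (\<Sum>i\<in>UNIV. \<Sum>a\<in>UNIV. \<Sum>b\<in>UNIV. (w i * A $ (j, i) $ (a, b)) *C x (a ## b ## i ## \<phi>))"
      by (simp add: fam_simps scaleC_sum_right scaleC_scaleC)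
    also have "\<dots> = (\<Sum>a\<in>UNIV. \<Sum>b\<in>UNIV. \<Sum>i\<in>UNIV. (w a * B $ (a, j) $ (b, i)) *C x (a ## b ## i ## \<phi>))"
      unfolding assms by (rule sum_rotate)
    also have "\<dots> = con w 0 (op B (Suc 0) x) (j ## \<phi>)"
      by (simp add: fam_simps scaleC_sum_right scaleC_scaleC)
    finally show "con w (Suc 0) (op A 0 x) (j ## \<phi>) = con w 0 (op B (Suc 0) x) (j ## \<phi>)" .
  qed
qed (simp_all add: fam_simps)

section \<open>Hecke relations, inverses, naturality and partial traces of the braid
  matrices\<close>

context braid_matrices
begin

abbreviation one :: "'n \<Rightarrow> complex" where "one \<equiv> \<lambda>_. 1"
abbreviation wi :: "'n \<Rightarrow> complex" where "wi \<equiv> \<lambda>i. inverse (wq i)"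

lemma op_Rs: "op Rs 0 x (i ## j ## \<phi>) =
    kap i j *C x (j ## i ## \<phi>) + (if pos i < pos j then hc else 0) *C x (i ## j ## \<phi>)"
proof -
  have "op Rs 0 x (i ## j ## \<phi>) = (\<Sum>a\<in>UNIV. \<Sum>b\<in>UNIV.
      (if a = j \<and> b = i then kap i j *C x (a ## b ## \<phi>) else 0) +
      (if a = i \<and> b = j then (if pos i < pos j then hc else 0) *C x (a ## b ## \<phi>) else 0))"
    unfolding op_0_scons Rs_nth scaleC_add_left scaleC_if3 scaleC_if[of "_ \<and> _ = _"] ..
  also have "\<dots> = kap i j *C x (j ## i ## \<phi>) + (if pos i < pos j then hc else 0) *C x (i ## j ## \<phi>)"
    by (simp only: sum.distrib sum_delta2)
  finally show ?thesis .
qed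

lemma hc_qc: "qc * qc = hc * qc + 1"
  by (simp add: hc_def algebra_simps)

lemma pos_trichotomy:
  obtains "i = j" | "i \<noteq> j" "pos i < pos j" "\<not> pos j < pos i" | "i \<noteq> j" "pos j < pos i" "\<not> pos i < pos j"
  using pos_inj[of i j] by (cases "pos i" "pos j" rule: linorder_cases) auto

lemma Rm_hecke:
  fixes x :: "('n, 'b::complex_vector) fam"
  shows "op Rm k (op Rm k x) = (\<lambda>\<phi>. hc *C op Rm k x \<phi> + x \<phi>)"
proof (rule op_shift[where L = "\<lambda>k x. op Rm k (op Rm k x)" and L' = "\<lambda>k x \<phi>. hc *C op Rm k x \<phi> + x \<phi>"])
  fix x :: "('n, 'b) fam"
  show "op Rm 0 (op Rm 0 x) = (\<lambda>\<phi>. hc *C op Rm 0 x \<phi> + x \<phi>)"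
  proof (rule fam_eqI)
    fix i and \<psi> :: "nat \<Rightarrow> 'n"
    obtain j \<phi> where [simp]: "\<psi> = j ## \<phi>" by (rule stream_cases)
    show "op Rm 0 (op Rm 0 x) (i ## \<psi>) = hc *C op Rm 0 x (i ## \<psi>) + x (i ## \<psi>)"
      by (rule pos_trichotomy[of i j])
        (simp_all add: op_Rm kap_def scaleC_add_right scaleC_scaleC scaleC_one hc_qc scaleC_add_left)
  qed
qed (simp_all add: fam_simps)

lemma Rs_hecke:
  fixes x :: "('n, 'b::complex_vector) fam"
  shows "op Rs k (op Rs k x) = (\<lambda>\<phi>. hc *C op Rs k x \<phi> + x \<phi>)"
proof (rule op_shift[where L = "\<lambda>k x. op Rs k (op Rs k x)" and L' = "\<lambda>k x \<phi>. hc *C op Rs k x \<phi> + x \<phi>"])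
  fix x :: "('n, 'b) fam"
  show "op Rs 0 (op Rs 0 x) = (\<lambda>\<phi>. hc *C op Rs 0 x \<phi> + x \<phi>)"
  proof (rule fam_eqI)
    fix i and \<psi> :: "nat \<Rightarrow> 'n"
    obtain j \<phi> where [simp]: "\<psi> = j ## \<phi>" by (rule stream_cases)
    show "op Rs 0 (op Rs 0 x) (i ## \<psi>) = hc *C op Rs 0 x (i ## \<psi>) + x (i ## \<psi>)"
      by (rule pos_trichotomy[of i j])
        (simp_all add: op_Rs kap_def scaleC_add_right scaleC_scaleC scaleC_one hc_qc scaleC_add_left)
  qed
qed (simp_all add: fam_simps)

lemma op_Ri_eq: "op Ri k x = (\<lambda>\<phi>. op Rm k x \<phi> - hc *C x \<phi>)"
  by (simp add: Ri_def op_mat_diff op_mat_scale op_mat_1)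

lemma op_Rsi_eq: "op Rsi k x = (\<lambda>\<phi>. op Rs k x \<phi> - hc *C x \<phi>)"
  by (simp add: Rsi_def op_mat_diff op_mat_scale op_mat_1)

lemma Ri_Rm [simp]: "op Ri k (op Rm k x) = x" and Rm_Ri [simp]: "op Rm k (op Ri k x) = x"
  by (simp_all add: op_Ri_eq op_diff op_scale Rm_hecke)

lemma Rsi_Rs [simp]: "op Rsi k (op Rs k x) = x" and Rs_Rsi [simp]: "op Rs k (op Rsi k x) = x"
  by (simp_all add: op_Rsi_eq op_diff op_scale Rs_hecke)

lemma Rs_Rsi_mat: "Rs ** Rsi = mat 1" "Rsi ** Rs = mat 1"
  by (rule op_eq_imp_mat_eq; simp add: op_mat_mult op_mat_1)+

lemma sum_pos: "(\<Sum>j\<in>UNIV. if m \<le> pos j \<and> pos j < n then F (pos j) else 0) = (\<Sum>k\<in>{m..<n}. F k)"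
  if "n \<le> N"
proof -
  have "(\<Sum>j\<in>UNIV. if m \<le> pos j \<and> pos j < n then F (pos j) else 0) =
    (\<Sum>k\<in>{..<N}. if m \<le> k \<and> k < n then F k else 0)"
    by (rule sum.reindex_bij_betw[OF pos])
  also have "\<dots> = (\<Sum>k\<in>{k\<in>{..<N}. m \<le> k \<and> k < n}. F k)"
    by (rule sum.inter_filter[symmetric]) simp
  also have "{k\<in>{..<N}. m \<le> k \<and> k < n} = {m..<n}"
    using that by auto
  finally show ?thesis .
qed

lemma hc_powi: "hc * qc powi z = qc powi (z + 1) - qc powi (z - 1)"
  by (simp add: hc_def left_diff_distrib power_int_add power_int_diff field_simps)

text \<open>The sum telescopes: \<open>hc\<close> times a power of q is the difference of the two
  neighbouring powers, and the exponents advance by 2.\<close>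

lemma sum_powi: "m \<le> n \<Longrightarrow> (\<Sum>k\<in>{m..<n}. hc * qc powi (2 * int k + c)) = qc powi (2 * int n + c - 1) - qc powi (2 * int m + c - 1)"
  by (induction n rule: dec_induct) (simp_all add: hc_powi algebra_simps)

lemma sum_powi': "(\<Sum>k\<in>{0..<n}. hc * qc powi (c - 2 * int k)) = qc powi (c + 1) - qc powi (c + 1 - 2 * int n)"
  by (induction n) (simp_all add: hc_powi algebra_simps)

lemma wq_sum: "qc * wq i + (\<Sum>b\<in>UNIV. if pos b < pos i then hc * wq b else 0) = qc powi (int N)"
proof -
  have "(\<Sum>b\<in>UNIV. if pos b < pos i then hc * wq b else 0) =
    (\<Sum>k\<in>{0..<pos i}. hc * qc powi (int N - 1 - 2 * int k))"
    unfolding wq_def using sum_pos[of "pos i" 0 "\<lambda>k. hc * qc powi (int N - 1 - 2 * int k)"] pos_less[of i] by simp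
  also have "\<dots> = qc powi (int N) - qc powi (int N - 2 * int (pos i))"
    by (simp add: sum_powi')
  finally show ?thesis
    by (simp add: wq_def power_int_diff power_int_add field_simps)
qed

lemma wi_sum: "inverse qc * wi i - (\<Sum>b\<in>UNIV. if pos b < pos i then hc * wi b else 0) = qc powi (- int N)"
proof -
  have wi: "wi b = qc powi (2 * int (pos b) + (1 - int N))" for b
    by (simp add: wq_def algebra_simps flip: power_int_minus)
  have "(\<Sum>b\<in>UNIV. if pos b < pos i then hc * wi b else 0) =
    (\<Sum>k\<in>{0..<pos i}. hc * qc powi (2 * int k + (1 - int N)))"
    unfolding wi using sum_pos[of "pos i" 0 "\<lambda>k. hc * qc powi (2 * int k + (1 - int N))"] pos_less[of i] by simp
  also have "\<dots> = qc powi (2 * int (pos i) - int N) - qc powi (- int N)"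
    by (simp add: sum_powi)
  finally show ?thesis
    unfolding wi by (simp add: power_int_diff power_int_add field_simps)
qed

lemma wq_quot_sum:
  assumes "pos a < pos d"
  shows "(\<Sum>j\<in>UNIV. if pos a < pos j \<and> pos j < pos d then hc * (wq d / wq j) else 0) = inverse qc - qc * (wq d / wq a)"
proof -
  have w: "wq d / wq j = qc powi (2 * int (pos j) + (- 2 * int (pos d)))" for j
    by (simp add: wq_def flip: power_int_diff)
  have "(\<Sum>j\<in>UNIV. if pos a < pos j \<and> pos j < pos d then hc * (wq d / wq j) else 0) =
    (\<Sum>k\<in>{Suc (pos a)..<pos d}. hc * qc powi (2 * int k + (- 2 * int (pos d))))"
    unfolding w using sum_pos[of "pos d" "Suc (pos a)" "\<lambda>k. hc * qc powi (2 * int k + (- 2 * int (pos d)))"] pos_less[of d]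
    by (simp add: Suc_le_eq)
  also have "\<dots> = qc powi (2 * int (pos d) + (- 2 * int (pos d)) - 1) - qc powi (2 * int (Suc (pos a)) + (- 2 * int (pos d)) - 1)"
    using assms by (intro sum_powi) simp
  also have "\<dots> = inverse qc - qc * (wq d / wq a)"
    unfolding w by (simp add: power_int_diff power_int_add field_simps power_int_minus)
  finally show ?thesis .
qed

text \<open>Beyond the expected entries, only a = b and c = d with a before d can contribute. There
  the triangular terms form the telescoping sum of \<open>wq_quot_sum\<close>, and the weights in
  \<open>Xm\<close> make it cancel against the remaining term.\<close>

lemma Ym_Xm: "Ym ** Xm = mat 1"
proof -
  have "(Ym ** Xm) $ (a, b) $ (c, d) = (if a = c \<and> b = d then 1 else 0)" for a b c d
  proof -
    define G where "G j i = wq d / wq j * Ri $ (i, d) $ (j, c)" for j i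
    have 1: "(\<Sum>i\<in>UNIV. Rm $ (j, a) $ (i, b) * G j i) =
      (if j = b then kap b a * G b a else 0) + (if b = a \<and> pos a < pos j then hc else 0) * G j j" for j
    proof -
      have "(\<Sum>i\<in>UNIV. Rm $ (j, a) $ (i, b) * G j i) =
        (\<Sum>i\<in>UNIV. (if i = a then (if j = b then kap j a else 0) * G j a else 0) +
          (if i = j then (if b = a \<and> pos a < pos j then hc else 0) * G j j else 0))"
        by (rule sum.cong[OF refl]) (simp add: Rm_nth)
      then show ?thesis
        by (simp add: sum.distrib)
    qed
    have 2: "G b a = wq d / wq b * (if b = d \<and> a = c then inverse (kap a d) else 0)
        - wq d / wq b * (if b = a \<and> c = d \<and> pos a < pos d then hc else 0)"
      unfolding G_def Ri_nth by (simp add: algebra_simps)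
    have 3: "G j j = (if j = d then (if c = d then inverse qc else 0) else 0)
        - (if c = d \<and> pos j < pos d then hc * (wq d / wq j) else 0)" for j
      unfolding G_def Ri_nth by (simp add: algebra_simps kap_def)
    have "(Ym ** Xm) $ (a, b) $ (c, d) = (\<Sum>j\<in>UNIV. \<Sum>i\<in>UNIV. Rm $ (j, a) $ (i, b) * G j i)"
      unfolding matrix_matrix_mult_def by (simp add: Ym_nth Xm_nth G_def flip: sum_prod_UNIV)
    also have "\<dots> = kap b a * G b a + (if b = a then (\<Sum>j\<in>UNIV. (if pos a < pos j then hc * G j j else 0)) else 0)"
      unfolding 1 by (auto simp: sum.distrib intro!: sum.cong)
    finally have A: "(Ym ** Xm) $ (a, b) $ (c, d) =
        kap b a * G b a + (if b = a then (\<Sum>j\<in>UNIV. (if pos a < pos j then hc * G j j else 0)) else 0)" .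
    have B: "(\<Sum>j\<in>UNIV. (if pos a < pos j then hc * G j j else 0)) =
      (if c = d \<and> pos a < pos d then hc * (inverse qc - (inverse qc - qc * (wq d / wq a))) else 0)"
    proof (cases "c = d")
      case True
      have "(\<Sum>j\<in>UNIV. (if pos a < pos j then hc * G j j else 0)) =
        (\<Sum>j\<in>UNIV. (if j = d then (if pos a < pos d then hc * inverse qc else 0) else 0) -
          hc * (if pos a < pos j \<and> pos j < pos d then hc * (wq d / wq j) else 0))"
        unfolding 3 by (rule sum.cong[OF refl]) (simp add: True)
      also have "\<dots> = (if pos a < pos d then hc * inverse qc else 0) -
         hc * (\<Sum>j\<in>UNIV. (if pos a < pos j \<and> pos j < pos d then hc * (wq d / wq j) else 0))"
        by (simp add: sum_subtractf sum_distrib_left)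
      also have "\<dots> = (if pos a < pos d then hc * (inverse qc - (inverse qc - qc * (wq d / wq a))) else 0)"
      proof (cases "pos a < pos d")
        case False
        then have "(if pos a < pos j \<and> pos j < pos d then hc * (wq d / wq j) else 0) = 0" for j
          by auto
        with False show ?thesis by simp
      qed (simp add: wq_quot_sum right_diff_distrib)
      finally show ?thesis using True by simp
    next
      case False
      then have "G j j = 0" for j by (simp add: 3)
      with False show ?thesis by (simp cong: if_cong)
    qed
    show ?thesis
      unfolding A B 2 by (cases "a = b") (auto simp: kap_def)
  qed
  then show ?thesis
    unfolding vec_eq_iff by (auto simp: mat_def)
qed

lemma Xm_Ym: "Xm ** Ym = mat 1"
  using Ym_Xm matrix_left_right_inverse by blast

lemma Xm_Ym_op [simp]: "op Xm k (op Ym k x) = x" and Ym_Xm_op [simp]: "op Ym k (op Xm k x) = x"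
  by (simp_all add: op_mat_1 Xm_Ym Ym_Xm flip: op_mat_mult)

lemma Ri_weight: "Ri $ (i, j) $ (a, b) \<noteq> 0 \<Longrightarrow> wq i * wq j = wq a * wq b"
  unfolding Ri_nth by (auto split: if_splits)

lemma op_Rm_ins: "op Rm k (ins one (Suc k) x) = op Ym (Suc k) (ins one k x)"
  by (rule op_ins_shift) (simp add: Ym_nth)

lemma op_Ym_ins: "op Ym k (ins one (Suc k) x) = op Rs (Suc k) (ins one k x)"
  by (rule op_ins_shift) (simp add: Ym_nth Rs_eq)

lemma Ri_weight': "Ri $ (i, j) $ (a, b) * (wq i * wq j) = Ri $ (i, j) $ (a, b) * (wq a * wq b)"
  using Ri_weight[of i j a b] by auto

lemma op_Rsi_ins: "op Rsi k (ins wi (Suc k) x) = op Xm (Suc k) (ins wi k x)"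
proof (rule op_ins_shift)
  fix i j k a
  show "Rsi $ (i, j) $ (a, k) * wi k = Xm $ (j, k) $ (i, a) * wi i"
    using Ri_weight'[of k a j i] by (auto simp: Xm_nth Rsi_eq field_simps)
qed

lemma op_Xm_ins: "op Xm k (ins wi (Suc k) x) = op Ri (Suc k) (ins wi k x)"
  by (rule op_ins_shift) (simp add: Xm_nth field_simps)

lemma con_op_Xm: "con wq k (op Xm (Suc k) x) = con wq (Suc k) (op Ri k x)"
  by (rule con_op_shift) (simp add: Xm_nth)

lemma con_op_Xm': "con wq (Suc k) (op Xm k x) = con wq k (op Rsi (Suc k) x)"
proof (rule con_op_shift')
  fix i j a b
  show "wq i * Xm $ (j, i) $ (a, b) = wq a * Rsi $ (a, j) $ (b, i)"
    using Ri_weight'[of i b j a] by (simp add: Xm_nth Rsi_eq field_simps)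
qed

text \<open>E after the braiding is an invariant form on V \<otimes> (dual of V), hence a multiple
  of E'. The scalar is the partial trace computed in \<open>wi_sum\<close>.\<close>

lemma con_one_op_Xm: "con one k (op Xm k x) = (\<lambda>\<phi>. qc powi (- int N) *C con wq k (x :: ('n, 'm::complex_vector) fam) \<phi>)"
proof (rule op_shift[where L = "\<lambda>k x. con one k (op Xm k x)" and L' = "\<lambda>k x \<phi>. qc powi (- int N) *C con wq k x \<phi>"])
  fix x :: "('n, 'm) fam"
  have X: "(\<Sum>j\<in>UNIV. Xm $ (j, j) $ (a, b)) = (if a = b then qc powi (- int N) * wq a else 0)" for a b
  proof -
    have "(\<Sum>j\<in>UNIV. Xm $ (j, j) $ (a, b)) = (\<Sum>j\<in>UNIV. (if j = a then (if a = b then inverse qc else 0) else 0)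
       - (if a = b then wq a * (if pos j < pos a then hc * wi j else 0) else 0))"
      by (rule sum.cong[OF refl]) (simp add: Xm_nth Ri_nth kap_def field_simps)
    also have "\<dots> = (if a = b then inverse qc - wq a * (\<Sum>j\<in>UNIV. if pos j < pos a then hc * wi j else 0) else 0)"
      by (simp add: sum_subtractf sum_distrib_left)
    also have "\<dots> = (if a = b then qc powi (- int N) * wq a else 0)"
      unfolding wi_sum[of a, symmetric] by (simp add: algebra_simps)
    finally show ?thesis .
  qed
  show "con one 0 (op Xm 0 x) = (\<lambda>\<phi>. qc powi (- int N) *C con wq 0 x \<phi>)"
  proof
    fix \<phi>
    have "con one 0 (op Xm 0 x) \<phi> = (\<Sum>j\<in>UNIV. \<Sum>a\<in>UNIV. \<Sum>b\<in>UNIV. Xm $ (j, j) $ (a, b) *C x (a ## b ## \<phi>))"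
      by (simp add: fam_simps scaleC_one)
    also have "\<dots> = (\<Sum>a\<in>UNIV. \<Sum>b\<in>UNIV. (\<Sum>j\<in>UNIV. Xm $ (j, j) $ (a, b)) *C x (a ## b ## \<phi>))"
      by (rule trans[OF sum_rotate]) (simp add: scaleC_sum_left)
    also have "\<dots> = qc powi (- int N) *C con wq 0 x \<phi>"
      unfolding X by (simp add: scaleC_if fam_simps scaleC_sum_right scaleC_scaleC)
    finally show "con one 0 (op Xm 0 x) \<phi> = qc powi (- int N) *C con wq 0 x \<phi>" .
  qed
qed (simp_all add: fam_simps)

lemma Rm_trace: "(\<Sum>b\<in>UNIV. wq b * Rm $ (i, b) $ (a, b)) = (if a = i then qc powi (int N) else 0)"
proof -
  have "(\<Sum>b\<in>UNIV. wq b * Rm $ (i, b) $ (a, b)) = (\<Sum>b\<in>UNIV. (if b = i then (if a = i then qc * wq i else 0) else 0)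
       + (if a = i then (if pos b < pos i then hc * wq b else 0) else 0))"
    by (rule sum.cong[OF refl]) (auto simp: Rm_nth kap_def)
  also have "\<dots> = (if a = i then qc powi (int N) else 0)"
    unfolding wq_sum[of i, symmetric] by (simp add: sum.distrib)
  finally show ?thesis .
qed

lemma Rs_trace: "(\<Sum>b\<in>UNIV. wq b * Rs $ (b, i) $ (b, a)) = (if a = i then qc powi (int N) else 0)"
  using Rm_trace[of a i] by (simp add: Rs_eq eq_commute)

text \<open>Closing one strand of the braiding with C and E' gives an endomorphism of the simple
  module V, hence a scalar; its value q^N is \<open>wq_sum\<close>.\<close>

lemma con_Rm_ins: "con wq (Suc k) (op Rm k (ins one (Suc k) x)) = (\<lambda>\<phi>. qc powi (int N) *C (x :: ('n, 'm::complex_vector) fam) \<phi>)"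
proof (rule op_shift[where L = "\<lambda>k x. con wq (Suc k) (op Rm k (ins one (Suc k) x))" and L' = "\<lambda>k x \<phi>. qc powi (int N) *C x \<phi>"])
  fix x :: "('n, 'm) fam"
  show "con wq (Suc 0) (op Rm 0 (ins one (Suc 0) x)) = (\<lambda>\<phi>. qc powi (int N) *C x \<phi>)"
  proof (rule fam_eqI)
    fix i \<phi>
    have "con wq (Suc 0) (op Rm 0 (ins one (Suc 0) x)) (i ## \<phi>) =
        (\<Sum>b\<in>UNIV. \<Sum>a\<in>UNIV. (wq b * Rm $ (i, b) $ (a, b)) *C x (a ## \<phi>))"
      by (simp add: con_Suc_scons con_0 op_0_ins_1 scaleC_sum_right scaleC_scaleC)
    also have "\<dots> = (\<Sum>a\<in>UNIV. (\<Sum>b\<in>UNIV. wq b * Rm $ (i, b) $ (a, b)) *C x (a ## \<phi>))"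
      by (subst sum.swap) (simp add: scaleC_sum_left)
    also have "\<dots> = qc powi (int N) *C x (i ## \<phi>)"
      unfolding Rm_trace by (simp add: scaleC_if)
    finally show "con wq (Suc 0) (op Rm 0 (ins one (Suc 0) x)) (i ## \<phi>) = qc powi (int N) *C x (i ## \<phi>)" .
  qed
qed (simp_all add: fam_simps)

lemma con_Rs_ins: "con wq k (op Rs (Suc k) (ins one k x)) = (\<lambda>\<phi>. qc powi (int N) *C (x :: ('n, 'm::complex_vector) fam) \<phi>)"
proof (rule op_shift[where L = "\<lambda>k x. con wq k (op Rs (Suc k) (ins one k x))" and L' = "\<lambda>k x \<phi>. qc powi (int N) *C x \<phi>"])
  fix x :: "('n, 'm) fam"
  show "con wq 0 (op Rs (Suc 0) (ins one 0 x)) = (\<lambda>\<phi>. qc powi (int N) *C x \<phi>)"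
  proof (rule fam_eqI)
    fix i \<phi>
    have "con wq 0 (op Rs (Suc 0) (ins one 0 x)) (i ## \<phi>) =
        (\<Sum>b\<in>UNIV. \<Sum>a\<in>UNIV. (wq b * Rs $ (b, i) $ (b, a)) *C x (a ## \<phi>))"
      by (simp add: con_0 op_1_ins_0 scaleC_sum_right scaleC_scaleC)
    also have "\<dots> = (\<Sum>a\<in>UNIV. (\<Sum>b\<in>UNIV. wq b * Rs $ (b, i) $ (b, a)) *C x (a ## \<phi>))"
      by (subst sum.swap) (simp add: scaleC_sum_left)
    also have "\<dots> = qc powi (int N) *C x (i ## \<phi>)"
      unfolding Rs_trace by (simp add: scaleC_if)
    finally show "con wq 0 (op Rs (Suc 0) (ins one 0 x)) (i ## \<phi>) = qc powi (int N) *C x (i ## \<phi>)" .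
  qed
qed (simp_all add: fam_simps)

end

section \<open>Words in the coordinate algebra\<close>

lemma op_scaleC: "op R k (c *C x) = c *C op R k x"
  and op_minus: "op R k (x - y) = op R k x - op R k y"
  by (simp_all add: scaleC_fun_def fun_diff_def op_scale op_diff)

lemma pre_scaleC: "pre u (c *C x) = c *C pre u x"
  and pre_minus: "pre u (x - y) = pre u x - pre u y"
  by (simp_all add: scaleC_fun_def fun_diff_def fun_eq_iff pre_def mult_scaleC_right right_diff_distrib)

lemma ins_scaleC: "ins w k (c *C x) = c *C ins w k x"
proof (induction k arbitrary: x)
  case 0
  then show ?case
    by (simp add: scaleC_fun_def fun_eq_iff ins.simps scaleC_scaleC mult.commute)
next
  case (Suc k)
  have "(\<lambda>\<psi>. (c *C x) (a ## \<psi>)) = c *C (\<lambda>\<psi>. x (a ## \<psi>))" for a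
    by (simp add: scaleC_fun_def)
  then show ?case
    by (intro fam_eqI) (simp add: ins_Suc_scons Suc, simp add: scaleC_fun_def ins_Suc_scons)
qed

lemma con_scaleC: "con w k (c *C x) = c *C con w k x"
proof (induction k arbitrary: x)
  case 0
  then show ?case
    by (simp add: scaleC_fun_def fun_eq_iff con.simps scaleC_scaleC scaleC_sum_right mult.commute)
next
  case (Suc k)
  have "(\<lambda>\<psi>. (c *C x) (a ## \<psi>)) = c *C (\<lambda>\<psi>. x (a ## \<psi>))" for a
    by (simp add: scaleC_fun_def)
  then show ?case
    by (intro fam_eqI) (simp add: con_Suc_scons Suc, simp add: scaleC_fun_def con_Suc_scons)
qed

lemma con_minus: "con w k (x - y) = con w k x - con w k y"
proof (induction k arbitrary: x y)
  case 0
  then show ?case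
    by (simp add: fun_diff_def fun_eq_iff con.simps scaleC_diff_right sum_subtractf)
next
  case (Suc k)
  have "(\<lambda>\<psi>. (x - y) (a ## \<psi>)) = (\<lambda>\<psi>. x (a ## \<psi>)) - (\<lambda>\<psi>. y (a ## \<psi>))" for a
    by (simp add: fun_diff_def)
  then show ?case
    by (intro fam_eqI) (simp add: con_Suc_scons Suc)
qed

lemma con_plus: "con w k (x + y) = con w k x + con w k y"
proof -
  have "con w k (x + y - y) = con w k (x + y) - con w k y"
    by (rule con_minus)
  then show ?thesis
    by (simp add: algebra_simps)
qed

lemma con_pre: "con w (Suc k) (pre u x) = pre u (con w k x)"
proof -
  have *: "con w k (\<lambda>\<psi>. a * x \<psi>) = (\<lambda>\<phi>. a * con w k x \<phi>)" for a
  proof (induction k arbitrary: x)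
    case 0
    then show ?case by (intro ext) (simp add: con.simps sum_distrib_left mult_scaleC_right)
  qed (simp add: con.simps)
  show ?thesis
    by (rule fam_eqI) (simp add: fam_simps *)
qed

section \<open>The operators S, S with a tilde and T, and the braid relation for S\<close>

context braid_matrices
begin

text \<open>S without its power of q^(1/N); \<open>Stop\<close> and \<open>Top\<close> below are S
  with a tilde and T in the same normalisation, and \<open>Stiop\<close> is the inverse of
  \<open>Stop\<close>.\<close>

definition Sop :: "nat \<Rightarrow> ('n, 'm::complex_vector) fam \<Rightarrow> ('n, 'm) fam" where
  "Sop k x = op Xm (Suc k) (op Rm k (op Ym (Suc k) x))"

definition Stop :: "nat \<Rightarrow> ('n, 'm::complex_vector) fam \<Rightarrow> ('n, 'm) fam" where
  "Stop k x = op Xm k (op Rsi (Suc k) (op Ym k x))"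

definition Stiop :: "nat \<Rightarrow> ('n, 'm::complex_vector) fam \<Rightarrow> ('n, 'm) fam" where
  "Stiop k x = op Xm k (op Rs (Suc k) (op Ym k x))"

definition Top :: "nat \<Rightarrow> ('n, 'm::complex_vector) fam \<Rightarrow> ('n, 'm) fam" where
  "Top k x = Sop k (Stop (Suc k) x)"

lemma Stop_Stiop [simp]: "Stop k (Stiop k x) = x" "Stiop k (Stop k x) = x"
  by (simp_all add: Stop_def Stiop_def)

lemma op_commute3: "op A k (op B (Suc (Suc (k + m))) x) = op B (Suc (Suc (k + m))) (op A k x)"
  by (rule op_op_commute) simp

text \<open>Both factors of T are conjugated by the same \<open>Ym\<close> on the two middle legs,
  and after this conjugation \<open>Rm\<close> and \<open>Rsi\<close> act on disjoint legs.\<close>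

lemma Top_commute: "Top k x = Stop (Suc k) (Sop k x)"
  using op_commute3[of Rm k Rsi 0 "op Ym (Suc k) x"] by (simp add: Top_def Sop_def Stop_def)

lemma Sop_linear: "Sop k (c *C x) = c *C Sop k x" "Sop k (x - y) = Sop k x - Sop k y"
  by (simp_all add: Sop_def op_scaleC op_minus)

lemma Stop_linear: "Stop k (c *C x) = c *C Stop k x" "Stop k (x - y) = Stop k x - Stop k y"
  by (simp_all add: Stop_def op_scaleC op_minus)

lemma Stiop_linear: "Stiop k (c *C x) = c *C Stiop k x" "Stiop k (x - y) = Stiop k x - Stiop k y"
  by (simp_all add: Stiop_def op_scaleC op_minus)

lemma Sop_pre: "Sop (Suc k) (pre u x) = pre u (Sop k x)"
  and Stop_pre: "Stop (Suc k) (pre u x) = pre u (Stop k x)"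
  and Stiop_pre: "Stiop (Suc k) (pre u x) = pre u (Stiop k x)"
  by (simp_all add: Sop_def Stop_def Stiop_def op_pre)

lemma Sop_Stop_commute: "l \<ge> k + 3 \<Longrightarrow> Sop k (Stop l x) = Stop l (Sop k x)"
  by (simp add: Sop_def Stop_def op_op_commute[of "Suc k" l Ym] op_op_commute[of k l Rm] op_op_commute[of "Suc k" l Xm]
      op_op_commute[of "Suc k" "Suc l" Ym Rsi] op_op_commute[of k "Suc l" Rm] op_op_commute[of "Suc k" "Suc l" Xm Rsi])

lemma op_Rs_Xm: "op Rs k (op Xm (Suc k) (op Xm k x)) = op Xm (Suc k) (op Xm k (op Rs (Suc k) x))"
proof -
  have "op Ym k (op Ym (Suc k) (op Rs k (op Xm (Suc k) (op Xm k x)))) = op Rs (Suc k) x"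
    by (subst op_Ym_Rs_braid) simp
  then have "op Xm (Suc k) (op Xm k (op Ym k (op Ym (Suc k) (op Rs k (op Xm (Suc k) (op Xm k x)))))) =
      op Xm (Suc k) (op Xm k (op Rs (Suc k) x))"
    by simp
  then show ?thesis by simp
qed

text \<open>On five legs alternating between V and its dual, starting with V, this moves the three V
  legs to the front. Conjugation by it turns S on the legs 1 to 3 and on the legs 3 to 5 into
  \<open>Rm\<close> at adjacent positions, so the braid relation for S comes from the one for
  \<open>Rm\<close>.\<close>

definition Uop :: "('n, 'm::complex_vector) fam \<Rightarrow> ('n, 'm) fam" where
  "Uop x = op Ym 2 (op Ym (Suc 0) (op Ym 3 x))"

definition Uiop :: "('n, 'm::complex_vector) fam \<Rightarrow> ('n, 'm) fam" where
  "Uiop x = op Xm 3 (op Xm (Suc 0) (op Xm 2 x))"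

lemma Sop_0_conj: "Sop 0 x = Uiop (op Rm 0 (Uop x))"
proof -
  have "Uiop (op Rm 0 (Uop x)) = op Xm 3 (op Xm (Suc 0) (op Rm 0 (op Xm 2 (Uop x))))"
    using op_op_commute[of 0 2 Rm Xm "Uop x"] by (simp add: Uiop_def)
  also have "\<dots> = op Xm 3 (op Xm (Suc 0) (op Rm 0 (op Ym 3 (op Ym (Suc 0) x))))"
    using op_op_commute[of "Suc 0" 3 Ym Ym x] by (simp add: Uop_def)
  also have "\<dots> = op Xm 3 (op Xm (Suc 0) (op Ym 3 (op Rm 0 (op Ym (Suc 0) x))))"
    using op_op_commute[of 0 3 Rm Ym "op Ym (Suc 0) x"] by simp
  also have "\<dots> = op Xm (Suc 0) (op Rm 0 (op Ym (Suc 0) x))"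
    using op_op_commute[of "Suc 0" 3 Xm Ym "op Rm 0 (op Ym (Suc 0) x)"] by simp
  finally show ?thesis
    by (simp add: Sop_def)
qed

lemma Sop_2_conj: "Sop 2 x = Uiop (op Rm (Suc 0) (Uop x))"
proof -
  have "Uiop (op Rm (Suc 0) (Uop x)) = op Xm 3 (op Xm (Suc 0) (op Xm 2 (op Rm (Suc 0) (op Ym 2 (op Ym (Suc 0) (op Ym 3 x))))))"
    by (simp add: Uiop_def Uop_def)
  also have "op Rm (Suc 0) (op Ym 2 (op Ym (Suc 0) (op Ym 3 x))) = op Ym 2 (op Ym (Suc 0) (op Rm 2 (op Ym 3 x)))"
    using op_Rm_Ym_braid[of "Suc 0" "op Ym 3 x"] by (simp add: numeral_2_eq_2)
  finally show ?thesis
    by (simp add: Sop_def eval_nat_numeral)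
qed

lemma Uop_Uiop [simp]: "Uop (Uiop x) = x"
  by (simp add: Uop_def Uiop_def)

lemma Sop_braid: "Sop 2 (Sop 0 (Sop 2 x)) = Sop 0 (Sop 2 (Sop 0 x))"
  using op_Rm_braid[of 0 "Uop x"] by (simp add: Sop_0_conj Sop_2_conj)

end

text \<open>The relations of \<A> in the normalised matrices: the factor with exponent (\<omega>_s,
  \<omega>_s) = 1 - 1/N absorbs the fractional power of each braiding, which leaves q or its
  inverse.\<close>

locale coord_algebra = braid_matrices q N pos
  for q N and pos :: "'n::finite \<Rightarrow> nat" +
  fixes f v :: "'n \<Rightarrow> 'a::complex_algebra"
  assumes N_pos: "0 < N"
    and ff: "(\<Sum>a\<in>UNIV. \<Sum>b\<in>UNIV. Rm $ (i, j) $ (a, b) *C (f a * f b)) = qc *C (f i * f j)"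
    and vv: "(\<Sum>a\<in>UNIV. \<Sum>b\<in>UNIV. Rs $ (i, j) $ (a, b) *C (v a * v b)) = qc *C (v i * v j)"
    and fv: "(\<Sum>a\<in>UNIV. \<Sum>b\<in>UNIV. Xm $ (j, i) $ (a, b) *C (f a * v b)) = inverse qc *C (v j * f i)"
    and vf: "(\<Sum>i\<in>UNIV. v i * f i) = 1"
begin

abbreviation F where "F \<equiv> pre f"
abbreviation W where "W \<equiv> pre v"
abbreviation C where "C \<equiv> ins one 0"
abbreviation C' where "C' \<equiv> ins wi 0"

lemma op_pre_pre:
  fixes g h :: "'n \<Rightarrow> 'a"
  assumes "\<And>i j. (\<Sum>a\<in>UNIV. \<Sum>b\<in>UNIV. A $ (i, j) $ (a, b) *C (g a * h b)) = c *C (g' i * h' j :: 'a)"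
  shows "op A 0 (pre g (pre h x)) = c *C pre g' (pre h' x)"
proof (rule fam_eqI)
  fix i and \<psi> :: "nat \<Rightarrow> 'n"
  obtain j \<phi> where [simp]: "\<psi> = j ## \<phi>" by (rule stream_cases)
  have "op A 0 (pre g (pre h x)) (i ## j ## \<phi>) = (\<Sum>a\<in>UNIV. \<Sum>b\<in>UNIV. A $ (i, j) $ (a, b) *C (g a * h b)) * x \<phi>"
    by (simp add: fam_simps sum_distrib_right mult_scaleC_left mult.assoc)
  then show "op A 0 (pre g (pre h x)) (i ## \<psi>) = (c *C pre g' (pre h' x)) (i ## \<psi>)"
    by (simp add: assms scaleC_fun_def mult_scaleC_left mult.assoc pre_scons)
qed

lemma Rm_FF: "op Rm 0 (F (F x)) = qc *C F (F x)"
  and Rs_WW: "op Rs 0 (W (W x)) = qc *C W (W x)"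
  and Xm_FW: "op Xm 0 (F (W x)) = inverse qc *C W (F x)"
  by (intro op_pre_pre ff vv fv)+

lemma scaleC_inverse_qc [simp]: "qc *C inverse qc *C x = (x :: 'm::complex_vector)" "inverse qc *C qc *C x = (x :: 'm::complex_vector)"
  by (simp_all add: scaleC_scaleC scaleC_one)

lemma Ym_WF: "op Ym 0 (W (F x)) = qc *C F (W x)"
proof -
  have "op Ym 0 (op Xm 0 (F (W x))) = inverse qc *C op Ym 0 (W (F x))"
    by (simp add: Xm_FW op_scaleC)
  then have "qc *C F (W x) = qc *C inverse qc *C op Ym 0 (W (F x))"
    by simp
  then show ?thesis by simp
qed

lemma Rsi_WW: "op Rsi 0 (W (W x)) = inverse qc *C W (W x)"
proof -
  have "op Rsi 0 (op Rs 0 (W (W x))) = qc *C op Rsi 0 (W (W x))"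
    by (simp only: Rs_WW op_scaleC)
  then have "inverse qc *C W (W x) = inverse qc *C qc *C op Rsi 0 (W (W x))"
    by simp
  then show ?thesis by simp
qed

lemma con_one_WF: "con one 0 (W (F x)) = x"
  by (rule ext) (simp add: fam_simps scaleC_one mult.assoc[symmetric] vf flip: sum_distrib_right)

text \<open>The defining relation normalises E v f, not E' f v. By \<open>con_one_op_Xm\<close> the
  exchange of f and v carries the one into the other.\<close>

lemma con_FW: "con wq 0 (F (W x)) = qc powi (int N - 1) *C x"
proof -
  have "con one 0 (op Xm 0 (F (W x))) = qc powi (- int N) *C con wq 0 (F (W x))"
    by (simp add: con_one_op_Xm scaleC_fun_def)
  then have "qc powi int N *C qc powi (- int N) *C con wq 0 (F (W x)) = qc powi int N *C inverse qc *C x"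
    by (simp add: Xm_FW con_scaleC con_one_WF)
  moreover have "qc powi int N * qc powi (- int N) = 1"
    by (simp add: power_int_minus)
  moreover have "qc powi int N * inverse qc = qc powi (int N - 1)"
    by (simp add: power_int_diff divide_inverse)
  ultimately show ?thesis
    by (simp add: scaleC_scaleC scaleC_one)
qed

text \<open>Sorting f v f into f f v, applying \<open>Rm\<close>, which acts there by q, and sorting
  back; the factors of the two exchanges cancel. In the same way S with a tilde acts on v f v by the
  inverse of q.\<close>

lemma Sop_FWF: "Sop 0 (F (W (F x))) = qc *C F (W (F x))"
  by (simp add: Sop_def op_pre Ym_WF Rm_FF Xm_FW pre_scaleC op_scaleC)

lemma Stop_WFW: "Stop 0 (W (F (W x))) = inverse qc *C W (F (W x))"
  by (simp add: Stop_def op_pre Ym_WF Rsi_WW Xm_FW pre_scaleC op_scaleC scaleC_left_commute[of qc])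

lemma W_C: "pre u (ins w 0 x) = ins w (Suc 0) (pre u x)"
  by (simp add: ins_pre)

lemma Ym_WC: "op Ym 0 (W (C x)) = op Rs (Suc 0) (C (W x))"
  by (simp add: W_C op_Ym_ins)

lemma Rm_FC: "op Rm 0 (F (C x)) = op Ym (Suc 0) (C (F x))"
  by (simp add: W_C op_Rm_ins)

lemma Rsi_WC': "op Rsi 0 (W (C' x)) = op Xm (Suc 0) (C' (W x))"
  by (simp add: W_C op_Rsi_ins)

lemma Xm_FC': "op Xm 0 (F (C' x)) = op Ri (Suc 0) (C' (F x))"
  by (simp add: W_C op_Xm_ins)

lemma op_C: "op A (Suc (Suc k)) (ins w 0 x) = ins w 0 (op A k x)"
  by (rule ins_op_commute) simp

lemma Sop_FWC': "Sop 0 (F (W (C x))) = op Xm (Suc 0) (op Rm 0 (op Rs 2 (F (C (W x)))))"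
  by (simp add: Sop_def op_pre Ym_WC numeral_2_eq_2)

text \<open>Drawing the coevaluation through both strands of p moves it from behind p to its front.
  The first form of this element exposes S on the leading legs, the second the inverse of S with a
  tilde on the trailing ones; both are used.\<close>

lemma Sop_FWC: "Sop 0 (F (W (C x))) = Stiop (Suc 0) (C (F (W x)))"
proof -
  have "op Rm 0 (op Rs 2 (F (C (W x)))) = op Rs 2 (op Rm 0 (F (C (W x))))"
    by (rule op_op_commute) simp
  also have "\<dots> = op Rs 2 (op Ym (Suc 0) (C (F (W x))))"
    by (simp add: Rm_FC)
  finally show ?thesis
    by (simp add: Sop_FWC' Stiop_def numeral_2_eq_2)
qed

text \<open>
  For \<open>x = 1\<close> these are the prescribed pairings of \<open>\<Omega>\<^sub>-\<close> with \<open>\<Omega>\<^sub>+\<close> and of \<open>\<Omega>\<^sub>+\<close> with \<open>\<Omega>\<^sub>-\<close> on generators. An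
  arbitrary family \<open>x\<close> on the right is needed to express right linearity.
\<close>

definition beta_mp :: "('n, 'a) fam \<Rightarrow> ('n, 'a) fam" where
  "beta_mp x = F (C' (W x)) - qc powi (1 - int N) *C F (W (F (W x)))"

definition beta_pm :: "('n, 'a) fam \<Rightarrow> ('n, 'a) fam" where
  "beta_pm x = qc powi (2 - int N) *C Sop 0 (F (W (C x))) - qc powi (3 - int N) *C F (W (F (W x)))"

lemma con_F_C': "con wq 0 (F (C' x)) = F x"
  by (rule fam_eqI) (simp add: fam_simps mult_scaleC_right scaleC_scaleC_if scaleC_one)

lemma con_C'_W: "con wq (Suc 0) (C' (W x)) = W x"
  by (rule fam_eqI) (simp add: fam_simps scaleC_scaleC_if scaleC_one)

lemma powi_beta_mp: "qc powi (1 - int N) * qc powi (int N - 1) = 1"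
  by (simp flip: power_int_add)

lemma powi_beta_pm: "qc powi (2 - int N) * qc ^ N = qc * qc" "qc powi (3 - int N) * qc powi (int N - 1) = qc * qc"
proof -
  show "qc powi (2 - int N) * qc ^ N = qc * qc"
    by (simp add: power_int_diff power2_eq_square)
  show "qc powi (3 - int N) * qc powi (int N - 1) = qc * qc"
    by (simp add: power2_eq_square flip: power_int_add)
qed

lemma con_Rs_C: "con wq 0 (op Rs (Suc 0) (C x)) = qc ^ N *C x"
  using con_Rs_ins[of 0 x] by (simp only: scaleC_fun_def power_int_of_nat)

lemma con_Rm_C: "con wq (Suc 0) (op Rm 0 (ins one (Suc 0) x)) = qc ^ N *C x"
  using con_Rm_ins[of 0 x] by (simp only: scaleC_fun_def power_int_of_nat)

text \<open>The zigzag identity contracts the C' term to p, and E' turns p p into q^(N-1) p. The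
  coefficient q^(1-N) is exactly the one that makes the two cancel, as the relation E' applied to
  the first differential demands.\<close>

lemma con_0_beta_mp: "con wq 0 (beta_mp x) = 0"
  by (simp add: beta_mp_def con_minus con_scaleC con_F_C' con_FW scaleC_scaleC powi_beta_mp scaleC_one)

lemma con_2_beta_mp: "con wq 2 (beta_mp x) = 0"
  by (simp add: beta_mp_def con_minus con_scaleC con_pre numeral_2_eq_2 con_C'_W con_FW pre_scaleC scaleC_scaleC
      powi_beta_mp scaleC_one)

text \<open>Both terms of the pairing start with f, so p times the pairing starts with f v f, where
  S acts by q.\<close>

lemma Sop_beta_mp: "Sop 0 (F (W (beta_mp x))) = qc *C F (W (beta_mp x))"
  by (simp add: beta_mp_def pre_minus pre_scaleC Sop_linear Sop_FWF scaleC_diff_right scaleC_left_commute[of qc])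

lemma Stop_FWFC': "Stop (Suc 0) (F (W (F (C' (W x))))) = qc *C op Xm (Suc 0) (op Xm 3 (F (F (C' (W (W x))))))"
proof -
  have "Stop (Suc 0) (F (W (F (C' (W x))))) = qc *C op Xm (Suc 0) (op Rsi 2 (F (F (W (C' (W x))))))"
    by (simp add: Stop_def op_pre Ym_WF op_scaleC pre_scaleC numeral_2_eq_2)
  also have "op Rsi 2 (F (F (W (C' (W x))))) = op Xm 3 (F (F (C' (W (W x)))))"
    by (simp add: eval_nat_numeral op_pre Rsi_WC')
  finally show ?thesis .
qed

lemma Top_beta_mp: "Top 0 (F (W (beta_mp x))) = qc *C Stop (Suc 0) (F (W (beta_mp x)))"
  by (simp add: Top_commute Sop_beta_mp Stop_linear)

text \<open>The relation of \<Omega>_+ in the second argument. A factor p in front of \<partial>p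
  moves into the first argument and there becomes T p on the left, so the relation must hold on the
  last three of the six legs of T applied to p times the pairing. For the C' term, sorting exposes
  the pair v v.\<close>

lemma Stop_3_Top_beta_mp: "Stop 3 (Top 0 (F (W (beta_mp x)))) = inverse qc *C Top 0 (F (W (beta_mp x)))"
proof -
  have "Stop 3 (op Xm (Suc 0) (op Xm 3 (F (F (C' (W (W x))))))) = op Xm 3 (op Xm (Suc 0) (op Rsi 4 (F (F (C' (W (W x)))))))"
    using op_op_commute[of "Suc 0" 3 Xm Xm "F (F (C' (W (W x))))"] op_op_commute[of "Suc 0" 4 Xm Rsi "F (F (C' (W (W x))))"]
      op_op_commute[of "Suc 0" 3 Xm Ym "op Xm 3 (F (F (C' (W (W x)))))"]
    by (simp add: Stop_def)
  also have "op Rsi 4 (F (F (C' (W (W x))))) = inverse qc *C F (F (C' (W (W x))))"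
    by (simp add: eval_nat_numeral op_pre op_C Rsi_WW pre_scaleC ins_scaleC)
  also have "op Xm 3 (op Xm (Suc 0) (inverse qc *C F (F (C' (W (W x)))))) = inverse qc *C op Xm (Suc 0) (op Xm 3 (F (F (C' (W (W x))))))"
    using op_op_commute[of "Suc 0" 3 Xm Xm "F (F (C' (W (W x))))"] by (simp add: op_scaleC)
  finally have 1: "Stop 3 (Stop (Suc 0) (F (W (F (C' (W x)))))) = inverse qc *C Stop (Suc 0) (F (W (F (C' (W x)))))"
    by (simp add: Stop_FWFC' Stop_linear scaleC_left_commute[of qc])
  have 2: "Stop (Suc 0) (F (W (F (W (F (W x)))))) = inverse qc *C F (W (F (W (F (W x)))))"
    "Stop 3 (F (W (F (W (F (W x)))))) = inverse qc *C F (W (F (W (F (W x)))))"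
    by (simp_all add: eval_nat_numeral Stop_pre Stop_WFW pre_scaleC)
  have "Stop 3 (Stop (Suc 0) (F (W (beta_mp x)))) = inverse qc *C Stop (Suc 0) (F (W (beta_mp x)))"
    by (simp add: beta_mp_def pre_minus pre_scaleC Stop_linear 1 2 scaleC_diff_right
        scaleC_left_commute[of "qc powi (1 - int N)"])
  then show ?thesis
    by (simp add: Top_beta_mp Stop_linear)
qed

text \<open>Two applications of T carry p from the left of the pairing to its right. Two of the four
  factors act by q and its inverse, by the relations just established, so that one S and one S with
  a tilde remain; on the C' term they are undone by naturality.\<close>

lemma Top_2_Top_beta_mp: "Top 2 (Top 0 (F (W (beta_mp x)))) = beta_mp (F (W x))"
proof -
  have "Top 2 (Top 0 (F (W (beta_mp x)))) = Sop 2 (Stop 3 (Top 0 (F (W (beta_mp x)))))"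
    by (simp add: Top_def eval_nat_numeral)
  also have "\<dots> = Sop 2 (Stop (Suc 0) (F (W (beta_mp x))))"
    by (simp add: Stop_3_Top_beta_mp) (simp add: Top_beta_mp)
  also have "\<dots> = beta_mp (F (W x))"
  proof -
    have "Sop 2 (Stop (Suc 0) (F (W (F (C' (W x)))))) = qc *C op Xm 3 (op Rm 2 (op Ym 3 (op Xm 3 (op Xm (Suc 0) (F (F (C' (W (W x)))))))))"
      using op_op_commute[of "Suc 0" 3 Xm Xm "F (F (C' (W (W x))))"]
      by (simp add: Stop_FWFC' Sop_linear) (simp add: Sop_def)
    also have "\<dots> = qc *C op Xm 3 (op Rm 2 (F (op Ri (Suc 0) (C' (F (W (W x)))))))"
      by (simp add: op_pre Xm_FC')
    also have "\<dots> = qc *C op Xm 3 (F (C' (F (W (W x)))))"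
      by (simp add: op_pre numeral_2_eq_2)
    also have "\<dots> = F (C' (W (F (W x))))"
      by (simp add: eval_nat_numeral op_pre op_C Xm_FW pre_scaleC ins_scaleC)
    finally have 1: "Sop 2 (Stop (Suc 0) (F (W (F (C' (W x)))))) = F (C' (W (F (W x))))" .
    have 2: "Stop (Suc 0) (F (W (F (W (F (W x)))))) = inverse qc *C F (W (F (W (F (W x)))))"
      "Sop 2 (F (W (F (W (F (W x)))))) = qc *C F (W (F (W (F (W x)))))"
      by (simp_all add: eval_nat_numeral Stop_pre Stop_WFW Sop_pre Sop_FWF pre_scaleC)
    show ?thesis
      by (simp add: beta_mp_def pre_minus pre_scaleC Stop_linear Sop_linear 1 2)
  qed
  finally show ?thesis .
qed

end

section \<open>The pairing of \<Omega>_+ with \<Omega>_-, and the contractions of the middle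
  legs\<close>

context coord_algebra
begin

text \<open>E' passes the outer \<open>Xm\<close> of S and becomes \<open>Ri\<close>, which cancels
  \<open>Rm\<close>. What is left is the partial trace of \<open>Rs\<close>, equal to q^N, and this
  balances the p p term.\<close>

lemma con_0_beta_pm: "con wq 0 (beta_pm x) = 0"
proof -
  have "con wq 0 (Sop 0 (F (W (C x)))) = con wq (Suc 0) (op Ym (Suc 0) (F (W (C x))))"
    by (simp add: Sop_def con_op_Xm)
  also have "\<dots> = F (con wq 0 (op Rs (Suc 0) (C (W x))))"
    by (simp add: op_pre Ym_WC con_pre)
  also have "\<dots> = qc powi (int N) *C F (W x)"
    by (simp add: con_Rs_C pre_scaleC)
  finally show ?thesis
    by (simp add: beta_pm_def con_minus con_scaleC con_FW scaleC_scaleC powi_beta_pm)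
qed

text \<open>On the last two legs the naturality is used from the other side: E' produces an
  \<open>Rsi\<close> that cancels \<open>Rs\<close>, and the partial trace of \<open>Rm\<close>
  remains.\<close>

lemma con_2_beta_pm: "con wq 2 (beta_pm x) = 0"
proof -
  have "con wq 2 (Sop 0 (F (W (C x)))) = con wq (Suc 0) (op Rsi 2 (op Rm 0 (op Rs 2 (F (C (W x))))))"
    by (simp add: Sop_FWC' numeral_2_eq_2 con_op_Xm')
  also have "op Rsi 2 (op Rm 0 (op Rs 2 (F (C (W x))))) = op Rm 0 (F (C (W x)))"
    using op_op_commute[of 0 2 Rm Rsi "op Rs 2 (F (C (W x)))"] by simp
  also have "con wq (Suc 0) (op Rm 0 (F (C (W x)))) = qc powi (int N) *C F (W x)"
    by (simp add: con_Rm_C W_C)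
  finally show ?thesis
    by (simp add: beta_pm_def con_minus con_scaleC con_FW scaleC_scaleC powi_beta_pm numeral_2_eq_2 con_pre pre_scaleC)
qed

lemma C_F_W: "C (F (W x)) = op Xm (Suc 0) (op Rm 0 (F (C (W x))))"
  by (simp add: Rm_FC)

text \<open>A normal form in which all f stand before C and all v behind it. The two v are then
  adjacent, so \<open>Rs\<close> at position 4 acts on the sorted word by q.\<close>

lemma Sop_2_FWFWC:
  "Sop 2 (F (W (F (W (C x))))) =
   op Xm (Suc 0) (qc *C op Xm 3 (op Xm 2 (op Rs 4 (op Rs 3 (op Rm (Suc 0) (F (F (C (W (W x))))))))))"
proof -
  have "Sop 2 (F (W (F (W (C x))))) = F (W (Stiop (Suc 0) (C (F (W x)))))"
    by (simp add: numeral_2_eq_2 Sop_pre Sop_FWC)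
  also have "\<dots> = Stiop 3 (F (W (C (F (W x)))))"
    by (simp add: eval_nat_numeral Stiop_pre)
  also have "W (C (F (W x))) = op Xm 0 (op Rs (Suc 0) (C (W (F (W x)))))"
    by (simp flip: Ym_WC)
  also have "F (op Xm 0 (op Rs (Suc 0) (C (W (F (W x)))))) = op Xm (Suc 0) (op Rs 2 (F (C (W (F (W x))))))"
    by (simp add: numeral_2_eq_2 op_pre)
  also have "Stiop 3 \<dots> = op Xm (Suc 0) (Stiop 3 (op Rs 2 (F (C (W (F (W x)))))))"
    by (simp add: Stiop_def op_op_commute[of "Suc 0" 3 Xm Ym, symmetric] op_op_commute[of "Suc 0" 4 Xm Rs, symmetric]
        op_op_commute[of "Suc 0" 3 Xm Xm, symmetric])
  also have "F (C (W (F (W x)))) = qc *C op Xm 3 (F (C (F (W (W x)))))"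
    by (simp add: eval_nat_numeral op_pre op_C Xm_FW pre_scaleC ins_scaleC)
  also have "F (C (F (W (W x)))) = op Xm 2 (op Rm (Suc 0) (F (F (C (W (W x))))))"
    by (simp add: C_F_W op_pre numeral_2_eq_2)
  also have "Stiop 3 (op Rs 2 (qc *C op Xm 3 (op Xm 2 (op Rm (Suc 0) (F (F (C (W (W x)))))))))
    = qc *C Stiop 3 (op Xm 3 (op Xm 2 (op Rs 3 (op Rm (Suc 0) (F (F (C (W (W x)))))))))"
    using op_Rs_Xm[of 2 "op Rm (Suc 0) (F (F (C (W (W x)))))"] by (simp add: op_scaleC Stiop_linear)
  also have "Stiop 3 (op Xm 3 (op Xm 2 (op Rs 3 (op Rm (Suc 0) (F (F (C (W (W x)))))))))
    = op Xm 3 (op Xm 2 (op Rs 4 (op Rs 3 (op Rm (Suc 0) (F (F (C (W (W x)))))))))"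
    by (simp add: Stiop_def op_op_commute[of 2 4 Xm Rs])
  finally show ?thesis .
qed

text \<open>Naturality and the braid relation transport the eigenvalue q of \<open>Rs\<close> from
  the adjacent v v at position 4 of the normal form to position 2, which is where S with a tilde
  acts after conjugation.\<close>

lemma Stop_1_Sop_2: "Stop (Suc 0) (Sop 2 (F (W (F (W (C x)))))) = inverse qc *C Sop 2 (F (W (F (W (C x)))))"
proof -
  define G where "G = F (F (C (W (W x))))"
  define Q where "Q = op Xm 3 (op Xm 2 (op Rs 4 (op Rs 3 (op Rm (Suc 0) G))))"
  have G: "op Rs 4 G = qc *C G"
    by (simp add: G_def eval_nat_numeral op_pre op_C Rs_WW pre_scaleC ins_scaleC)
  have "op Rs 2 Q = op Xm 3 (op Xm 2 (op Rs 3 (op Rs 4 (op Rs 3 (op Rm (Suc 0) G)))))"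
    using op_Rs_Xm[of 2] by (simp add: Q_def)
  also have "op Rs 3 (op Rs 4 (op Rs 3 (op Rm (Suc 0) G))) = op Rs 4 (op Rs 3 (op Rs 4 (op Rm (Suc 0) G)))"
    using op_Rs_braid[of 3 "op Rm (Suc 0) G"] by simp
  also have "op Rs 4 (op Rm (Suc 0) G) = qc *C op Rm (Suc 0) G"
    using op_op_commute[of "Suc 0" 4 Rm Rs G] by (simp add: G op_scaleC)
  finally have "op Rs 2 Q = qc *C Q"
    by (simp add: Q_def op_scaleC)
  then have "op Rsi 2 (qc *C Q) = Q"
    by (metis Rsi_Rs)
  then have "qc *C op Rsi 2 Q = qc *C inverse qc *C Q"
    by (simp add: op_scaleC)
  then have "inverse qc *C qc *C op Rsi 2 Q = inverse qc *C qc *C inverse qc *C Q"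
    by simp
  then have Q: "op Rsi 2 Q = inverse qc *C Q"
    by simp
  show ?thesis
    unfolding Sop_2_FWFWC G_def[symmetric] Q_def[symmetric]
    using Q by (simp add: Stop_def op_scaleC numeral_2_eq_2)
qed

lemma Stop_beta_pm: "Stop (Suc 0) (F (W (beta_pm x))) = inverse qc *C F (W (beta_pm x))"
proof -
  have 1: "F (W (Sop 0 (F (W (C x))))) = Sop 2 (F (W (F (W (C x)))))"
    by (simp add: numeral_2_eq_2 Sop_pre)
  have 2: "Stop (Suc 0) (F (W (F (W (F (W x)))))) = inverse qc *C F (W (F (W (F (W x)))))"
    by (simp add: Stop_pre Stop_WFW pre_scaleC)
  show ?thesis
    by (simp add: beta_pm_def pre_minus pre_scaleC 1 2 Stop_linear Stop_1_Sop_2 scaleC_diff_right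
        scaleC_left_commute[of "qc powi (2 - int N)"] scaleC_left_commute[of "qc powi (3 - int N)"])
qed

lemma Top_beta_pm: "Top 0 (F (W (beta_pm x))) = inverse qc *C Sop 0 (F (W (beta_pm x)))"
  by (simp add: Top_def Stop_beta_pm Sop_linear)

text \<open>The leading term times p is \<open>Sop 2\<close> of the word f v f v C. By the braid
  relation for S the outermost \<open>Sop 2\<close> turns into an innermost \<open>Sop 0\<close>,
  and this acts on f v f by q.\<close>

lemma Sop_2_Top_beta_pm: "Sop 2 (Top 0 (F (W (beta_pm x)))) = qc *C Top 0 (F (W (beta_pm x)))"
proof -
  have 1: "F (W (Sop 0 (F (W (C x))))) = Sop 2 (F (W (F (W (C x)))))"
    by (simp add: numeral_2_eq_2 Sop_pre)
  have 2: "Sop 2 (F (W (F (W (F (W x)))))) = qc *C F (W (F (W (F (W x)))))"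
    by (simp add: numeral_2_eq_2 Sop_pre Sop_FWF pre_scaleC)
  have "Sop 2 (Sop 0 (F (W (beta_pm x)))) = qc *C Sop 0 (F (W (beta_pm x)))"
    by (simp add: beta_pm_def pre_minus pre_scaleC 1 2 Sop_linear Sop_braid Sop_FWF scaleC_diff_right
        scaleC_left_commute[of "qc powi (2 - int N)"] scaleC_left_commute[of "qc powi (3 - int N)"])
  then show ?thesis
    by (simp add: Top_beta_pm Sop_linear)
qed

lemma Top_2_Top_beta_pm: "Top 2 (Top 0 (F (W (beta_pm x)))) = beta_pm (F (W x))"
proof -
  have "Top 2 (Top 0 (F (W (beta_pm x)))) = Stop 3 (Sop 2 (Top 0 (F (W (beta_pm x)))))"
    by (simp add: Top_commute eval_nat_numeral)
  also have "\<dots> = Stop 3 (Sop 0 (F (W (beta_pm x))))"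
    by (simp add: Sop_2_Top_beta_pm) (simp add: Top_beta_pm)
  also have "\<dots> = Sop 0 (Stop 3 (F (W (beta_pm x))))"
    by (simp add: Sop_Stop_commute)
  also have "\<dots> = beta_pm (F (W x))"
  proof -
    \<comment> \<open>With C moved in front of p, the leading term is an inverse of S with a tilde,
      which \<open>Stop 3\<close> cancels.\<close>
    have 1: "Stop 3 (F (W (Sop 0 (F (W (C x)))))) = F (W (C (F (W x))))"
      by (simp add: Sop_FWC eval_nat_numeral Stop_pre)
    have 2: "Stop 3 (F (W (F (W (F (W x)))))) = inverse qc *C F (W (F (W (F (W x)))))"
      by (simp add: eval_nat_numeral Stop_pre Stop_WFW pre_scaleC)
    show ?thesis
      unfolding beta_pm_def pre_minus pre_scaleC Stop_linear Sop_linear 1 2 Sop_FWF scaleC_inverse_qc ..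
  qed
  finally show ?thesis .
qed

lemma con_one_Xm: "con one k (op Xm k x) = qc powi (- int N) *C con wq k x"
  by (simp only: con_one_op_Xm scaleC_fun_def)

text \<open>\<open>P\<close> stands for p \<partial>p and \<open>D\<close> for \<partial>p; then
  \<open>qc *C Sop 0 P\<close> is \<partial>p p. Once the middle legs are separated by
  \<open>Ym\<close>, E becomes a multiple of E'. The relation together with E' \<partial>p = 0 makes
  this contraction of p \<partial>p vanish, and therefore \<open>Rm\<close> may be replaced by
  \<open>Ri\<close> in the second one, which naturality reduces to the known contraction of
  p.\<close>

lemma plus_module_contractions:
  fixes P :: "('n, 'm::complex_vector) fam"
  assumes St: "Stop (Suc 0) P = inverse qc *C P" and P2: "con wq 2 P = 0"
    and P0: "con wq 0 P = qc powi (int N - 1) *C D"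
  shows "con one (Suc 0) P = 0" and "con one (Suc 0) (qc *C Sop 0 P) = D"
proof -
  define Q where "Q = op Ym (Suc 0) P"
  have PQ: "P = op Xm (Suc 0) Q"
    by (simp add: Q_def)
  have "op Ym (Suc 0) (op Xm (Suc 0) (op Rsi 2 Q)) = inverse qc *C Q"
    using St by (simp add: Q_def Stop_def op_scaleC numeral_2_eq_2)
  then have Q: "op Rsi 2 Q = inverse qc *C Q"
    by simp
  have "con wq (Suc (Suc 0)) (op Xm (Suc 0) Q) = con wq (Suc 0) (op Rsi 2 Q)"
    by (simp add: con_op_Xm' numeral_2_eq_2)
  then have "inverse qc *C con wq (Suc 0) Q = 0"
    using P2 by (simp add: PQ Q[unfolded numeral_2_eq_2] con_scaleC numeral_2_eq_2)
  then have "qc *C inverse qc *C con wq (Suc 0) Q = 0"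
    by simp
  then have Q1: "con wq (Suc 0) Q = 0"
    by simp
  show "con one (Suc 0) P = 0"
    by (simp add: PQ con_one_Xm Q1)
  have "op Rm 0 Q = op Ri 0 Q + hc *C Q"
    by (simp add: op_Ri_eq fun_eq_iff scaleC_fun_def)
  then have "con wq (Suc 0) (op Rm 0 Q) = con wq 0 P"
    by (simp add: con_plus con_scaleC Q1 con_op_Xm PQ)
  then have "con one (Suc 0) (qc *C Sop 0 P) = qc *C qc powi (- int N) *C qc powi (int N - 1) *C D"
    by (simp add: Sop_def con_scaleC con_one_Xm P0 flip: Q_def)
  also have "\<dots> = (qc * qc powi (- int N) * qc powi (int N - 1)) *C D"
    by (simp add: scaleC_scaleC mult.assoc)
  also have "qc * qc powi (- int N) * qc powi (int N - 1) = 1"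
    by (simp add: power_int_minus power_int_diff)
  finally show "con one (Suc 0) (qc *C Sop 0 P) = D"
    by (simp add: scaleC_one)
qed

text \<open>For p dbar p the relation makes \<open>Rm\<close> act by q on the separated legs, so its
  inverse links the contraction of the middle legs to that of the first two; the relation E' dbar p
  = 0 kills the contraction of dbar p p.\<close>

lemma minus_module_contractions:
  fixes P :: "('n, 'm::complex_vector) fam"
  assumes S: "Sop 0 P = qc *C P" and P2: "con wq 2 P = 0"
    and P0: "con wq 0 P = qc powi (int N - 1) *C D"
  shows "con one (Suc 0) P = D" and "con one (Suc 0) (inverse qc *C Stop (Suc 0) P) = 0"
proof -
  define Q where "Q = op Ym (Suc 0) P"
  have PQ: "P = op Xm (Suc 0) Q"
    by (simp add: Q_def)
  have "op Ym (Suc 0) (op Xm (Suc 0) (op Rm 0 Q)) = qc *C Q"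
    using S by (simp add: Q_def Sop_def op_scaleC)
  then have "op Rm 0 Q = qc *C Q"
    by simp
  then have "op Ri 0 (qc *C Q) = Q"
    by (metis Ri_Rm)
  then have "con wq (Suc 0) (qc *C op Ri 0 Q) = con wq (Suc 0) Q"
    by (simp add: op_scaleC)
  then have Q1: "con wq (Suc 0) Q = qc *C con wq 0 P"
    by (simp add: con_scaleC PQ con_op_Xm)
  have "con one (Suc 0) P = qc powi (- int N) *C qc *C qc powi (int N - 1) *C D"
    by (simp add: PQ con_one_Xm Q1) (simp add: P0 flip: PQ)
  also have "\<dots> = (qc powi (- int N) * qc * qc powi (int N - 1)) *C D"
    by (simp add: scaleC_scaleC mult.assoc)
  also have "qc powi (- int N) * qc * qc powi (int N - 1) = 1"
    by (simp add: power_int_minus power_int_diff)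
  finally show "con one (Suc 0) P = D"
    by (simp add: scaleC_one)
  have "con wq (Suc 0) (op Rsi 2 Q) = con wq 2 P"
    by (simp add: PQ con_op_Xm' numeral_2_eq_2)
  then show "con one (Suc 0) (inverse qc *C Stop (Suc 0) P) = 0"
    using P2 by (simp add: Stop_def con_scaleC con_one_Xm numeral_2_eq_2 flip: Q_def)
qed

end

section \<open>Bimodules, presentations and tensor products\<close>

lemma sum_UNIV_when: "(\<Sum>k\<in>UNIV. \<Sum>l\<in>UNIV. if k = i \<and> l = j then G k l else 0) = G (i::'n::finite) (j::'k::finite)"
proof -
  have "(\<Sum>k\<in>UNIV. \<Sum>l\<in>UNIV. if k = i \<and> l = j then G k l else 0) =
    (\<Sum>k\<in>UNIV. if k = i then \<Sum>l\<in>UNIV. if l = j then G k l else 0 else 0)"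
    by (intro sum.cong refl) auto
  then show ?thesis by simp
qed

locale subalgebra =
  fixes B :: "'a::complex_algebra set"
  assumes one_closed: "1 \<in> B"
    and add_closed: "x \<in> B \<Longrightarrow> y \<in> B \<Longrightarrow> x + y \<in> B"
    and mult_closed: "x \<in> B \<Longrightarrow> y \<in> B \<Longrightarrow> x * y \<in> B"
    and scale_closed: "x \<in> B \<Longrightarrow> c *C x \<in> B"
begin

lemma zero_closed: "0 \<in> B"
  using scale_closed[OF one_closed, of 0] by simp

lemma minus_closed: "x \<in> B \<Longrightarrow> y \<in> B \<Longrightarrow> x - y \<in> B"
  using add_closed[of x "(-1) *C y"] scale_closed[of y "-1"] by (simp add: scaleC_minus_left scaleC_one)

lemma sum_closed: "(\<And>i. i \<in> I \<Longrightarrow> x i \<in> B) \<Longrightarrow> (\<Sum>i\<in>I. x i) \<in> B"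
  by (induction I rule: infinite_finite_induct) (auto simp: zero_closed add_closed)

lemma scalar_closed: "c *C 1 \<in> B"
  by (intro scale_closed one_closed)

end

locale bimod_over = subalgebra B for B :: "'a::complex_algebra set" +
  fixes M :: "('a, 'm::complex_vector) bimod"
  assumes bimodule: "bimodule B M"
begin

abbreviation la (infixr "\<rhd>" 70) where "b \<rhd> x \<equiv> lact M b x"
abbreviation ra (infixl "\<lhd>" 70) where "x \<lhd> b \<equiv> ract M x b"

lemma la_add: "b \<in> B \<Longrightarrow> b \<rhd> (x + y) = b \<rhd> x + b \<rhd> y"
  and add_la: "b \<in> B \<Longrightarrow> c \<in> B \<Longrightarrow> (b + c) \<rhd> x = b \<rhd> x + c \<rhd> x"
  and mult_la: "b \<in> B \<Longrightarrow> c \<in> B \<Longrightarrow> (b * c) \<rhd> x = b \<rhd> (c \<rhd> x)"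
  and ra_add: "b \<in> B \<Longrightarrow> (x + y) \<lhd> b = x \<lhd> b + y \<lhd> b"
  and add_ra: "b \<in> B \<Longrightarrow> c \<in> B \<Longrightarrow> x \<lhd> (b + c) = x \<lhd> b + x \<lhd> c"
  and mult_ra: "b \<in> B \<Longrightarrow> c \<in> B \<Longrightarrow> x \<lhd> (b * c) = (x \<lhd> b) \<lhd> c"
  and la_ra: "b \<in> B \<Longrightarrow> c \<in> B \<Longrightarrow> b \<rhd> (x \<lhd> c) = (b \<rhd> x) \<lhd> c"
  and scalar_la: "(z *C 1) \<rhd> x = z *C x"
  and scalar_ra: "x \<lhd> (z *C 1) = z *C x"
  using bimodule one_closed unfolding bimodule_def by blast+

lemma scaleC_la: "b \<in> B \<Longrightarrow> (z *C b) \<rhd> x = z *C (b \<rhd> x)"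
  using mult_la[of "z *C 1" b x] by (simp add: scalar_closed scalar_la mult_scaleC_left)

lemma la_scaleC: "b \<in> B \<Longrightarrow> b \<rhd> (z *C x) = z *C (b \<rhd> x)"
  using mult_la[of b "z *C 1" x] scaleC_la[of b z x] by (simp add: scalar_closed scalar_la mult_scaleC_right)

lemma ra_scaleC: "b \<in> B \<Longrightarrow> x \<lhd> (z *C b) = z *C (x \<lhd> b)"
  using mult_ra[of b "z *C 1" x] by (simp add: scalar_closed scalar_ra mult_scaleC_right)

lemma scaleC_ra: "b \<in> B \<Longrightarrow> (z *C x) \<lhd> b = z *C (x \<lhd> b)"
  using mult_ra[of "z *C 1" b x] ra_scaleC[of b x z] by (simp add: scalar_closed scalar_ra mult_scaleC_left)

lemma one_la: "1 \<rhd> x = x" and one_ra: "x \<lhd> 1 = x"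
  using scalar_la[of 1 x] scalar_ra[of x 1] by (simp_all add: scaleC_one)

lemma la_zero: "b \<in> B \<Longrightarrow> b \<rhd> 0 = 0" and zero_la: "0 \<rhd> x = 0"
  and ra_zero: "b \<in> B \<Longrightarrow> 0 \<lhd> b = 0" and zero_ra: "x \<lhd> 0 = 0"
  using la_scaleC[of b 0 0] scaleC_la[OF one_closed, of 0 x] scaleC_ra[of b 0 0] ra_scaleC[OF one_closed, of x 0]
  by simp_all

lemma la_sum: "b \<in> B \<Longrightarrow> b \<rhd> (\<Sum>i\<in>I. x i) = (\<Sum>i\<in>I. b \<rhd> x i)"
  by (induction I rule: infinite_finite_induct) (simp_all add: la_zero la_add)

lemma sum_la: "(\<And>i. i \<in> I \<Longrightarrow> b i \<in> B) \<Longrightarrow> (\<Sum>i\<in>I. b i) \<rhd> x = (\<Sum>i\<in>I. b i \<rhd> x)"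
  by (induction I rule: infinite_finite_induct) (simp_all add: zero_la add_la sum_closed)

lemma ra_sum: "b \<in> B \<Longrightarrow> (\<Sum>i\<in>I. x i) \<lhd> b = (\<Sum>i\<in>I. x i \<lhd> b)"
  by (induction I rule: infinite_finite_induct) (simp_all add: ra_zero ra_add)

lemma sum_ra: "(\<And>i. i \<in> I \<Longrightarrow> b i \<in> B) \<Longrightarrow> x \<lhd> (\<Sum>i\<in>I. b i) = (\<Sum>i\<in>I. x \<lhd> b i)"
  by (induction I rule: infinite_finite_induct) (simp_all add: zero_ra add_ra sum_closed)

lemma minus_la: "b \<in> B \<Longrightarrow> c \<in> B \<Longrightarrow> (b - c) \<rhd> x = b \<rhd> x - c \<rhd> x"
  using add_la[of "b - c" c x] minus_closed[of b c] by simp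

lemma minus_ra: "b \<in> B \<Longrightarrow> c \<in> B \<Longrightarrow> x \<lhd> (b - c) = x \<lhd> b - x \<lhd> c"
  using add_ra[of "b - c" c x] minus_closed[of b c] by simp

end

definition left_linear :: "'a::complex_algebra set \<Rightarrow> ('a, 'm::complex_vector) bimod \<Rightarrow> ('m \<Rightarrow> 'a) \<Rightarrow> bool" where
  "left_linear B M h \<longleftrightarrow> range h \<subseteq> B \<and> (\<forall>x y. h (x + y) = h x + h y) \<and> (\<forall>b\<in>B. \<forall>x. h (lact M b x) = b * h x)"

locale presented_bimod = bimod_over B M for B :: "'a::complex_algebra set" and M :: "('a, 'm::complex_vector) bimod" +
  fixes d :: "'n::finite \<Rightarrow> 'n \<Rightarrow> 'm" and rels :: "('n \<Rightarrow> 'n \<Rightarrow> 'a) set"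
  assumes presents: "presents_left_module B (lact M) d rels"
begin

abbreviation coeffs :: "('n \<Rightarrow> 'n \<Rightarrow> 'a) set" where "coeffs \<equiv> {c. \<forall>i j. c i j \<in> B}"
abbreviation val :: "('n \<Rightarrow> 'n \<Rightarrow> 'a) \<Rightarrow> 'm" where "val c \<equiv> \<Sum>i\<in>UNIV. \<Sum>j\<in>UNIV. c i j \<rhd> d i j"

lemma val_surj: "\<exists>c\<in>coeffs. x = val c"
proof -
  have "x \<in> val ` coeffs"
    using presents unfolding presents_left_module_def Let_def by simp
  then show ?thesis by (rule imageE) blast
qed

lemma val_zero_iff: "c \<in> coeffs \<Longrightarrow> val c = 0 \<longleftrightarrow> c \<in> left_submodule B hull rels"
  using presents unfolding presents_left_module_def Let_def by blast

lemma val_rel: "c \<in> rels \<Longrightarrow> c \<in> coeffs \<Longrightarrow> val c = 0"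
  by (subst val_zero_iff) (auto simp: hull_inc)

lemma val_add: "c \<in> coeffs \<Longrightarrow> c' \<in> coeffs \<Longrightarrow> val (c + c') = val c + val c'"
  by (simp add: add_la sum.distrib)

lemma val_diff: "c \<in> coeffs \<Longrightarrow> c' \<in> coeffs \<Longrightarrow> val (c - c') = val c - val c'"
  by (simp add: minus_la sum_subtractf)

lemma val_act: "b \<in> B \<Longrightarrow> c \<in> coeffs \<Longrightarrow> val (free_act b c) = b \<rhd> val c"
  by (simp add: free_act_def mult_la la_sum)

lemma left_linear_zero: "left_linear B M h \<Longrightarrow> h 0 = 0"
  unfolding left_linear_def by (metis add_cancel_right_right)

lemma left_linear_sum:
  assumes "left_linear B M h"
  shows "h (\<Sum>i\<in>I. x i) = (\<Sum>i\<in>I. h (x i))"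
  using assms left_linear_zero[OF assms] unfolding left_linear_def
  by (induction I rule: infinite_finite_induct) simp_all

lemma left_linear_val:
  assumes "left_linear B M h" "c \<in> coeffs"
  shows "h (val c) = (\<Sum>i\<in>UNIV. \<Sum>j\<in>UNIV. c i j * h (d i j))"
proof -
  have "h (c i j \<rhd> d i j) = c i j * h (d i j)" for i j
    using assms unfolding left_linear_def by simp
  then show ?thesis
    by (simp add: left_linear_sum[OF assms(1)])
qed

lemma left_linear_eqI:
  assumes "left_linear B M h" "left_linear B M h'" "\<And>i j. h (d i j) = h' (d i j)"
  shows "h x = h' x"
proof -
  obtain c where c: "c \<in> coeffs" "x = val c"
    using val_surj by blast
  show ?thesis
    unfolding c(2) left_linear_val[OF assms(1) c(1)] left_linear_val[OF assms(2) c(1)] assms(3) ..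
qed

text \<open>The universal property of a presentation: evaluating coefficient families at
  \<open>u\<close> kills the submodule generated by \<open>rels\<close>, so the result depends only
  on the element that a family represents.\<close>

lemma left_map_exists:
  assumes u: "\<And>i j. u i j \<in> B"
    and rels: "\<And>c. c \<in> rels \<Longrightarrow> (\<Sum>i\<in>UNIV. \<Sum>j\<in>UNIV. c i j * u i j) = 0"
  shows "\<exists>h. left_linear B M h \<and> (\<forall>i j. h (d i j) = u i j)"
proof -
  define vu where "vu c = (\<Sum>i\<in>UNIV. \<Sum>j\<in>UNIV. c i j * u i j)" for c :: "'n \<Rightarrow> 'n \<Rightarrow> 'a"
  have vu_add: "vu (c + c') = vu c + vu c'" for c c'
    by (simp add: vu_def distrib_right sum.distrib)
  have vu_diff: "vu (c - c') = vu c - vu c'" for c c'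
    by (simp add: vu_def left_diff_distrib sum_subtractf)
  have vu_act: "vu (free_act b c) = b * vu c" for b c
    by (simp add: vu_def free_act_def sum_distrib_left mult.assoc)
  have "left_submodule B {c. vu c = 0}"
    unfolding left_submodule_def by (simp add: vu_add vu_act) (simp add: vu_def)
  then have "left_submodule B hull rels \<subseteq> {c. vu c = 0}"
    using rels by (intro hull_minimal) (auto simp: vu_def)
  then have "vu c = vu c'" if "c \<in> coeffs" "c' \<in> coeffs" "val c = val c'" for c c'
  proof -
    have "c - c' \<in> coeffs"
      using that by (auto intro: minus_closed)
    moreover have "val (c - c') = 0"
      using that by (simp only: val_diff) simp
    ultimately have "c - c' \<in> left_submodule B hull rels"
      by (simp only: val_zero_iff)
    then show ?thesis
      using \<open>left_submodule B hull rels \<subseteq> _\<close> by (auto simp: vu_diff)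
  qed
  note vu_eq = this
  define h where "h x = vu (SOME c. c \<in> coeffs \<and> x = val c)" for x
  have h_val: "h (val c) = vu c" if "c \<in> coeffs" for c
  proof -
    define c' where "c' = (SOME c'. c' \<in> coeffs \<and> val c = val c')"
    have c': "c' \<in> coeffs \<and> val c = val c'"
      unfolding c'_def by (rule someI[of _ c]) (use that in simp)
    have "vu c' = vu c"
      by (rule vu_eq) (use c' that in simp_all)
    then show ?thesis
      by (simp only: h_def c'_def)
  qed
  have "left_linear B M h"
    unfolding left_linear_def
  proof (intro conjI allI ballI)
    show "range h \<subseteq> B"
    proof safe
      fix x
      obtain c where c: "c \<in> coeffs" "x = val c" using val_surj by blast
      then show "h x \<in> B"
        by (simp only: h_val) (auto simp: vu_def intro!: sum_closed mult_closed u)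
    qed
    show "h (x + y) = h x + h y" for x y
    proof -
      obtain c where c: "c \<in> coeffs" "x = val c" using val_surj by blast
      obtain c' where c': "c' \<in> coeffs" "y = val c'" using val_surj by blast
      have "c + c' \<in> coeffs" using c(1) c'(1) by (auto intro: add_closed)
      then have "h (val (c + c')) = vu c + vu c'" by (simp only: h_val vu_add)
      then show ?thesis using c(1) c'(1) unfolding c(2) c'(2) by (simp only: val_add h_val)
    qed
    show "h (b \<rhd> x) = b * h x" if "b \<in> B" for b x
    proof -
      obtain c where c: "c \<in> coeffs" "x = val c" using val_surj by blast
      then have "free_act b c \<in> coeffs" using that by (auto simp: free_act_def intro: mult_closed)
      then have "h (val (free_act b c)) = b * vu c" by (simp only: h_val vu_act)
      then show ?thesis using c that by (simp only: val_act h_val)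
    qed
  qed
  moreover have "h (d i j) = u i j" for i j
  proof -
    have c: "free_gen i j \<in> coeffs" by (auto simp: free_gen_def one_closed zero_closed)
    have "val (free_gen i j) = d i j"
      using sum_UNIV_when[of i j "\<lambda>k l. d k l"] by (simp add: free_gen_def if_distrib[of "\<lambda>b. b \<rhd> _"] one_la zero_la cong: if_cong)
    moreover have "vu (free_gen i j) = u i j"
      using sum_UNIV_when[of i j "\<lambda>k l. u k l"] by (simp add: vu_def free_gen_def if_distrib[of "\<lambda>b. b * _"] cong: if_cong)
    ultimately show ?thesis
      using h_val[OF c] by simp
  qed
  ultimately show ?thesis by blast
qed

end

text \<open>\<open>lam k l\<close> is the pairing with the generator \<open>d2 k l\<close> on the
  right. Balancing forces the coefficients of the second argument to act on the first from the
  right, hence the shape of \<open>lam_rels2\<close>.\<close>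

locale bimod_pair = M1: presented_bimod B M1 d1 rels1 + M2: presented_bimod B M2 d2 rels2
  for B :: "'a::complex_algebra set" and M1 :: "('a, 'm::complex_vector) bimod"
    and d1 :: "'n::finite \<Rightarrow> 'n \<Rightarrow> 'm" and rels1
    and M2 :: "('a, 'k::complex_vector) bimod" and d2 :: "'n \<Rightarrow> 'n \<Rightarrow> 'k" and rels2 +
  fixes lam :: "'n \<Rightarrow> 'n \<Rightarrow> 'm \<Rightarrow> 'a"
  assumes lam: "left_linear B M1 (lam k l)"
    and rels2: "rels2 \<subseteq> M2.coeffs"
    and lam_rels2: "c \<in> rels2 \<Longrightarrow> (\<Sum>k\<in>UNIV. \<Sum>l\<in>UNIV. lam k l (ract M1 (d1 i j) (c k l))) = 0"
begin

lemma lam_add: "lam k l (x + y) = lam k l x + lam k l y"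
  and lam_la: "b \<in> B \<Longrightarrow> lam k l (lact M1 b x) = b * lam k l x"
  and lam_closed: "lam k l x \<in> B"
  using lam[of k l] unfolding left_linear_def by auto

definition ev2 :: "'m \<Rightarrow> ('n \<Rightarrow> 'n \<Rightarrow> 'a) \<Rightarrow> 'a" where
  "ev2 x c = (\<Sum>k\<in>UNIV. \<Sum>l\<in>UNIV. lam k l (ract M1 x (c k l)))"

lemma ev2_left_linear: "c \<in> M2.coeffs \<Longrightarrow> left_linear B M1 (\<lambda>x. ev2 x c)"
  unfolding left_linear_def ev2_def
  by (auto simp: M1.ra_add lam_add lam_la M1.la_ra[symmetric] sum.distrib sum_distrib_left intro!: M1.sum_closed lam_closed)

lemma ev2_add: "c \<in> M2.coeffs \<Longrightarrow> c' \<in> M2.coeffs \<Longrightarrow> ev2 x (c + c') = ev2 x c + ev2 x c'"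
  by (simp add: ev2_def M1.add_ra lam_add sum.distrib)

lemma ev2_act: "b \<in> B \<Longrightarrow> c \<in> M2.coeffs \<Longrightarrow> ev2 x (free_act b c) = ev2 (ract M1 x b) c"
  by (simp add: ev2_def free_act_def M1.mult_ra)

lemma ev2_hull:
  assumes "c \<in> left_submodule B hull rels2"
  shows "c \<in> M2.coeffs \<and> (\<forall>x. ev2 x c = 0)"
proof -
  have z: "lam k l 0 = 0" for k l
    by (rule M1.left_linear_zero[OF lam])
  have "left_submodule B {c. c \<in> M2.coeffs \<and> (\<forall>x. ev2 x c = 0)}"
    unfolding left_submodule_def
  proof (intro conjI ballI)
    show "0 \<in> {c. c \<in> M2.coeffs \<and> (\<forall>x. ev2 x c = 0)}"
      by (simp add: ev2_def M1.zero_closed M1.zero_ra z)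
  next
    fix b c assume "b \<in> B" "c \<in> {c. c \<in> M2.coeffs \<and> (\<forall>x. ev2 x c = 0)}"
    then show "free_act b c \<in> {c. c \<in> M2.coeffs \<and> (\<forall>x. ev2 x c = 0)}"
      by (auto simp: ev2_act) (simp add: free_act_def M1.mult_closed)
  qed (auto simp: ev2_add M1.add_closed)
  moreover have "rels2 \<subseteq> {c. c \<in> M2.coeffs \<and> (\<forall>x. ev2 x c = 0)}"
  proof
    fix c assume c: "c \<in> rels2"
    then have c': "c \<in> M2.coeffs" using rels2 by blast
    \<comment> \<open>\<open>ev2 x c\<close> is left linear in \<open>x\<close>, so a relation that
      is killed for the generators of \<open>M1\<close> is killed for every
      \<open>x\<close>.\<close>
    have "left_linear B M1 (\<lambda>_. 0)"
      unfolding left_linear_def using M1.zero_closed by auto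
    from M1.left_linear_eqI[OF ev2_left_linear[OF c'] this]
    have "ev2 x c = 0" for x
      using lam_rels2[OF c] by (simp add: ev2_def)
    with c' show "c \<in> {c. c \<in> M2.coeffs \<and> (\<forall>x. ev2 x c = 0)}"
      by blast
  qed
  ultimately have "left_submodule B hull rels2 \<subseteq> {c. c \<in> M2.coeffs \<and> (\<forall>x. ev2 x c = 0)}"
    by (intro hull_minimal)
  then show ?thesis
    using assms by blast
qed

definition beta :: "'m \<Rightarrow> 'k \<Rightarrow> 'a" where
  "beta x y = ev2 x (SOME c. c \<in> M2.coeffs \<and> y = M2.val c)"

lemma ev2_diff: "c \<in> M2.coeffs \<Longrightarrow> c' \<in> M2.coeffs \<Longrightarrow> ev2 x (c - c') = ev2 x c - ev2 x c'"
  using ev2_add[of "c - c'" c' x] M1.minus_closed by simp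

lemma beta_val: "c \<in> M2.coeffs \<Longrightarrow> beta x (M2.val c) = ev2 x c"
proof -
  assume c: "c \<in> M2.coeffs"
  define c' where "c' = (SOME c'. c' \<in> M2.coeffs \<and> M2.val c = M2.val c')"
  have c': "c' \<in> M2.coeffs \<and> M2.val c = M2.val c'"
    unfolding c'_def by (rule someI[of _ c]) (use c in simp)
  then have "c' - c \<in> M2.coeffs"
    using c by (auto intro: M1.minus_closed)
  moreover have "M2.val (c' - c) = 0"
    using c c' M2.val_diff[of c' c] by simp
  ultimately have "c' - c \<in> left_submodule B hull rels2"
    by (simp only: M2.val_zero_iff)
  then have "ev2 x (c' - c) = 0"
    using ev2_hull by blast
  then have "ev2 x c' = ev2 x c"
    using ev2_diff[of c' c x] c c' by simp
  then show ?thesis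
    by (simp only: beta_def c'_def)
qed

lemma beta_left_linear: "left_linear B M1 (\<lambda>x. beta x y)"
proof -
  obtain c where "c \<in> M2.coeffs" "y = M2.val c" using M2.val_surj by blast
  then show ?thesis
    using ev2_left_linear[of c] by (simp only: beta_val)
qed

lemma beta_closed: "beta x y \<in> B"
  and beta_add_left: "beta (x + x') y = beta x y + beta x' y"
  and beta_la: "b \<in> B \<Longrightarrow> beta (lact M1 b x) y = b * beta x y"
  using beta_left_linear[of y] unfolding left_linear_def by auto

lemma beta_add_right: "beta x (y + y') = beta x y + beta x y'"
proof -
  obtain c where c: "c \<in> M2.coeffs" "y = M2.val c" using M2.val_surj by blast
  obtain c' where c': "c' \<in> M2.coeffs" "y' = M2.val c'" using M2.val_surj by blast
  have cc: "c + c' \<in> M2.coeffs" using c(1) c'(1) by (auto intro: M1.add_closed)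
  have "beta x (M2.val (c + c')) = ev2 x c + ev2 x c'"
    using c(1) c'(1) by (simp only: beta_val[OF cc] ev2_add)
  then show ?thesis
    using c(1) c'(1) unfolding c(2) c'(2) by (simp only: M2.val_add beta_val)
qed

lemma beta_balanced: "b \<in> B \<Longrightarrow> beta x (lact M2 b y) = beta (ract M1 x b) y"
proof -
  assume b: "b \<in> B"
  obtain c where c: "c \<in> M2.coeffs" "y = M2.val c" using M2.val_surj by blast
  then have bc: "free_act b c \<in> M2.coeffs" using b by (auto simp: free_act_def intro: M1.mult_closed)
  have "beta x (M2.val (free_act b c)) = ev2 (ract M1 x b) c"
    using c b by (simp only: beta_val[OF bc] ev2_act)
  then show ?thesis
    using c b by (simp only: M2.val_act beta_val)
qed

lemma beta_gen: "beta x (d2 k l) = lam k l x"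
proof -
  have c: "free_gen k l \<in> M2.coeffs" by (auto simp: free_gen_def M1.one_closed M1.zero_closed)
  have "M2.val (free_gen k l) = d2 k l"
    using sum_UNIV_when[of k l "\<lambda>k l. d2 k l"]
    by (simp add: free_gen_def if_distrib[of "\<lambda>b. lact M2 b _"] M2.one_la M2.zero_la cong: if_cong)
  moreover have "ev2 x (free_gen k l) = lam k l x"
    using sum_UNIV_when[of k l "\<lambda>k l. lam k l x"]
    by (simp add: ev2_def free_gen_def if_distrib[of "\<lambda>b. lam _ _ (ract M1 x b)"] M1.one_ra M1.zero_ra
        M1.left_linear_zero[OF lam] cong: if_cong)
  ultimately show ?thesis
    using beta_val[OF c] by simp
qed

text \<open>For fixed \<open>p\<close> both sides are left linear in \<open>x\<close>, and balancing
  absorbs the coefficients of \<open>y\<close> into \<open>x\<close>; hence it suffices to compare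
  them on generators.\<close>

lemma beta_right_linear_gen:
  assumes p: "p \<in> B" and gen: "\<And>i j k l. beta (d1 i j) (ract M2 (d2 k l) p) = lam k l (d1 i j) * p"
  shows "beta x (ract M2 y p) = beta x y * p"
proof -
  have 1: "beta x (ract M2 (d2 k l) p) = beta x (d2 k l) * p" for x k l
  proof (rule M1.left_linear_eqI)
    show "left_linear B M1 (\<lambda>x. beta x (ract M2 (d2 k l) p))"
      by (rule beta_left_linear)
    show "left_linear B M1 (\<lambda>x. beta x (d2 k l) * p)"
      unfolding left_linear_def
      using p by (auto simp: beta_add_left distrib_right beta_la mult.assoc intro!: M1.mult_closed beta_closed)
  qed (simp add: gen beta_gen)
  obtain c where c: "c \<in> M2.coeffs" "y = M2.val c" using M2.val_surj by blast
  have z: "beta x 0 = 0" for x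
    using beta_add_right[of x 0 0] by simp
  have s: "beta x (\<Sum>i\<in>I. w i) = (\<Sum>i\<in>I. beta x (w i))" for x I and w :: "'n \<Rightarrow> 'k"
    by (induction I rule: infinite_finite_induct) (simp_all add: z beta_add_right)
  show ?thesis
    using c(1) p unfolding c(2)
    by (simp add: M2.ra_sum s beta_balanced 1 sum_distrib_right flip: M2.la_ra)
qed

end

subsection \<open>Tensor products\<close>

lemma tensor_eval_superset:
  assumes "finite A" "Poly_Mapping.keys z \<subseteq> A"
  shows "tensor_eval g z = (\<Sum>p\<in>A. Poly_Mapping.lookup z p *C g (fst p) (snd p))"
proof -
  have "tensor_eval g z = (\<Sum>p\<in>Poly_Mapping.keys z. Poly_Mapping.lookup z p *C g (fst p) (snd p))"
    unfolding tensor_eval_def by (simp add: case_prod_beta)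
  also have "\<dots> = (\<Sum>p\<in>A. Poly_Mapping.lookup z p *C g (fst p) (snd p))"
    using assms by (intro sum.mono_neutral_left) (auto simp: in_keys_iff)
  finally show ?thesis .
qed

lemma tensor_eval_add: "tensor_eval g (z + z') = tensor_eval g z + tensor_eval g z'"
proof -
  let ?A = "Poly_Mapping.keys z \<union> Poly_Mapping.keys z'"
  have "Poly_Mapping.keys (z + z') \<subseteq> ?A"
    by (rule keys_add)
  then show ?thesis
    by (simp add: tensor_eval_superset[of ?A] lookup_add scaleC_add_left sum.distrib)
qed

lemma tensor_eval_scale: "tensor_eval g (c *C z) = c *C tensor_eval g z"
proof -
  have "Poly_Mapping.keys (c *C z) \<subseteq> Poly_Mapping.keys z"
    by (auto simp: in_keys_iff lookup_scaleC scaleC_complex_def)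
  then show ?thesis
    by (simp add: tensor_eval_superset[of "Poly_Mapping.keys z"] lookup_scaleC scaleC_sum_right scaleC_scaleC scaleC_complex_def)
qed

lemma tensor_eval_diff: "tensor_eval g (z - z') = tensor_eval g z - tensor_eval g z'"
  using tensor_eval_add[of g "z - z'" z'] by simp

lemma tensor_eval_single: "tensor_eval g (Poly_Mapping.single (x, y) c) = c *C g x y"
  by (simp add: tensor_eval_superset[of "{(x, y)}"])

definition balanced ::
    "'a::complex_algebra set \<Rightarrow> ('a, 'm::complex_vector) bimod \<Rightarrow> ('a, 'k::complex_vector) bimod \<Rightarrow>
     ('m \<Rightarrow> 'k \<Rightarrow> 'u::complex_vector) \<Rightarrow> bool" where
  "balanced B M N g \<longleftrightarrow>
     (\<forall>x x' y. g (x + x') y = g x y + g x' y) \<and> (\<forall>x y y'. g x (y + y') = g x y + g x y') \<and>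
     (\<forall>c x y. g (c *C x) y = c *C g x y) \<and> (\<forall>b\<in>B. \<forall>x y. g (ract M x b) y = g x (lact N b y))"

lemma tensor_eval_relations: "balanced B M N g \<longleftrightarrow> (\<forall>z\<in>tensor_relations B M N. tensor_eval g z = 0)"
proof
  assume "balanced B M N g"
  then show "\<forall>z\<in>tensor_relations B M N. tensor_eval g z = 0"
    unfolding balanced_def tensor_relations_def Let_def
    by (auto simp: tensor_eval_diff tensor_eval_scale tensor_eval_single scaleC_one)
next
  assume *: "\<forall>z\<in>tensor_relations B M N. tensor_eval g z = 0"
  let ?p = "\<lambda>x y. Poly_Mapping.single (x, y) (1::complex)"
  have "g (x + x') y = g x y + g x' y" for x x' y
  proof -
    have "tensor_eval g (?p (x + x') y - ?p x y - ?p x' y) = 0"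
      using * unfolding tensor_relations_def Let_def by blast
    then show ?thesis
      by (simp add: tensor_eval_diff tensor_eval_add tensor_eval_single scaleC_one algebra_simps)
  qed
  moreover have "g x (y + y') = g x y + g x y'" for x y y'
  proof -
    have "tensor_eval g (?p x (y + y') - ?p x y - ?p x y') = 0"
      using * unfolding tensor_relations_def Let_def by blast
    then show ?thesis
      by (simp add: tensor_eval_diff tensor_eval_add tensor_eval_single scaleC_one algebra_simps)
  qed
  moreover have "g (c *C x) y = c *C g x y" for c x y
  proof -
    have "tensor_eval g (?p (c *C x) y - c *C ?p x y) = 0"
      using * unfolding tensor_relations_def Let_def by blast
    then show ?thesis
      by (simp add: tensor_eval_diff tensor_eval_scale tensor_eval_single scaleC_one)
  qed
  moreover have "g (ract M x b) y = g x (lact N b y)" if "b \<in> B" for b x y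
  proof -
    have "tensor_eval g (?p (ract M x b) y - ?p x (lact N b y)) = 0"
      using * that unfolding tensor_relations_def Let_def by blast
    then show ?thesis
      by (simp add: tensor_eval_diff tensor_eval_single scaleC_one)
  qed
  ultimately show "balanced B M N g"
    unfolding balanced_def by blast
qed

locale tensor_prod =
  fixes B :: "'a::complex_algebra set" and M :: "('a, 'm::complex_vector) bimod"
    and N :: "('a, 'k::complex_vector) bimod" and T :: "('a, 't::complex_vector) bimod"
    and tens :: "'m \<Rightarrow> 'k \<Rightarrow> 't"
  assumes tensor_product: "tensor_product B M N T tens"
begin

lemma tens_balanced: "balanced B M N tens"
  unfolding tensor_eval_relations using tensor_product unfolding tensor_product_def
  by (auto intro: hull_inc)

lemma tens_surj: "\<exists>z. t = tensor_eval tens z"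
  using tensor_product unfolding tensor_product_def by (metis surjD)

lemma tensor_lift:
  assumes g: "balanced B M N g"
  shows "\<exists>h. (\<forall>s t. h (s + t) = h s + h t) \<and> (\<forall>c t. h (c *C t) = c *C h t) \<and> (\<forall>x y. h (tens x y) = g x y)"
proof -
  have "complex_subspace {z. tensor_eval g z = 0}"
    unfolding complex_subspace_def
    by (simp add: tensor_eval_add tensor_eval_scale) (simp add: tensor_eval_def)
  then have "complex_subspace hull tensor_relations B M N \<subseteq> {z. tensor_eval g z = 0}"
    using g unfolding tensor_eval_relations by (intro hull_minimal) auto
  then have ker: "tensor_eval g z = 0" if "tensor_eval tens z = 0" for z
    using tensor_product that unfolding tensor_product_def by blast
  define h where "h t = tensor_eval g (SOME z. t = tensor_eval tens z)" for t
  have h: "h (tensor_eval tens z) = tensor_eval g z" for z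
  proof -
    define z' where "z' = (SOME z'. tensor_eval tens z = tensor_eval tens z')"
    have "tensor_eval tens z = tensor_eval tens z'"
      unfolding z'_def by (rule someI[of _ z]) simp
    then have "tensor_eval g (z - z') = 0"
      by (intro ker) (simp add: tensor_eval_diff)
    then show ?thesis
      by (simp add: h_def tensor_eval_diff flip: z'_def)
  qed
  have "h (s + t) = h s + h t" for s t
  proof -
    obtain z where z: "s = tensor_eval tens z" using tens_surj by blast
    obtain z' where z': "t = tensor_eval tens z'" using tens_surj by blast
    show ?thesis
      unfolding z z' by (simp add: h tensor_eval_add flip: tensor_eval_add)
  qed
  moreover have "h (c *C t) = c *C h t" for c t
  proof -
    obtain z where z: "t = tensor_eval tens z" using tens_surj by blast
    show ?thesis
      unfolding z by (metis h tensor_eval_scale)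
  qed
  moreover have "h (tens x y) = g x y" for x y
    using h[of "Poly_Mapping.single (x, y) 1"] by (simp add: tensor_eval_single scaleC_one)
  ultimately show ?thesis by blast
qed

lemma tensor_induct:
  assumes "\<And>x y. P (tens x y)" "P 0" "\<And>s t. P s \<Longrightarrow> P t \<Longrightarrow> P (s + t)" "\<And>c t. P t \<Longrightarrow> P (c *C t)"
  shows "P t"
proof -
  obtain z where t: "t = tensor_eval tens z" using tens_surj by blast
  have "P (\<Sum>p\<in>A. Poly_Mapping.lookup z p *C tens (fst p) (snd p))" for A
    by (induction A rule: infinite_finite_induct) (use assms in auto)
  then show ?thesis
    unfolding t tensor_eval_superset[OF finite_keys order.refl] .
qed

end

section \<open>Weights\<close>

lemma wform_simple_root:
  assumes "k \<in> {1..r}"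
  shows "wform r (simple_root k) \<mu> = \<mu> k - \<mu> (k + 1)"
proof -
  have "wform r (simple_root k) \<mu> = (\<Sum>l=1..r+1. (if l = k then \<mu> l else 0) - (if l = k + 1 then \<mu> l else 0))"
    unfolding wform_def simple_root_def pos_root_def by (intro sum.cong) auto
  also have "\<dots> = \<mu> k - \<mu> (k + 1)"
    using assms unfolding sum_subtractf by (subst (1 2) sum.delta) auto
  finally show ?thesis .
qed

lemma sum_indicator_le: "(\<Sum>k=1..n. if k \<le> i then (1::real) else 0) = real (min i n)"
proof -
  have "(\<Sum>k=1..n. if k \<le> i then (1::real) else 0) = (\<Sum>k\<in>{k\<in>{1..n}. k \<le> i}. 1)"
    by (rule sum.inter_filter[symmetric]) simp
  also have "{k\<in>{1..n}. k \<le> i} = {1..min i n}"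
    by auto
  finally show ?thesis by simp
qed

lemma fund_weight_sum: "i \<in> {1..r} \<Longrightarrow> (\<Sum>k=1..r+1. fund_weight r i k) = 0"
proof -
  assume i: "i \<in> {1..r}"
  have "(\<Sum>k=1..r+1. fund_weight r i k) = (\<Sum>k=1..r+1. (if k \<le> i then 1 else 0) - real i / real (r + 1))"
    by (intro sum.cong) (auto simp: fund_weight_def)
  also have "\<dots> = real i - real i"
    unfolding sum_subtractf sum_indicator_le using i by simp
  finally show ?thesis by simp
qed

lemma lattice_sum: "\<mu> \<in> weight_lattice r \<Longrightarrow> (\<Sum>k=1..r+1. \<mu> k) = 0"
proof -
  assume "\<mu> \<in> weight_lattice r"
  then obtain c :: "nat \<Rightarrow> int" where c: "\<mu> = (\<lambda>k. \<Sum>i=1..r. of_int (c i) * fund_weight r i k)"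
    unfolding weight_lattice_def by blast
  have "(\<Sum>k=1..r+1. \<mu> k) = (\<Sum>i=1..r. of_int (c i) * (\<Sum>k=1..r+1. fund_weight r i k))"
    unfolding c by (subst sum.swap) (simp only: sum_distrib_left)
  also have "\<dots> = 0"
    using fund_weight_sum by (intro sum.neutral) simp
  finally show ?thesis .
qed

lemma fund_weight_lattice: "i \<in> {1..r} \<Longrightarrow> fund_weight r i \<in> weight_lattice r"
  unfolding weight_lattice_def
  by (intro CollectI exI[of _ "\<lambda>j. if j = i then 1 else 0"])
     (simp add: if_distrib[of "\<lambda>c. c * _"] if_distrib[of real_of_int] cong: if_cong)

lemma longest_weyl_sum: "(\<Sum>k=1..r+1. longest_weyl r \<mu> k) = (\<Sum>k=1..r+1. \<mu> k)"
proof -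
  have "(\<Sum>k=1..r+1. longest_weyl r \<mu> k) = (\<Sum>k=1..r+1. \<mu> (r + 2 - k))"
    by (intro sum.cong) (auto simp: longest_weyl_def)
  also have "\<dots> = (\<Sum>k=1..r+1. \<mu> k)"
    by (rule sum.reindex_bij_witness[of _ "\<lambda>k. r + 2 - k" "\<lambda>k. r + 2 - k"]) auto
  finally show ?thesis .
qed

text \<open>Simple roots see only differences of consecutive coordinates; the coordinate sum fixes
  the remaining constant.\<close>

lemma weight_eqI:
  assumes "(\<Sum>k=1..r+1. \<mu> k) = (\<Sum>k=1..r+1. \<nu> k)"
    and "\<And>k. k \<in> {1..r} \<Longrightarrow> wform r (simple_root k) \<mu> = wform r (simple_root k) \<nu>"
    and "k \<in> {1..r+1}"
  shows "\<mu> k = \<nu> k"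
proof -
  have d: "\<mu> k - \<nu> k = \<mu> 1 - \<nu> 1" if "k \<in> {1..r+1}" for k
    using that
  proof (induction k)
    case (Suc k)
    show ?case
    proof (cases "k = 0")
      case False
      then have k: "k \<in> {1..r}" using Suc.prems by simp
      have "\<mu> k - \<mu> (k + 1) = \<nu> k - \<nu> (k + 1)"
        using assms(2)[OF k] by (simp only: wform_simple_root[OF k])
      moreover have "\<mu> k - \<nu> k = \<mu> 1 - \<nu> 1"
        using k by (intro Suc.IH) simp
      ultimately show ?thesis by simp
    qed simp
  qed simp
  have "(\<Sum>k=1..r+1. \<mu> k - \<nu> k) = (\<Sum>k=1..r+1. \<mu> 1 - \<nu> 1)"
    by (intro sum.cong d) auto
  then have "\<mu> 1 = \<nu> 1"
    using assms(1) unfolding sum_subtractf by simp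
  then show ?thesis
    using d[OF assms(3)] by simp
qed

lemma two_rho_eq:
  assumes "k \<in> {1..r+1}"
  shows "two_rho r k = real r + 2 - 2 * real k"
proof -
  have "two_rho r k = (\<Sum>a=1..r+1. (if k = a then real (card {a<..r+1}) else 0) - (\<Sum>b\<in>{a<..r+1}. if k = b then 1 else 0))"
    unfolding two_rho_def pos_root_def by (intro sum.cong) (auto simp: sum_subtractf)
  also have "\<dots> = (\<Sum>a=1..r+1. (if k = a then real (card {a<..r+1}) else 0)) - (\<Sum>a=1..r+1. if a \<le> k - 1 then 1 else 0)"
    unfolding sum_subtractf using assms by (intro arg_cong2[where f = "(-)"] sum.cong refl) auto
  also have "\<dots> = real (r + 1 - k) - real (k - 1)"
    unfolding sum_indicator_le using assms by (subst sum.delta') auto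
  also have "\<dots> = real r + 2 - 2 * real k"
    using assms by (simp add: of_nat_diff)
  finally show ?thesis .
qed

text \<open>Summation by parts, expressing 2\<rho> as the sum of k (r + 1 - k) \<alpha>_k. It
  reduces pairings with 2\<rho> to the pairings with simple roots, which are what the eigenvalues of
  the K_k determine.\<close>

lemma wform_two_rho:
  "wform r (two_rho r) \<mu> = (\<Sum>k=1..r. real k * (real r + 1 - real k) * wform r (simple_root k) \<mu>)"
proof -
  have s: "(\<Sum>k=1..n. real k * (real r + 1 - real k) * (\<mu> k - \<mu> (k + 1))) =
      (\<Sum>k=1..n. (real r + 2 - 2 * real k) * \<mu> k) - real n * (real r + 1 - real n) * \<mu> (n + 1)" for n
    by (induction n) (simp_all add: algebra_simps)
  have "wform r (two_rho r) \<mu> = (\<Sum>k=1..r+1. (real r + 2 - 2 * real k) * \<mu> k)"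
    unfolding wform_def by (intro sum.cong refl) (simp only: two_rho_eq)
  also have "\<dots> = (\<Sum>k=1..r+1. real k * (real r + 1 - real k) * (\<mu> k - \<mu> (k + 1)))"
    by (simp only: s) simp
  also have "\<dots> = (\<Sum>k=1..r. real k * (real r + 1 - real k) * (\<mu> k - \<mu> (k + 1)))"
    by simp
  also have "\<dots> = (\<Sum>k=1..r. real k * (real r + 1 - real k) * wform r (simple_root k) \<mu>)"
    by (intro sum.cong refl) (simp only: wform_simple_root)
  finally show ?thesis .
qed

text \<open>Renumbers the simple roots so that the k-th step down the chain always uses the index
  \<open>dir b r k\<close>: increasing for V(\<omega>_1), decreasing for V(\<omega>_r). Dualising
  negates \<open>b\<close>.\<close>

definition dir :: "bool \<Rightarrow> nat \<Rightarrow> nat \<Rightarrow> nat" where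
  "dir b r k = (if b then r + 1 - k else k)"

lemma dir_mem: "k \<in> {1..r} \<Longrightarrow> dir b r k \<in> {1..r}"
  by (auto simp: dir_def)

lemma dir_dir: "k \<in> {1..r} \<Longrightarrow> dir b r (dir b r k) = k"
  by (auto simp: dir_def)

lemma dir_not: "k \<in> {1..r} \<Longrightarrow> dir (\<not> b) r k = dir b r (r + 1 - k)"
  by (auto simp: dir_def)

lemma dir_eq_iff: "k \<in> {1..r} \<Longrightarrow> l \<in> {1..r} \<Longrightarrow> dir b r k = dir b r l \<longleftrightarrow> k = l"
  by (auto simp: dir_def)

text \<open>The weight of the basis vector at position \<open>n\<close>, counted from the highest weight vector.\<close>
definition wtpos :: "bool \<Rightarrow> nat \<Rightarrow> nat \<Rightarrow> weight" where
  "wtpos b r n k = (if k \<in> {1..r+1} then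
     (if b then 1 / real (r + 1) - (if k = r + 1 - n then 1 else 0) else (if k = n + 1 then 1 else 0) - 1 / real (r + 1)) else 0)"

lemma wtpos_sum: "n \<le> r \<Longrightarrow> (\<Sum>k=1..r+1. wtpos b r n k) = 0"
proof -
  assume n: "n \<le> r"
  have "(\<Sum>k=1..r+1. wtpos b r n k) = (\<Sum>k=1..r+1. if b then 1 / real (r + 1) - (if k = r + 1 - n then 1 else 0) else (if k = n + 1 then 1 else 0) - 1 / real (r + 1))"
    by (intro sum.cong refl) (simp add: wtpos_def)
  also have "\<dots> = 0"
    using n by (cases b) (simp_all add: sum_subtractf del: sum.cl_ivl_Suc)
  finally show ?thesis .
qed

lemma wform_wtpos:
  assumes "k \<in> {1..r}" "n \<le> r"
  shows "wform r (simple_root (dir b r k)) (wtpos b r n) = (if k = n + 1 then 1 else if k = n then -1 else 0)"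
proof (cases b)
  case True
  have m: "r + 1 - k \<in> {1..r+1}" "r + 1 - k + 1 \<in> {1..r+1}"
    and e: "r + 1 - k = r + 1 - n \<longleftrightarrow> k = n" "r + 1 - k + 1 = r + 1 - n \<longleftrightarrow> k = n + 1"
    using assms by auto
  have "wtpos b r n (r + 1 - k) - wtpos b r n (r + 1 - k + 1) = (if k = n + 1 then 1 else 0) - (if k = n then 1 else 0)"
    unfolding wtpos_def if_P[OF m(1)] if_P[OF m(2)] e by (simp add: True)
  then show ?thesis
    unfolding wform_simple_root[OF dir_mem[OF assms(1)]] by (simp add: dir_def True)
next
  case False
  have m: "k \<in> {1..r+1}" "k + 1 \<in> {1..r+1}"
    using assms by auto
  have "wtpos b r n k - wtpos b r n (k + 1) = (if k = n + 1 then 1 else 0) - (if k = n then 1 else 0)"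
    unfolding wtpos_def if_P[OF m(1)] if_P[OF m(2)] by (simp add: False)
  then show ?thesis
    unfolding wform_simple_root[OF dir_mem[OF assms(1)]] by (simp add: dir_def False)
qed

lemma wtpos_eqI:
  assumes "(\<Sum>k=1..r+1. \<mu> k) = 0" "n \<le> r"
    and "\<And>k. k \<in> {1..r} \<Longrightarrow> wform r (simple_root (dir b r k)) \<mu> = (if k = n + 1 then 1 else if k = n then -1 else 0)"
    and "k \<in> {1..r+1}"
  shows "\<mu> k = wtpos b r n k"
proof (rule weight_eqI[OF _ _ assms(4)])
  show "(\<Sum>k=1..r+1. \<mu> k) = (\<Sum>k=1..r+1. wtpos b r n k)"
    using assms(1) wtpos_sum[OF assms(2)] by simp
  fix l assume l: "l \<in> {1..r}"
  show "wform r (simple_root l) \<mu> = wform r (simple_root l) (wtpos b r n)"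
    using assms(3)[OF dir_mem[OF l, of b]] wform_wtpos[OF dir_mem[OF l, of b] assms(2), of b] by (simp only: dir_dir[OF l])
qed

lemma wform_cong: "(\<And>k. k \<in> {1..r+1} \<Longrightarrow> \<mu> k = \<mu>' k) \<Longrightarrow> (\<And>k. k \<in> {1..r+1} \<Longrightarrow> \<nu> k = \<nu>' k) \<Longrightarrow> wform r \<mu> \<nu> = wform r \<mu>' \<nu>'"
  unfolding wform_def by (intro sum.cong refl) simp

lemma wform_delta:
  assumes "i \<in> {1..r+1}" "j \<in> {1..r+1}"
  shows "(\<Sum>k=1..r+1. ((if k = i then 1 else 0) - c) * ((if k = j then 1 else 0) - c)) = (if i = j then 1 else 0) - 2 * c + real (r + 1) * c * c"
proof -
  have "(\<Sum>k=1..r+1. ((if k = i then 1 else 0) - c) * ((if k = j then 1 else 0) - c)) =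
    (\<Sum>k=1..r+1. (if k = i then (if i = j then 1 else 0) else 0) - (if k = i then c else 0) - (if k = j then c else 0) + c * c)"
    by (intro sum.cong refl) (auto simp: algebra_simps)
  also have "\<dots> = (if i = j then 1 else 0) - c - c + real (r + 1) * (c * c)"
    using assms by (simp add: sum.distrib sum_subtractf del: sum.cl_ivl_Suc)
  finally show ?thesis by (simp add: algebra_simps)
qed

lemma wform_wtpos_wtpos:
  assumes "n \<le> r" "m \<le> r"
  shows "wform r (wtpos b r n) (wtpos b r m) = (if n = m then 1 else 0) - 1 / real (r + 1)"
    and "wform r (wtpos b r n) (wtpos (\<not> b) r m) = 1 / real (r + 1) - (if n + m = r then 1 else 0)"
proof -
  define g where "g i k = (if k = i then 1 else 0) - 1 / real (r + 1)" for i k :: nat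
  have g: "(\<Sum>k=1..r+1. g i k * g j k) = (if i = j then 1 else 0) - 1 / real (r + 1)"
    if "i \<in> {1..r+1}" "j \<in> {1..r+1}" for i j
    unfolding g_def wform_delta[OF that] by (simp add: field_simps)
  have w: "wform r (wtpos False r n) \<nu> = (\<Sum>k=1..r+1. g (n + 1) k * \<nu> k)"
    "wform r (wtpos True r n) \<nu> = (\<Sum>k=1..r+1. - (g (r + 1 - n) k * \<nu> k))" for n \<nu>
    unfolding wform_def by (intro sum.cong refl; simp add: wtpos_def g_def algebra_simps)+
  have w': "(\<Sum>k=1..r+1. y k * wtpos False r n k) = (\<Sum>k=1..r+1. y k * g (n + 1) k)"
    "(\<Sum>k=1..r+1. y k * wtpos True r n k) = (\<Sum>k=1..r+1. - (y k * g (r + 1 - n) k))" for n and y :: "nat \<Rightarrow> real"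
    by (intro sum.cong refl; simp add: wtpos_def g_def algebra_simps)+
  have w'': "(\<Sum>k=1..r+1. - (y k * wtpos False r n k)) = (\<Sum>k=1..r+1. - (y k * g (n + 1) k))"
    "(\<Sum>k=1..r+1. - (y k * wtpos True r n k)) = (\<Sum>k=1..r+1. y k * g (r + 1 - n) k)" for n and y :: "nat \<Rightarrow> real"
    by (intro sum.cong refl; simp add: wtpos_def g_def algebra_simps)+
  have m: "n + 1 \<in> {1..r+1}" "r + 1 - n \<in> {1..r+1}" "m + 1 \<in> {1..r+1}" "r + 1 - m \<in> {1..r+1}"
    using assms by auto
  show "wform r (wtpos b r n) (wtpos b r m) = (if n = m then 1 else 0) - 1 / real (r + 1)"
    using assms by (cases b) (simp_all only: w w' w'' g[OF m(1) m(3)] g[OF m(2) m(4)], auto)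
  show "wform r (wtpos b r n) (wtpos (\<not> b) r m) = 1 / real (r + 1) - (if n + m = r then 1 else 0)"
    using assms by (cases b) (simp_all only: not_True_eq_False not_False_eq_True w w' w'' sum_negf g[OF m(1) m(4)] g[OF m(2) m(3)], auto)
qed

lemma fund_weight_wtpos:
  assumes "1 \<le> r"
  shows "fund_weight r 1 = wtpos False r 0" "fund_weight r r = wtpos True r 0"
  using assms by (auto simp: fund_weight_def wtpos_def fun_eq_iff field_simps)

lemma longest_weyl_wtpos: "n \<le> r \<Longrightarrow> longest_weyl r (wtpos b r n) = wtpos b r (r - n)"
proof
  fix k assume n: "n \<le> r"
  show "longest_weyl r (wtpos b r n) k = wtpos b r (r - n) k"
  proof (cases "k \<in> {1..r+1}")
    case True
    then have m: "r + 2 - k \<in> {1..r+1}"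
      and e: "r + 2 - k = r + 1 - n \<longleftrightarrow> k = r + 1 - (r - n)" "r + 2 - k = n + 1 \<longleftrightarrow> k = r - n + 1"
      using n by auto
    show ?thesis
      unfolding longest_weyl_def wtpos_def if_P[OF m] if_P[OF True] e ..
  next
    case False
    then show ?thesis
      unfolding longest_weyl_def wtpos_def by (simp only: if_False)
  qed
qed

lemma wform_two_rho_wtpos:
  assumes "n \<le> r" "\<And>k. k \<in> {1..r} \<Longrightarrow> wform r (simple_root (dir b r k)) \<mu> = (if k = n + 1 then 1 else if k = n then -1 else 0)"
  shows "wform r (two_rho r) \<mu> = real r - 2 * real n"
proof -
  have "wform r (two_rho r) \<mu> = (\<Sum>k=1..r. real k * (real r + 1 - real k) * wform r (simple_root k) \<mu>)"
    by (rule wform_two_rho)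
  \<comment> \<open>The coefficients k (r + 1 - k) are symmetric under reversing the
    numbering.\<close>
  also have "\<dots> = (\<Sum>k=1..r. real k * (real r + 1 - real k) * wform r (simple_root (dir b r k)) \<mu>)"
    by (rule sum.reindex_bij_witness[of _ "dir b r" "dir b r"]) (auto simp: dir_def of_nat_diff algebra_simps)
  also have "\<dots> = (\<Sum>k=1..r. (if k = n + 1 then real k * (real r + 1 - real k) else 0) - (if k = n then real k * (real r + 1 - real k) else 0))"
    using assms(2) by (intro sum.cong refl) auto
  also have "\<dots> = real r - 2 * real n"
    using assms(1) by (cases "n = 0"; cases "n = r") (simp_all add: sum_subtractf sum_negf algebra_simps)
  finally show ?thesis .
qed

section \<open>Modules with a chain of one-dimensional weight spaces\<close>

lemma matrix_mult_sum2: "(A ** B) $ p $ s = (\<Sum>c\<in>UNIV. \<Sum>d\<in>UNIV. A $ p $ (c, d) * B $ (c, d) $ s)"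
  unfolding matrix_matrix_mult_def by (simp flip: sum_prod_UNIV)

lemma kron_nth: "kron A B $ (i, j) $ (a, b) = A $ i $ a * B $ j $ b"
  by (simp add: kron_def)

text \<open>One matrix entry of the statement that \<open>Rm\<close> commutes with E_k, with the
  basis indices replaced by their positions. As E_k moves only position k to k - 1, a few equalities
  between the four positions decide all cases. \<open>chain_F\<close> does the same for F_k.\<close>

lemma chain_E:
  fixes x y u w k :: nat and Q h e :: complex
  assumes Q: "Q \<noteq> 0" and h: "h = Q - inverse Q"
  defines "Ev \<equiv> \<lambda>x u. if u = k \<and> Suc x = k then e else 0"
    and "kq \<equiv> \<lambda>x. if Suc x = k then Q else if x = k then inverse Q else 1"
  shows "(if x = y then Q else 1) * (Ev y u * (if x = w then kq x else 0) + (if y = u then Ev x w else 0)) +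
    (if y < x then h else 0) * (Ev x u * (if y = w then kq y else 0) + (if x = u then Ev y w else 0)) =
    (if u = w then Q else 1) * (Ev x w * (if y = u then kq y else 0) + (if x = w then Ev y u else 0)) +
    (if w < u then h else 0) * (Ev x u * (if y = w then kq y else 0) + (if x = u then Ev y w else 0))"
proof -
  consider "u \<noteq> k" "w \<noteq> k" | "Suc x \<noteq> k" "Suc y \<noteq> k" | "u = k" "k = Suc x" | "w = k" "k = Suc x" "u \<noteq> k"
     | "u = k" "k = Suc y" "Suc x \<noteq> k" | "w = k" "k = Suc y" "u \<noteq> k" "Suc x \<noteq> k"
    by blast
  then show ?thesis
  proof cases
    case 1 then show ?thesis by (simp add: Ev_def)
  next
    case 2 then show ?thesis by (simp add: Ev_def)
  next
    case 3
    show ?thesis unfolding 3 Ev_def kq_def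
      by (cases "w = y"; cases "y = x"; cases "y = Suc x"; (hypsubst)?; (hypsubst)?; simp add: Q h field_simps)
  next
    case 4
    then show ?thesis unfolding 4 Ev_def kq_def
      by (cases "u = y"; cases "y = x"; cases "y = Suc x"; (hypsubst)?; (hypsubst)?; simp add: Q h field_simps)
  next
    case 5
    then show ?thesis unfolding 5 Ev_def kq_def
      by (cases "w = x"; cases "x = y"; cases "x = Suc y"; (hypsubst)?; (hypsubst)?; simp add: Q h field_simps)
  next
    case 6
    then show ?thesis unfolding 6 Ev_def kq_def
      by (cases "u = x"; cases "y = x"; cases "x = Suc y"; (hypsubst)?; (hypsubst)?; simp add: Q h field_simps)
  qed
qed
lemma chain_F:
  fixes x y u w k :: nat and Q h e :: complex
  assumes Q: "Q \<noteq> 0" and h: "h = Q - inverse Q"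
  defines "Ev \<equiv> \<lambda>x u. if x = k \<and> Suc u = k then e else 0"
    and "kq \<equiv> \<lambda>x. if Suc x = k then inverse Q else if x = k then Q else 1"
  shows "(if x = y then Q else 1) * (Ev y u * (if x = w then 1 else 0) + (if y = u then kq y * Ev x w else 0)) +
    (if y < x then h else 0) * (Ev x u * (if y = w then 1 else 0) + (if x = u then kq x * Ev y w else 0)) =
    (if u = w then Q else 1) * (Ev x w * (if y = u then 1 else 0) + (if x = w then kq x * Ev y u else 0)) +
    (if w < u then h else 0) * (Ev x u * (if y = w then 1 else 0) + (if x = u then kq x * Ev y w else 0))"
proof -
  consider "x \<noteq> k" "y \<noteq> k" | "Suc u \<noteq> k" "Suc w \<noteq> k" | "x = k" "k = Suc u" | "y = k" "k = Suc u" "x \<noteq> k"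
     | "x = k" "k = Suc w" "Suc u \<noteq> k" | "y = k" "k = Suc w" "x \<noteq> k" "Suc u \<noteq> k"
    by blast
  then show ?thesis
  proof cases
    case 1 then show ?thesis by (simp add: Ev_def)
  next
    case 2 then show ?thesis by (simp add: Ev_def)
  next
    case 3
    show ?thesis unfolding 3 Ev_def kq_def
      by (cases "w = y"; cases "y = u"; cases "y = Suc u"; (hypsubst)?; (hypsubst)?; simp add: Q h field_simps)
  next
    case 4
    then show ?thesis unfolding 4 Ev_def kq_def
      by (cases "w = x"; cases "x = u"; cases "x = Suc u"; (hypsubst)?; (hypsubst)?; simp add: Q h field_simps)
  next
    case 5
    then show ?thesis unfolding 5 Ev_def kq_def
      by (cases "u = y"; cases "y = w"; cases "y = Suc w"; (hypsubst)?; (hypsubst)?; simp add: Q h field_simps)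
  next
    case 6
    then show ?thesis unfolding 6 Ev_def kq_def
      by (cases "u = x"; cases "x = w"; cases "x = Suc w"; (hypsubst)?; (hypsubst)?; simp add: Q h field_simps)
  qed
qed

lemma sum_collapse:
  fixes G :: "'n::finite \<Rightarrow> 'm::finite \<Rightarrow> complex"
  shows "(\<Sum>c\<in>UNIV. \<Sum>d\<in>UNIV. G c d * (U c * (if d = b then \<kappa> else 0) + (if c = i then V d else 0))) =
    (\<Sum>c\<in>UNIV. G c b * U c * \<kappa>) + (\<Sum>d\<in>UNIV. G i d * V d)"
proof -
  have "(\<Sum>c\<in>UNIV. \<Sum>d\<in>UNIV. G c d * (U c * (if d = b then \<kappa> else 0) + (if c = i then V d else 0))) =
    (\<Sum>c\<in>UNIV. (\<Sum>d\<in>UNIV. if d = b then G c d * U c * \<kappa> else 0) + (if c = i then \<Sum>d\<in>UNIV. G c d * V d else 0))"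
    unfolding sum.distrib[symmetric] by (rule sum.cong[OF refl]) (simp add: distrib_left sum.distrib if_distrib[of "\<lambda>x. _ * x"] cong: if_cong)
  then show ?thesis
    by (simp add: sum.distrib)
qed

text \<open>\<open>b\<close> records whether the simple roots are met along the chain in decreasing order.\<close>
locale chain_module =
  fixes q :: real and r :: nat and b :: bool and pos :: "'n::finite \<Rightarrow> nat" and M :: "'n uq_rep"
    and eE eF :: "nat \<Rightarrow> complex"
  assumes q: "0 < q" "q < 1" and r: "1 \<le> r"
    and pos: "bij_betw pos UNIV {..<r+1}"
    and K: "k \<in> {1..r} \<Longrightarrow> M (gK (dir b r k)) $ i $ j =
      (if i = j then if Suc (pos i) = k then complex_of_real q else if pos i = k then inverse (complex_of_real q) else 1 else 0)"
    and Ki: "k \<in> {1..r} \<Longrightarrow> M (gKinv (dir b r k)) $ i $ j =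
      (if i = j then if Suc (pos i) = k then inverse (complex_of_real q) else if pos i = k then complex_of_real q else 1 else 0)"
    and E: "k \<in> {1..r} \<Longrightarrow> M (gE (dir b r k)) $ i $ j = (if pos j = k \<and> Suc (pos i) = k then eE k else 0)"
    and F: "k \<in> {1..r} \<Longrightarrow> M (gF (dir b r k)) $ i $ j = (if pos i = k \<and> Suc (pos j) = k then eF k else 0)"
    and eE: "k \<in> {1..r} \<Longrightarrow> eE k \<noteq> 0" and eF: "k \<in> {1..r} \<Longrightarrow> eF k \<noteq> 0"
begin

sublocale braid_matrices q "Suc r" pos
  by unfold_locales (use q pos in simp_all)

definition kq :: "nat \<Rightarrow> 'n \<Rightarrow> complex" where
  "kq k i = (if Suc (pos i) = k then qc else if pos i = k then inverse qc else 1)"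

lemma kq_nz [simp]: "kq k i \<noteq> 0"
  by (simp add: kq_def)

lemma K_kq: "k \<in> {1..r} \<Longrightarrow> M (gK (dir b r k)) $ i $ j = (if i = j then kq k i else 0)"
  by (simp add: K kq_def qc_def)

lemma Ki_kq: "k \<in> {1..r} \<Longrightarrow> M (gKinv (dir b r k)) $ i $ j = (if i = j then inverse (kq k i) else 0)"
  by (simp add: Ki kq_def qc_def)

lemma pos_surj: "n \<le> r \<Longrightarrow> \<exists>i. pos i = n"
  using pos unfolding bij_betw_def by (metis imageE lessThan_iff less_Suc_eq_le Suc_eq_plus1)

lemma gens_cases:
  assumes "X \<in> uq_gens r"
  obtains k where "k \<in> {1..r}" "X = gK (dir b r k)" | k where "k \<in> {1..r}" "X = gKinv (dir b r k)"
    | k where "k \<in> {1..r}" "X = gE (dir b r k)" | k where "k \<in> {1..r}" "X = gF (dir b r k)"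
proof -
  have *: "dir b r l \<in> {1..r}" "l = dir b r (dir b r l)" if "l \<in> {1..r}" for l
    using dir_mem[OF that] dir_dir[OF that] by simp_all
  from assms consider l where "l \<in> {1..r}" "X = gK l" | l where "l \<in> {1..r}" "X = gKinv l"
    | l where "l \<in> {1..r}" "X = gE l" | l where "l \<in> {1..r}" "X = gF l"
    unfolding uq_gens_def by blast
  then show ?thesis
  proof cases
    case (1 l) then show ?thesis using that(1)[of "dir b r l"] *[of l] by simp
  next
    case (2 l) then show ?thesis using that(2)[of "dir b r l"] *[of l] by simp
  next
    case (3 l) then show ?thesis using that(3)[of "dir b r l"] *[of l] by simp
  next
    case (4 l) then show ?thesis using that(4)[of "dir b r l"] *[of l] by simp
  qed
qed

lemma Rm_mult: "(Rm ** A) $ (i, j) $ (c, d) =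
    kap i j * A $ (j, i) $ (c, d) + (if pos j < pos i then hc else 0) * A $ (i, j) $ (c, d)"
proof -
  have 1: "(if P then x else 0) * y = (if P then x * y else (0::complex))"
    "(if P \<and> Q \<and> L then x else 0) * y = (if P \<and> Q then (if L then x else 0) * y else (0::complex))" for P Q L x y
    by simp_all
  show ?thesis
    unfolding matrix_mult_sum2 Rm_nth distrib_right 1(2) 1(1)[of "_ \<and> _ = _"] sum.distrib sum_delta2 ..
qed

lemma mult_Rm: "(A ** Rm) $ (i, j) $ (c, d) =
    kap c d * A $ (i, j) $ (d, c) + (if pos d < pos c then hc else 0) * A $ (i, j) $ (c, d)"
proof -
  have 1: "y * (if P then x else 0) = (if P then y * x else (0::complex))"
    "y * (if P \<and> Q \<and> L then x else 0) = (if P \<and> Q then y * (if L then x else 0) else (0::complex))" for P Q L x y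
    by simp_all
  have 2: "Rm $ (x, y) $ (c, d) = (if x = d \<and> y = c then kap c d else 0) + (if x = c \<and> y = d \<and> pos d < pos c then hc else 0)" for x y
    unfolding Rm_nth kap_def by (rule arg_cong2[where f = "(+)"]) auto
  show ?thesis
    unfolding matrix_mult_sum2 2 distrib_left 1(2) 1(1)[of _ "_ \<and> _ = _"] sum.distrib sum_delta2 by (simp add: mult.commute)
qed

lemma kap_pos: "kap i j = (if pos i = pos j then qc else 1)"
  by (simp add: kap_def pos_inj)

lemma tensor_E: "k \<in> {1..r} \<Longrightarrow> tensor_rep M M (gE (dir b r k)) $ (i, j) $ (a, c) =
    (if pos a = k \<and> Suc (pos i) = k then eE k else 0) *
      (if pos j = pos c then if Suc (pos j) = k then qc else if pos j = k then inverse qc else 1 else 0) +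
    (if pos i = pos a then if pos c = k \<and> Suc (pos j) = k then eE k else 0 else 0)"
  unfolding tensor_rep.simps vector_add_component kron_nth E K_kq kq_def mat_def pos_inj by simp

lemma tensor_F: "k \<in> {1..r} \<Longrightarrow> tensor_rep M M (gF (dir b r k)) $ (i, j) $ (a, c) =
    (if pos i = k \<and> Suc (pos a) = k then eF k else 0) * (if pos j = pos c then 1 else 0) +
    (if pos i = pos a then (if Suc (pos i) = k then inverse qc else if pos i = k then qc else 1) *
      (if pos j = k \<and> Suc (pos c) = k then eF k else 0) else 0)"
  unfolding tensor_rep.simps vector_add_component kron_nth F Ki_kq kq_def mat_def pos_inj by simp

lemma Rm_intertwines:
  assumes "X \<in> uq_gens r"
  shows "Rm ** tensor_rep M M X = tensor_rep M M X ** Rm"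
proof -
  have "(Rm ** tensor_rep M M X) $ (x, y) $ (u, w) = (tensor_rep M M X ** Rm) $ (x, y) $ (u, w)" for x y u w
    using assms
  proof (cases rule: gens_cases)
    case (1 k)
    show ?thesis
      unfolding 1(2) Rm_mult mult_Rm tensor_rep.simps kron_nth K_kq[OF 1(1)] kap_pos kq_def pos_inj[symmetric]
      by (cases "pos x = pos u"; cases "pos y = pos u"; cases "pos x = pos w"; cases "pos y = pos w"; simp)
  next
    case (2 k)
    show ?thesis
      unfolding 2(2) Rm_mult mult_Rm tensor_rep.simps kron_nth Ki_kq[OF 2(1)] kap_pos kq_def pos_inj[symmetric]
      by (cases "pos x = pos u"; cases "pos y = pos u"; cases "pos x = pos w"; cases "pos y = pos w"; simp)
  next
    case (3 k)
    show ?thesis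
      unfolding 3(2) Rm_mult mult_Rm tensor_E[OF 3(1)] kap_pos by (rule chain_E[OF qc_nz hc_def])
  next
    case (4 k)
    show ?thesis
      unfolding 4(2) Rm_mult mult_Rm tensor_F[OF 4(1)] kap_pos by (rule chain_F[OF qc_nz hc_def])
  qed
  then show ?thesis
    unfolding vec_eq_iff by auto
qed

end

lemma axis_if: "axis j x $ i = (if i = j then x else 0)"
  by (simp add: axis_def)
lemma matvec_axis: "((A :: complex^'a^'b) *v axis j 1) $ i = A $ i $ j"
proof -
  have "(A *v axis j 1) $ i = (\<Sum>k\<in>UNIV. if k = j then A $ i $ k else 0)"
    unfolding matrix_vector_mult_def vec_lambda_beta axis_if by (simp only: mult_1_right mult_zero_right if_distrib[of "\<lambda>x. _ * x"])
  then show ?thesis by simp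
qed

section \<open>Duals of chain modules and the module maps between V and its dual\<close>

context chain_module
begin

lemma pos_le: "pos i \<le> r"
  using pos_less[of i] by simp

text \<open>Transposition reverses the chain, so positions become r - pos and the order of the
  simple roots flips. The factors -q and its inverse arise from the antipodes, where K and its
  inverse act on the vector at position \<open>m\<close> of the original chain.\<close>

lemma dual_chain: "chain_module q r (\<not> b) (\<lambda>i. r - pos i) (dual_rep M)
    (\<lambda>k. - qc * eE (r + 1 - k)) (\<lambda>k. - inverse qc * eF (r + 1 - k))"
proof
  show "0 < q" "q < 1" "1 \<le> r" by (fact q r)+
  have "bij_betw (\<lambda>n. r - n) {..<r+1} {..<r+1}"
    by (rule bij_betw_byWitness[where f' = "\<lambda>n. r - n"]) auto
  from bij_betw_trans[OF pos this]
  show "bij_betw (\<lambda>i. r - pos i) UNIV {..<r+1}"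
    by (simp add: comp_def)
next
  fix k i j assume k: "k \<in> {1..r}"
  define m where "m = r + 1 - k"
  have m: "m \<in> {1..r}" using k by (auto simp: m_def)
  have d: "dir (\<not> b) r k = dir b r m" unfolding m_def by (rule dir_not[OF k])
  have e: "r - pos i = k \<longleftrightarrow> Suc (pos i) = m" "Suc (r - pos i) = k \<longleftrightarrow> pos i = m" for i
    using pos_le[of i] k by (auto simp: m_def)
  have x: "\<not> (Suc (pos i) = m \<and> pos i = m)" for i by simp
  show "dual_rep M (gK (dir (\<not> b) r k)) $ i $ j =
      (if i = j then if Suc (r - pos i) = k then complex_of_real q else if r - pos i = k then inverse (complex_of_real q) else 1 else 0)"
    unfolding dual_rep.simps d transpose_def e by (simp add: Ki[OF m])
  show "dual_rep M (gKinv (dir (\<not> b) r k)) $ i $ j =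
      (if i = j then if Suc (r - pos i) = k then inverse (complex_of_real q) else if r - pos i = k then complex_of_real q else 1 else 0)"
    unfolding dual_rep.simps d transpose_def e by (simp add: K[OF m])
  have "dual_rep M (gE (dir (\<not> b) r k)) $ i $ j = - (\<Sum>c\<in>UNIV. if c = i then M (gE (dir b r m)) $ j $ i * inverse (kq m i) else 0)"
    unfolding dual_rep.simps d transpose_def matrix_matrix_mult_def
    by (simp add: Ki_kq[OF m] if_distrib[of "\<lambda>x. _ * x"] cong: if_cong)
  also have "\<dots> = (if r - pos j = k \<and> Suc (r - pos i) = k then - qc * eE m else 0)"
    by (simp add: E[OF m] kq_def e)
  finally show "dual_rep M (gE (dir (\<not> b) r k)) $ i $ j = (if r - pos j = k \<and> Suc (r - pos i) = k then - qc * eE (r + 1 - k) else 0)"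
    unfolding m_def .
  have "dual_rep M (gF (dir (\<not> b) r k)) $ i $ j = - (\<Sum>c\<in>UNIV. if j = c then kq m j * M (gF (dir b r m)) $ j $ i else 0)"
    unfolding dual_rep.simps d transpose_def matrix_matrix_mult_def
    by (simp add: K_kq[OF m] if_distrib[of "\<lambda>x. x * _"] cong: if_cong)
  also have "\<dots> = (if r - pos i = k \<and> Suc (r - pos j) = k then - inverse qc * eF m else 0)"
    by (simp add: F[OF m] kq_def e)
  finally show "dual_rep M (gF (dir (\<not> b) r k)) $ i $ j = (if r - pos i = k \<and> Suc (r - pos j) = k then - inverse qc * eF (r + 1 - k) else 0)"
    unfolding m_def .
next
  fix k assume "k \<in> {1..r}"
  then have "r + 1 - k \<in> {1..r}" by auto
  then show "- qc * eE (r + 1 - k) \<noteq> 0" "- inverse qc * eF (r + 1 - k) \<noteq> 0"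
    using eE eF by simp_all
qed

text \<open>Reversing the positions exchanges the two triangular parts. The braiding of the dual
  with itself is thereby an instance of the computation for V.\<close>

lemma dual_Rm: "braid_matrices.Rm q (\<lambda>i. r - pos i) = Rs"
proof -
  interpret D: chain_module q r "\<not> b" "\<lambda>i. r - pos i" "dual_rep M" "\<lambda>k. - qc * eE (r + 1 - k)" "\<lambda>k. - inverse qc * eF (r + 1 - k)"
    by (rule dual_chain)
  have l: "r - pos j < r - pos i \<longleftrightarrow> pos i < pos j" for i j
    using pos_le[of i] pos_le[of j] by auto
  have "D.Rm $ (i, j) $ (a, c) = Rs $ (i, j) $ (a, c)" for i j a c
    unfolding D.Rm_nth Rs_nth l ..
  then show ?thesis
    unfolding vec_eq_iff by auto
qed

lemma Rm_kq: "Rm $ (i, j) $ (a, c) * (kq k i * kq k j) = Rm $ (i, j) $ (a, c) * (kq k a * kq k c)"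
  unfolding Rm_nth by (auto simp: mult.commute)

lemma sum_collapse':
  fixes G :: "'n \<Rightarrow> 'n \<Rightarrow> complex"
  shows "(\<Sum>c\<in>UNIV. \<Sum>d\<in>UNIV. (U c * (if d = y then \<kappa> else 0) + (if c = i then V d else 0)) * G c d) =
    (\<Sum>c\<in>UNIV. U c * \<kappa> * G c y) + (\<Sum>d\<in>UNIV. V d * G i d)"
  using sum_collapse[of G U y \<kappa> i V] by (simp add: mult_ac)

text \<open>For K this is conservation of weight. For E and F, an entry of the claim is an entry of
  \<open>Rm_intertwines\<close> with indices moved between rows and columns; the factors of K in the
  coproduct turn into those of the antipode by \<open>Rm_kq\<close>.\<close>

lemma Ym_intertwines:
  assumes "X \<in> uq_gens r"
  shows "Ym ** tensor_rep (dual_rep M) M X = tensor_rep M (dual_rep M) X ** Ym"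
proof -
  have "(Ym ** tensor_rep (dual_rep M) M X) $ (x, y) $ (j, i) = (tensor_rep M (dual_rep M) X ** Ym) $ (x, y) $ (j, i)" for x y i j
    using assms
  proof (cases rule: gens_cases)
    case (1 k)
    have A: "tensor_rep (dual_rep M) M X $ (c, d) $ (j, i) = (if c = j \<and> d = i then inverse (kq k j) * kq k i else 0)" for c d
      unfolding 1(2) tensor_rep.simps dual_rep.simps kron_nth fst_conv snd_conv transpose_def by (simp add: K_kq[OF 1(1)] Ki_kq[OF 1(1)])
    have B: "tensor_rep M (dual_rep M) X $ (x, y) $ (c, d) = (if c = x \<and> d = y then kq k x * inverse (kq k y) else 0)" for c d
      unfolding 1(2) tensor_rep.simps dual_rep.simps kron_nth fst_conv snd_conv transpose_def
      by (simp add: K_kq[OF 1(1)] Ki_kq[OF 1(1)] eq_commute[of c] eq_commute[of d])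
    show ?thesis
      unfolding matrix_mult_sum2 A B Ym_nth if_distrib[of "\<lambda>x. _ * x"] if_distrib[of "\<lambda>x. x * _"] mult_zero_left mult_zero_right sum_delta2
      using Rm_kq[of j x i y k] by (auto simp: field_simps)
  next
    case (2 k)
    have A: "tensor_rep (dual_rep M) M X $ (c, d) $ (j, i) = (if c = j \<and> d = i then kq k j * inverse (kq k i) else 0)" for c d
      unfolding 2(2) tensor_rep.simps dual_rep.simps kron_nth fst_conv snd_conv transpose_def by (simp add: K_kq[OF 2(1)] Ki_kq[OF 2(1)])
    have B: "tensor_rep M (dual_rep M) X $ (x, y) $ (c, d) = (if c = x \<and> d = y then inverse (kq k x) * kq k y else 0)" for c d
      unfolding 2(2) tensor_rep.simps dual_rep.simps kron_nth fst_conv snd_conv transpose_def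
      by (simp add: K_kq[OF 2(1)] Ki_kq[OF 2(1)] eq_commute[of c] eq_commute[of d])
    show ?thesis
      unfolding matrix_mult_sum2 A B Ym_nth if_distrib[of "\<lambda>x. _ * x"] if_distrib[of "\<lambda>x. x * _"] mult_zero_left mult_zero_right sum_delta2
      using Rm_kq[of j x i y k] by (auto simp: field_simps)
  next
    case (3 k)
    let ?E = "M (gE (dir b r k))"
    have dE: "dual_rep M (gE (dir b r k)) $ c $ d = - (?E $ d $ c * inverse (kq k c))" for c d
      unfolding dual_rep.simps transpose_def matrix_matrix_mult_def
      by (simp add: Ki_kq[OF 3(1)] if_distrib[of "\<lambda>x. _ * x"] cong: if_cong)
    have A: "tensor_rep (dual_rep M) M X $ (c, d) $ (j, i) =
        - (?E $ j $ c * inverse (kq k c)) * (if d = i then kq k i else 0) + (if c = j then ?E $ d $ i else 0)" for c d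
      unfolding 3(2) tensor_rep.simps vector_add_component kron_nth dE by (simp add: K_kq[OF 3(1)] mat_def)
    have B: "tensor_rep M (dual_rep M) X $ (x, y) $ (c, d) =
        ?E $ x $ c * (if d = y then inverse (kq k y) else 0) + (if c = x then - (?E $ d $ y * inverse (kq k y)) else 0)" for c d
      unfolding 3(2) tensor_rep.simps vector_add_component kron_nth dE fst_conv snd_conv mat_def
      by (simp add: transpose_def Ki_kq[OF 3(1)] eq_commute[of c] eq_commute[of d])
    have C: "tensor_rep M M X $ (c, d) $ (i, y) = ?E $ c $ i * (if d = y then kq k y else 0) + (if c = i then ?E $ d $ y else 0)" for c d
      unfolding 3(2) tensor_rep.simps vector_add_component kron_nth by (simp add: K_kq[OF 3(1)] mat_def)
    have D: "tensor_rep M M X $ (j, x) $ (c, d) = ?E $ j $ c * (if d = x then kq k x else 0) + (if c = j then ?E $ x $ d else 0)" for c d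
      unfolding 3(2) tensor_rep.simps vector_add_component kron_nth fst_conv snd_conv mat_def K_kq[OF 3(1)]
      by (simp add: eq_commute[of c] eq_commute[of d])
    have "(\<Sum>c\<in>UNIV. \<Sum>d\<in>UNIV. Rm $ (j, x) $ (c, d) * tensor_rep M M X $ (c, d) $ (i, y)) =
        (\<Sum>c\<in>UNIV. \<Sum>d\<in>UNIV. tensor_rep M M X $ (j, x) $ (c, d) * Rm $ (c, d) $ (i, y))"
      unfolding matrix_mult_sum2[symmetric] Rm_intertwines[OF assms] ..
    then have "(\<Sum>c\<in>UNIV. Rm $ (j, x) $ (c, y) * ?E $ c $ i * kq k y) + (\<Sum>d\<in>UNIV. Rm $ (j, x) $ (i, d) * ?E $ d $ y) =
        (\<Sum>c\<in>UNIV. ?E $ j $ c * kq k x * Rm $ (c, x) $ (i, y)) + (\<Sum>d\<in>UNIV. ?E $ x $ d * Rm $ (j, d) $ (i, y))" (is "?a + ?b = ?c + ?d")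
      unfolding C D sum_collapse sum_collapse' .
    \<comment> \<open>Dividing by the eigenvalue of K at \<open>y\<close> produces the inverse of K
      that the antipode of E carries.\<close>
    then have "inverse (kq k y) * (?a + ?b) = inverse (kq k y) * (?c + ?d)"
      by (simp only:)
    moreover have "inverse (kq k y) * (?E $ j $ c * kq k x * Rm $ (c, x) $ (i, y)) = ?E $ j $ c * inverse (kq k c) * kq k i * Rm $ (c, x) $ (i, y)" for c
      using Rm_kq[of c x i y k] by (simp add: field_simps)
    moreover have "inverse (kq k y) * (Rm $ (j, x) $ (c, y) * ?E $ c $ i * kq k y) = Rm $ (j, x) $ (c, y) * ?E $ c $ i" for c
      by simp
    ultimately have "(\<Sum>c\<in>UNIV. Rm $ (j, x) $ (c, y) * ?E $ c $ i) + (\<Sum>d\<in>UNIV. inverse (kq k y) * (Rm $ (j, x) $ (i, d) * ?E $ d $ y)) =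
       (\<Sum>c\<in>UNIV. ?E $ j $ c * inverse (kq k c) * kq k i * Rm $ (c, x) $ (i, y)) + (\<Sum>d\<in>UNIV. inverse (kq k y) * (?E $ x $ d * Rm $ (j, d) $ (i, y)))"
      by (simp only: distrib_left sum_distrib_left)
    then show ?thesis
      unfolding matrix_mult_sum2 A B Ym_nth sum_collapse[of "\<lambda>c d. Rm $ (c, x) $ (d, y)"] sum_collapse'[where G = "\<lambda>c d. Rm $ (j, c) $ (i, d)"]
      by (simp add: sum_negf algebra_simps)
  next
    case (4 k)
    let ?F = "M (gF (dir b r k))"
    have dF: "dual_rep M (gF (dir b r k)) $ c $ d = - (kq k d * ?F $ d $ c)" for c d
      unfolding dual_rep.simps transpose_def matrix_matrix_mult_def
      by (simp add: K_kq[OF 4(1)] if_distrib[of "\<lambda>x. x * _"] cong: if_cong)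
    have A: "tensor_rep (dual_rep M) M X $ (c, d) $ (j, i) =
        - (kq k j * ?F $ j $ c) * (if d = i then 1 else 0) + (if c = j then kq k j * ?F $ d $ i else 0)" for c d
      unfolding 4(2) tensor_rep.simps vector_add_component kron_nth dF fst_conv snd_conv
      by (simp add: transpose_def K_kq[OF 4(1)] mat_def)
    have B: "tensor_rep M (dual_rep M) X $ (x, y) $ (c, d) =
        ?F $ x $ c * (if d = y then 1 else 0) + (if c = x then - (inverse (kq k x) * (kq k d * ?F $ d $ y)) else 0)" for c d
      unfolding 4(2) tensor_rep.simps vector_add_component kron_nth dF fst_conv snd_conv Ki_kq[OF 4(1)] mat_def
      by (simp add: eq_commute[of c] eq_commute[of d])
    have C: "tensor_rep M M X $ (c, d) $ (i, y) = ?F $ c $ i * (if d = y then 1 else 0) + (if c = i then inverse (kq k i) * ?F $ d $ y else 0)" for c d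
      unfolding 4(2) tensor_rep.simps vector_add_component kron_nth fst_conv snd_conv Ki_kq[OF 4(1)] mat_def by simp
    have D: "tensor_rep M M X $ (j, x) $ (c, d) = ?F $ j $ c * (if d = x then 1 else 0) + (if c = j then inverse (kq k j) * ?F $ x $ d else 0)" for c d
      unfolding 4(2) tensor_rep.simps vector_add_component kron_nth fst_conv snd_conv Ki_kq[OF 4(1)] mat_def
      by (simp add: eq_commute[of c] eq_commute[of d])
    have "(\<Sum>c\<in>UNIV. \<Sum>d\<in>UNIV. Rm $ (j, x) $ (c, d) * tensor_rep M M X $ (c, d) $ (i, y)) =
        (\<Sum>c\<in>UNIV. \<Sum>d\<in>UNIV. tensor_rep M M X $ (j, x) $ (c, d) * Rm $ (c, d) $ (i, y))"
      unfolding matrix_mult_sum2[symmetric] Rm_intertwines[OF assms] ..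
    then have "(\<Sum>c\<in>UNIV. Rm $ (j, x) $ (c, y) * ?F $ c $ i * 1) + (\<Sum>d\<in>UNIV. Rm $ (j, x) $ (i, d) * (inverse (kq k i) * ?F $ d $ y)) =
        (\<Sum>c\<in>UNIV. ?F $ j $ c * 1 * Rm $ (c, x) $ (i, y)) + (\<Sum>d\<in>UNIV. inverse (kq k j) * ?F $ x $ d * Rm $ (j, d) $ (i, y))" (is "?a + ?b = ?c + ?d")
      unfolding C D sum_collapse sum_collapse' .
    then have "kq k j * (?a + ?b) = kq k j * (?c + ?d)"
      by (simp only:)
    moreover have "kq k j * (Rm $ (j, x) $ (i, d) * (inverse (kq k i) * ?F $ d $ y)) = inverse (kq k x) * (kq k d * ?F $ d $ y) * Rm $ (j, x) $ (i, d)" for d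
      using Rm_kq[of j x i d k] by (simp add: field_simps)
    moreover have "kq k j * (inverse (kq k j) * ?F $ x $ d * Rm $ (j, d) $ (i, y)) = ?F $ x $ d * Rm $ (j, d) $ (i, y)" for d
      by simp
    ultimately have "(\<Sum>c\<in>UNIV. kq k j * (Rm $ (j, x) $ (c, y) * ?F $ c $ i * 1)) + (\<Sum>d\<in>UNIV. inverse (kq k x) * (kq k d * ?F $ d $ y) * Rm $ (j, x) $ (i, d)) =
       (\<Sum>c\<in>UNIV. kq k j * (?F $ j $ c * 1 * Rm $ (c, x) $ (i, y))) + (\<Sum>d\<in>UNIV. ?F $ x $ d * Rm $ (j, d) $ (i, y))"
      by (simp only: distrib_left sum_distrib_left)
    then show ?thesis
      unfolding matrix_mult_sum2 A B Ym_nth sum_collapse[of "\<lambda>c d. Rm $ (c, x) $ (d, y)"] sum_collapse'[where G = "\<lambda>c d. Rm $ (j, c) $ (i, d)"]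
      by (simp add: sum_negf algebra_simps)
  qed
  then show ?thesis
    unfolding vec_eq_iff by auto
qed

lemma Xm_intertwines:
  assumes "X \<in> uq_gens r"
  shows "Xm ** tensor_rep M (dual_rep M) X = tensor_rep (dual_rep M) M X ** Xm"
proof -
  have "Xm ** (Ym ** tensor_rep (dual_rep M) M X) ** Xm = Xm ** (tensor_rep M (dual_rep M) X ** Ym) ** Xm"
    by (simp only: Ym_intertwines[OF assms])
  then have "(Xm ** Ym) ** tensor_rep (dual_rep M) M X ** Xm = Xm ** tensor_rep M (dual_rep M) X ** (Ym ** Xm)"
    by (simp only: matrix_mul_assoc)
  then show ?thesis
    by (simp add: Xm_Ym Ym_Xm)
qed

lemma kq_qpow: "kq k i = qpow q (if k = pos i + 1 then 1 else if k = pos i then -1 else 0)"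
  using q by (auto simp: kq_def qpow_def qc_def powr_minus)

lemma weight_vector_axis: "weight_vector q r M (wtpos b r (pos i)) (axis i 1)"
  unfolding weight_vector_def
proof (intro conjI ballI)
  show "axis i 1 \<noteq> (0 :: complex^'n)"
    by (simp add: axis_eq_0_iff)
  fix l assume l: "l \<in> {1..r}"
  have k: "dir b r l \<in> {1..r}" by (rule dir_mem[OF l])
  have "(M (gK (dir b r (dir b r l))) *v axis i 1) $ j = (kq (dir b r l) i *C axis i 1) $ j" for j
    unfolding matvec_axis by (simp add: K_kq[OF k] scaleC_vec_def scaleC_complex_def axis_if)
  then show "M (gK l) *v axis i 1 = qpow q (wform r (simple_root l) (wtpos b r (pos i))) *C axis i 1"
    using wform_wtpos[OF k pos_le, of b i] unfolding vec_eq_iff dir_dir[OF l] by (simp add: kq_qpow)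
qed

lemma highest_axis: "pos i = 0 \<Longrightarrow> highest_weight_vector q r M (wtpos b r 0) (axis i 1)"
  unfolding highest_weight_vector_def
proof (intro conjI ballI)
  assume i: "pos i = 0"
  then show "weight_vector q r M (wtpos b r 0) (axis i 1)"
    using weight_vector_axis[of i] by simp
  fix l assume l: "l \<in> {1..r}"
  have k: "dir b r l \<in> {1..r}" by (rule dir_mem[OF l])
  have "(M (gE (dir b r (dir b r l))) *v axis i 1) $ j = 0" for j
    unfolding matvec_axis using k i by (simp add: E[OF k])
  then show "M (gE l) *v axis i 1 = 0"
    unfolding vec_eq_iff dir_dir[OF l] by simp
qed

lemma lowest_axis: "pos i = r \<Longrightarrow> lowest_weight_vector q r M (wtpos b r r) (axis i 1)"
  unfolding lowest_weight_vector_def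
proof (intro conjI ballI)
  assume i: "pos i = r"
  then show "weight_vector q r M (wtpos b r r) (axis i 1)"
    using weight_vector_axis[of i] by simp
  fix l assume l: "l \<in> {1..r}"
  have k: "dir b r l \<in> {1..r}" by (rule dir_mem[OF l])
  have "(M (gF (dir b r (dir b r l))) *v axis i 1) $ j = 0" for j
    unfolding matvec_axis using k i by (simp add: F[OF k])
  then show "M (gF l) *v axis i 1 = 0"
    unfolding vec_eq_iff dir_dir[OF l] by simp
qed

lemma weight_vector_wtpos:
  assumes "weight_vector q r M \<mu> x" "x $ i \<noteq> 0" "(\<Sum>k=1..r+1. \<mu> k) = 0" "k \<in> {1..r+1}"
  shows "\<mu> k = wtpos b r (pos i) k"
proof (rule wtpos_eqI[OF assms(3) pos_le _ assms(4)])
  fix k assume k: "k \<in> {1..r}"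
  have "M (gK (dir b r k)) *v x = qpow q (wform r (simple_root (dir b r k)) \<mu>) *C x"
    using assms(1) dir_mem[OF k] unfolding weight_vector_def by blast
  then have "(M (gK (dir b r k)) *v x) $ i = qpow q (wform r (simple_root (dir b r k)) \<mu>) * x $ i"
    by (simp add: scaleC_vec_def scaleC_complex_def)
  moreover have "(M (gK (dir b r k)) *v x) $ i = kq k i * x $ i"
    unfolding matrix_vector_mult_def by (simp add: K_kq[OF k] if_distrib[of "\<lambda>y. y * _"] cong: if_cong)
  ultimately have "qpow q (wform r (simple_root (dir b r k)) \<mu>) = kq k i"
    using assms(2) by simp
  then have "q powr (wform r (simple_root (dir b r k)) \<mu>) = q powr (if k = pos i + 1 then 1 else if k = pos i then -1 else 0)"
    unfolding kq_qpow qpow_def of_real_eq_iff .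
  then show "wform r (simple_root (dir b r k)) \<mu> = (if k = pos i + 1 then 1 else if k = pos i then -1 else 0)"
    using q by (subst (asm) powr_inj) auto
qed

lemma highest_support:
  assumes "highest_weight_vector q r M \<mu> x" "pos i0 = 0"
  shows "x = x $ i0 *C axis i0 1"
proof -
  have "x $ j = 0" if "pos j \<noteq> 0" for j
  proof -
    have k: "pos j \<in> {1..r}" using that pos_le[of j] by auto
    obtain i where i: "pos i = pos j - 1" using pos_surj[of "pos j - 1"] pos_le[of j] by fastforce
    have "(M (gE (dir b r (pos j))) *v x) $ i = 0"
      using assms(1) dir_mem[OF k] unfolding highest_weight_vector_def by simp
    moreover have "(M (gE (dir b r (pos j))) *v x) $ i = eE (pos j) * x $ j"
      unfolding matrix_vector_mult_def using i k
      by (simp add: E[OF k] pos_inj if_distrib[of "\<lambda>y. y * _"] cong: if_cong)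
    ultimately show ?thesis using eE[OF k] by simp
  qed
  moreover have "pos j \<noteq> 0" if "j \<noteq> i0" for j
    using that assms(2) pos_inj by metis
  ultimately show ?thesis
    by (simp add: vec_eq_iff scaleC_vec_def scaleC_complex_def axis_if)
qed

lemma lowest_support:
  assumes "lowest_weight_vector q r M \<mu> x" "pos i0 = r"
  shows "x = x $ i0 *C axis i0 1"
proof -
  have "x $ j = 0" if "pos j \<noteq> r" for j
  proof -
    have k: "Suc (pos j) \<in> {1..r}" using that pos_le[of j] by auto
    obtain i where i: "pos i = Suc (pos j)" using pos_surj[of "Suc (pos j)"] k by auto
    have "(M (gF (dir b r (Suc (pos j)))) *v x) $ i = 0"
      using assms(1) dir_mem[OF k] unfolding lowest_weight_vector_def by simp
    moreover have "(M (gF (dir b r (Suc (pos j)))) *v x) $ i = eF (Suc (pos j)) * x $ j"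
      unfolding matrix_vector_mult_def using i
      by (simp add: F[OF k] pos_inj if_distrib[of "\<lambda>y. y * _"] cong: if_cong)
    ultimately show ?thesis using eF[OF k] by simp
  qed
  moreover have "pos j \<noteq> r" if "j \<noteq> i0" for j
    using that assms(2) pos_inj by metis
  ultimately show ?thesis
    by (simp add: vec_eq_iff scaleC_vec_def scaleC_complex_def axis_if)
qed

end

lemma matrix_diff_mult: "(A - B) ** (C :: complex^'a^'b) = A ** C - B ** C"
  by (simp add: vec_eq_iff matrix_matrix_mult_def left_diff_distrib sum_subtractf)

lemma mult_matrix_diff: "(C :: complex^'a^'b) ** (A - B) = C ** A - C ** B"
  by (simp add: vec_eq_iff matrix_matrix_mult_def right_diff_distrib sum_subtractf)

lemma tens_vec_axis: "tens_vec (axis i 1) (axis j 1) = axis (i, j) 1"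
  by (auto simp: vec_eq_iff tens_vec_def axis_if)

lemma tens_vec_scale: "tens_vec (c *C x) (d *C y) = (c * d) *C tens_vec x y"
  by (simp add: vec_eq_iff tens_vec_def scaleC_vec_def scaleC_complex_def)

lemma matrix_scaleC_vec: "(A :: complex^'a^'b) *v (c *C x) = c *C (A *v x)"
  by (simp add: vec_eq_iff matrix_vector_mult_def scaleC_vec_def scaleC_complex_def sum_distrib_left mult_ac)

lemma scaleC_matrix_vec: "(c *C A :: complex^'a^'b) *v x = c *C (A *v x)"
  by (simp add: vec_eq_iff matrix_vector_mult_def scaleC_vec_def scaleC_complex_def sum_distrib_left mult_ac)

lemma scaleC_matrix_mult: "(c *C A :: complex^'a^'b) ** B = c *C (A ** B)" "A ** (c *C B) = c *C (A ** B)"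
  by (simp_all add: vec_eq_iff matrix_matrix_mult_def scaleC_vec_def scaleC_complex_def sum_distrib_left mult_ac)

text \<open>The tensor product of a highest and a lowest weight vector generates the tensor product, so an
  intertwiner is determined by its value there.\<close>

lemma intertwiner_zero:
  fixes D :: "complex^('a::finite \<times> 'b::finite)^('b \<times> 'a)"
  assumes M: "chain_module q r b pos M eE eF" and M': "chain_module q r b' pos' M' eE' eF'"
    and D: "\<And>X. X \<in> uq_gens r \<Longrightarrow> D ** tensor_rep M M' X = tensor_rep M' M X ** D"
    and i0: "pos i0 = 0" and w0: "pos' w0 = r" and zero: "D *v axis (i0, w0) 1 = 0"
  shows "D = 0"
proof -
  interpret M: chain_module q r b pos M eE eF by fact
  interpret M': chain_module q r b' pos' M' eE' eF' by fact
  have gens: "k \<in> {1..r} \<Longrightarrow> gE k \<in> uq_gens r" "k \<in> {1..r} \<Longrightarrow> gF k \<in> uq_gens r" for k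
    by (auto simp: uq_gens_def)
  have col: "(\<Sum>c\<in>UNIV. \<Sum>d\<in>UNIV. D $ p $ (c, d) * tensor_rep M M' X $ (c, d) $ (i, w)) = 0"
    if "X \<in> uq_gens r" "\<And>s. D $ s $ (i, w) = 0" for X i w p
    using D[OF that(1)] that(2) unfolding matrix_mult_sum2[symmetric] by (simp add: matrix_matrix_mult_def)
  \<comment> \<open>E kills the highest weight vector in the first factor, so on such tensors it
    acts in the second factor only and climbs from the lowest weight vector through the whole
    chain.\<close>
  have A: "D $ p $ (i0, w) = 0" if "pos' w = r - n" "n \<le> r" for n w p
    using that
  proof (induction n arbitrary: w p)
    case 0
    then have "w = w0" using w0 M'.pos_inj[of w w0] by simp
    then show ?case
      using arg_cong[OF zero, of "\<lambda>x. x $ p"] by (simp only: matvec_axis) simp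
  next
    case (Suc n)
    define k where "k = r - n"
    have k: "k \<in> {1..r}" using Suc.prems by (auto simp: k_def)
    obtain u where u: "pos' u = k" using M'.pos_surj[of k] by (auto simp: k_def)
    have z: "M (gE (dir b' r k)) $ c $ i0 = 0" for c
    proof -
      have m: "dir b r (dir b' r k) \<in> {1..r}" by (intro dir_mem k)
      show ?thesis
        using M.E[OF m, of c i0] m i0 by (simp add: dir_dir[OF dir_mem[OF k]])
    qed
    have w: "pos' d = pos' w \<longleftrightarrow> d = w" "Suc (pos' d) = k \<longleftrightarrow> d = w" for d
      using Suc.prems M'.pos_inj[of d w] by (auto simp: k_def)
    have e: "tensor_rep M M' (gE (dir b' r k)) $ (c, d) $ (i0, u) = 0 * (if d = u then 1 else 0) + (if c = i0 then if d = w then eE' k else 0 else 0)" for c d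
      unfolding tensor_rep.simps vector_add_component kron_nth fst_conv snd_conv z M'.E[OF k] w(2) mat_def by (simp add: u)
    have s: "D $ s $ (i0, u) = 0" for s
      by (rule Suc.IH) (use u Suc.prems in \<open>simp_all add: k_def\<close>)
    have "D $ p $ (i0, w) * eE' k = 0"
      using col[OF gens(1)[OF dir_mem[OF k, of b']] s, of p]
      unfolding e sum_collapse[of "\<lambda>c d. D $ p $ (c, d)" "\<lambda>c. 0" u 1 i0 "\<lambda>d. if d = w then eE' k else 0"]
      by (simp add: if_distrib[of "\<lambda>y. _ * y"] cong: if_cong)
    then show ?case
      using M'.eE[OF k] by simp
  qed
  have A': "D $ p $ (i0, w) = 0" for p w
    by (rule A[of _ "r - pos' w"]) (use M'.pos_le[of w] in auto)
  \<comment> \<open>F lowers the first factor by one step. The other term of its coproduct leaves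
    the first factor in place and is covered by the induction hypothesis, which holds for every
    vector in the second factor.\<close>
  have B: "D $ p $ (i, w) = 0" if "pos i = n" for n i w p
    using that
  proof (induction n arbitrary: i w p)
    case 0
    then have "i = i0" using i0 M.pos_inj[of i i0] by simp
    then show ?case using A' by simp
  next
    case (Suc n)
    define k where "k = Suc n"
    have k: "k \<in> {1..r}" using Suc.prems M.pos_le[of i] by (auto simp: k_def)
    obtain u where u: "pos u = n" using M.pos_surj[of n] k by (auto simp: k_def)
    have i: "pos c = k \<longleftrightarrow> c = i" for c
      using Suc.prems M.pos_inj[of c i] by (auto simp: k_def)
    have m: "dir b r k \<in> {1..r}" by (rule dir_mem[OF k])
    have e: "tensor_rep M M' (gF (dir b r k)) $ (c, d) $ (u, w) = (if c = i then eF k else 0) * (if d = w then 1 else 0) + (if c = u then inverse (M.kq k u) * M' (gF (dir b r k)) $ d $ w else 0)" for c d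
      unfolding tensor_rep.simps vector_add_component kron_nth fst_conv snd_conv M.F[OF k] M.Ki_kq[OF k] i mat_def
      by (simp add: u k_def)
    have s: "D $ s $ (u, w) = 0" for s w
      by (rule Suc.IH[OF u])
    have "D $ p $ (i, w) * eF k = 0"
      using col[OF gens(2)[OF m] s, of p w]
      unfolding e sum_collapse[of "\<lambda>c d. D $ p $ (c, d)" "\<lambda>c. if c = i then eF k else 0" w 1 u
          "\<lambda>d. inverse (M.kq k u) * M' (gF (dir b r k)) $ d $ w"]
      by (simp add: s if_distrib[of "\<lambda>y. _ * y"] if_distrib[of "\<lambda>y. y * _"] cong: if_cong)
    then show ?case
      using M.eF[OF k] by simp
  qed
  show ?thesis
    using B by (simp add: vec_eq_iff)
qed

definition braid_cond :: "real \<Rightarrow> nat \<Rightarrow> 'a::finite uq_rep \<Rightarrow> 'b::finite uq_rep \<Rightarrow> complex^('a \<times> 'b)^('b \<times> 'a) \<Rightarrow> bool" where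
  "braid_cond q r M N R \<longleftrightarrow>
     (\<forall>X\<in>uq_gens r. R ** tensor_rep M N X = tensor_rep N M X ** R) \<and>
     (\<forall>\<mu>\<in>weight_lattice r. \<forall>\<nu>\<in>weight_lattice r. \<forall>x y.
        highest_weight_vector q r M \<mu> x \<and> lowest_weight_vector q r N (longest_weyl r \<nu>) y \<longrightarrow>
        R *v tens_vec x y = qpow q (wform r \<mu> (longest_weyl r \<nu>)) *C tens_vec y x)"

lemma braiding_braid_cond: "braiding q r M N = (THE R. braid_cond q r M N R)"
  unfolding braiding_def braid_cond_def ..

locale chain_pair = M: chain_module q r b pos M eE eF + M': chain_module q r b' pos' M' eE' eF'
  for q r b and pos :: "'a::finite \<Rightarrow> nat" and M eE eF and b' and pos' :: "'b::finite \<Rightarrow> nat" and M' eE' eF' +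
  fixes i0 w0
  assumes i0: "pos i0 = 0" and w0: "pos' w0 = r"
begin

text \<open>The condition in the definition of the braiding ranges over all weights and vectors.
  Highest and lowest weight vectors are unique up to scalars and their weights are determined on the
  coordinates that the form uses, so a single value decides the condition.\<close>

lemma braid_value:
  assumes R: "R *v axis (i0, w0) 1 = qpow q (wform r (wtpos b r 0) (wtpos b' r r)) *C axis (w0, i0) 1"
    and \<mu>: "\<mu> \<in> weight_lattice r" and \<nu>: "\<nu> \<in> weight_lattice r"
    and hx: "highest_weight_vector q r M \<mu> x" and ly: "lowest_weight_vector q r M' (longest_weyl r \<nu>) y"
  shows "R *v tens_vec x y = qpow q (wform r \<mu> (longest_weyl r \<nu>)) *C tens_vec y x"
proof -
  define c where "c = x $ i0"
  define d where "d = y $ w0"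
  have x: "x = c *C axis i0 1" and y: "y = d *C axis w0 1"
    unfolding c_def d_def using M.highest_support[OF hx i0] M'.lowest_support[OF ly w0] .
  have wv: "weight_vector q r M \<mu> x" "weight_vector q r M' (longest_weyl r \<nu>) y"
    using hx ly unfolding highest_weight_vector_def lowest_weight_vector_def by blast+
  have z: "0 *C w = 0" for w :: "complex^'c"
    by simp
  have nz: "x $ i0 \<noteq> 0" "y $ w0 \<noteq> 0"
    using wv x y z unfolding weight_vector_def c_def[symmetric] d_def[symmetric] by metis+
  have "\<mu> k = wtpos b r 0 k" if "k \<in> {1..r+1}" for k
    using M.weight_vector_wtpos[OF wv(1) nz(1) lattice_sum[OF \<mu>] that] i0 by simp
  moreover have "longest_weyl r \<nu> k = wtpos b' r r k" if "k \<in> {1..r+1}" for k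
    using M'.weight_vector_wtpos[OF wv(2) nz(2) _ that] w0 lattice_sum[OF \<nu>] by (simp only: longest_weyl_sum)
  ultimately have w: "wform r \<mu> (longest_weyl r \<nu>) = wform r (wtpos b r 0) (wtpos b' r r)"
    by (rule wform_cong)
  show ?thesis
    unfolding x y w tens_vec_scale tens_vec_axis matrix_scaleC_vec R scaleC_scaleC by (simp add: mult_ac)
qed

lemma wtpos_lattice: "wtpos c r 0 \<in> weight_lattice r"
  using fund_weight_lattice[of 1 r] fund_weight_lattice[of r r] M.r fund_weight_wtpos[OF M.r] by (cases c) simp_all

lemma braid_cond_value:
  assumes "braid_cond q r M M' R"
  shows "R *v axis (i0, w0) 1 = qpow q (wform r (wtpos b r 0) (wtpos b' r r)) *C axis (w0, i0) 1"
proof -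
  have l: "longest_weyl r (wtpos b' r 0) = wtpos b' r r"
    using longest_weyl_wtpos[of 0 r b'] by simp
  have "R *v tens_vec (axis i0 1) (axis w0 1) =
      qpow q (wform r (wtpos b r 0) (longest_weyl r (wtpos b' r 0))) *C tens_vec (axis w0 1) (axis i0 1)"
    using assms wtpos_lattice M.highest_axis[OF i0] M'.lowest_axis[OF w0] unfolding braid_cond_def l[symmetric] by blast
  then show ?thesis
    unfolding l tens_vec_axis .
qed

lemma braiding_eq:
  assumes R: "\<And>X. X \<in> uq_gens r \<Longrightarrow> R ** tensor_rep M M' X = tensor_rep M' M X ** R"
    and val: "R *v axis (i0, w0) 1 = qpow q (wform r (wtpos b r 0) (wtpos b' r r)) *C axis (w0, i0) 1"
  shows "braiding q r M M' = R"
  unfolding braiding_braid_cond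
proof (rule the_equality)
  show "braid_cond q r M M' R"
    unfolding braid_cond_def using R braid_value[OF val] by blast
next
  fix R' assume R': "braid_cond q r M M' R'"
  have "R' *v axis (i0, w0) 1 = R *v axis (i0, w0) 1"
    unfolding braid_cond_value[OF R'] val ..
  then have z: "(R' - R) *v axis (i0, w0) 1 = 0"
    by (simp add: matrix_vector_mult_diff_rdistrib)
  have "R' - R = 0"
  proof (rule intertwiner_zero[OF M.chain_module_axioms M'.chain_module_axioms])
    show "pos i0 = 0" "pos' w0 = r" "(R' - R) *v axis (i0, w0) 1 = 0" by (fact i0 w0 z)+
    fix X assume X: "X \<in> uq_gens r"
    have "R' ** tensor_rep M M' X = tensor_rep M' M X ** R'"
      using R' X unfolding braid_cond_def by blast
    then show "(R' - R) ** tensor_rep M M' X = tensor_rep M' M X ** (R' - R)"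
      by (simp only: matrix_diff_mult mult_matrix_diff R[OF X])
  qed
  then show "R' = R" by simp
qed

end

context chain_module
begin

text \<open>\<open>Rm\<close> flips the extreme vectors with coefficient 1, so the scalar is q to
  the power (\<lambda>, w_0 \<lambda>) = -1/N with N = r + 1.\<close>

lemma braiding_M_M: "braiding q r M M = qpow q (- 1 / real (r + 1)) *C Rm"
proof -
  obtain i0 where i0: "pos i0 = 0" using pos_surj[of 0] by auto
  obtain w0 where w0: "pos w0 = r" using pos_surj[of r] by auto
  interpret P: chain_pair q r b pos M eE eF b pos M eE eF i0 w0
    by unfold_locales (fact i0 w0)+
  show ?thesis
  proof (rule P.braiding_eq)
    fix X assume "X \<in> uq_gens r"
    then show "(qpow q (- 1 / real (r + 1)) *C Rm) ** tensor_rep M M X = tensor_rep M M X ** (qpow q (- 1 / real (r + 1)) *C Rm)"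
      by (simp only: scaleC_matrix_mult Rm_intertwines)
  next
    have n: "i0 \<noteq> w0" using i0 w0 r by auto
    have "(Rm *v axis (i0, w0) 1) $ (x, y) = axis (w0, i0) 1 $ (x, y)" for x y
    proof (cases "x = w0 \<and> y = i0")
      case True
      then show ?thesis
        unfolding matvec_axis using n i0 w0 by (simp add: Rm_nth kap_def axis_if)
    next
      case False
      then have n1: "\<not> (i0 = y \<and> w0 = x)" and n3: "(x, y) \<noteq> (w0, i0)" by blast+
      have n2: "\<not> (i0 = x \<and> w0 = y \<and> pos y < pos x)"
        using i0 w0 by auto
      show ?thesis
        unfolding matvec_axis Rm_nth axis_if if_not_P[OF n1] if_not_P[OF n2] if_not_P[OF n3] by simp
    qed
    then have "Rm *v axis (i0, w0) 1 = axis (w0, i0) 1"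
      unfolding vec_eq_iff by auto
    moreover have "wform r (wtpos b r 0) (wtpos b r r) = - 1 / real (r + 1)"
      using wform_wtpos_wtpos(1)[of 0 r r b] r by simp
    ultimately show "(qpow q (- 1 / real (r + 1)) *C Rm) *v axis (i0, w0) 1 = qpow q (wform r (wtpos b r 0) (wtpos b r r)) *C axis (w0, i0) 1"
      by (simp only: scaleC_matrix_vec)
  qed
qed

lemma braiding_dual_dual: "braiding q r (dual_rep M) (dual_rep M) = qpow q (- 1 / real (r + 1)) *C Rs"
  using chain_module.braiding_M_M[OF dual_chain] by (simp only: dual_Rm)

text \<open>The highest weight vector of V and the lowest one of its dual carry the same index.
  There \<open>Xm\<close> has the entry 1/q, while the prescribed exponent is 1/N - 1, which leaves
  q^(1/N).\<close>

lemma braiding_M_dual: "braiding q r M (dual_rep M) = qpow q (1 / real (r + 1)) *C Xm"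
proof -
  obtain i0 where i0: "pos i0 = 0" using pos_surj[of 0] by auto
  then have w0: "r - pos i0 = r" by simp
  interpret P: chain_pair q r b pos M eE eF "\<not> b" "\<lambda>i. r - pos i" "dual_rep M"
      "\<lambda>k. - qc * eE (r + 1 - k)" "\<lambda>k. - inverse qc * eF (r + 1 - k)" i0 i0
    using chain_module_axioms dual_chain i0 w0 by (intro chain_pair.intro chain_pair_axioms.intro)
  show ?thesis
  proof (rule P.braiding_eq)
    fix X assume "X \<in> uq_gens r"
    then show "(qpow q (1 / real (r + 1)) *C Xm) ** tensor_rep M (dual_rep M) X = tensor_rep (dual_rep M) M X ** (qpow q (1 / real (r + 1)) *C Xm)"
      by (simp only: scaleC_matrix_mult Xm_intertwines)
  next
    have "(Xm *v axis (i0, i0) 1) $ (x, y) = (inverse qc *C axis (i0, i0) 1) $ (x, y)" for x y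
    proof (cases "x = i0 \<and> y = i0")
      case True
      then show ?thesis
        unfolding matvec_axis by (simp add: Xm_nth Ri_nth kap_def axis_if scaleC_vec_def scaleC_complex_def)
    next
      case False
      then have n1: "\<not> (x = i0 \<and> i0 = y)" and n3: "(x, y) \<noteq> (i0, i0)" by blast+
      have n2: "\<not> (x = y \<and> i0 = i0 \<and> pos y < pos i0)" using i0 by simp
      show ?thesis
        unfolding matvec_axis Xm_nth Ri_nth scaleC_vec_def scaleC_complex_def vec_lambda_beta axis_if
          if_not_P[OF n1] if_not_P[OF n2] if_not_P[OF n3] by simp
    qed
    then have "Xm *v axis (i0, i0) 1 = inverse qc *C axis (i0, i0) 1"
      unfolding vec_eq_iff by auto
    moreover have "wform r (wtpos b r 0) (wtpos (\<not> b) r r) = 1 / real (r + 1) - 1"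
      using wform_wtpos_wtpos(2)[of 0 r r b] by simp
    moreover have "qpow q (1 / real (r + 1)) * inverse qc = qpow q (1 / real (r + 1) - 1)"
      using q by (simp add: qpow_def qc_def powr_diff divide_inverse)
    ultimately show "(qpow q (1 / real (r + 1)) *C Xm) *v axis (i0, i0) 1 = qpow q (wform r (wtpos b r 0) (wtpos (\<not> b) r r)) *C axis (i0, i0) 1"
      by (simp only: scaleC_matrix_vec scaleC_scaleC)
  qed
qed

end

section \<open>The structure of the fundamental module\<close>

lemma cartan_dir:
  assumes "k \<in> {1..r}" "l \<in> {1..r}"
  shows "wform r (simple_root (dir b r k)) (simple_root (dir b r l)) =
    (if k = l then 2 else 0) - (if k = Suc l then 1 else 0) - (if l = Suc k then 1 else 0)"
proof -
  have *: "wform r (simple_root k) (simple_root l) =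
    (if k = l then 2 else 0) - (if k = Suc l then 1 else 0) - (if l = Suc k then 1 else 0)"
    if "k \<in> {1..r}" "l \<in> {1..r}" for k l
    unfolding wform_simple_root[OF that(1)] by (auto simp: simple_root_def pos_root_def)
  have e: "dir b r k = dir b r l \<longleftrightarrow> k = l"
    by (rule dir_eq_iff[OF assms])
  have e': "dir b r k = Suc (dir b r l) \<longleftrightarrow> (if b then l = Suc k else k = Suc l)"
    "dir b r l = Suc (dir b r k) \<longleftrightarrow> (if b then k = Suc l else l = Suc k)"
    using assms unfolding dir_def atLeastAtMost_iff by (cases b; simp only: if_True if_False; arith)+
  show ?thesis
    unfolding *[OF dir_mem[OF assms(1)] dir_mem[OF assms(2)]] e e'
    by (cases b; simp only: if_True if_False)
qed

text \<open>Generated from \<open>y\<close> by the operators F alone. If \<open>y\<close> is a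
  weight vector killed by all E, this is already a submodule, because E passes F at the cost of
  terms in K and its inverse.\<close>

inductive_set f_span :: "real \<Rightarrow> nat \<Rightarrow> 'n::finite uq_rep \<Rightarrow> complex^'n \<Rightarrow> (complex^'n) set" for q r V y where
  zero: "0 \<in> f_span q r V y"
| base: "y \<in> f_span q r V y"
| add: "x \<in> f_span q r V y \<Longrightarrow> x' \<in> f_span q r V y \<Longrightarrow> x + x' \<in> f_span q r V y"
| scale: "x \<in> f_span q r V y \<Longrightarrow> c *C x \<in> f_span q r V y"
| F: "x \<in> f_span q r V y \<Longrightarrow> l \<in> {1..r} \<Longrightarrow> V (gF l) *v x \<in> f_span q r V y"

lemma matvec_add: "(A :: complex^'a^'b) *v (x + y) = A *v x + A *v y"
  by (simp add: matrix_vector_right_distrib)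

lemma matvec_zero: "(A :: complex^'a^'b) *v 0 = 0"
  by (simp add: vec_eq_iff matrix_vector_mult_def)

lemma vec_scaleC_nth: "(c *C x) $ i = c * ((x :: complex^'n) $ i)"
  by (simp add: scaleC_vec_def scaleC_complex_def)

context quantum_fundamental_module
begin

abbreviation "VE k \<equiv> V (gE k)"
abbreviation "VF k \<equiv> V (gF k)"
abbreviation "VK k \<equiv> V (gK k)"
abbreviation "VKi k \<equiv> V (gKinv k)"

definition hs :: complex where "hs = inverse (qpow q 1 - qpow q (- 1))"

lemma mod_rels:
  assumes "i \<in> {1..r}" "j \<in> {1..r}"
  shows "VK i ** VKi i = mat 1" "VKi i ** VK i = mat 1"
    "VK i ** VF j ** VKi i = qpow q (- wform r (simple_root i) (simple_root j)) *C VF j"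
    "VE i ** VF j - VF j ** VE i = (if i = j then hs *C (VK i - VKi i) else 0)"
proof -
  have "uq_module q r V"
    using V unfolding simple_highest_weight_module_def by blast
  from this[unfolded uq_module_def Let_def, rule_format, OF assms]
  show "VK i ** VKi i = mat 1" "VKi i ** VK i = mat 1"
    "VK i ** VF j ** VKi i = qpow q (- wform r (simple_root i) (simple_root j)) *C VF j"
    "VE i ** VF j - VF j ** VE i = (if i = j then hs *C (VK i - VKi i) else 0)"
    unfolding hs_def by blast+
qed

lemma qpow_nz [simp]: "qpow q x \<noteq> 0"
  using q by (simp add: qpow_def)

lemma qpow_add: "qpow q (x + y) = qpow q x * qpow q y"
  using q by (simp add: qpow_def powr_add)

lemma qpow_inj: "qpow q x = qpow q y \<longleftrightarrow> x = y"
  using q by (simp add: qpow_def powr_inj)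

lemma Ki_K: "i \<in> {1..r} \<Longrightarrow> VKi i *v (VK i *v x) = x" and K_Ki: "i \<in> {1..r} \<Longrightarrow> VK i *v (VKi i *v x) = x"
  using mod_rels(1,2)[of i i] by (simp_all add: matrix_vector_mul_assoc)

lemma K_F:
  assumes "i \<in> {1..r}" "j \<in> {1..r}"
  shows "VK i *v (VF j *v x) = qpow q (- wform r (simple_root i) (simple_root j)) *C (VF j *v (VK i *v x))"
proof -
  have "(VK i ** VF j ** VKi i) *v (VK i *v x) = (qpow q (- wform r (simple_root i) (simple_root j)) *C VF j) *v (VK i *v x)"
    by (simp only: mod_rels(3)[OF assms])
  then show ?thesis
    by (simp add: matrix_vector_mul_assoc[symmetric] Ki_K[OF assms(1)] scaleC_matrix_vec)
qed

lemma Ki_F: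
  assumes "i \<in> {1..r}" "j \<in> {1..r}"
  shows "VKi i *v (VF j *v x) = qpow q (wform r (simple_root i) (simple_root j)) *C (VF j *v (VKi i *v x))"
proof -
  let ?a = "wform r (simple_root i) (simple_root j)"
  have "VK i *v (VF j *v (VKi i *v x)) = qpow q (- ?a) *C (VF j *v x)"
    using K_F[OF assms, of "VKi i *v x"] by (simp add: K_Ki[OF assms(1)])
  then have "VKi i *v (VK i *v (VF j *v (VKi i *v x))) = qpow q (- ?a) *C (VKi i *v (VF j *v x))"
    by (simp add: matrix_scaleC_vec)
  then have "qpow q ?a *C (VF j *v (VKi i *v x)) = (qpow q ?a * qpow q (- ?a)) *C (VKi i *v (VF j *v x))"
    by (simp add: Ki_K[OF assms(1)] scaleC_scaleC)
  then show ?thesis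
    using q by (simp add: qpow_add[symmetric] scaleC_one) (simp add: qpow_def scaleC_one)
qed

lemma E_F:
  assumes "i \<in> {1..r}" "j \<in> {1..r}"
  shows "VE i *v (VF j *v x) = VF j *v (VE i *v x) + (if i = j then hs *C (VK i *v x - VKi i *v x) else 0)"
proof -
  have "(VE i ** VF j - VF j ** VE i) *v x = (if i = j then hs *C (VK i - VKi i) else 0) *v x"
    by (simp only: mod_rels(4)[OF assms])
  then show ?thesis
    by (cases "i = j") (simp_all add: matrix_vector_mult_diff_rdistrib matrix_vector_mul_assoc[symmetric] scaleC_matrix_vec algebra_simps)
qed

lemma f_span_closed:
  assumes E: "\<And>l. l \<in> {1..r} \<Longrightarrow> VE l *v y = 0"
    and K: "\<And>l. l \<in> {1..r} \<Longrightarrow> VK l *v y = qpow q (c l) *C y"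
    and "x \<in> f_span q r V y" "l \<in> {1..r}"
  shows "VK l *v x \<in> f_span q r V y \<and> VKi l *v x \<in> f_span q r V y \<and> VE l *v x \<in> f_span q r V y"
  using assms(3,4)
proof (induction arbitrary: l)
  case zero
  then show ?case by (simp add: matvec_zero f_span.zero)
next
  case base
  have "VKi l *v (VK l *v y) = qpow q (c l) *C (VKi l *v y)"
    using K[OF base] by (simp add: matrix_scaleC_vec)
  then have "inverse (qpow q (c l)) *C y = inverse (qpow q (c l)) *C qpow q (c l) *C (VKi l *v y)"
    unfolding Ki_K[OF base] by (rule arg_cong)
  then have "VKi l *v y = inverse (qpow q (c l)) *C y"
    by (simp add: scaleC_scaleC scaleC_one)
  then show ?case
    using K[OF base] E[OF base] by (simp add: f_span.zero f_span.base f_span.scale)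
next
  case (add x x')
  then show ?case by (simp add: matvec_add f_span.add)
next
  case (scale x c)
  then show ?case by (simp add: matrix_scaleC_vec f_span.scale)
next
  case (F x m)
  have d: "VK l *v x - VKi l *v x = VK l *v x + (-1) *C (VKi l *v x)"
    by (simp add: scaleC_minus_left scaleC_one)
  have "VF m *v (VE l *v x) + hs *C (VK l *v x - VKi l *v x) \<in> f_span q r V y"
    unfolding d using F by (intro f_span.intros) simp_all
  then show ?case
    using F unfolding K_F[OF F.prems F.hyps(2)] Ki_F[OF F.prems F.hyps(2)] E_F[OF F.prems F.hyps(2)]
    by (auto intro!: f_span.intros)
qed

definition kap_wt :: "nat \<Rightarrow> 'n \<Rightarrow> complex" where
  "kap_wt l i = qpow q (wform r (simple_root l) (wt i))"

lemma VK_nth: "l \<in> {1..r} \<Longrightarrow> VK l $ j $ i = (if j = i then kap_wt l i else 0)"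
proof -
  assume l: "l \<in> {1..r}"
  have "VK l *v axis i 1 = kap_wt l i *C axis i 1"
    using wt[of i] l unfolding weight_vector_def kap_wt_def by blast
  then have "(VK l *v axis i 1) $ j = (kap_wt l i *C axis i 1) $ j"
    by simp
  then show ?thesis
    by (simp only: matvec_axis vec_scaleC_nth axis_if) simp
qed

lemma VK_vec: "l \<in> {1..r} \<Longrightarrow> (VK l *v x) $ i = kap_wt l i * x $ i"
proof -
  assume l: "l \<in> {1..r}"
  have "(VK l *v x) $ i = (\<Sum>j\<in>UNIV. if i = j then kap_wt l j * x $ j else 0)"
    unfolding matrix_vector_mult_def vec_lambda_beta VK_nth[OF l] by (rule sum.cong) auto
  then show ?thesis by simp
qed

text \<open>A grading by height: each F lowers the pairing with 2\<rho> by 2 (\<open>VF_ht\<close>),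
  so it separates the levels of the chain.\<close>

definition ht :: "'n \<Rightarrow> real" where "ht i = wform r (two_rho r) (wt i)"

lemma two_rho_simple: "l \<in> {1..r} \<Longrightarrow> wform r (two_rho r) (simple_root l) = 2"
proof -
  assume l: "l \<in> {1..r}"
  have "wform r (two_rho r) (simple_root l) = wform r (simple_root l) (two_rho r)"
    by (simp add: wform_def mult.commute)
  also have "\<dots> = two_rho r l - two_rho r (l + 1)"
    by (rule wform_simple_root[OF l])
  also have "\<dots> = 2"
    using l by (subst (1 2) two_rho_eq) auto
  finally show ?thesis .
qed

lemma VF_ht: "l \<in> {1..r} \<Longrightarrow> VF l $ i $ j \<noteq> 0 \<Longrightarrow> ht i = ht j - 2"
proof -
  assume l: "l \<in> {1..r}" and nz: "VF l $ i $ j \<noteq> 0"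
  have "wform r (simple_root k) (wt i) = wform r (simple_root k) (wt j) - wform r (simple_root k) (simple_root l)" if k: "k \<in> {1..r}" for k
  proof -
    have a: "VK k *v axis j 1 = kap_wt k j *C axis j 1"
      using wt[of j] k unfolding weight_vector_def kap_wt_def by blast
    have "(VK k *v (VF l *v axis j 1)) $ i = (qpow q (- wform r (simple_root k) (simple_root l)) *C (VF l *v (VK k *v axis j 1))) $ i"
      by (simp only: K_F[OF k l])
    then have "kap_wt k i * VF l $ i $ j = qpow q (- wform r (simple_root k) (simple_root l)) * (kap_wt k j * VF l $ i $ j)"
      unfolding a matrix_scaleC_vec VK_vec[OF k] vec_scaleC_nth matvec_axis .
    then have "kap_wt k i = qpow q (- wform r (simple_root k) (simple_root l)) * kap_wt k j"
      using nz by simp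
    then show ?thesis
      unfolding kap_wt_def qpow_add[symmetric] qpow_inj by simp
  qed
  then have "ht i = (\<Sum>k=1..r. real k * (real r + 1 - real k) * (wform r (simple_root k) (wt j) - wform r (simple_root k) (simple_root l)))"
    unfolding ht_def by (subst wform_two_rho) (intro sum.cong refl, simp)
  also have "\<dots> = ht j - wform r (two_rho r) (simple_root l)"
    unfolding ht_def wform_two_rho by (simp only: right_diff_distrib sum_subtractf)
  finally show ?thesis
    using two_rho_simple[OF l] by simp
qed

lemma VF_support:
  assumes "l \<in> {1..r}" "\<And>i. x $ i \<noteq> 0 \<Longrightarrow> P (ht i - 2)" "(VF l *v x) $ i \<noteq> 0"
  shows "P (ht i)"
proof -
  have "\<exists>j. VF l $ i $ j * x $ j \<noteq> 0"
  proof (rule ccontr)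
    assume "\<not> ?thesis"
    then have "(VF l *v x) $ i = 0"
      unfolding matrix_vector_mult_def vec_lambda_beta by (intro sum.neutral) auto
    with assms(3) show False by simp
  qed
  then obtain j where "VF l $ i $ j \<noteq> 0" "x $ j \<noteq> 0" by auto
  then show ?thesis
    using VF_ht[OF assms(1)] assms(2) by simp
qed

definition dirb :: bool where "dirb = (s \<noteq> 1)"

lemma omega_eq: "fund_weight r s = wtpos dirb r 0"
  unfolding dirb_def using s fund_weight_wtpos[OF rank] by (cases "s = 1") auto

lemma hw_ex: "\<exists>x. highest_weight_vector q r V (fund_weight r s) x"
  using V unfolding simple_highest_weight_module_def by blast

definition x0 :: "complex^'n" where "x0 = (SOME x. highest_weight_vector q r V (fund_weight r s) x)"

lemma x0: "highest_weight_vector q r V (fund_weight r s) x0"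
  unfolding x0_def by (rule someI_ex[OF hw_ex])

lemma x0_nz: "x0 \<noteq> 0"
  and x0_E: "l \<in> {1..r} \<Longrightarrow> VE l *v x0 = 0"
  and x0_K: "l \<in> {1..r} \<Longrightarrow> VK l *v x0 = qpow q (wform r (simple_root l) (fund_weight r s)) *C x0"
  using x0 unfolding highest_weight_vector_def weight_vector_def by blast+

lemma x0_ht: "x0 $ i \<noteq> 0 \<Longrightarrow> ht i = real r"
proof -
  assume nz: "x0 $ i \<noteq> 0"
  have "wform r (simple_root l) (wt i) = wform r (simple_root l) (wtpos dirb r 0)" if l: "l \<in> {1..r}" for l
  proof -
    have "(VK l *v x0) $ i = (qpow q (wform r (simple_root l) (fund_weight r s)) *C x0) $ i"
      by (simp only: x0_K[OF l])
    then show ?thesis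
      using nz unfolding VK_vec[OF l] vec_scaleC_nth kap_wt_def omega_eq by (simp add: qpow_inj)
  qed
  then have "ht i = wform r (two_rho r) (wtpos dirb r 0)"
    unfolding ht_def wform_two_rho by (intro sum.cong refl) simp
  also have "\<dots> = real r"
    using wform_two_rho_wtpos[of 0 r dirb "wtpos dirb r 0"] wform_wtpos[of _ r 0 dirb] by simp
  finally show ?thesis .
qed

lemma simple_V: "complex_subspace W \<Longrightarrow> (\<And>X x. X \<in> uq_gens r \<Longrightarrow> x \<in> W \<Longrightarrow> V X *v x \<in> W) \<Longrightarrow> W = {0} \<or> W = UNIV"
  using V unfolding simple_highest_weight_module_def simple_module_def by blast

lemma gens_E: "X \<in> uq_gens r \<longleftrightarrow> (\<exists>l\<in>{1..r}. X = gK l \<or> X = gKinv l \<or> X = gE l \<or> X = gF l)"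
  unfolding uq_gens_def by blast

text \<open>A nonzero singular vector would generate V by the operators F alone. These only lower
  the height, so the highest weight vector, of height r, could not be reached.\<close>

lemma singular_zero:
  assumes E: "\<And>l. l \<in> {1..r} \<Longrightarrow> VE l *v y = 0"
    and K: "\<And>l. l \<in> {1..r} \<Longrightarrow> VK l *v y = qpow q (c l) *C y"
    and h: "\<And>i. y $ i \<noteq> 0 \<Longrightarrow> ht i < real r"
  shows "y = 0"
proof -
  have sub: "complex_subspace (f_span q r V y)"
    unfolding complex_subspace_def by (auto intro: f_span.intros)
  have "f_span q r V y = {0} \<or> f_span q r V y = UNIV"
  proof (rule simple_V[OF sub])
    fix X x assume "X \<in> uq_gens r" "x \<in> f_span q r V y"
    then show "V X *v x \<in> f_span q r V y"
      using f_span_closed[OF E K] f_span.F unfolding gens_E by blast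
  qed
  moreover have "f_span q r V y \<noteq> UNIV"
  proof
    assume *: "f_span q r V y = UNIV"
    have "ht i < real r" if "x \<in> f_span q r V y" "x $ i \<noteq> 0" for x i
      using that
    proof (induction arbitrary: i)
      case (F x l)
      show ?case
        by (rule VF_support[OF F.hyps(2) _ F.prems, where P = "\<lambda>z. z < real r"]) (use F.IH in fastforce)
    next
      case (add x x')
      then show ?case by (cases "x $ i = 0") auto
    qed (use h in \<open>auto simp: vec_scaleC_nth\<close>)
    then have "x0 $ i = 0" for i
      using x0_ht[of i] * by fastforce
    then show False
      using x0_nz by (simp add: vec_eq_iff)
  qed
  ultimately show ?thesis
    using f_span.base[of y q r V] by auto
qed

fun xs :: "nat \<Rightarrow> complex^'n" where
  "xs 0 = x0"
| "xs (Suc j) = VF (dir dirb r (Suc j)) *v xs j"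

lemma hs_1: "hs *C ((qpow q 1 *C x) - (qpow q (-1) *C x)) = (x :: complex^'n)"
  "hs *C ((qpow q (-1) *C x) - (qpow q 1 *C x)) = - (x :: complex^'n)"
proof -
  have "qpow q 1 \<noteq> qpow q (-1)"
    unfolding qpow_inj by simp
  then have h: "hs * (qpow q 1 - qpow q (-1)) = 1"
    by (simp add: hs_def)
  have "hs *C ((qpow q 1 *C x) - (qpow q (-1) *C x)) = (hs * (qpow q 1 - qpow q (-1))) *C x" for x :: "complex^'n"
    by (simp only: scaleC_scaleC[symmetric] scaleC_diff_left)
  then show 1: "hs *C ((qpow q 1 *C x) - (qpow q (-1) *C x)) = x" for x :: "complex^'n"
    by (simp add: h scaleC_one)
  show "hs *C ((qpow q (-1) *C x) - (qpow q 1 *C x)) = - x"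
    using arg_cong[OF 1[of x], of uminus] by (simp add: scaleC_diff_right)
qed

definition kexp :: "nat \<Rightarrow> nat \<Rightarrow> real" where
  "kexp k j = (if k = Suc j then 1 else 0) - (if k = j then 1 else 0)"

lemma Ki_of_K: "l \<in> {1..r} \<Longrightarrow> VK l *v x = qpow q a *C x \<Longrightarrow> VKi l *v x = qpow q (- a) *C x"
proof -
  assume l: "l \<in> {1..r}" and "VK l *v x = qpow q a *C x"
  then have "VKi l *v (VK l *v x) = qpow q a *C (VKi l *v x)"
    by (simp add: matrix_scaleC_vec)
  then have "qpow q (- a) *C x = qpow q (- a) *C qpow q a *C (VKi l *v x)"
    unfolding Ki_K[OF l] by (rule arg_cong)
  also have "\<dots> = VKi l *v x"
    using q by (simp add: scaleC_scaleC qpow_add[symmetric]) (simp add: qpow_def scaleC_one)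
  finally show ?thesis by simp
qed

text \<open>The four statements need each other at smaller \<open>j\<close>. The action of K and E
  follows from the commutation rules. Each F_k with k different from j + 1 sends \<open>xs j\<close>
  to a singular vector of height below r, which is zero by \<open>singular_zero\<close>; this
  confines V to a single chain.\<close>

lemma xs_props:
  "j \<le> r \<Longrightarrow> (\<forall>k\<in>{1..r}. VK (dir dirb r k) *v xs j = qpow q (kexp k j) *C xs j) \<and>
     (\<forall>k\<in>{1..r}. VE (dir dirb r k) *v xs j = (if k = j then xs (j - 1) else 0)) \<and>
     (\<forall>k\<in>{1..r}. k \<noteq> Suc j \<longrightarrow> VF (dir dirb r k) *v xs j = 0) \<and>
     (\<forall>i. xs j $ i \<noteq> 0 \<longrightarrow> ht i = real r - 2 * real j)"
proof (induction j rule: less_induct)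
  case (less j)
  let ?d = "dir dirb r"
  have d: "?d k \<in> {1..r}" if "k \<in> {1..r}" for k by (rule dir_mem[OF that])
  have A: "VK (?d k) *v xs j = qpow q (kexp k j) *C xs j" if k: "k \<in> {1..r}" for k
  proof (cases j)
    case 0
    have "wform r (simple_root (?d k)) (fund_weight r s) = kexp k 0"
      unfolding omega_eq using wform_wtpos[OF k, of 0 dirb] k by (auto simp: kexp_def)
    then show ?thesis
      using x0_K[OF d[OF k]] by (simp add: 0)
  next
    case (Suc m)
    have m: "Suc m \<in> {1..r}" using Suc less.prems by auto
    have IH: "VK (?d k) *v xs m = qpow q (kexp k m) *C xs m"
      using less.IH[of m] Suc less.prems k by simp
    have e: "- wform r (simple_root (?d k)) (simple_root (?d (Suc m))) + kexp k m = kexp k j"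
      unfolding cartan_dir[OF k m] kexp_def using Suc by auto
    show ?thesis
      unfolding Suc xs.simps K_F[OF d[OF k] d[OF m]] IH matrix_scaleC_vec scaleC_scaleC qpow_add[symmetric] e[unfolded Suc] ..
  qed
  have Ki: "VKi (?d k) *v xs j = qpow q (- kexp k j) *C xs j" if k: "k \<in> {1..r}" for k
    by (rule Ki_of_K[OF d[OF k] A[OF k]])
  have B: "VE (?d k) *v xs j = (if k = j then xs (j - 1) else 0)" if k: "k \<in> {1..r}" for k
  proof (cases j)
    case 0
    then show ?thesis using x0_E[OF d[OF k]] k by simp
  next
    case (Suc m)
    have m: "Suc m \<in> {1..r}" using Suc less.prems by auto
    have IH: "VK (?d k) *v xs m = qpow q (kexp k m) *C xs m" "VE (?d k) *v xs m = (if k = m then xs (m - 1) else 0)"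
      using less.IH[of m] Suc less.prems k by auto
    have z: "VF (?d (Suc m)) *v xs (m - 1) = 0" if "k = m"
      using less.IH[of "m - 1"] Suc less.prems m k that by auto
    have z': "VF (?d (Suc m)) *v (VE (?d k) *v xs m) = 0"
      unfolding IH(2) using z by (simp add: matvec_zero)
    have "hs *C (VK (?d k) *v xs m - VKi (?d k) *v xs m) = xs m" if "k = Suc m"
      unfolding IH(1) Ki_of_K[OF d[OF k] IH(1)] using that hs_1(1) by (simp add: kexp_def)
    then show ?thesis
      unfolding Suc xs.simps E_F[OF d[OF k] d[OF m]] z' dir_eq_iff[OF k m] by auto
  qed
  have D: "ht i = real r - 2 * real j" if "xs j $ i \<noteq> 0" for i
  proof (cases j)
    case 0
    then show ?thesis using x0_ht[of i] that by simp
  next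
    case (Suc m)
    have m: "Suc m \<in> {1..r}" using Suc less.prems by auto
    show ?thesis
    proof (rule VF_support[OF d[OF m]])
      show "(VF (?d (Suc m)) *v xs m) $ i \<noteq> 0"
        using that by (simp add: Suc)
      fix i' assume "xs m $ i' \<noteq> 0"
      then show "ht i' - 2 = real r - 2 * real j"
        using less.IH[of m] Suc less.prems by auto
    qed
  qed
  have C: "VF (?d k) *v xs j = 0" if k: "k \<in> {1..r}" "k \<noteq> Suc j" for k
  proof (rule singular_zero)
    fix l0 assume l0: "l0 \<in> {1..r}"
    define l where "l = ?d l0"
    have l: "l \<in> {1..r}" "l0 = ?d l" unfolding l_def using d[OF l0] dir_dir[OF l0] by simp_all
    \<comment> \<open>In the case k = l = j this term is \<open>xs j\<close>, and it cancels the
      commutator of E and F, which equals - \<open>xs j\<close> because K has eigenvalue 1/q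
      there.\<close>
    have 1: "VF (?d k) *v (VE (?d l) *v xs j) = (if l = j \<and> k = j then xs j else 0)"
    proof (cases "l = j")
      case True
      then obtain m where m: "j = Suc m" using l by (cases j) auto
      have "VF (?d k) *v xs m = (if k = j then xs j else 0)"
        using less.IH[of m] m less.prems k by auto
      then show ?thesis
        unfolding B[OF l(1)] using m True by simp
    next
      case False
      then show ?thesis
        unfolding B[OF l(1)] by (simp add: matvec_zero)
    qed
    have 2: "hs *C (VK (?d l) *v xs j - VKi (?d l) *v xs j) = (if k = j then - xs j else 0)" if "l = k"
      unfolding A[OF l(1)] Ki[OF l(1)] using that k hs_1(2)[of "xs j"] by (auto simp: kexp_def)
    show "VE l0 *v (VF (?d k) *v xs j) = 0"
      unfolding l(2) E_F[OF d[OF l(1)] d[OF k(1)]] 1 dir_eq_iff[OF l(1) k(1)] using 2 by auto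
  next
    fix l0 assume l0: "l0 \<in> {1..r}"
    have l: "?d l0 \<in> {1..r}" "?d (?d l0) = l0" using d[OF l0] dir_dir[OF l0] by simp_all
    show "VK l0 *v (VF (?d k) *v xs j) = qpow q (- wform r (simple_root l0) (simple_root (?d k)) + kexp (?d l0) j) *C (VF (?d k) *v xs j)"
      unfolding K_F[OF l0 d[OF k(1)]] A[OF l(1), unfolded l(2)] matrix_scaleC_vec scaleC_scaleC qpow_add ..
  next
    fix i assume nz: "(VF (?d k) *v xs j) $ i \<noteq> 0"
    have "ht i - 2 < real r" if "xs j $ i \<noteq> 0" for i
      using D[OF that] by simp
    then have "ht i' - 2 < real r" if "xs j $ i' \<noteq> 0" for i'
      using that by blast
    then show "ht i < real r"
      by (rule VF_support[OF d[OF k(1)] _ nz, where P = "\<lambda>z. z < real r"])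
  qed
  show ?case
    by (intro conjI ballI allI impI; (rule A B C D; assumption))
qed

lemma xs_K: "j \<le> r \<Longrightarrow> k \<in> {1..r} \<Longrightarrow> VK (dir dirb r k) *v xs j = qpow q (kexp k j) *C xs j"
  and xs_E: "j \<le> r \<Longrightarrow> k \<in> {1..r} \<Longrightarrow> VE (dir dirb r k) *v xs j = (if k = j then xs (j - 1) else 0)"
  and xs_F: "j \<le> r \<Longrightarrow> k \<in> {1..r} \<Longrightarrow> k \<noteq> Suc j \<Longrightarrow> VF (dir dirb r k) *v xs j = 0"
  and xs_ht: "j \<le> r \<Longrightarrow> xs j $ i \<noteq> 0 \<Longrightarrow> ht i = real r - 2 * real j"
  using xs_props by blast+

lemma xs_nz: "j \<le> r \<Longrightarrow> xs j \<noteq> 0"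
proof (induction j)
  case 0
  then show ?case using x0_nz by simp
next
  case (Suc j)
  have "VE (dir dirb r (Suc j)) *v xs (Suc j) = xs j"
    using xs_E[OF Suc.prems, of "Suc j"] Suc.prems by simp
  then show ?case
    using Suc matvec_zero[of "VE (dir dirb r (Suc j))"] by (metis Suc_leD)
qed

lemma matvec_sum: "(A :: complex^'a^'b) *v (\<Sum>j\<in>I. x j) = (\<Sum>j\<in>I. A *v x j)"
  by (induction I rule: infinite_finite_induct) (simp_all add: matvec_zero matvec_add)

text \<open>The rules in \<open>xs_props\<close> make the span of the chain stable under all
  generators, so simplicity of V applies.\<close>

lemma xs_span: "\<exists>c. x = (\<Sum>j\<le>r. c j *C xs j)"
proof -
  define W where "W = {x. \<exists>c. x = (\<Sum>j\<le>r. c j *C xs j)}"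
  have mem: "a *C xs j \<in> W" if "j \<le> r" for a j
  proof -
    have "a *C xs j = (\<Sum>i\<le>r. (if i = j then a else 0) *C xs i)"
      using that by (simp add: scaleC_if)
    then show ?thesis unfolding W_def by (intro CollectI exI[of _ "\<lambda>i. if i = j then a else 0"])
  qed
  have zero: "0 \<in> W"
    using mem[of 0 0] by simp
  have add: "x + y \<in> W" if "x \<in> W" "y \<in> W" for x y
  proof -
    obtain c c' where "x = (\<Sum>j\<le>r. c j *C xs j)" "y = (\<Sum>j\<le>r. c' j *C xs j)"
      using \<open>x \<in> W\<close> \<open>y \<in> W\<close> unfolding W_def by blast
    then have "x + y = (\<Sum>j\<le>r. (c j + c' j) *C xs j)"
      by (simp add: scaleC_add_left sum.distrib)
    then show ?thesis
      unfolding W_def by (intro CollectI exI[of _ "\<lambda>j. c j + c' j"])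
  qed
  have scale: "a *C x \<in> W" if x: "x \<in> W" for a x
  proof -
    obtain c where "x = (\<Sum>j\<le>r. c j *C xs j)"
      using x unfolding W_def by blast
    then have "a *C x = (\<Sum>j\<le>r. (a * c j) *C xs j)"
      by (simp add: scaleC_sum_right scaleC_scaleC)
    then show ?thesis
      unfolding W_def by (intro CollectI exI[of _ "\<lambda>j. a * c j"])
  qed
  have sum: "(\<Sum>j\<in>I. g j) \<in> W" if "\<And>j. j \<in> I \<Longrightarrow> g j \<in> W" for g :: "nat \<Rightarrow> complex^'n" and I
    using that by (induction I rule: infinite_finite_induct) (auto simp: zero add)
  have "W = {0} \<or> W = UNIV"
  proof (rule simple_V)
    show "complex_subspace W"
      unfolding complex_subspace_def using zero add scale by blast
    fix X x assume X: "X \<in> uq_gens r" and "x \<in> W"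
    then obtain c where x: "x = (\<Sum>j\<le>r. c j *C xs j)"
      unfolding W_def by blast
    have "V X *v xs j \<in> W" if j: "j \<le> r" for j
    proof -
      obtain l where l: "l \<in> {1..r}" and X': "X = gK l \<or> X = gKinv l \<or> X = gE l \<or> X = gF l"
        using X unfolding gens_E by blast
      define k where "k = dir dirb r l"
      have k: "k \<in> {1..r}" "l = dir dirb r k"
        unfolding k_def using dir_mem[OF l] dir_dir[OF l] by simp_all
      have "VK l *v xs j \<in> W"
        unfolding k(2) xs_K[OF j k(1)] by (rule mem[OF j])
      moreover have "VKi l *v xs j \<in> W"
        using Ki_of_K[OF l xs_K[OF j k(1), folded k(2)]] mem[OF j] by simp
      moreover have "VE l *v xs j \<in> W"
        unfolding k(2) xs_E[OF j k(1)] using mem[of "j - 1" 1] j zero by (simp add: scaleC_one)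
      moreover have "VF l *v xs j \<in> W"
      proof (cases "k = Suc j")
        case True
        then have "VF l *v xs j = 1 *C xs (Suc j)"
          by (simp add: k(2) scaleC_one)
        then show ?thesis using mem[of "Suc j" 1] True k(1) by simp
      next
        case False
        show ?thesis unfolding k(2) xs_F[OF j k(1) False] by (rule zero)
      qed
      ultimately show ?thesis using X' by blast
    qed
    then show "V X *v x \<in> W"
      unfolding x matvec_sum matrix_scaleC_vec by (intro sum scale) simp
  qed
  moreover have "W \<noteq> {0}"
    using mem[of 0 1] xs_nz[of 0] by (auto simp: scaleC_one)
  ultimately show ?thesis
    unfolding W_def by blast
qed

text \<open>The weight basis is arbitrary. The \<open>xs j\<close> have pairwise different heights,
  so comparing coordinates of one height in the expansion of a basis vector shows that some
  \<open>xs j\<close> is a multiple of it.\<close>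

lemma pos_ex: "\<exists>j. j \<le> r \<and> ht i = real r - 2 * real j \<and> (\<exists>d. d \<noteq> 0 \<and> xs j = d *C axis i 1)"
proof -
  obtain c where c: "axis i 1 = (\<Sum>j\<le>r. c j *C xs j)"
    using xs_span by blast
  have comp: "axis i 1 $ i' = c j * xs j $ i'" if "j \<le> r" "ht i' = real r - 2 * real j" for i' j
  proof -
    have "axis i 1 $ i' = (\<Sum>l\<le>r. c l * xs l $ i')"
      unfolding c by (simp add: vec_scaleC_nth)
    also have "\<dots> = (\<Sum>l\<le>r. if l = j then c j * xs j $ i' else 0)"
    proof (intro sum.cong refl)
      fix l assume "l \<in> {..r}"
      then have "l \<noteq> j \<Longrightarrow> xs l $ i' = 0"
        using xs_ht[of l i'] that by auto
      then show "c l * xs l $ i' = (if l = j then c j * xs j $ i' else 0)"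
        by simp
    qed
    finally show ?thesis using that by simp
  qed
  have "\<exists>j\<le>r. xs j $ i \<noteq> 0"
  proof (rule ccontr)
    assume "\<not> ?thesis"
    with arg_cong[OF c, of "\<lambda>u. u $ i"] show False
      by (simp add: vec_scaleC_nth)
  qed
  then obtain j where j: "j \<le> r" "xs j $ i \<noteq> 0" by blast
  then have h: "ht i = real r - 2 * real j" by (simp add: xs_ht)
  have 1: "c j * xs j $ i = 1"
    using comp[OF j(1) h] by (simp add: axis_if)
  have "xs j $ i' = (xs j $ i *C axis i 1) $ i'" for i'
  proof (cases "i' = i")
    case False
    show ?thesis
    proof (rule ccontr)
      assume n: "xs j $ i' \<noteq> (xs j $ i *C axis i 1) $ i'"
      then have nz: "xs j $ i' \<noteq> 0"
        using False by (simp add: vec_scaleC_nth axis_if)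
      have "c j * xs j $ i' = 0"
        using comp[OF j(1) xs_ht[OF j(1) nz]] False by (simp add: axis_if)
      then show False using nz 1 by auto
    qed
  qed (simp add: vec_scaleC_nth axis_if)
  then have "xs j = xs j $ i *C axis i 1"
    unfolding vec_eq_iff by blast
  then show ?thesis
    using j h by blast
qed

definition pos :: "'n \<Rightarrow> nat" where
  "pos i = (SOME j. j \<le> r \<and> ht i = real r - 2 * real j \<and> (\<exists>d. d \<noteq> 0 \<and> xs j = d *C axis i 1))"

lemma pos_props: "pos i \<le> r" "ht i = real r - 2 * real (pos i)" "\<exists>d. d \<noteq> 0 \<and> xs (pos i) = d *C axis i 1"
  using someI_ex[OF pos_ex[of i]] unfolding pos_def by blast+

lemma xs_pos: "j \<le> r \<Longrightarrow> \<exists>d. \<forall>i. pos i = j \<longrightarrow> d \<noteq> 0 \<and> xs j = d *C axis i 1"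
proof -
  assume j: "j \<le> r"
  show ?thesis
  proof (cases "\<exists>i. pos i = j")
    case True
    then obtain i where i: "pos i = j" by blast
    then obtain d where d: "d \<noteq> 0" "xs j = d *C axis i 1" using pos_props(3)[of i] by blast
    have "i' = i" if "pos i' = j" for i'
    proof -
      have "\<exists>d. d \<noteq> 0 \<and> xs j = d *C axis i' 1" using pos_props(3)[of i'] unfolding \<open>pos i' = j\<close> .
      then obtain d' where d': "d' \<noteq> 0" "xs j = d' *C axis i' 1" by (elim exE conjE)
      have "(d *C axis i 1 :: complex^'n) $ i' = (d' *C axis i' 1 :: complex^'n) $ i'" using d d' by simp
      then show ?thesis using d' by (simp add: vec_scaleC_nth axis_if split: if_splits)
    qed
    then show ?thesis using d by blast
  qed blast
qed

definition dcoef :: "nat \<Rightarrow> complex" where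
  "dcoef j = (SOME d. \<forall>i. pos i = j \<longrightarrow> d \<noteq> 0 \<and> xs j = d *C axis i 1)"

lemma dcoef: "dcoef (pos i) \<noteq> 0" "xs (pos i) = dcoef (pos i) *C axis i 1"
  using someI_ex[OF xs_pos[OF pos_props(1)[of i]]] unfolding dcoef_def by blast+

lemma pos_bij: "bij_betw pos UNIV {..<r+1}"
proof (rule bij_betw_imageI)
  show "inj pos"
  proof
    fix i i' assume "pos i = pos i'"
    then have "dcoef (pos i) *C axis i 1 = (dcoef (pos i) *C axis i' 1 :: complex^'n)"
      using dcoef(2)[of i] dcoef(2)[of i'] by simp
    then have "(dcoef (pos i) *C axis i 1 :: complex^'n) $ i = (dcoef (pos i) *C axis i' 1 :: complex^'n) $ i"
      by simp
    then show "i = i'" using dcoef(1)[of i] by (simp add: vec_scaleC_nth axis_if split: if_splits)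
  qed
  show "range pos = {..<r+1}"
  proof (intro equalityI subsetI)
    fix j assume "j \<in> {..<r+1}"
    then have j: "j \<le> r" by simp
    then obtain i where "xs j $ i \<noteq> 0" using xs_nz[OF j] by (auto simp: vec_eq_iff)
    then have "ht i = real r - 2 * real j" by (rule xs_ht[OF j])
    then have "pos i = j" using pos_props(2)[of i] by simp
    then show "j \<in> range pos" by blast
  next
    fix j assume "j \<in> range pos"
    then obtain i where "j = pos i" by blast
    then show "j \<in> {..<r+1}" using pos_props(1)[of i] by simp
  qed
qed

lemma axis_xs: "axis i 1 = inverse (dcoef (pos i)) *C xs (pos i)"
  using dcoef(1)[of i] by (simp add: dcoef(2) scaleC_scaleC scaleC_one)

lemma pos_eq_iff: "pos i = pos j \<longleftrightarrow> i = j"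
  using bij_betw_imp_inj_on[OF pos_bij] by (blast dest: injD)

lemma dcoef_nz: "j \<le> r \<Longrightarrow> dcoef j \<noteq> 0"
proof -
  assume "j \<le> r"
  then have "j \<in> range pos" using pos_bij unfolding bij_betw_def by auto
  then show ?thesis using dcoef(1) by blast
qed

text \<open>The vectors \<open>xs j\<close> are the basis vectors rescaled by \<open>dcoef\<close>,
  whence the quotients: the weight basis comes without normalisation, so the entries of E and F can
  only be asserted to be nonzero.\<close>

lemma chain_V: "chain_module q r dirb pos V (\<lambda>k. dcoef (k - 1) / dcoef k) (\<lambda>k. dcoef k / dcoef (k - 1))"
proof
  show "0 < q" "q < 1" "1 \<le> r" "bij_betw pos UNIV {..<r+1}"
    by (fact q rank pos_bij)+
next
  fix k i j assume k: "k \<in> {1..r}"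
  note d = dir_mem[OF k, of dirb]
  have kw: "kap_wt (dir dirb r k) j = qpow q (kexp k (pos j))" for j
  proof -
    have "(VK (dir dirb r k) *v xs (pos j)) $ j = (qpow q (kexp k (pos j)) *C xs (pos j)) $ j"
      by (simp only: xs_K[OF pos_props(1) k])
    then show ?thesis
      unfolding VK_vec[OF d] vec_scaleC_nth using dcoef(1)[of j] by (simp add: dcoef(2)[of j] vec_scaleC_nth axis_if)
  qed
  have qq: "qpow q (kexp k (pos j)) = (if Suc (pos j) = k then complex_of_real q else if pos j = k then inverse (complex_of_real q) else 1)" for j
    using q by (auto simp: kexp_def qpow_def powr_minus)
  show "VK (dir dirb r k) $ i $ j = (if i = j then if Suc (pos i) = k then complex_of_real q else if pos i = k then inverse (complex_of_real q) else 1 else 0)"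
    unfolding VK_nth[OF d] kw qq by simp
  have "VKi (dir dirb r k) *v axis j 1 = qpow q (- kexp k (pos j)) *C axis j 1"
    unfolding axis_xs[of j] matrix_scaleC_vec Ki_of_K[OF d xs_K[OF pos_props(1) k]] by (rule scaleC_left_commute)
  then have "(VKi (dir dirb r k) *v axis j 1) $ i = (qpow q (- kexp k (pos j)) *C axis j 1) $ i"
    by simp
  moreover have "qpow q (- kexp k (pos j)) = (if Suc (pos j) = k then inverse (complex_of_real q) else if pos j = k then complex_of_real q else 1)"
    using q by (auto simp: kexp_def qpow_def powr_minus)
  ultimately show "VKi (dir dirb r k) $ i $ j = (if i = j then if Suc (pos i) = k then inverse (complex_of_real q) else if pos i = k then complex_of_real q else 1 else 0)"
    unfolding matvec_axis vec_scaleC_nth axis_if by simp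
  have "VE (dir dirb r k) *v axis j 1 = inverse (dcoef (pos j)) *C (if k = pos j then xs (pos j - 1) else 0)"
    unfolding axis_xs[of j] matrix_scaleC_vec xs_E[OF pos_props(1) k] ..
  then have E: "VE (dir dirb r k) $ i $ j = (inverse (dcoef (pos j)) *C (if k = pos j then xs (pos j - 1) else 0)) $ i"
    unfolding matvec_axis[symmetric] by (rule arg_cong)
  have xsi: "xs m $ i = (if pos i = m then dcoef m else 0)" if "m \<le> r" for m
  proof -
    obtain i' where i': "pos i' = m" using pos_bij \<open>m \<le> r\<close> unfolding bij_betw_def by (metis imageE lessThan_iff less_Suc_eq_le Suc_eq_plus1)
    show ?thesis
      using dcoef(2)[of i'] i' pos_eq_iff[of i i'] by (simp add: vec_scaleC_nth axis_if)
  qed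
  show "VE (dir dirb r k) $ i $ j = (if pos j = k \<and> Suc (pos i) = k then dcoef (k - 1) / dcoef k else 0)"
  proof -
    have "k - 1 \<le> r" "pos i = k - 1 \<longleftrightarrow> Suc (pos i) = k" using k by auto
    then have "xs (k - 1) $ i = (if Suc (pos i) = k then dcoef (k - 1) else 0)"
      using xsi[of "k - 1"] by simp
    then show ?thesis
      unfolding E vec_scaleC_nth by (cases "pos j = k") (simp_all add: divide_inverse)
  qed
  have "VF (dir dirb r k) *v axis j 1 = inverse (dcoef (pos j)) *C (if k = Suc (pos j) then xs (Suc (pos j)) else 0)"
    unfolding axis_xs[of j] matrix_scaleC_vec using xs_F[OF pos_props(1) k] by (cases "k = Suc (pos j)") simp_all
  then have F: "VF (dir dirb r k) $ i $ j = (inverse (dcoef (pos j)) *C (if k = Suc (pos j) then xs (Suc (pos j)) else 0)) $ i"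
    unfolding matvec_axis[symmetric] by (rule arg_cong)
  show "VF (dir dirb r k) $ i $ j = (if pos i = k \<and> Suc (pos j) = k then dcoef k / dcoef (k - 1) else 0)"
    unfolding F vec_scaleC_nth using k xsi[of k] by (cases "Suc (pos j) = k") (auto simp: divide_inverse)
  have "dcoef (k - 1) / dcoef k \<noteq> 0 \<and> dcoef k / dcoef (k - 1) \<noteq> 0"
  proof -
    have "k \<le> r" "k - 1 \<le> r" using k by auto
    then show ?thesis
      using dcoef_nz by simp
  qed
  then show "dcoef (k - 1) / dcoef k \<noteq> 0" "dcoef k / dcoef (k - 1) \<noteq> 0"
    by blast+
qed

sublocale chain: chain_module q r dirb pos V "\<lambda>k. dcoef (k - 1) / dcoef k" "\<lambda>k. dcoef k / dcoef (k - 1)"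
  by (rule chain_V)

lemma wq_wt: "qpow q (wform r (two_rho r) (wt i)) = chain.wq i" "qpow q (- wform r (two_rho r) (wt i)) = inverse (chain.wq i)"
proof -
  have h: "wform r (two_rho r) (wt i) = real_of_int (int (Suc r) - 1 - 2 * int (pos i))"
    using pos_props(2)[of i] by (simp add: ht_def)
  have e: "qpow q (real_of_int z) = chain.qc powi z" for z
  proof -
    have "q powr real_of_int z = q powi z"
      using q by (simp add: powr_real_of_int')
    then show ?thesis
      unfolding qpow_def chain.qc_def by simp
  qed
  show "qpow q (wform r (two_rho r) (wt i)) = chain.wq i"
    by (simp only: h e chain.wq_def)
  show "qpow q (- wform r (two_rho r) (wt i)) = inverse (chain.wq i)"
    by (simp only: h of_int_minus[symmetric] e power_int_minus chain.wq_def)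
qed

end

section \<open>Pairings of the two halves of the calculus\<close>

lemma op_eq_upd:
  "op R k x \<phi> = (\<Sum>a\<in>UNIV. \<Sum>b\<in>UNIV. (R $ (\<phi> k, \<phi> (Suc k)) $ (a, b)) *C x (\<phi>(k := a, Suc k := b)))"
proof (induction k arbitrary: x \<phi>)
  case 0
  have *: "a ## b ## stl (stl \<phi>) = \<phi>(0 := a, Suc 0 := b)" for a b
    by (auto simp: fun_eq_iff split: nat.split)
  show ?case by (simp only: op.simps One_nat_def *)
next
  case (Suc k)
  have *: "\<phi> 0 ## (stl \<phi>)(k := a, Suc k := b) = \<phi>(Suc k := a, Suc (Suc k) := b)" for a b
    by (auto simp: fun_eq_iff split: nat.split)
  show ?case by (simp only: op.simps Suc *)
qed

lemma con_1: "con w (Suc 0) x \<phi> = (\<Sum>a\<in>UNIV. w a *C x (\<phi> 0 ## a ## a ## stl \<phi>))"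
  and con_2: "con w 2 x \<phi> = (\<Sum>a\<in>UNIV. w a *C x (\<phi> 0 ## \<phi> 1 ## a ## a ## stl (stl \<phi>)))"
  by (simp_all add: numeral_2_eq_2 con.simps)

text \<open>Legs that an operator does not touch may be frozen. This allows families in which those
  legs select the linear map applied to the other ones.\<close>

lemma op_param:
  assumes "\<And>\<phi> a b. g (\<phi>(k := a, Suc k := b)) = g \<phi>"
  shows "op R k (\<lambda>\<psi>. X (g \<psi>) \<psi>) = (\<lambda>\<phi>. op R k (X (g \<phi>)) \<phi>)"
  by (rule ext) (simp add: op_eq_upd assms)

text \<open>Linearity on a closed subset instead of a type, because the coefficient families of the
  presentations take their values in the set \<B>.\<close>

definition clinear_on :: "'x::complex_vector set \<Rightarrow> ('x \<Rightarrow> 'y::complex_vector) \<Rightarrow> bool" where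
  "clinear_on S h \<longleftrightarrow> 0 \<in> S \<and> h 0 = 0 \<and> (\<forall>x\<in>S. \<forall>y\<in>S. x + y \<in> S \<and> h (x + y) = h x + h y) \<and>
     (\<forall>c. \<forall>x\<in>S. c *C x \<in> S \<and> h (c *C x) = c *C h x)"

lemma clinear_on_scale: "clinear_on S h \<Longrightarrow> x \<in> S \<Longrightarrow> c *C x \<in> S \<and> h (c *C x) = c *C h x"
  by (simp add: clinear_on_def)

lemma clinear_on_sum:
  assumes "clinear_on S h" "\<And>i. i \<in> I \<Longrightarrow> x i \<in> S"
  shows "sum x I \<in> S \<and> h (sum x I) = (\<Sum>i\<in>I. h (x i))"
  using assms by (induction I rule: infinite_finite_induct) (simp_all add: clinear_on_def)

lemma clinear_on_diff:
  assumes "clinear_on S h" "x \<in> S" "y \<in> S"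
  shows "x - y \<in> S \<and> h (x - y) = h x - h y"
proof -
  have *: "x - y = x + (-1) *C y" "h x - h y = h x + (-1) *C h y"
    by (simp_all add: scaleC_minus_left scaleC_one)
  have "(-1) *C y \<in> S \<and> h ((-1) *C y) = (-1) *C h y"
    by (rule clinear_on_scale[OF assms(1,3)])
  then show ?thesis
    using assms(1,2) unfolding * clinear_on_def by (metis (no_types, lifting))
qed

lemma clinear_on_op:
  assumes "clinear_on S h" "\<And>\<phi>. x \<phi> \<in> S"
  shows "op R k x \<phi> \<in> S" and "h (op R k x \<phi>) = op R k (\<lambda>\<psi>. h (x \<psi>)) \<phi>"
proof -
  let ?g = "\<lambda>a b. (R $ (\<phi> k, \<phi> (Suc k)) $ (a, b)) *C x (\<phi>(k := a, Suc k := b))"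
  have 1: "?g a b \<in> S \<and> h (?g a b) = (R $ (\<phi> k, \<phi> (Suc k)) $ (a, b)) *C h (x (\<phi>(k := a, Suc k := b)))" for a b
    by (rule clinear_on_scale[OF assms(1)]) (rule assms(2))
  have 2: "(\<Sum>b\<in>UNIV. ?g a b) \<in> S \<and> h (\<Sum>b\<in>UNIV. ?g a b) = (\<Sum>b\<in>UNIV. h (?g a b))" for a
    using 1 by (intro clinear_on_sum[OF assms(1)]) blast
  have "(\<Sum>a\<in>UNIV. \<Sum>b\<in>UNIV. ?g a b) \<in> S \<and>
      h (\<Sum>a\<in>UNIV. \<Sum>b\<in>UNIV. ?g a b) = (\<Sum>a\<in>UNIV. h (\<Sum>b\<in>UNIV. ?g a b))"
    using 2 by (intro clinear_on_sum[OF assms(1)]) blast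
  then show "op R k x \<phi> \<in> S" and "h (op R k x \<phi>) = op R k (\<lambda>\<psi>. h (x \<psi>)) \<phi>"
    using 1 2 unfolding op_eq_upd by simp_all
qed

lemma clinear_on_mult_right: "clinear_on UNIV (\<lambda>x. x * (b :: 'a::complex_algebra))"
  by (simp add: clinear_on_def distrib_right mult_scaleC_left)

lemma op_mult_right:
  fixes Y :: "('n::finite, 'a::complex_algebra) fam"
  assumes "\<And>\<phi> a b. g (\<phi>(k := a, Suc k := b)) = g \<phi>"
  shows "op R k (\<lambda>\<psi>. Y \<psi> * g \<psi>) = (\<lambda>\<phi>. op R k Y \<phi> * g \<phi>)"
  by (simp add: op_param[of g k R "\<lambda>b \<psi>. Y \<psi> * b", OF assms] clinear_on_op(2)[OF clinear_on_mult_right])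

context bimod_over
begin

lemma clinear_la: "b \<in> B \<Longrightarrow> clinear_on UNIV (\<lambda>x. b \<rhd> x)"
  by (simp add: clinear_on_def la_zero la_add la_scaleC)

lemma left_linear_clinear: "left_linear B M h \<Longrightarrow> clinear_on UNIV h"
proof -
  assume h: "left_linear B M h"
  have "h (c *C x) = c *C h x" for c x
  proof -
    have "h ((c *C 1) \<rhd> x) = (c *C 1) * h x"
      using h scalar_closed unfolding left_linear_def by blast
    then show ?thesis by (simp add: scalar_la mult_scaleC_left)
  qed
  moreover have "h (0 + 0) = h 0 + h 0"
    using h unfolding left_linear_def by blast
  ultimately show ?thesis
    using h unfolding left_linear_def clinear_on_def by simp
qed

end

context braid_matrices
begin

text \<open>\<open>S\<close> and \<open>S\<close> with a tilde are both of this form, with \<open>B\<close> acting on one side of the middle legs.\<close>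

definition Lop :: "complex^('n \<times> 'n)^('n \<times> 'n) \<Rightarrow> nat \<Rightarrow> nat \<Rightarrow> ('n, 'm::complex_vector) fam \<Rightarrow> ('n, 'm) fam" where
  "Lop B l k x = op Xm (Suc k) (op B (l + k) (op Ym (Suc k) x))"

lemma Sop_Lop: "Sop k = Lop Rm 0 k" and Stop_Lop: "Stop (Suc k) = Lop Rsi 2 k"
  and Top_Lop: "Top k x = Lop Rm 0 k (Lop Rsi 2 k x)"
  by (simp_all add: fun_eq_iff Top_def Sop_def Stop_def Lop_def)

lemma Lop_param:
  assumes "\<And>\<phi> m a. m \<in> {Suc k, Suc (Suc k), l + k, Suc (l + k)} \<Longrightarrow> g (\<phi>(m := a)) = g \<phi>"
  shows "Lop B l k (\<lambda>\<psi>. X (g \<psi>) \<psi>) = (\<lambda>\<phi>. Lop B l k (X (g \<phi>)) \<phi>)"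
proof -
  have g: "g (\<phi>(l + k := a, Suc (l + k) := b)) = g \<phi>" "g (\<phi>(Suc k := a, Suc (Suc k) := b)) = g \<phi>" for \<phi> a b
    by (simp_all add: assms)
  show ?thesis
    unfolding Lop_def
    using op_param[of g "Suc k" Ym X, OF g(2)] op_param[of g "l + k" B "\<lambda>c. op Ym (Suc k) (X c)", OF g(1)]
      op_param[of g "Suc k" Xm "\<lambda>c. op B (l + k) (op Ym (Suc k) (X c))", OF g(2)] by simp
qed

lemma Lop_scons: "Lop B l (Suc k) x (a ## \<psi>) = Lop B l k (\<lambda>\<psi>. x (a ## \<psi>)) \<psi>"
  by (simp add: Lop_def fam_simps)

lemma clinear_on_Lop:
  assumes "clinear_on S h" "\<And>\<phi>. x \<phi> \<in> S"
  shows "Lop B l k x \<phi> \<in> S" and "h (Lop B l k x \<phi>) = Lop B l k (\<lambda>\<psi>. h (x \<psi>)) \<phi>"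
  unfolding Lop_def
  by (intro clinear_on_op(1)[OF assms(1)] assms)
    (simp add: clinear_on_op[OF assms(1)] assms(2))

lemma clinear_on_Top:
  assumes "clinear_on S h" "\<And>\<phi>. x \<phi> \<in> S"
  shows "Top k x \<phi> \<in> S" and "h (Top k x \<phi>) = Top k (\<lambda>\<psi>. h (x \<psi>)) \<phi>"
  unfolding Top_Lop
  by (intro clinear_on_Lop(1)[OF assms(1)] assms)
    (simp add: clinear_on_Lop[OF assms(1)] assms(2))

lemma Top_param:
  assumes "\<And>\<phi> m a. m \<in> {k, Suc k, Suc (Suc k), Suc (Suc (Suc k))} \<Longrightarrow> g (\<phi>(m := a)) = g \<phi>"
  shows "Top k (\<lambda>\<psi>. X (g \<psi>) \<psi>) = (\<lambda>\<phi>. Top k (X (g \<phi>)) \<phi>)"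
proof -
  have 1: "g (\<phi>(m := a)) = g \<phi>" if "m \<in> {Suc k, Suc (Suc k), 2 + k, Suc (2 + k)}" for \<phi> m a
    using that by (intro assms) auto
  have 2: "g (\<phi>(m := a)) = g \<phi>" if "m \<in> {Suc k, Suc (Suc k), 0 + k, Suc (0 + k)}" for \<phi> m a
    using that by (intro assms) auto
  show ?thesis
    unfolding Top_Lop
    using Lop_param[of k 2 g Rsi X, OF 1] Lop_param[of k 0 g Rm "\<lambda>c. Lop Rsi 2 k (X c)", OF 2] by simp
qed

lemma Top_scons: "Top (Suc k) x (a ## \<psi>) = Top k (\<lambda>\<psi>. x (a ## \<psi>)) \<psi>"
  by (simp add: Top_Lop Lop_scons)

lemma Top_inverse: "x = op Xm 1 (op Rs 2 (op Ym 1 (op Xm 1 (op Ri 0 (op Ym 1 (Top 0 x))))))"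
  by (simp add: Top_def Sop_def Stop_def numeral_2_eq_2)

end

text \<open>The common form of both halves. \<Omega>_+ has \<open>A\<close> = \<open>Rsi\<close>,
  \<open>l\<close> = 2, \<open>c\<close> = 1/q and \<open>t\<close> = q^2; \<Omega>_- has
  \<open>A\<close> = \<open>Rm\<close>, \<open>l\<close> = 0, \<open>c\<close> = q and
  \<open>t\<close> = q^-2. The scalar \<open>e\<close> in \<open>rels_eq\<close> is the power of
  q^(1/N) in S or S with a tilde, and \<open>span_p\<close> says that \<B> is spanned by words in
  p.\<close>

locale half_calculus = coord_algebra q N pos f v + presented_bimod Bs M d rels
  for q :: real and N :: nat and pos :: "'n::finite \<Rightarrow> nat" and f v :: "'n \<Rightarrow> 'a::complex_algebra"
    and Bs :: "'a set" and M :: "('a, 'm::complex_vector) bimod" and d :: "'n \<Rightarrow> 'n \<Rightarrow> 'm" and rels +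
  fixes A :: "complex^('n \<times> 'n)^('n \<times> 'n)" and l :: nat and c t :: complex
  assumes l_le: "l \<le> 2" and t_nz: "t \<noteq> 0"
    and p_closed: "f i * v j \<in> Bs"
    and span_p: "b \<in> Bs \<Longrightarrow> Q 1 \<Longrightarrow> (\<And>x y. Q x \<Longrightarrow> Q y \<Longrightarrow> Q (x + y)) \<Longrightarrow> (\<And>z x. Q x \<Longrightarrow> Q (z *C x)) \<Longrightarrow>
      (\<And>x i j. x \<in> Bs \<Longrightarrow> Q x \<Longrightarrow> Q (x * (f i * v j))) \<Longrightarrow> Q b"
    and rels_eq: "\<exists>e. e \<noteq> 0 \<and> rels =
      range (\<lambda>\<phi>. e *C (Lop A l 0 (\<lambda>\<phi>. free_act (f (\<phi> 0) * v (\<phi> 1)) (free_gen (\<phi> 2) (\<phi> 3))) \<phi> -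
        c *C free_act (f (\<phi> 0) * v (\<phi> 1)) (free_gen (\<phi> 2) (\<phi> 3)))) \<union>
      {\<Sum>a\<in>UNIV. wq a *C free_gen a a}"
    and right: "(\<lambda>\<phi>. ract M (d (\<phi> 0) (\<phi> 1)) (f (\<phi> 2) * v (\<phi> 3))) =
      t *C Top 0 (\<lambda>\<phi>. lact M (f (\<phi> 0) * v (\<phi> 1)) (d (\<phi> 2) (\<phi> 3)))"
begin

text \<open>For \<Omega>_+ the three families are p \<partial>p, \<partial>p p and \<partial>p;
  \<open>gp\<close> lifts the first one to the free module, in which the relations live.\<close>

definition Pf :: "('n, 'm) fam" where "Pf \<phi> = (f (\<phi> 0) * v (\<phi> 1)) \<rhd> d (\<phi> 2) (\<phi> 3)"
definition Rf :: "('n, 'm) fam" where "Rf \<phi> = d (\<phi> 0) (\<phi> 1) \<lhd> (f (\<phi> 2) * v (\<phi> 3))"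
definition Df :: "('n, 'm) fam" where "Df \<phi> = d (\<phi> 0) (\<phi> 1)"
definition gp :: "('n, 'n \<Rightarrow> 'n \<Rightarrow> 'a) fam" where
  "gp \<phi> = free_act (f (\<phi> 0) * v (\<phi> 1)) (free_gen (\<phi> 2) (\<phi> 3))"

definition valf :: "('n \<Rightarrow> 'n \<Rightarrow> 'a) \<Rightarrow> 'm" where "valf x = val x"

lemma gen_coeffs: "free_gen i j \<in> coeffs"
  by (auto simp: free_gen_def one_closed zero_closed)

lemma gp_coeffs: "gp \<phi> \<in> coeffs"
  using p_closed by (auto simp: gp_def free_act_def free_gen_def mult_closed one_closed zero_closed)

lemma clinear_val: "clinear_on coeffs valf"
proof -
  have "valf (z *C c) = z *C valf c" if "c \<in> coeffs" for z c
    using that by (simp add: valf_def scaleC_fun_def scaleC_la scaleC_sum_right)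
  moreover have "valf (c + c') = valf c + valf c'" if "c \<in> coeffs" "c' \<in> coeffs" for c c'
    unfolding valf_def by (rule val_add[OF that])
  moreover have "valf 0 = 0"
    by (simp add: valf_def zero_la)
  ultimately show ?thesis
    unfolding clinear_on_def by (simp add: zero_closed add_closed scale_closed scaleC_fun_def)
qed

lemma val_gen: "valf (free_gen i j) = d i j"
  using sum_UNIV_when[of i j "\<lambda>k l. d k l"]
  by (simp add: valf_def free_gen_def if_distrib[of "\<lambda>b. b \<rhd> _"] one_la zero_la cong: if_cong)

lemma val_gp: "valf (gp \<phi>) = Pf \<phi>"
  unfolding gp_def Pf_def using val_act[OF p_closed gen_coeffs] val_gen by (simp only: valf_def)

lemma rels_gp: obtains e where "e \<noteq> 0"
  "rels = range (\<lambda>\<phi>. e *C (Lop A l 0 gp \<phi> - c *C gp \<phi>)) \<union> {\<Sum>a\<in>UNIV. wq a *C free_gen a a}"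
  using rels_eq unfolding gp_def[abs_def] by blast

lemma rel_gp:
  assumes h: "clinear_on coeffs h"
  shows "Lop A l 0 gp \<phi> - c *C gp \<phi> \<in> coeffs"
    and "h (Lop A l 0 gp \<phi> - c *C gp \<phi>) = Lop A l 0 (\<lambda>\<psi>. h (gp \<psi>)) \<phi> - c *C h (gp \<phi>)"
proof -
  have L: "Lop A l 0 gp \<phi> \<in> coeffs" "h (Lop A l 0 gp \<phi>) = Lop A l 0 (\<lambda>\<psi>. h (gp \<psi>)) \<phi>"
    by (rule clinear_on_Lop[OF h gp_coeffs])+
  have S: "c *C gp \<phi> \<in> coeffs \<and> h (c *C gp \<phi>) = c *C h (gp \<phi>)"
    by (rule clinear_on_scale[OF h gp_coeffs])
  note D = clinear_on_diff[OF h L(1) conjunct1[OF S]]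
  show "Lop A l 0 gp \<phi> - c *C gp \<phi> \<in> coeffs"
    by (rule conjunct1[OF D])
  show "h (Lop A l 0 gp \<phi> - c *C gp \<phi>) = Lop A l 0 (\<lambda>\<psi>. h (gp \<psi>)) \<phi> - c *C h (gp \<phi>)"
    by (simp only: conjunct2[OF D] L(2) conjunct2[OF S])
qed

lemma rel_con:
  assumes h: "clinear_on coeffs h"
  shows "(\<Sum>a\<in>UNIV. wq a *C free_gen a a) \<in> coeffs"
    and "h (\<Sum>a\<in>UNIV. wq a *C free_gen a a) = (\<Sum>a\<in>UNIV. wq a *C h (free_gen a a))"
proof -
  have S: "wq a *C free_gen a a \<in> coeffs \<and> h (wq a *C free_gen a a) = wq a *C h (free_gen a a)" for a
    by (rule clinear_on_scale[OF h gen_coeffs])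
  note D = clinear_on_sum[OF h, of UNIV "\<lambda>a. wq a *C free_gen a a", OF conjunct1[OF S]]
  show "(\<Sum>a\<in>UNIV. wq a *C free_gen a a) \<in> coeffs"
    by (rule conjunct1[OF D])
  show "h (\<Sum>a\<in>UNIV. wq a *C free_gen a a) = (\<Sum>a\<in>UNIV. wq a *C h (free_gen a a))"
    by (simp only: conjunct2[OF D] conjunct2[OF S])
qed

lemma rels_cases:
  assumes "x \<in> rels"
  obtains (gp) e \<phi> where "x = e *C (Lop A l 0 gp \<phi> - c *C gp \<phi>)" | (con) "x = (\<Sum>a\<in>UNIV. wq a *C free_gen a a)"
proof -
  obtain e where "rels = range (\<lambda>\<phi>. e *C (Lop A l 0 gp \<phi> - c *C gp \<phi>)) \<union> {\<Sum>a\<in>UNIV. wq a *C free_gen a a}"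
    by (rule rels_gp)
  then show ?thesis
    using assms that by blast
qed

lemma rels_coeffs: "rels \<subseteq> coeffs"
proof
  fix x assume "x \<in> rels"
  then show "x \<in> coeffs"
  proof (cases rule: rels_cases)
    case (gp e \<phi>)
    then show ?thesis
      using clinear_on_scale[OF clinear_val rel_gp(1)[OF clinear_val], of e \<phi>] by (simp only:)
  next
    case con
    then show ?thesis
      using rel_con(1)[OF clinear_val] by (simp only:)
  qed
qed

lemma rel_ev:
  assumes h: "clinear_on coeffs h" and x: "x \<in> rels"
    and "\<And>\<phi>. Lop A l 0 (\<lambda>\<psi>. h (gp \<psi>)) \<phi> = c *C h (gp \<phi>)" "(\<Sum>a\<in>UNIV. wq a *C h (free_gen a a)) = 0"
  shows "h x = 0"
  using x
proof (cases rule: rels_cases)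
  case (gp e \<phi>)
  have "h (e *C (Lop A l 0 gp \<phi> - c *C gp \<phi>)) = e *C h (Lop A l 0 gp \<phi> - c *C gp \<phi>)"
    by (rule conjunct2[OF clinear_on_scale[OF h rel_gp(1)[OF h]]])
  then show ?thesis
    by (simp only: gp rel_gp(2)[OF h] assms(3) diff_self scaleC_zero_right)
next
  case con
  then show ?thesis
    by (simp only: rel_con(2)[OF h] assms(4))
qed

lemma P_rel: "Lop A l 0 Pf = c *C Pf"
proof (rule ext)
  fix \<phi>
  obtain e where e: "e \<noteq> 0"
    "rels = range (\<lambda>\<phi>. e *C (Lop A l 0 gp \<phi> - c *C gp \<phi>)) \<union> {\<Sum>a\<in>UNIV. wq a *C free_gen a a}"
    by (rule rels_gp)
  note S = clinear_on_scale[OF clinear_val rel_gp(1)[OF clinear_val], of e \<phi>]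
  have "e *C (Lop A l 0 gp \<phi> - c *C gp \<phi>) \<in> rels"
    unfolding e(2) by blast
  from val_rel[OF this conjunct1[OF S]]
  have "valf (e *C (Lop A l 0 gp \<phi> - c *C gp \<phi>)) = 0"
    unfolding valf_def .
  then have "valf (Lop A l 0 gp \<phi> - c *C gp \<phi>) = 0"
    using e(1) by (simp only: conjunct2[OF S] scaleC_eq_0_iff simp_thms)
  then show "Lop A l 0 Pf \<phi> = (c *C Pf) \<phi>"
    unfolding rel_gp(2)[OF clinear_val] val_gp by (simp add: scaleC_fun_def)
qed

lemma d_trace: "(\<Sum>a\<in>UNIV. wq a *C d a a) = 0"
proof -
  obtain e where
    "rels = range (\<lambda>\<phi>. e *C (Lop A l 0 gp \<phi> - c *C gp \<phi>)) \<union> {\<Sum>a\<in>UNIV. wq a *C free_gen a a}"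
    by (rule rels_gp)
  then have "(\<Sum>a\<in>UNIV. wq a *C free_gen a a) \<in> rels"
    by blast
  from val_rel[OF this rel_con(1)[OF clinear_val]]
  have "valf (\<Sum>a\<in>UNIV. wq a *C free_gen a a) = 0"
    unfolding valf_def .
  then show ?thesis
    unfolding rel_con(2)[OF clinear_val] val_gen .
qed

lemma fv_trace: "(\<Sum>a\<in>UNIV. wq a *C (f a * v a)) = qc powi (int N - 1) *C 1"
proof -
  have "con wq 0 (F (W (\<lambda>_. 1))) \<phi> = (qc powi (int N - 1) *C (\<lambda>_. 1)) \<phi>" for \<phi>
    unfolding con_FW ..
  then show ?thesis
    by (simp add: fam_simps scaleC_fun_def)
qed

lemma con_0_P: "con wq 0 Pf = qc powi (int N - 1) *C Df"
proof
  fix \<phi>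
  have "con wq 0 Pf \<phi> = (\<Sum>a\<in>UNIV. (wq a *C (f a * v a)) \<rhd> d (\<phi> 0) (\<phi> 1))"
    by (simp add: con_0 Pf_def scaleC_la p_closed)
  also have "\<dots> = (qc powi (int N - 1) *C 1) \<rhd> d (\<phi> 0) (\<phi> 1)"
    unfolding fv_trace[symmetric] by (rule sum_la[symmetric]) (simp add: scale_closed p_closed)
  finally show "con wq 0 Pf \<phi> = (qc powi (int N - 1) *C Df) \<phi>"
    by (simp add: scalar_la Df_def scaleC_fun_def)
qed

lemma con_2_R: "con wq 2 Rf = qc powi (int N - 1) *C Df"
proof
  fix \<phi>
  have "con wq 2 Rf \<phi> = (\<Sum>a\<in>UNIV. d (\<phi> 0) (\<phi> 1) \<lhd> (wq a *C (f a * v a)))"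
    by (simp add: con_2 Rf_def ra_scaleC p_closed)
  also have "\<dots> = d (\<phi> 0) (\<phi> 1) \<lhd> (qc powi (int N - 1) *C 1)"
    unfolding fv_trace[symmetric] by (rule sum_ra[symmetric]) (simp add: scale_closed p_closed)
  finally show "con wq 2 Rf \<phi> = (qc powi (int N - 1) *C Df) \<phi>"
    by (simp add: scalar_ra Df_def scaleC_fun_def)
qed

lemma con_2_P: "con wq 2 Pf = 0"
proof
  fix \<phi>
  have "con wq 2 Pf \<phi> = (f (\<phi> 0) * v (\<phi> 1)) \<rhd> (\<Sum>a\<in>UNIV. wq a *C d a a)"
    by (simp add: con_2 Pf_def la_sum la_scaleC p_closed)
  then show "con wq 2 Pf \<phi> = 0 \<phi>"
    by (simp add: d_trace la_zero p_closed)
qed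

lemma R_P: "Rf = t *C Top 0 Pf"
  using right unfolding Rf_def[abs_def] Pf_def[abs_def] .

text \<open>The presentation provides generators of a left module only. Because T is invertible, x p
  \<partial>p is a combination of the elements x \<partial>p p, so induction over words in p shows
  that b \<partial>p lies in the right span for every b in \<B>.\<close>

lemma right_span:
  assumes d: "\<And>i j. Q (d i j)" and add: "\<And>x y. Q x \<Longrightarrow> Q y \<Longrightarrow> Q (x + y)"
    and ra: "\<And>x b. Q x \<Longrightarrow> b \<in> Bs \<Longrightarrow> Q (x \<lhd> b)"
  shows "Q x"
proof -
  define S where "S = {x. Q x}"
  have scale: "Q (z *C x)" if "Q x" for z x
    using ra[OF that scalar_closed, of z] by (simp add: scalar_ra)
  then have S: "clinear_on S (\<lambda>x. x)"
    unfolding clinear_on_def S_def using add scale[OF d, of 0] scale by simp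
  define W where "W = {x. \<forall>b. b \<in> Bs \<longrightarrow> Q (b \<rhd> x)}"
  have la_d: "b \<rhd> d i j \<in> S" if b: "b \<in> Bs" for b i j
  proof -
    have "b \<in> Bs \<and> (\<forall>i j. b \<rhd> d i j \<in> S)"
    proof (rule span_p[OF b])
      show "1 \<in> Bs \<and> (\<forall>i j. 1 \<rhd> d i j \<in> S)"
        by (simp add: one_closed one_la S_def d)
    next
      fix x i j assume xB: "x \<in> Bs" and x: "x \<in> Bs \<and> (\<forall>i j. x \<rhd> d i j \<in> S)"
      have R: "x \<rhd> Rf \<psi> \<in> S" for \<psi>
        unfolding Rf_def la_ra[OF xB p_closed] using x p_closed ra unfolding S_def by blast
      have "x \<rhd> Top 0 Pf \<psi> \<in> S" for \<psi>
      proof -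
        have "x \<rhd> Rf \<psi> = t *C (x \<rhd> Top 0 Pf \<psi>)"
          by (simp add: R_P scaleC_fun_def la_scaleC[OF xB])
        then have "x \<rhd> Top 0 Pf \<psi> = inverse t *C (x \<rhd> Rf \<psi>)"
          by (simp add: scaleC_scaleC scaleC_one t_nz)
        then show ?thesis
          using R[of \<psi>] scale unfolding S_def by simp
      qed
      note T = this
      let ?X = "\<lambda>y. \<forall>\<psi>. x \<rhd> y \<psi> \<in> S"
      have X: "?X (op m k y)" if "?X y" for m k y
      proof
        fix \<psi>
        have "x \<rhd> op m k y \<psi> = op m k (\<lambda>\<psi>. x \<rhd> y \<psi>) \<psi>"
          by (rule clinear_on_op(2)[OF clinear_la[OF xB]]) simp
        also have "\<dots> \<in> S"
          using that by (intro clinear_on_op(1)[OF S]) simp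
        finally show "x \<rhd> op m k y \<psi> \<in> S" .
      qed
      have "?X Pf"
        by (subst Top_inverse) (intro X allI T)
      then have P: "x \<rhd> Pf \<psi> \<in> S" for \<psi> by blast
      have "(x * (f i * v j)) \<rhd> d i' j' \<in> S" for i' j'
        using P[of "i ## j ## i' ## j' ## undefined"] mult_la[OF xB p_closed, of i j] by (simp add: Pf_def)
      then show "x * (f i * v j) \<in> Bs \<and> (\<forall>i' j'. (x * (f i * v j)) \<rhd> d i' j' \<in> S)"
        using mult_closed[OF xB p_closed] by blast
    next
      fix x y assume "x \<in> Bs \<and> (\<forall>i j. x \<rhd> d i j \<in> S)" "y \<in> Bs \<and> (\<forall>i j. y \<rhd> d i j \<in> S)"
      then show "x + y \<in> Bs \<and> (\<forall>i j. (x + y) \<rhd> d i j \<in> S)"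
        using add by (simp add: add_la add_closed S_def)
    next
      fix z x assume "x \<in> Bs \<and> (\<forall>i j. x \<rhd> d i j \<in> S)"
      then show "z *C x \<in> Bs \<and> (\<forall>i j. (z *C x) \<rhd> d i j \<in> S)"
        using scale by (simp add: scaleC_la scale_closed S_def)
    qed
    then show ?thesis by blast
  qed
  obtain c where c: "c \<in> coeffs" "x = val c" using val_surj by blast
  have 1: "(\<Sum>j\<in>UNIV. c i j \<rhd> d i j) \<in> S" for i
    using clinear_on_sum[OF S, of UNIV "\<lambda>j. c i j \<rhd> d i j"] la_d c(1) by blast
  have "val c \<in> S"
    using clinear_on_sum[OF S, of UNIV "\<lambda>i. \<Sum>j\<in>UNIV. c i j \<rhd> d i j"] 1 by blast
  then show ?thesis
    unfolding c(2) S_def by simp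
qed

end

definition depends :: "nat \<Rightarrow> ('n, 'm) fam \<Rightarrow> bool" where
  "depends n x \<longleftrightarrow> (\<forall>\<phi> \<psi>. (\<forall>m<n. \<phi> m = \<psi> m) \<longrightarrow> x \<phi> = x \<psi>)"

lemma depends_op: "depends n x \<Longrightarrow> Suc k < n \<Longrightarrow> depends n (op R k x)"
  unfolding depends_def
proof (intro allI impI)
  fix \<phi> \<psi> :: "nat \<Rightarrow> 'a"
  assume x: "\<forall>\<phi> \<psi>. (\<forall>m<n. \<phi> m = \<psi> m) \<longrightarrow> x \<phi> = x \<psi>" and k: "Suc k < n" and *: "\<forall>m<n. \<phi> m = \<psi> m"
  have "x (\<phi>(k := a, Suc k := b)) = x (\<psi>(k := a, Suc k := b))" for a b
    using x[rule_format, of "\<phi>(k := a, Suc k := b)" "\<psi>(k := a, Suc k := b)"] * by simp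
  moreover have "\<phi> k = \<psi> k" "\<phi> (Suc k) = \<psi> (Suc k)"
    using k * by simp_all
  ultimately show "op R k x \<phi> = op R k x \<psi>"
    unfolding op_eq_upd by simp
qed

text \<open>The conditions on a candidate \<open>b\<close> for the values of the pairing on
  generators: the relations of both modules and both E' contractions, and compatibility with right
  multiplication by p. Where the second argument is concerned \<open>Top 0\<close> appears, because
  its coefficients are moved to the right of the first argument.\<close>

locale pairing_data =
  H1: half_calculus q N pos f v Bs M1 d1 rels1 A1 l1 c1 t1 +
  H2: half_calculus q N pos f v Bs M2 d2 rels2 A2 l2 c2 t2
  for q :: real and N :: nat and pos :: "'n::finite \<Rightarrow> nat" and f v :: "'n \<Rightarrow> 'a::complex_algebra"
    and Bs :: "'a set" and M1 :: "('a, 'm::complex_vector) bimod" and d1 :: "'n \<Rightarrow> 'n \<Rightarrow> 'm" and rels1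
    and A1 l1 c1 t1
    and M2 :: "('a, 'k::complex_vector) bimod" and d2 :: "'n \<Rightarrow> 'n \<Rightarrow> 'k" and rels2 and A2 l2 c2 t2 +
  fixes b :: "('n, 'a) fam"
  assumes b_dep: "depends 4 b"
    and b_closed: "b \<phi> \<in> Bs"
    and b_rel1: "H1.Lop A1 l1 0 (H1.F (H1.W b)) = c1 *C H1.F (H1.W b)"
    and b_con_0: "con H1.wq 0 b = 0" and b_con_2: "con H1.wq 2 b = 0"
    and b_rel2: "H1.Lop A2 l2 2 (H1.Top 0 (H1.F (H1.W b))) = c2 *C H1.Top 0 (H1.F (H1.W b))"
    and b_right: "H1.Top 2 (H1.Top 0 (H1.F (H1.W b))) \<phi> = b \<phi> * (f (\<phi> 4) * v (\<phi> 5))"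
    and t1_t2: "t1 * t2 = 1"
begin

abbreviation "G \<equiv> H1.F (H1.W b)"

text \<open>\<open>b\<close> reads four indices only (\<open>b_dep\<close>), so the tail of the
  sequence is filled with an index that is at hand.\<close>

definition bs :: "'n \<Rightarrow> 'n \<Rightarrow> 'n \<Rightarrow> 'n \<Rightarrow> 'a" where
  "bs i j k l = b (i ## j ## k ## l ## (\<lambda>_. i))"

lemma bs_b: "bs (\<phi> 0) (\<phi> 1) (\<phi> 2) (\<phi> 3) = b \<phi>"
  unfolding bs_def
proof (rule b_dep[unfolded depends_def, rule_format])
  fix m :: nat assume "m < 4"
  then consider "m = 0" | "m = 1" | "m = 2" | "m = 3" by linarith
  then show "(\<phi> 0 ## \<phi> 1 ## \<phi> 2 ## \<phi> 3 ## (\<lambda>_. \<phi> 0)) m = \<phi> m"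
    by cases (simp_all add: eval_nat_numeral)
qed

lemma G_bs: "G \<phi> = (f (\<phi> 0) * v (\<phi> 1)) * bs (\<phi> 2) (\<phi> 3) (\<phi> 4) (\<phi> 5)"
  using bs_b[of "stl (stl \<phi>)"] by (simp add: pre_def mult.assoc eval_nat_numeral)

lemma lam_exists: "\<exists>h. left_linear Bs M1 h \<and> (\<forall>i j. h (d1 i j) = bs i j k l)"
proof (rule H1.left_map_exists)
  show "bs i j k l \<in> Bs" for i j
    unfolding bs_def by (rule b_closed)
  define h where "h c = (\<Sum>i\<in>UNIV. \<Sum>j\<in>UNIV. c i j * bs i j k l)" for c
  have h: "clinear_on H1.coeffs h"
    by (simp add: clinear_on_def h_def H1.zero_closed H1.add_closed H1.scale_closed distrib_right sum.distrib
        scaleC_fun_def mult_scaleC_left scaleC_sum_right)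
  have h_gen: "h (free_gen i j) = bs i j k l" for i j
    using sum_UNIV_when[of i j "\<lambda>i j. bs i j k l"]
    by (simp add: h_def free_gen_def if_distrib[of "\<lambda>b. b * _"] cong: if_cong)
  have h_act: "h (free_act x c) = x * h c" for x c
    by (simp add: h_def free_act_def sum_distrib_left mult.assoc)
  let ?G = "\<lambda>\<phi>. (f (\<phi> 0) * v (\<phi> 1)) * bs (\<phi> 2) (\<phi> 3) k l"
  have h_gp: "h (H1.gp \<phi>) = ?G \<phi>" for \<phi>
    by (simp add: H1.gp_def h_act h_gen)
  have rel: "H1.Lop A1 l1 0 ?G \<phi> = c1 *C ?G \<phi>" for \<phi>
  proof -
    \<comment> \<open>\<open>b_rel1\<close> acts on legs in front of positions 4 and 5, so these are
      frozen and the relation is read at a sequence that carries \<open>k\<close> and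
      \<open>l\<close> there.\<close>
    let ?\<phi> = "\<phi>(4 := k, 5 := l)"
    let ?X = "\<lambda>(k, l) \<phi>. (f (\<phi> 0) * v (\<phi> 1)) * bs (\<phi> 2) (\<phi> 3) k l"
    let ?g = "\<lambda>\<phi>. (\<phi> (4::nat), \<phi> (5::nat))"
    have "H1.Lop A1 l1 0 (\<lambda>\<psi>. ?X (?g \<psi>) \<psi>) = (\<lambda>\<phi>. H1.Lop A1 l1 0 (?X (?g \<phi>)) \<phi>)"
      by (rule H1.Lop_param) (use H1.l_le in auto)
    then have *: "H1.Lop A1 l1 0 G = (\<lambda>\<phi>. H1.Lop A1 l1 0 (?X (?g \<phi>)) \<phi>)"
      by (simp add: G_bs[abs_def])
    define Y where "Y = H1.Lop A1 l1 0 ?G"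
    have dep: "Y ?\<phi> = Y \<phi>"
    proof -
      have op4: "\<forall>\<phi>. op R m x (\<phi>(4 := k, 5 := l)) = op R m x \<phi>"
        if "Suc m < 4" "\<forall>\<phi>. x (\<phi>(4 := k, 5 := l)) = x \<phi>" for R m and x :: "('n, 'a) fam"
      proof
        fix \<phi> :: "nat \<Rightarrow> 'n"
        have "(\<phi>(4 := k, 5 := l))(m := a, Suc m := b) = (\<phi>(m := a, Suc m := b))(4 := k, 5 := l)" for a b
          using that(1) by (auto simp: fun_eq_iff)
        then show "op R m x (\<phi>(4 := k, 5 := l)) = op R m x \<phi>"
          unfolding op_eq_upd using that by simp
      qed
      have "\<forall>\<phi>. Y (\<phi>(4 := k, 5 := l)) = Y \<phi>"
        unfolding Y_def H1.Lop_def using H1.l_le by (intro op4) simp_all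
      then show ?thesis by blast
    qed
    have "Y ?\<phi> = c1 *C G ?\<phi>"
      using fun_cong[OF b_rel1, of ?\<phi>] by (simp add: * Y_def scaleC_fun_def)
    then show ?thesis
      unfolding dep unfolding Y_def G_bs by simp
  qed
  have tr: "(\<Sum>a\<in>UNIV. H1.wq a *C bs a a k l) = 0"
    using fun_cong[OF b_con_0, of "k ## l ## (\<lambda>_. k)"] bs_b[of "a ## a ## k ## l ## (\<lambda>_. k)" for a]
    by (simp add: con_0)
  show "(\<Sum>i\<in>UNIV. \<Sum>j\<in>UNIV. c i j * bs i j k l) = 0" if "c \<in> rels1" for c
    using H1.rel_ev[OF h that] rel tr unfolding h_gp h_gen by (simp add: h_def)
qed

definition lam :: "'n \<Rightarrow> 'n \<Rightarrow> 'm \<Rightarrow> 'a" where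
  "lam k l = (SOME h. left_linear Bs M1 h \<and> (\<forall>i j. h (d1 i j) = bs i j k l))"

lemma lam: "left_linear Bs M1 (lam k l)" and lam_d: "lam k l (d1 i j) = bs i j k l"
  using someI_ex[OF lam_exists[of k l]] unfolding lam_def by blast+

text \<open>The value of (d1 p, d2): the right action turns d1 p into a multiple of T p d1, and the
  left linear map passes inside T, which leaves the two legs of d2 alone.\<close>

lemma lam_R: "lam (\<phi> 4) (\<phi> 5) (H1.Rf \<phi>) = t1 *C H1.Top 0 G \<phi>"
proof -
  have c: "clinear_on UNIV (lam k l)" for k l
    by (rule H1.left_linear_clinear[OF lam])
  have P: "lam (\<phi> 4) (\<phi> 5) (H1.Pf \<phi>) = G \<phi>" for \<phi>
    using lam H1.p_closed unfolding left_linear_def by (simp add: H1.Pf_def G_bs lam_d)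
  let ?g = "\<lambda>\<phi>. (\<phi> (4::nat), \<phi> (5::nat))"
  have "lam (\<phi> 4) (\<phi> 5) (H1.Rf \<phi>) = t1 *C H1.Top 0 (\<lambda>\<psi>. lam (\<phi> 4) (\<phi> 5) (H1.Pf \<psi>)) \<phi>"
    using clinear_on_scale[OF c, of "H1.Top 0 H1.Pf \<phi>"] H1.clinear_on_Top(2)[OF c, of H1.Pf]
    by (simp add: H1.R_P scaleC_fun_def)
  also have "H1.Top 0 (\<lambda>\<psi>. lam (\<phi> 4) (\<phi> 5) (H1.Pf \<psi>)) \<phi> = H1.Top 0 G \<phi>"
  proof -
    let ?X = "\<lambda>(k, l) \<phi>. lam k l (H1.Pf \<phi>)"
    have "H1.Top 0 (\<lambda>\<psi>. ?X (?g \<psi>) \<psi>) = (\<lambda>\<phi>. H1.Top 0 (?X (?g \<phi>)) \<phi>)"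
      by (rule H1.Top_param) auto
    then have "H1.Top 0 G = (\<lambda>\<phi>. H1.Top 0 (?X (?g \<phi>)) \<phi>)"
      by (simp add: P)
    then show ?thesis by simp
  qed
  finally show ?thesis .
qed

lemma lam_rels2:
  assumes "c \<in> rels2"
  shows "(\<Sum>k\<in>UNIV. \<Sum>l\<in>UNIV. lam k l (ract M1 (d1 i j) (c k l))) = 0"
proof -
  define h where "h c = (\<Sum>k\<in>UNIV. \<Sum>l\<in>UNIV. lam k l (ract M1 (d1 i j) (c k l)))" for c
  have c: "clinear_on UNIV (lam k l)" for k l
    by (rule H1.left_linear_clinear[OF lam])
  have l0: "lam k l 0 = 0" and ls: "lam k l (z *C x) = z *C lam k l x" and la: "lam k l (x + y) = lam k l x + lam k l y" for k l z x y
    using c[of k l] unfolding clinear_on_def by simp_all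
  have h: "clinear_on H1.coeffs h"
    by (simp add: clinear_on_def h_def H1.zero_closed H1.add_closed H1.scale_closed H1.zero_ra l0
        H1.add_ra la sum.distrib scaleC_fun_def H1.ra_scaleC ls scaleC_sum_right)
  have h1: "h (\<lambda>k' l'. if k' = k \<and> l' = l then x else 0) = lam k l (ract M1 (d1 i j) x)" for k l x
    using sum_UNIV_when[of k l "\<lambda>k l. lam k l (ract M1 (d1 i j) x)"]
    by (simp add: h_def if_distrib[of "\<lambda>b. lam _ _ (ract M1 _ b)"] H1.zero_ra l0 cong: if_cong)
  have h_gen: "h (free_gen k l) = bs i j k l" for k l
    using h1[of k l 1] by (simp add: free_gen_def H1.one_ra lam_d)
  have h_gp: "h (H1.gp \<phi>) = t1 *C H1.Top 0 G (i ## j ## \<phi>)" for \<phi>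
  proof -
    have "H1.gp \<phi> = (\<lambda>k' l'. if k' = \<phi> 2 \<and> l' = \<phi> 3 then f (\<phi> 0) * v (\<phi> 1) else 0)"
      by (simp add: H1.gp_def free_act_def free_gen_def fun_eq_iff)
    then have "h (H1.gp \<phi>) = lam (\<phi> 2) (\<phi> 3) (ract M1 (d1 i j) (f (\<phi> 0) * v (\<phi> 1)))"
      by (simp only: h1)
    then show ?thesis
      using lam_R[of "i ## j ## \<phi>"] by (simp add: H1.Rf_def eval_nat_numeral)
  qed
  have cs: "clinear_on UNIV (\<lambda>x::'a. t1 *C x)"
    by (simp add: clinear_on_def scaleC_add_right scaleC_left_commute)
  have 1: "H1.Lop A2 l2 0 (\<lambda>\<psi>. h (H1.gp \<psi>)) \<phi> = c2 *C h (H1.gp \<phi>)" for \<phi>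
  proof -
    have "H1.Lop A2 l2 0 (\<lambda>\<psi>. h (H1.gp \<psi>)) \<phi> = t1 *C H1.Lop A2 l2 0 (\<lambda>\<psi>. H1.Top 0 G (i ## j ## \<psi>)) \<phi>"
      unfolding h_gp using H1.clinear_on_Lop(2)[OF cs, of "\<lambda>\<psi>. H1.Top 0 G (i ## j ## \<psi>)" A2 l2 0 \<phi>] by simp
    also have "H1.Lop A2 l2 0 (\<lambda>\<psi>. H1.Top 0 G (i ## j ## \<psi>)) \<phi> = H1.Lop A2 l2 2 (H1.Top 0 G) (i ## j ## \<phi>)"
      by (simp add: numeral_2_eq_2 H1.Lop_scons)
    also have "\<dots> = c2 *C H1.Top 0 G (i ## j ## \<phi>)"
      by (simp add: b_rel2 scaleC_fun_def)
    finally show ?thesis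
      unfolding h_gp by (simp add: scaleC_left_commute)
  qed
  have 2: "(\<Sum>a\<in>UNIV. H1.wq a *C h (free_gen a a)) = 0"
    using fun_cong[OF b_con_2, of "i ## j ## (\<lambda>_. i)"] unfolding h_gen by (simp add: con_2 bs_def)
  have "h c = 0"
    by (rule H2.rel_ev[OF h assms]) (use 1 2 in \<open>simp_all add: H1.gp_def[abs_def] H2.gp_def[abs_def]\<close>)
  then show ?thesis
    by (simp add: h_def)
qed

sublocale bimod_pair Bs M1 d1 rels1 M2 d2 rels2 lam
  by standard (use lam H2.rels_coeffs lam_rels2 in auto)

lemma beta_d: "beta (d1 i j) (d2 k l) = bs i j k l"
  by (simp add: beta_gen lam_d)

lemma beta_fam: "beta (d1 (\<phi> 0) (\<phi> 1)) (d2 (\<phi> 2) (\<phi> 3)) = b \<phi>"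
  by (simp only: beta_d bs_b)

lemma clinear_beta: "clinear_on UNIV (\<lambda>x. beta x y)" "clinear_on UNIV (beta x)"
proof -
  show "clinear_on UNIV (\<lambda>x. beta x y)"
    by (rule H1.left_linear_clinear[OF beta_left_linear])
  have "beta x (z *C y) = z *C beta x y" for z y
    using beta_balanced[of "z *C 1" x y] clinear_on_scale[OF H1.left_linear_clinear[OF beta_left_linear[of y]], of x z]
    by (simp add: H1.scalar_closed H1.scalar_ra H2.scalar_la)
  moreover have "beta x (0 + 0) = beta x 0 + beta x 0"
    by (rule beta_add_right)
  ultimately show "clinear_on UNIV (beta x)"
    by (simp add: clinear_on_def beta_add_right)
qed

text \<open>On generators (d1, d2 p) = t2 T (d1, p d2) = t2 T (d1 p, d2), which is t1 t2 times T on
  the last four legs after T on the first four, applied to p (d1, d2). Now \<open>b_right\<close>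
  and t1 t2 = 1 give (d1, d2) p.\<close>

lemma beta_right_linear_p: "beta x (ract M2 y (f m * v n)) = beta x y * (f m * v n)"
proof (rule beta_right_linear_gen[OF H1.p_closed])
  fix i j k l
  define \<phi> where "\<phi> = k ## l ## m ## n ## (\<lambda>_. i)"
  have P: "beta (d1 i j) (H2.Pf \<psi>) = t1 *C H1.Top 0 G (i ## j ## \<psi>)" for \<psi>
    using lam_R[of "i ## j ## \<psi>"]
    by (simp add: H2.Pf_def H1.Rf_def beta_balanced H1.p_closed beta_gen eval_nat_numeral)
  have cs: "clinear_on UNIV (\<lambda>x::'a. t1 *C x)"
    by (simp add: clinear_on_def scaleC_add_right scaleC_left_commute)
  have "beta (d1 i j) (ract M2 (d2 k l) (f m * v n)) = beta (d1 i j) (H2.Rf \<phi>)"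
    by (simp add: H2.Rf_def \<phi>_def eval_nat_numeral)
  also have "\<dots> = t2 *C H1.Top 0 (\<lambda>\<psi>. beta (d1 i j) (H2.Pf \<psi>)) \<phi>"
    using clinear_on_scale[OF clinear_beta(2), of "H1.Top 0 H2.Pf \<phi>"] H1.clinear_on_Top(2)[OF clinear_beta(2), of H2.Pf]
    by (simp add: H2.R_P scaleC_fun_def)
  also have "H1.Top 0 (\<lambda>\<psi>. beta (d1 i j) (H2.Pf \<psi>)) \<phi> = t1 *C H1.Top 2 (H1.Top 0 G) (i ## j ## \<phi>)"
    unfolding P using H1.clinear_on_Top(2)[OF cs, of "\<lambda>\<psi>. H1.Top 0 G (i ## j ## \<psi>)" 0 \<phi>]
    by (simp add: numeral_2_eq_2 H1.Top_scons)
  also have "H1.Top 2 (H1.Top 0 G) (i ## j ## \<phi>) = b (i ## j ## \<phi>) * (f m * v n)"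
    unfolding b_right by (simp add: \<phi>_def eval_nat_numeral)
  also have "b (i ## j ## \<phi>) = bs i j k l"
    using bs_b[of "i ## j ## \<phi>"] by (simp add: \<phi>_def eval_nat_numeral)
  finally show "beta (d1 i j) (ract M2 (d2 k l) (f m * v n)) = lam k l (d1 i j) * (f m * v n)"
    using t1_t2 by (simp add: scaleC_scaleC mult.commute[of t2] scaleC_one lam_d)
qed

lemma beta_right_linear: "c \<in> Bs \<Longrightarrow> beta x (ract M2 y c) = beta x y * c"
proof -
  assume c: "c \<in> Bs"
  have "c \<in> Bs \<and> (\<forall>x y. beta x (ract M2 y c) = beta x y * c)"
  proof (rule H1.span_p[OF c])
    show "1 \<in> Bs \<and> (\<forall>x y. beta x (ract M2 y 1) = beta x y * 1)"
      by (simp add: H2.one_ra H1.one_closed)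
  next
    fix a a' assume "a \<in> Bs \<and> (\<forall>x y. beta x (ract M2 y a) = beta x y * a)"
      "a' \<in> Bs \<and> (\<forall>x y. beta x (ract M2 y a') = beta x y * a')"
    then show "a + a' \<in> Bs \<and> (\<forall>x y. beta x (ract M2 y (a + a')) = beta x y * (a + a'))"
      by (simp add: H1.add_closed H2.add_ra beta_add_right distrib_left)
  next
    fix z a assume "a \<in> Bs \<and> (\<forall>x y. beta x (ract M2 y a) = beta x y * a)"
    then show "z *C a \<in> Bs \<and> (\<forall>x y. beta x (ract M2 y (z *C a)) = beta x y * (z *C a))"
      using clinear_on_scale[OF clinear_beta(2)] by (simp add: H1.scale_closed H2.ra_scaleC mult_scaleC_right)
  next
    fix a i j assume "a \<in> Bs" "a \<in> Bs \<and> (\<forall>x y. beta x (ract M2 y a) = beta x y * a)"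
    then show "a * (f i * v j) \<in> Bs \<and> (\<forall>x y. beta x (ract M2 y (a * (f i * v j))) = beta x y * (a * (f i * v j)))"
      using H1.p_closed by (simp add: H1.mult_closed H2.mult_ra beta_right_linear_p mult.assoc)
  qed
  then show ?thesis by blast
qed

end


lemma (in half_calculus) left_span:
  assumes d: "\<And>i j. Q (d i j)" and add: "\<And>x y. Q x \<Longrightarrow> Q y \<Longrightarrow> Q (x + y)"
    and la: "\<And>x b. Q x \<Longrightarrow> b \<in> Bs \<Longrightarrow> Q (b \<rhd> x)"
  shows "Q x"
proof -
  have Q0: "Q 0"
    using la[OF d zero_closed] by (simp add: zero_la)
  have sum: "Q (sum g I)" if "\<And>i. i \<in> I \<Longrightarrow> Q (g i)" for g and I :: "'n set"
    using that by (induction I rule: infinite_finite_induct) (auto simp: Q0 add)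
  obtain c where c: "c \<in> coeffs" "x = val c" using val_surj by blast
  then show ?thesis
    unfolding c(2) by (intro sum la d) auto
qed

section \<open>The two pairings in coordinates, and their dependence on the indices\<close>

context coord_algebra
begin

text \<open>Coefficients of S, and in \<open>Stc\<close> of the inverse of S with a tilde. They are
  made explicit because in the inversion identities the pairing acts on a module element with which
  it also shares a summation index.\<close>

definition Sc :: "'n \<Rightarrow> 'n \<Rightarrow> 'n \<Rightarrow> 'n \<Rightarrow> 'n \<Rightarrow> 'n \<Rightarrow> complex" where
  "Sc i j k a b c = (\<Sum>j'\<in>UNIV. \<Sum>k'\<in>UNIV. \<Sum>b'\<in>UNIV. Xm$(j,k)$(j',k') * Rm$(i,j')$(a,b') * Ym$(b',k')$(b,c))"

definition Stc :: "'n \<Rightarrow> 'n \<Rightarrow> 'n \<Rightarrow> 'n \<Rightarrow> 'n \<Rightarrow> 'n \<Rightarrow> complex" where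
  "Stc i j k a b c = (\<Sum>i'\<in>UNIV. \<Sum>j'\<in>UNIV. \<Sum>b'\<in>UNIV. Xm$(i,j)$(i',j') * Rs$(j',k)$(b',c) * Ym$(i',b')$(a,b))"

lemma Sop_coeff: "Sop 0 x (i ## j ## k ## \<phi>) =
    (\<Sum>a\<in>UNIV. \<Sum>b\<in>UNIV. \<Sum>c\<in>UNIV. Sc i j k a b c *C x (a ## b ## c ## \<phi>))"
  unfolding Sop_def Sc_def by (rule op_212)

lemma Stiop_coeff: "Stiop (Suc 0) x (h ## i ## j ## k ## \<phi>) =
    (\<Sum>a\<in>UNIV. \<Sum>b\<in>UNIV. \<Sum>c\<in>UNIV. Stc i j k a b c *C x (h ## a ## b ## c ## \<phi>))"
  unfolding Stiop_def Stc_def by (simp only: op_Suc_scons op_121)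

abbreviation u1 :: "('n, 'a) fam" where "u1 \<equiv> \<lambda>_. 1"

lemma FWFW_eq: "F (W (F (W u1))) \<phi> = (f (\<phi> 0) * v (\<phi> 1)) * (f (\<phi> 2) * v (\<phi> 3))"
  by (simp add: pre_def mult.assoc eval_nat_numeral)

lemma FCW_eq: "F (C' (W u1)) \<phi> = (if \<phi> 1 = \<phi> 2 then inverse (wq (\<phi> 1)) *C (f (\<phi> 0) * v (\<phi> 3)) else 0)"
  by (simp add: pre_def ins.simps eval_nat_numeral mult_scaleC_right)

lemma FWC_eq: "F (W (C u1)) \<phi> = (if \<phi> 2 = \<phi> 3 then f (\<phi> 0) * v (\<phi> 1) else 0)"
  by (simp add: pre_def ins.simps eval_nat_numeral scaleC_one)

lemma CFW_eq: "C (F (W u1)) \<phi> = (if \<phi> 0 = \<phi> 1 then f (\<phi> 2) * v (\<phi> 3) else 0)"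
  by (simp add: pre_def ins.simps eval_nat_numeral scaleC_one)

lemma beta_mp_eq: "beta_mp u1 \<phi> = (if \<phi> 1 = \<phi> 2 then inverse (wq (\<phi> 1)) *C (f (\<phi> 0) * v (\<phi> 3)) else 0) -
    qc powi (1 - int N) *C ((f (\<phi> 0) * v (\<phi> 1)) * (f (\<phi> 2) * v (\<phi> 3)))"
  by (simp add: beta_mp_def FCW_eq FWFW_eq scaleC_fun_def)

lemma beta_pm_eq: "beta_pm u1 \<phi> = qc powi (2 - int N) *C Sop 0 (F (W (C u1))) \<phi> -
    qc powi (3 - int N) *C ((f (\<phi> 0) * v (\<phi> 1)) * (f (\<phi> 2) * v (\<phi> 3)))"
  by (simp add: beta_pm_def FWFW_eq scaleC_fun_def)

lemma beta_pm_depends: "depends 4 (beta_pm u1)"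
proof -
  have "depends 4 (F (W (C u1)))"
    unfolding depends_def FWC_eq by simp
  then have "depends 4 (Sop 0 (F (W (C u1))))"
    unfolding Sop_def by (intro depends_op) simp_all
  then show ?thesis
    unfolding depends_def beta_pm_eq
  proof (intro allI impI)
    fix \<phi> \<psi> :: "nat \<Rightarrow> 'n"
    assume "\<forall>\<phi> \<psi>. (\<forall>m<4. \<phi> m = \<psi> m) \<longrightarrow> Sop 0 (F (W (C u1))) \<phi> = Sop 0 (F (W (C u1))) \<psi>"
      and *: "\<forall>m<4. \<phi> m = \<psi> m"
    then have "Sop 0 (F (W (C u1))) \<phi> = Sop 0 (F (W (C u1))) \<psi>"
      by blast
    moreover have "\<phi> 0 = \<psi> 0" "\<phi> 1 = \<psi> 1" "\<phi> 2 = \<psi> 2" "\<phi> 3 = \<psi> 3"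
      using * by simp_all
    ultimately show "qc powi (2 - int N) *C Sop 0 (F (W (C u1))) \<phi> -
        qc powi (3 - int N) *C ((f (\<phi> 0) * v (\<phi> 1)) * (f (\<phi> 2) * v (\<phi> 3))) =
      qc powi (2 - int N) *C Sop 0 (F (W (C u1))) \<psi> -
        qc powi (3 - int N) *C ((f (\<psi> 0) * v (\<psi> 1)) * (f (\<psi> 2) * v (\<psi> 3)))"
      by simp
  qed
qed

lemma beta_mp_depends: "depends 4 (beta_mp u1)"
  unfolding depends_def beta_mp_eq by simp

lemma beta_mp_right: "beta_mp (F (W u1)) \<phi> = beta_mp u1 \<phi> * (f (\<phi> 4) * v (\<phi> 5))"
  by (simp add: beta_mp_def scaleC_fun_def pre_def ins.simps eval_nat_numeral left_diff_distrib
      mult_scaleC_left mult_scaleC_right mult.assoc)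

lemma beta_pm_right: "beta_pm (F (W u1)) \<phi> = beta_pm u1 \<phi> * (f (\<phi> 4) * v (\<phi> 5))"
proof -
  let ?g = "\<lambda>\<phi>. f (\<phi> 4) * v (\<phi> 5)"
  have "F (W (C (F (W u1)))) = (\<lambda>\<psi>. F (W (C u1)) \<psi> * ?g \<psi>)"
    by (simp add: fun_eq_iff pre_def ins.simps eval_nat_numeral mult_scaleC_left mult_scaleC_right mult.assoc)
  moreover have "Sop 0 (\<lambda>\<psi>. F (W (C u1)) \<psi> * ?g \<psi>) = (\<lambda>\<psi>. Sop 0 (F (W (C u1))) \<psi> * ?g \<psi>)"
    unfolding Sop_def by (subst op_mult_right, simp)+ (rule refl)
  moreover have "F (W (F (W (F (W u1))))) \<phi> = F (W (F (W u1))) \<phi> * ?g \<phi>"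
    by (simp add: pre_def eval_nat_numeral mult.assoc)
  ultimately show ?thesis
    by (simp add: beta_pm_def scaleC_fun_def left_diff_distrib mult_scaleC_left)
qed

end

locale flag_calculus = coord_algebra q N pos f v
  for q :: real and N :: nat and pos :: "'n::finite \<Rightarrow> nat" and f v :: "'n \<Rightarrow> 'a::complex_algebra" +
  fixes Bs :: "'a set" and Mp :: "('a, 'm::complex_vector) bimod" and dp :: "'n \<Rightarrow> 'n \<Rightarrow> 'm" and relsp
    and Mm :: "('a, 'k::complex_vector) bimod" and dm :: "'n \<Rightarrow> 'n \<Rightarrow> 'k" and relsm
  assumes plus: "half_calculus q N pos f v Bs Mp dp relsp Rsi 2 (inverse qc) (qc * qc)"
    and minus: "half_calculus q N pos f v Bs Mm dm relsm Rm 0 qc (inverse (qc * qc))"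
begin

sublocale P: half_calculus q N pos f v Bs Mp dp relsp Rsi 2 "inverse qc" "qc * qc"
  by (rule plus)

sublocale M: half_calculus q N pos f v Bs Mm dm relsm Rm 0 qc "inverse (qc * qc)"
  by (rule minus)

lemma beta_mp_closed: "beta_mp u1 \<phi> \<in> Bs"
  unfolding beta_mp_eq
  by (rule P.minus_closed) (simp_all add: P.zero_closed P.scale_closed P.mult_closed P.p_closed)

lemma beta_pm_closed: "beta_pm u1 \<phi> \<in> Bs"
proof -
  have id: "clinear_on Bs (\<lambda>x. x)"
    by (simp add: clinear_on_def P.zero_closed P.add_closed P.scale_closed)
  have "Sop 0 (F (W (C u1))) \<phi> \<in> Bs"
    unfolding Sop_Lop by (rule clinear_on_Lop(1)[OF id]) (simp add: FWC_eq P.p_closed P.zero_closed)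
  then show ?thesis
    unfolding beta_pm_eq by (intro P.minus_closed P.scale_closed P.mult_closed P.p_closed)
qed

sublocale mp: pairing_data q N pos f v Bs Mm dm relsm Rm 0 qc "inverse (qc * qc)"
  Mp dp relsp Rsi 2 "inverse qc" "qc * qc" "beta_mp u1"
proof
  show "Lop Rm 0 0 (F (W (beta_mp u1))) = qc *C F (W (beta_mp u1))"
    using Sop_beta_mp by (simp add: Sop_Lop)
  show "Lop Rsi 2 2 (Top 0 (F (W (beta_mp u1)))) = inverse qc *C Top 0 (F (W (beta_mp u1)))"
    using Stop_3_Top_beta_mp[of u1] by (simp flip: Stop_Lop)
  show "Top 2 (Top 0 (F (W (beta_mp u1)))) \<phi> = beta_mp u1 \<phi> * (f (\<phi> 4) * v (\<phi> 5))" for \<phi>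
    by (simp only: Top_2_Top_beta_mp beta_mp_right)
qed (simp_all add: beta_mp_depends beta_mp_closed con_0_beta_mp con_2_beta_mp power2_eq_square[symmetric] flip: power_mult_distrib)

sublocale pm: pairing_data q N pos f v Bs Mp dp relsp Rsi 2 "inverse qc" "qc * qc"
  Mm dm relsm Rm 0 qc "inverse (qc * qc)" "beta_pm u1"
proof
  show "Lop Rsi 2 0 (F (W (beta_pm u1))) = inverse qc *C F (W (beta_pm u1))"
    using Stop_beta_pm[of u1] by (simp flip: Stop_Lop)
  show "Lop Rm 0 2 (Top 0 (F (W (beta_pm u1)))) = qc *C Top 0 (F (W (beta_pm u1)))"
    using Sop_2_Top_beta_pm by (simp add: Sop_Lop)
  show "Top 2 (Top 0 (F (W (beta_pm u1)))) \<phi> = beta_pm u1 \<phi> * (f (\<phi> 4) * v (\<phi> 5))" for \<phi>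
    by (simp only: Top_2_Top_beta_pm beta_pm_right)
qed (simp_all add: beta_pm_depends beta_pm_closed con_0_beta_pm con_2_beta_pm power2_eq_square[symmetric] flip: power_mult_distrib)

text \<open>On p \<partial>p one factor of T is a scalar by the defining relation of the module: q^2
  T reduces to q S on \<Omega>_+, and q^-2 T to S with a tilde divided by q on \<Omega>_-.\<close>

lemma P_R: "P.Rf = qc *C Sop 0 P.Pf"
  and M_R: "M.Rf = inverse qc *C Stop (Suc 0) M.Pf"
proof -
  have 1: "Stop (Suc 0) P.Pf = inverse qc *C P.Pf" and 2: "Sop 0 M.Pf = qc *C M.Pf"
    using P.P_rel M.P_rel by (simp_all add: Sop_Lop Stop_Lop)
  show "P.Rf = qc *C Sop 0 P.Pf"
    unfolding P.R_P Top_def 1 Sop_linear by (simp add: scaleC_scaleC mult.assoc)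
  show "M.Rf = inverse qc *C Stop (Suc 0) M.Pf"
    unfolding M.R_P Top_commute 2 Stop_linear by (simp add: scaleC_scaleC mult.assoc)
qed

lemma contractions:
  "con one (Suc 0) P.Pf = 0" "con one (Suc 0) P.Rf = P.Df"
  "con one (Suc 0) M.Pf = M.Df" "con one (Suc 0) M.Rf = 0"
proof -
  have 1: "Stop (Suc 0) P.Pf = inverse qc *C P.Pf" and 2: "Sop 0 M.Pf = qc *C M.Pf"
    using P.P_rel M.P_rel by (simp_all add: Sop_Lop Stop_Lop)
  show "con one (Suc 0) P.Pf = 0" "con one (Suc 0) P.Rf = P.Df"
    unfolding P_R by (rule plus_module_contractions[OF 1 P.con_2_P P.con_0_P])+
  show "con one (Suc 0) M.Pf = M.Df" "con one (Suc 0) M.Rf = 0"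
    unfolding M_R by (rule minus_module_contractions[OF 2 M.con_2_P M.con_0_P])+
qed

lemma P_contract: "(\<Sum>a\<in>UNIV. lact Mp (f i * v a) (dp a l)) = 0"
  "(\<Sum>a\<in>UNIV. ract Mp (dp i a) (f a * v l)) = dp i l"
  and M_contract: "(\<Sum>a\<in>UNIV. lact Mm (f i * v a) (dm a l)) = dm i l"
  "(\<Sum>a\<in>UNIV. ract Mm (dm i a) (f a * v l)) = 0"
  using contractions[THEN fun_cong, of "i ## l ## undefined"]
  by (simp_all add: con_1 P.Pf_def P.Rf_def P.Df_def M.Pf_def M.Rf_def M.Df_def eval_nat_numeral scaleC_one)

lemma sum_delta_left: "(\<Sum>i\<in>UNIV. wq i *C (if i = k then inverse (wq i) *C g i else 0)) = (g (k::'n) :: 'z::complex_vector)"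
  by (simp add: scaleC_scaleC_if if_distrib[of "\<lambda>x. _ *C x"] scaleC_scaleC scaleC_one cong: if_cong)

text \<open>The sum is right linear in \<open>x\<close>, so generators suffice by
  \<open>right_span\<close>. The C' term leaves the middle contraction of \<partial>p p, which is
  \<partial>p; in the p p term the same contraction leaves the trace E' \<partial>p = 0 multiplied
  by p.\<close>

lemma inverse_plus_left: "(\<Sum>i\<in>UNIV. \<Sum>j\<in>UNIV. wq i *C ract Mp (dp i j) (mp.beta (dm j i) x)) = x"
proof (rule P.right_span)
  fix k l
  define z where "z = qc powi (1 - int N)"
  have b: "mp.beta (dm j i) (dp k l) =
    (if i = k then inverse (wq i) *C (f j * v l) else 0) - z *C ((f j * v i) * (f k * v l))" for i j
    unfolding mp.beta_d mp.bs_def beta_mp_eq z_def by (simp add: eval_nat_numeral)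
  have "ract Mp (dp i j) (mp.beta (dm j i) (dp k l)) =
    (if i = k then inverse (wq i) *C ract Mp (dp i j) (f j * v l) else 0) -
      z *C ract Mp (ract Mp (dp i j) (f j * v i)) (f k * v l)" for i j
    unfolding b by (simp add: P.minus_ra P.ra_scaleC P.mult_ra P.scale_closed P.mult_closed P.p_closed P.zero_closed P.zero_ra)
  then have "(\<Sum>j\<in>UNIV. ract Mp (dp i j) (mp.beta (dm j i) (dp k l))) =
    (if i = k then inverse (wq i) *C dp i l else 0) - z *C ract Mp (dp i i) (f k * v l)" for i
    by (simp add: sum_subtractf scaleC_sum_right[symmetric] P.ra_sum[OF P.p_closed, symmetric] P_contract)
  then have "(\<Sum>i\<in>UNIV. \<Sum>j\<in>UNIV. wq i *C ract Mp (dp i j) (mp.beta (dm j i) (dp k l))) =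
    (\<Sum>i\<in>UNIV. wq i *C (if i = k then inverse (wq i) *C dp i l else 0)) -
      z *C ract Mp (\<Sum>i\<in>UNIV. wq i *C dp i i) (f k * v l)"
    by (simp add: scaleC_sum_right[symmetric] scaleC_diff_right sum_subtractf P.ra_sum P.p_closed
        P.scaleC_ra)
      (simp add: scaleC_sum_right scaleC_left_commute[of z])
  then show "(\<Sum>i\<in>UNIV. \<Sum>j\<in>UNIV. wq i *C ract Mp (dp i j) (mp.beta (dm j i) (dp k l))) = dp k l"
    by (simp only: sum_delta_left P.d_trace P.ra_zero[OF P.p_closed] scaleC_zero_right diff_zero)
next
  fix x b
  assume "(\<Sum>i\<in>UNIV. \<Sum>j\<in>UNIV. wq i *C ract Mp (dp i j) (mp.beta (dm j i) x)) = x" "b \<in> Bs"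
  then show "(\<Sum>i\<in>UNIV. \<Sum>j\<in>UNIV. wq i *C ract Mp (dp i j) (mp.beta (dm j i) (ract Mp x b))) = ract Mp x b"
    by (simp add: mp.beta_right_linear P.mult_ra mp.beta_closed flip: P.scaleC_ra P.ra_sum)
qed (simp add: mp.beta_add_right P.add_ra mp.beta_closed scaleC_add_right sum.distrib)

text \<open>The mirror image, left linear in \<open>x\<close>: here the middle contraction of p dbar
  p is dbar p.\<close>

lemma inverse_minus_right: "(\<Sum>i\<in>UNIV. \<Sum>j\<in>UNIV. wq i *C lact Mm (mp.beta x (dp i j)) (dm j i)) = x"
proof (rule M.left_span)
  fix k l
  define z where "z = qc powi (1 - int N)"
  have b: "mp.beta (dm k l) (dp i j) =
    (if i = l then inverse (wq i) *C (f k * v j) else 0) - z *C ((f k * v l) * (f i * v j))" for i j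
    unfolding mp.beta_d mp.bs_def beta_mp_eq z_def by (simp add: eval_nat_numeral)
  have "lact Mm (mp.beta (dm k l) (dp i j)) (dm j i) =
    (if i = l then inverse (wq i) *C lact Mm (f k * v j) (dm j i) else 0) -
      z *C lact Mm (f k * v l) (lact Mm (f i * v j) (dm j i))" for i j
    unfolding b by (simp add: M.minus_la M.scaleC_la M.mult_la P.scale_closed P.mult_closed P.p_closed P.zero_closed M.zero_la)
  then have "(\<Sum>j\<in>UNIV. lact Mm (mp.beta (dm k l) (dp i j)) (dm j i)) =
    (if i = l then inverse (wq i) *C dm k i else 0) - z *C lact Mm (f k * v l) (dm i i)" for i
    by (simp add: sum_subtractf scaleC_sum_right[symmetric] M.la_sum[OF P.p_closed, symmetric] M_contract)
  then have "(\<Sum>i\<in>UNIV. \<Sum>j\<in>UNIV. wq i *C lact Mm (mp.beta (dm k l) (dp i j)) (dm j i)) =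
    (\<Sum>i\<in>UNIV. wq i *C (if i = l then inverse (wq i) *C dm k i else 0)) -
      z *C lact Mm (f k * v l) (\<Sum>i\<in>UNIV. wq i *C dm i i)"
    by (simp add: scaleC_sum_right[symmetric] scaleC_diff_right sum_subtractf M.la_sum P.p_closed
        M.la_scaleC)
      (simp add: scaleC_sum_right scaleC_left_commute[of z])
  then show "(\<Sum>i\<in>UNIV. \<Sum>j\<in>UNIV. wq i *C lact Mm (mp.beta (dm k l) (dp i j)) (dm j i)) = dm k l"
    by (simp only: sum_delta_left M.d_trace M.la_zero[OF P.p_closed] scaleC_zero_right diff_zero)
next
  fix x b
  assume "(\<Sum>i\<in>UNIV. \<Sum>j\<in>UNIV. wq i *C lact Mm (mp.beta x (dp i j)) (dm j i)) = x" "b \<in> Bs"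
  then show "(\<Sum>i\<in>UNIV. \<Sum>j\<in>UNIV. wq i *C lact Mm (mp.beta (lact Mm b x) (dp i j)) (dm j i)) = lact Mm b x"
    by (simp add: mp.beta_la M.mult_la mp.beta_closed flip: M.la_scaleC M.la_sum)
qed (simp add: mp.beta_add_left M.add_la mp.beta_closed scaleC_add_right sum.distrib)

lemma powi_inverse: "qc powi (2 - int N) *C inverse qc *C qc powi (int N - 1) *C x = (x :: 'z::complex_vector)"
proof -
  have "qc powi (2 - int N) * (inverse qc * qc powi (int N - 1)) = 1"
    by (simp add: power_int_diff power2_eq_square)
  then show ?thesis
    by (simp add: scaleC_scaleC scaleC_one)
qed

text \<open>The p p term vanishes because the middle contraction of p \<partial>p is 0. Contracting
  the coevaluation inside the S term with \<partial>p gives S p \<partial>p, that is \<partial>p p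
  divided by q, and E' on its last two legs returns \<partial>p up to the power of q that the
  prescribed coefficient cancels.\<close>

lemma inverse_plus_right: "(\<Sum>i\<in>UNIV. \<Sum>j\<in>UNIV. wq i *C lact Mp (pm.beta x (dm i j)) (dp j i)) = x"
proof (rule P.left_span)
  fix k l
  define z where "z = qc powi (2 - int N)"
  define z' where "z' = qc powi (3 - int N)"
  define S where "S i j = Sop 0 (F (W (C u1))) (k ## l ## i ## j ## (\<lambda>_. k))" for i j
  have id: "clinear_on Bs (\<lambda>x. x)"
    by (simp add: clinear_on_def P.zero_closed P.add_closed P.scale_closed)
  have S_closed: "S i j \<in> Bs" for i j
    unfolding S_def Sop_Lop by (rule clinear_on_Lop(1)[OF id]) (simp add: FWC_eq P.p_closed P.zero_closed)
  have b: "pm.beta (dp k l) (dm i j) = z *C S i j - z' *C ((f k * v l) * (f i * v j))" for i j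
    unfolding pm.beta_d pm.bs_def beta_pm_eq z_def z'_def S_def by (simp add: eval_nat_numeral)
  have S: "(\<Sum>j\<in>UNIV. lact Mp (S i j) (dp j i')) = Sop 0 P.Pf (k ## l ## i ## i' ## (\<lambda>_. k))" for i i'
  proof -
    have "lact Mp (S i j) (dp j i') =
      (\<Sum>a\<in>UNIV. \<Sum>b\<in>UNIV. \<Sum>c\<in>UNIV. if c = j then Sc k l i a b c *C lact Mp (f a * v b) (dp j i') else 0)" for j
      unfolding S_def Sop_coeff
      by (simp add: FWC_eq eval_nat_numeral P.sum_la P.sum_closed P.scale_closed P.p_closed P.zero_closed P.scaleC_la
          P.zero_la if_distrib[of "\<lambda>x. _ *C x"] if_distrib[of "\<lambda>x. lact Mp x _"] cong: if_cong)
    then have "(\<Sum>j\<in>UNIV. lact Mp (S i j) (dp j i')) =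
      (\<Sum>j\<in>UNIV. \<Sum>a\<in>UNIV. \<Sum>b\<in>UNIV. \<Sum>c\<in>UNIV. if c = j then Sc k l i a b c *C lact Mp (f a * v b) (dp j i') else 0)"
      by simp
    also have "\<dots> = (\<Sum>a\<in>UNIV. \<Sum>b\<in>UNIV. \<Sum>c\<in>UNIV. \<Sum>j\<in>UNIV. if c = j then Sc k l i a b c *C lact Mp (f a * v b) (dp j i') else 0)"
      by (rule sum_rotate4)
    also have "\<dots> = Sop 0 P.Pf (k ## l ## i ## i' ## (\<lambda>_. k))"
      unfolding Sop_coeff by (simp add: P.Pf_def eval_nat_numeral)
    finally show ?thesis .
  qed
  have "lact Mp (pm.beta (dp k l) (dm i j)) (dp j i) =
      z *C lact Mp (S i j) (dp j i) - z' *C lact Mp (f k * v l) (lact Mp (f i * v j) (dp j i))" for i j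
    unfolding b by (simp add: P.minus_la P.scaleC_la P.mult_la P.scale_closed P.mult_closed P.p_closed S_closed)
  then have "(\<Sum>j\<in>UNIV. lact Mp (pm.beta (dp k l) (dm i j)) (dp j i)) =
      z *C Sop 0 P.Pf (k ## l ## i ## i ## (\<lambda>_. k))" for i
    by (simp add: sum_subtractf scaleC_sum_right[symmetric] P.la_sum[OF P.p_closed, symmetric] P_contract S
        P.la_zero P.p_closed)
  then have "(\<Sum>i\<in>UNIV. \<Sum>j\<in>UNIV. wq i *C lact Mp (pm.beta (dp k l) (dm i j)) (dp j i)) =
      z *C con wq 2 (Sop 0 P.Pf) (k ## l ## (\<lambda>_. k))"
    by (simp add: scaleC_sum_right[symmetric] con_2) (simp add: scaleC_sum_right scaleC_left_commute[of z])
  also have "con wq 2 (Sop 0 P.Pf) = inverse qc *C con wq 2 P.Rf"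
    unfolding P_R con_scaleC by simp
  finally show "(\<Sum>i\<in>UNIV. \<Sum>j\<in>UNIV. wq i *C lact Mp (pm.beta (dp k l) (dm i j)) (dp j i)) = dp k l"
    unfolding P.con_2_R z_def by (simp add: scaleC_fun_def powi_inverse P.Df_def)
next
  fix x b
  assume "(\<Sum>i\<in>UNIV. \<Sum>j\<in>UNIV. wq i *C lact Mp (pm.beta x (dm i j)) (dp j i)) = x" "b \<in> Bs"
  then show "(\<Sum>i\<in>UNIV. \<Sum>j\<in>UNIV. wq i *C lact Mp (pm.beta (lact Mp b x) (dm i j)) (dp j i)) = lact Mp b x"
    by (simp add: pm.beta_la P.mult_la pm.beta_closed flip: P.la_scaleC P.la_sum)
qed (simp add: pm.beta_add_left P.add_la pm.beta_closed scaleC_add_right sum.distrib)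

text \<open>The leading term is used in the form with C in front (\<open>Sop_FWC\<close>).
  Contracting C with dbar p leaves the inverse of S with a tilde on dbar p p, that is p dbar p
  divided by q, and E' on the first two legs finishes as before.\<close>

lemma inverse_minus_left: "(\<Sum>i\<in>UNIV. \<Sum>j\<in>UNIV. wq i *C ract Mm (dm i j) (pm.beta (dp j i) x)) = x"
proof (rule M.right_span)
  fix k l
  define z where "z = qc powi (2 - int N)"
  define z' where "z' = qc powi (3 - int N)"
  define S where "S j i = Sop 0 (F (W (C u1))) (j ## i ## k ## l ## (\<lambda>_. k))" for i j
  have id: "clinear_on Bs (\<lambda>x. x)"
    by (simp add: clinear_on_def P.zero_closed P.add_closed P.scale_closed)
  have S_closed': "Sop 0 (F (W (C u1))) \<phi> \<in> Bs" for \<phi>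
    unfolding Sop_Lop by (rule clinear_on_Lop(1)[OF id]) (simp add: FWC_eq P.p_closed P.zero_closed)
  have S_closed: "S j i \<in> Bs" for i j
    unfolding S_def by (rule S_closed')
  have b': "beta_pm u1 (j ## i ## k ## l ## (\<lambda>_. k)) = z *C S j i - z' *C ((f j * v i) * (f k * v l))" for i j
    unfolding beta_pm_eq z_def z'_def S_def by (simp add: eval_nat_numeral)
  have b: "pm.beta (dp j i) (dm k l) = z *C S j i - z' *C ((f j * v i) * (f k * v l))" for i j
    unfolding b'[symmetric] pm.beta_d using pm.bs_b[of "j ## i ## k ## l ## (\<lambda>_. k)"] by (simp add: eval_nat_numeral)
  have S: "(\<Sum>j\<in>UNIV. ract Mm (dm i' j) (S j i)) = Stiop (Suc 0) M.Rf (i' ## i ## k ## l ## (\<lambda>_. k))" for i i'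
  proof -
    have "ract Mm (dm i' j) (S j i) =
      (\<Sum>a\<in>UNIV. \<Sum>b\<in>UNIV. \<Sum>c\<in>UNIV. if j = a then Stc i k l a b c *C ract Mm (dm i' j) (f b * v c) else 0)" for j
      unfolding S_def Sop_FWC Stiop_coeff
      by (simp add: CFW_eq eval_nat_numeral M.sum_ra P.sum_closed P.scale_closed P.p_closed P.zero_closed M.ra_scaleC
          M.zero_ra if_distrib[of "\<lambda>x. _ *C x"] if_distrib[of "\<lambda>x. ract Mm _ x"] cong: if_cong)
    then have "(\<Sum>j\<in>UNIV. ract Mm (dm i' j) (S j i)) =
      (\<Sum>j\<in>UNIV. \<Sum>a\<in>UNIV. \<Sum>b\<in>UNIV. \<Sum>c\<in>UNIV. if j = a then Stc i k l a b c *C ract Mm (dm i' j) (f b * v c) else 0)"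
      by simp
    also have "\<dots> = (\<Sum>a\<in>UNIV. \<Sum>b\<in>UNIV. \<Sum>c\<in>UNIV. \<Sum>j\<in>UNIV. if j = a then Stc i k l a b c *C ract Mm (dm i' j) (f b * v c) else 0)"
      by (rule sum_rotate4)
    also have "\<dots> = Stiop (Suc 0) M.Rf (i' ## i ## k ## l ## (\<lambda>_. k))"
      unfolding Stiop_coeff by (simp add: M.Rf_def eval_nat_numeral)
    finally show ?thesis .
  qed
  have "ract Mm (dm i j) (pm.beta (dp j i) (dm k l)) =
      z *C ract Mm (dm i j) (S j i) - z' *C ract Mm (ract Mm (dm i j) (f j * v i)) (f k * v l)" for i j
    unfolding b by (simp add: M.minus_ra M.ra_scaleC M.mult_ra P.scale_closed P.mult_closed P.p_closed S_closed)
  then have "(\<Sum>j\<in>UNIV. ract Mm (dm i j) (pm.beta (dp j i) (dm k l))) =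
      z *C Stiop (Suc 0) M.Rf (i ## i ## k ## l ## (\<lambda>_. k))" for i
    by (simp add: sum_subtractf scaleC_sum_right[symmetric] M.ra_sum[OF P.p_closed, symmetric] M_contract S
        M.ra_zero P.p_closed)
  then have "(\<Sum>i\<in>UNIV. \<Sum>j\<in>UNIV. wq i *C ract Mm (dm i j) (pm.beta (dp j i) (dm k l))) =
      z *C con wq 0 (Stiop (Suc 0) M.Rf) (k ## l ## (\<lambda>_. k))"
    by (simp add: scaleC_sum_right[symmetric] con_0) (simp add: scaleC_sum_right scaleC_left_commute[of z])
  also have "Stiop (Suc 0) M.Rf = inverse qc *C M.Pf"
    unfolding M_R Stiop_linear by simp
  finally show "(\<Sum>i\<in>UNIV. \<Sum>j\<in>UNIV. wq i *C ract Mm (dm i j) (pm.beta (dp j i) (dm k l))) = dm k l"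
    unfolding con_scaleC M.con_0_P z_def by (simp add: scaleC_fun_def powi_inverse M.Df_def)
next
  fix x b
  assume "(\<Sum>i\<in>UNIV. \<Sum>j\<in>UNIV. wq i *C ract Mm (dm i j) (pm.beta (dp j i) x)) = x" "b \<in> Bs"
  then show "(\<Sum>i\<in>UNIV. \<Sum>j\<in>UNIV. wq i *C ract Mm (dm i j) (pm.beta (dp j i) (ract Mm x b))) = ract Mm x b"
    by (simp add: pm.beta_right_linear M.mult_ra pm.beta_closed flip: M.scaleC_ra M.ra_sum)
qed (simp add: pm.beta_add_right M.add_ra pm.beta_closed scaleC_add_right sum.distrib)

end

section \<open>The quantum projective space\<close>

lemma poly_mapping_decompose: "z = (\<Sum>w\<in>Poly_Mapping.keys z. Poly_Mapping.single w (Poly_Mapping.lookup z w))"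
  by (rule poly_mapping_eqI) (simp add: lookup_sum lookup_single when_def in_keys_iff)

lemma free_eval_superset:
  assumes "finite A" "Poly_Mapping.keys z \<subseteq> A"
  shows "free_eval f v z = (\<Sum>w\<in>A. Poly_Mapping.lookup z w *C prod_list (map (case_gen f v) (letters w)))"
  unfolding free_eval_def using assms by (intro sum.mono_neutral_left) (auto simp: in_keys_iff)

lemma free_eval_add: "free_eval f v (x + y) = free_eval f v x + free_eval f v y"
proof -
  have "Poly_Mapping.keys (x + y) \<subseteq> Poly_Mapping.keys x \<union> Poly_Mapping.keys y"
    by (rule keys_add)
  then show ?thesis
    by (simp add: free_eval_superset[of "Poly_Mapping.keys x \<union> Poly_Mapping.keys y"] lookup_add scaleC_add_left
        sum.distrib)
qed

lemma keys_scaleC: "Poly_Mapping.keys (c *C x) \<subseteq> Poly_Mapping.keys (x :: 'x \<Rightarrow>\<^sub>0 complex)"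
  by (auto simp: in_keys_iff lookup_scaleC scaleC_complex_def)

lemma free_eval_scale: "free_eval f v (c *C x) = c *C free_eval f v x"
  by (simp add: free_eval_superset[of "Poly_Mapping.keys x", OF finite_keys keys_scaleC]
      free_eval_superset[of "Poly_Mapping.keys x", OF finite_keys order.refl]
      lookup_scaleC scaleC_sum_right scaleC_scaleC scaleC_complex_def)

lemma free_eval_zero: "free_eval f v 0 = 0"
  by (simp add: free_eval_def)

lemma free_eval_diff: "free_eval f v (x - y) = free_eval f v x - free_eval f v y"
  using free_eval_add[of f v "x - y" y] by simp

lemma free_eval_sum: "free_eval f v (sum g I) = (\<Sum>i\<in>I. free_eval f v (g i))"
  by (induction I rule: infinite_finite_induct) (simp_all add: free_eval_zero free_eval_add)

lemma free_eval_single: "free_eval f v (Poly_Mapping.single w c) = c *C prod_list (map (case_gen f v) (letters w))"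
  by (simp add: free_eval_superset[of "{w}"])

lemma free_eval_mult: "free_eval f v (x * y) = free_eval f v x * free_eval f v y"
proof -
  have 1: "free_eval f v (Poly_Mapping.single u a * Poly_Mapping.single w b) =
    free_eval f v (Poly_Mapping.single u a) * free_eval f v (Poly_Mapping.single w b)" for u w a b
    by (simp add: mult_single free_eval_single plus_word_def mult_scaleC_left mult_scaleC_right scaleC_scaleC mult.commute[of b a])
  have 2: "free_eval f v ((\<Sum>u\<in>A. Poly_Mapping.single u (g u)) * (\<Sum>w\<in>B. Poly_Mapping.single w (h w))) =
    free_eval f v (\<Sum>u\<in>A. Poly_Mapping.single u (g u)) * free_eval f v (\<Sum>w\<in>B. Poly_Mapping.single w (h w))" for A B g h
    by (simp add: sum_product free_eval_sum 1)
  show ?thesis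
    using 2[where A = "Poly_Mapping.keys x" and g = "Poly_Mapping.lookup x"
      and B = "Poly_Mapping.keys y" and h = "Poly_Mapping.lookup y"]
    unfolding poly_mapping_decompose[symmetric] .
qed

lemma free_eval_one: "free_eval f v 1 = 1"
  using free_eval_single[of f v 0 1] unfolding single_one by (simp add: zero_word_def scaleC_one)

lemma free_eval_gen: "free_eval f v (free_f i) = f i" "free_eval f v (free_v i) = v i"
  by (simp_all add: free_f_def free_v_def free_eval_single scaleC_one)

lemmas free_eval_simps = free_eval_add free_eval_scale free_eval_zero free_eval_diff free_eval_sum
  free_eval_mult free_eval_one free_eval_gen

lemma proj_space_subalgebra: "subalgebra (proj_space f v)"
proof
  let ?D = "{z. \<forall>w\<in>Poly_Mapping.keys z. word_degree w = 0}"
  have "1 \<in> ?D"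
    by (simp add: word_degree_def zero_word_def)
  then show "1 \<in> proj_space f v"
    unfolding proj_space_def by (intro image_eqI[of _ _ 1]) (simp_all add: free_eval_one)
  fix x y assume "x \<in> proj_space f v" "y \<in> proj_space f v"
  then obtain a b where a: "a \<in> ?D" "x = free_eval f v a" and b: "b \<in> ?D" "y = free_eval f v b"
    unfolding proj_space_def by blast
  have "a + b \<in> ?D"
    using a(1) b(1) keys_add[of a b] by auto
  then show "x + y \<in> proj_space f v"
    unfolding proj_space_def a(2) b(2) free_eval_add[symmetric] by blast
  have "a * b \<in> ?D"
  proof safe
    fix w assume "w \<in> Poly_Mapping.keys (a * b)"
    then obtain u u' where "w = u + u'" "u \<in> Poly_Mapping.keys a" "u' \<in> Poly_Mapping.keys b"
      using keys_mult[of a b] by blast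
    then show "word_degree w = 0"
      using a(1) b(1) by (simp add: word_degree_def plus_word_def)
  qed
  then show "x * y \<in> proj_space f v"
    unfolding proj_space_def a(2) b(2) free_eval_mult[symmetric] by blast
next
  fix x c assume "x \<in> proj_space f v"
  then obtain a where a: "\<forall>w\<in>Poly_Mapping.keys a. word_degree w = 0" "x = free_eval f v a"
    unfolding proj_space_def by blast
  then show "c *C x \<in> proj_space f v"
    unfolding proj_space_def a(2) free_eval_scale[symmetric] using keys_scaleC[of c a] by blast
qed

lemma pp_closed: "f i * v j \<in> proj_space f v"
proof -
  let ?z = "Poly_Mapping.single (Word [gen_f i, gen_v j]) (1::complex)"
  have "free_eval f v ?z = f i * v j"
    by (simp add: free_eval_single scaleC_one)
  moreover have "\<forall>w\<in>Poly_Mapping.keys ?z. word_degree w = 0"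
    by (simp add: word_degree_def)
  then have "free_eval f v ?z \<in> proj_space f v"
    unfolding proj_space_def by blast
  ultimately show ?thesis by simp
qed

text \<open>
  The elements of degree \<open>n\<close> obtained from a set of elements of degree zero by multiplication on the
  right with only \<open>f\<close>s or only \<open>v\<close>s.
\<close>

inductive graded_span :: "('n \<Rightarrow> 'a) \<Rightarrow> ('n \<Rightarrow> 'a) \<Rightarrow> 'a::complex_algebra set \<Rightarrow> int \<Rightarrow> 'a \<Rightarrow> bool"
  for f v S where
  base: "x \<in> S \<Longrightarrow> graded_span f v S 0 x"
| mult_f: "graded_span f v S n x \<Longrightarrow> 0 \<le> n \<Longrightarrow> graded_span f v S (n + 1) (x * f i)"
| mult_v: "graded_span f v S n x \<Longrightarrow> n \<le> 0 \<Longrightarrow> graded_span f v S (n - 1) (x * v i)"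
| add: "graded_span f v S n x \<Longrightarrow> graded_span f v S n y \<Longrightarrow> graded_span f v S n (x + y)"
| scale: "graded_span f v S n x \<Longrightarrow> graded_span f v S n (c *C x)"

section \<open>Generation of the degree-zero subalgebra by p\<close>

context coord_algebra
begin

lemma vf_eq: "v j * f i = qc *C (\<Sum>a\<in>UNIV. \<Sum>b\<in>UNIV. Xm $ (j, i) $ (a, b) *C (f a * v b))"
  by (simp add: fv)

lemma fv_eq: "f i * v j = inverse qc *C (\<Sum>a\<in>UNIV. \<Sum>b\<in>UNIV. Ym $ (i, j) $ (a, b) *C (v a * f b))"
proof -
  have "op Ym 0 (W (F (\<lambda>_. 1))) (i ## j ## undefined) = (qc *C F (W (\<lambda>_. 1))) (i ## j ## undefined)"
    by (simp only: Ym_WF)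
  then have "(\<Sum>a\<in>UNIV. \<Sum>b\<in>UNIV. Ym $ (i, j) $ (a, b) *C (v a * f b)) = qc *C (f i * v j)"
    by (simp add: fam_simps scaleC_fun_def)
  then show ?thesis by simp
qed

context
  fixes S :: "'a set"
  assumes S_add: "\<And>x y. x \<in> S \<Longrightarrow> y \<in> S \<Longrightarrow> x + y \<in> S" and S_scale: "\<And>c x. x \<in> S \<Longrightarrow> c *C x \<in> S"
    and S_p: "\<And>x i j. x \<in> S \<Longrightarrow> x * (f i * v j) \<in> S" and S_0: "0 \<in> S"
begin

lemma graded_span_sum:
  "graded_span f v S n 0 \<Longrightarrow> (\<And>i. i \<in> I \<Longrightarrow> graded_span f v S n (g i)) \<Longrightarrow> graded_span f v S n (sum g I)"
  by (induction I rule: infinite_finite_induct) (auto intro: graded_span.add)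

lemma graded_span_zero: "graded_span f v S n x \<Longrightarrow> graded_span f v S n 0"
  using graded_span.scale[of f v S n x 0] by simp

text \<open>The exchange relation moves p to the left of the last letter: f_k f_i v_j is a
  combination of the (f_k v_a) f_b, and v_k f_i v_j one of the (f_a v_b) v_j.\<close>

lemma graded_span_p: "graded_span f v S n x \<Longrightarrow> graded_span f v S n (x * (f i * v j))"
proof (induction arbitrary: i j rule: graded_span.induct)
  case (mult_f n x k)
  have "x * f k * (f i * v j) = inverse qc *C (\<Sum>a\<in>UNIV. \<Sum>b\<in>UNIV. Ym $ (i, j) $ (a, b) *C (x * (f k * v a) * f b))"
    unfolding fv_eq[of i j] by (simp add: mult_scaleC_right sum_distrib_left mult.assoc)
  also have "graded_span f v S (n + 1) \<dots>"
    using graded_span.mult_f[OF mult_f.IH mult_f.hyps(2)]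
    by (intro graded_span.scale graded_span_sum graded_span_zero[OF graded_span.mult_f[OF mult_f.IH mult_f.hyps(2)]])
  finally show ?case .
next
  case (mult_v n x k)
  have "x * v k * (f i * v j) = qc *C (\<Sum>a\<in>UNIV. \<Sum>b\<in>UNIV. Xm $ (k, i) $ (a, b) *C (x * (f a * v b) * v j))"
    by (simp add: mult.assoc[of x "v k"] mult.assoc[of "v k" "f i", symmetric] vf_eq mult_scaleC_right mult_scaleC_left
        sum_distrib_left sum_distrib_right mult.assoc)
  also have "graded_span f v S (n - 1) \<dots>"
    using graded_span.mult_v[OF mult_v.IH mult_v.hyps(2)]
    by (intro graded_span.scale graded_span_sum graded_span_zero[OF graded_span.mult_v[OF mult_v.IH mult_v.hyps(2)]])
  finally show ?case .
qed (auto simp: distrib_right mult_scaleC_left intro: graded_span.base graded_span.add graded_span.scale S_p)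

lemma graded_span_v: "graded_span f v S n x \<Longrightarrow> graded_span f v S (n - 1) (x * v j)"
proof (cases "n \<le> 0")
  case False
  assume "graded_span f v S n x"
  then show ?thesis
    using False
  proof (induction rule: graded_span.induct)
    case (mult_f n x k)
    then show ?case
      using graded_span_p[of n x k j] by (simp add: mult.assoc)
  qed (auto simp: distrib_right mult_scaleC_left intro: graded_span.add graded_span.scale)
qed (rule graded_span.mult_v)

lemma graded_span_f: "graded_span f v S n x \<Longrightarrow> graded_span f v S (n + 1) (x * f j)"
proof (cases "0 \<le> n")
  case False
  assume "graded_span f v S n x"
  then show ?thesis
    using False
  proof (induction rule: graded_span.induct)
    case (mult_v n x k)
    have "x * v k * f j = qc *C (\<Sum>a\<in>UNIV. \<Sum>b\<in>UNIV. Xm $ (k, j) $ (a, b) *C (x * (f a * v b)))"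
      by (simp add: mult.assoc[of x "v k"] vf_eq mult_scaleC_right sum_distrib_left)
    also have "graded_span f v S n \<dots>"
      by (intro graded_span.scale graded_span_sum[OF graded_span_zero[OF mult_v.hyps(1)]] graded_span_p mult_v.hyps)
    finally show ?case by simp
  qed (auto simp: distrib_right mult_scaleC_left intro: graded_span.add graded_span.scale)
qed (rule graded_span.mult_f)

text \<open>The side conditions of \<open>mult_f\<close> and \<open>mult_v\<close> make these two
  rules lead away from degree 0, so degree 0 consists of sums and multiples of elements of
  \<open>S\<close>.\<close>

lemma graded_span_0: "graded_span f v S n x \<Longrightarrow> n = 0 \<Longrightarrow> x \<in> S"
proof (induction rule: graded_span.induct)
  case (mult_f n x i)
  then show ?case by simp
qed (auto intro: S_add S_scale)

text \<open>A word of degree 0 may mix its letters in any order. Reading it from the left, each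
  letter that lowers the absolute degree is absorbed into a factor p, so the word ends in
  \<open>S\<close>.\<close>

lemma proj_space_subset:
  assumes one: "1 \<in> S"
  shows "proj_space f v \<subseteq> S"
proof
  fix b assume "b \<in> proj_space f v"
  then obtain z where z: "b = free_eval f v z" "\<forall>w\<in>Poly_Mapping.keys z. word_degree w = 0"
    unfolding proj_space_def by blast
  have word: "graded_span f v S (sum_list (map gen_degree ws)) (prod_list (map (case_gen f v) ws))" for ws
  proof (induction ws rule: rev_induct)
    case Nil
    then show ?case using graded_span.base[OF one] by simp
  next
    case (snoc g ws)
    then show ?case
      using graded_span_f graded_span_v by (cases g) simp_all
  qed
  have "prod_list (map (case_gen f v) (letters w)) \<in> S" if "w \<in> Poly_Mapping.keys z" for w
    using word[of "letters w"] z(2) that unfolding word_degree_def by (auto intro: graded_span_0)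
  then have "(\<Sum>w\<in>A. Poly_Mapping.lookup z w *C prod_list (map (case_gen f v) (letters w))) \<in> S"
    if "A \<subseteq> Poly_Mapping.keys z" for A
    using that by (induction A rule: infinite_finite_induct) (auto simp: S_0 intro: S_add S_scale)
  then show "b \<in> S"
    unfolding z(1) free_eval_def by blast
qed

end

lemma proj_space_induct:
  assumes "b \<in> proj_space f v" "Q 1" "\<And>x y. Q x \<Longrightarrow> Q y \<Longrightarrow> Q (x + y)" "\<And>z x. Q x \<Longrightarrow> Q (z *C x)"
    "\<And>x i j. x \<in> proj_space f v \<Longrightarrow> Q x \<Longrightarrow> Q (x * (f i * v j))"
  shows "Q b"
proof -
  interpret subalgebra "proj_space f v"
    by (rule proj_space_subalgebra)
  have "proj_space f v \<subseteq> {x \<in> proj_space f v. Q x}"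
    using assms(2-5) assms(4)[of 1 0]
    by (intro proj_space_subset) (auto intro: add_closed scale_closed mult_closed pp_closed one_closed zero_closed)
  then show ?thesis
    using assms(1) by blast
qed

end

section \<open>Transfer from legs to sequences\<close>

definition tr :: "nat \<Rightarrow> ('n, 'm) legs \<Rightarrow> ('n, 'm) fam" where
  "tr n x \<phi> = x (map \<phi> [0..<n])"

lemma tr_nth: "length I = n \<Longrightarrow> tr n x ((!) I) = x I"
  by (auto simp: tr_def map_nth)

lemma leg_components_tr: "leg_components n x = range (tr n x)"
proof
  show "leg_components n x \<subseteq> range (tr n x)"
    unfolding leg_components_def by (metis (mono_tags, lifting) image_subsetI mem_Collect_eq rangeI tr_nth)
  show "range (tr n x) \<subseteq> leg_components n x"
    unfolding leg_components_def tr_def by auto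
qed

lemma tr_leg_op:
  assumes "Suc k < n"
  shows "tr n (leg_op R (Suc k) x) = op R k (tr n x)"
proof
  fix \<phi> :: "nat \<Rightarrow> 'a"
  have "(map \<phi> [0..<n])[k := a, Suc k := b] = map (\<phi>(k := a, Suc k := b)) [0..<n]" for a b
    by (rule nth_equalityI) (auto simp: nth_list_update)
  then show "tr n (leg_op R (Suc k) x) \<phi> = op R k (tr n x) \<phi>"
    using assms by (simp add: tr_def leg_op_def op_eq_upd)
qed

lemma matrix_inv_eqI:
  fixes A :: "complex^'a::finite^'a"
  assumes "A ** B = mat 1" "B ** A = mat 1"
  shows "matrix_inv A = B"
proof -
  define C where "C = matrix_inv A"
  have C: "A ** C = mat 1 \<and> C ** A = mat 1"
    unfolding C_def matrix_inv_def by (rule someI[of _ B]) (simp add: assms)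
  have "C = (B ** A) ** C"
    by (simp add: assms)
  then show ?thesis
    using C by (simp add: matrix_mul_assoc[symmetric] C_def)
qed

lemma matrix_inv_scaleC:
  fixes A :: "complex^'a::finite^'a"
  assumes "A ** B = mat 1" "B ** A = mat 1" "c \<noteq> 0"
  shows "matrix_inv (c *C A) = inverse c *C B"
  by (rule matrix_inv_eqI) (simp_all add: scaleC_matrix_mult assms scaleC_scaleC scaleC_one)

context quantum_fundamental_module
begin

lemma qpow_mult: "qpow q x * qpow q y = qpow q (x + y)"
  by (simp add: qpow_def powr_add)

lemma qpow_0: "qpow q 0 = 1"
  using q by (simp add: qpow_def)

lemma qpow_inverse: "inverse (qpow q x) = qpow q (- x)"
  by (simp add: qpow_def powr_minus)

lemma qpow_powi: "qpow q (real_of_int z) = chain.qc powi z"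
proof -
  have "q powr real_of_int z = q powi z"
    using q by (simp add: powr_real_of_int')
  then show ?thesis
    unfolding qpow_def chain.qc_def by simp
qed

abbreviation "iN \<equiv> 1 / real (r + 1)"

lemmas braidings = chain.braiding_M_M chain.braiding_M_dual chain.braiding_dual_dual

lemma inverse_braidings:
  "matrix_inv (braiding q r V (dual_rep V)) = qpow q (- iN) *C chain.Ym"
  "matrix_inv (braiding q r (dual_rep V) (dual_rep V)) = qpow q iN *C chain.Rsi"
  unfolding braidings
  by (simp_all only: matrix_inv_scaleC[OF chain.Xm_Ym chain.Ym_Xm qpow_nz] matrix_inv_scaleC[OF chain.Rs_Rsi_mat qpow_nz]
      qpow_inverse minus_divide_left minus_minus)

lemma op_mat_scaleC: "op (c *C R) k x = c *C op R k x"
  by (simp only: op_mat_scale scaleC_fun_def)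

text \<open>The braiding of V with its dual and its inverse contribute opposite fractional powers,
  which leaves that of the braiding of V with itself. S with a tilde leaves the opposite power, so T
  has none.\<close>

lemma tr_S_op: "Suc (Suc k) < n \<Longrightarrow> tr n (S_op q r V (Suc k) x) = qpow q (- iN) *C chain.Sop k (tr n x)"
  unfolding S_op_def unfolding inverse_braidings unfolding braidings
  by (simp add: tr_leg_op op_mat_scaleC op_scaleC chain.Sop_def scaleC_scaleC qpow_mult)

lemma tr_St_op: "Suc (Suc k) < n \<Longrightarrow> tr n (St_op q r V (Suc k) x) = qpow q iN *C chain.Stop k (tr n x)"
  unfolding St_op_def unfolding inverse_braidings unfolding braidings
  by (simp add: tr_leg_op op_mat_scaleC op_scaleC chain.Stop_def scaleC_scaleC qpow_mult)

lemma tr_T_op: "Suc (Suc (Suc k)) < n \<Longrightarrow> tr n (T_op q r V (Suc k) x) = chain.Top k (tr n x)"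
  unfolding T_op_def
  by (simp add: tr_S_op tr_St_op chain.Top_def chain.Sop_linear scaleC_scaleC qpow_mult qpow_0 scaleC_one)

lemma omega_omega: "wform r (fund_weight r s) (fund_weight r s) = 1 - iN"
  unfolding omega_eq using wform_wtpos_wtpos(1)[of 0 r 0 dirb] by simp

lemma omega_rho: "wform r (fund_weight r s) (two_rho r) = real r"
proof -
  have "wform r (two_rho r) (wtpos dirb r 0) = real r"
    using wform_two_rho_wtpos[of 0 r dirb "wtpos dirb r 0"] wform_wtpos[of _ r 0 dirb] by simp
  then show ?thesis
    unfolding omega_eq by (simp add: wform_def mult.commute)
qed

lemma alpha_alpha: "wform r (simple_root s) (simple_root s) = 2"
proof -
  have "s \<in> {1..r}" using s rank by auto
  then show ?thesis
    by (simp only: wform_simple_root) (simp add: simple_root_def pos_root_def)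
qed

end

context quantum_projective_space
begin

lemma relation_zero: "z \<in> alg_relations q r s V free_f free_v \<Longrightarrow> free_eval f v z = 0"
  using presents unfolding presents_alg_def by (auto intro: hull_inc)

lemma coord_relations:
  "f i * f j = qpow q (- (1 - iN)) *C (\<Sum>a\<in>UNIV. \<Sum>b\<in>UNIV. braiding q r V V $ (i, j) $ (a, b) *C (f a * f b))"
  "v i * v j = qpow q (- (1 - iN)) *C (\<Sum>a\<in>UNIV. \<Sum>b\<in>UNIV. braiding q r (dual_rep V) (dual_rep V) $ (i, j) $ (a, b) *C (v a * v b))"
  "v i * f j = qpow q (1 - iN) *C (\<Sum>a\<in>UNIV. \<Sum>b\<in>UNIV. braiding q r V (dual_rep V) $ (i, j) $ (a, b) *C (f a * v b))"
  "(\<Sum>i\<in>UNIV. v i * f i) = 1"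
proof -
  let ?rel = "alg_relations q r s V free_f free_v"
  have "free_f i * free_f j - qpow q (- (1 - iN)) *C (\<Sum>a\<in>UNIV. \<Sum>b\<in>UNIV. braiding q r V V $ (i, j) $ (a, b) *C (free_f a * free_f b)) \<in> ?rel"
    unfolding alg_relations_def Let_def omega_omega leg_components_def
    by (intro UnI1 image_eqI[of _ _ "[i, j]"]) (simp_all add: leg_op_def leg_prod_def leg1_def)
  from relation_zero[OF this]
  show "f i * f j = qpow q (- (1 - iN)) *C (\<Sum>a\<in>UNIV. \<Sum>b\<in>UNIV. braiding q r V V $ (i, j) $ (a, b) *C (f a * f b))"
    by (simp add: free_eval_simps)
  have "free_v i * free_v j - qpow q (- (1 - iN)) *C (\<Sum>a\<in>UNIV. \<Sum>b\<in>UNIV. braiding q r (dual_rep V) (dual_rep V) $ (i, j) $ (a, b) *C (free_v a * free_v b)) \<in> ?rel"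
    unfolding alg_relations_def Let_def omega_omega leg_components_def
    by (rule UnI1, rule UnI1, rule UnI2, rule image_eqI[of _ _ "[i, j]"]) (simp_all add: leg_op_def leg_prod_def leg1_def)
  from relation_zero[OF this]
  show "v i * v j = qpow q (- (1 - iN)) *C (\<Sum>a\<in>UNIV. \<Sum>b\<in>UNIV. braiding q r (dual_rep V) (dual_rep V) $ (i, j) $ (a, b) *C (v a * v b))"
    by (simp add: free_eval_simps)
  have "free_v i * free_f j - qpow q (1 - iN) *C (\<Sum>a\<in>UNIV. \<Sum>b\<in>UNIV. braiding q r V (dual_rep V) $ (i, j) $ (a, b) *C (free_f a * free_v b)) \<in> ?rel"
    unfolding alg_relations_def Let_def omega_omega leg_components_def
    by (rule UnI1, rule UnI2, rule image_eqI[of _ _ "[i, j]"]) (simp_all add: leg_op_def leg_prod_def leg1_def)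
  from relation_zero[OF this]
  show "v i * f j = qpow q (1 - iN) *C (\<Sum>a\<in>UNIV. \<Sum>b\<in>UNIV. braiding q r V (dual_rep V) $ (i, j) $ (a, b) *C (f a * v b))"
    by (simp add: free_eval_simps)
  have "(\<Sum>i\<in>UNIV. free_v i * free_f i) - 1 \<in> ?rel"
    unfolding alg_relations_def Let_def omega_omega leg_components_def
    by (rule UnI2, rule image_eqI[of _ _ "[]"])
      (simp_all add: leg_contract_def ev_def leg_prod_def leg1_def scaleC_if scaleC_one)
  from relation_zero[OF this]
  show "(\<Sum>i\<in>UNIV. v i * f i) = 1"
    by (simp add: free_eval_simps)
qed

lemma qpow_cancel: "x = qpow q a *C qpow q b *C y \<Longrightarrow> a + b = real_of_int z \<Longrightarrow> y = chain.qc powi (- z) *C x"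
  by (simp add: scaleC_scaleC qpow_mult qpow_powi) (simp flip: power_int_add add: scaleC_one)

lemma coord: "coord_algebra q (Suc r) pos f v"
proof
  show "0 < Suc r" by simp
  show "(\<Sum>i\<in>UNIV. v i * f i) = 1" by (rule coord_relations)
  fix i j
  have "(\<Sum>a\<in>UNIV. \<Sum>b\<in>UNIV. chain.Rm $ (i, j) $ (a, b) *C (f a * f b)) = chain.qc powi (- (-1)) *C (f i * f j)"
    by (rule qpow_cancel[of _ "- (1 - iN)" "- iN"], subst coord_relations(1))
      (simp_all add: braidings scaleC_vec_def scaleC_sum_right scaleC_scaleC scaleC_complex_def)
  then show "(\<Sum>a\<in>UNIV. \<Sum>b\<in>UNIV. chain.Rm $ (i, j) $ (a, b) *C (f a * f b)) = chain.qc *C (f i * f j)"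
    by simp
  have "(\<Sum>a\<in>UNIV. \<Sum>b\<in>UNIV. chain.Rs $ (i, j) $ (a, b) *C (v a * v b)) = chain.qc powi (- (-1)) *C (v i * v j)"
    by (rule qpow_cancel[of _ "- (1 - iN)" "- iN"], subst coord_relations(2))
      (simp_all add: braidings scaleC_vec_def scaleC_sum_right scaleC_scaleC scaleC_complex_def)
  then show "(\<Sum>a\<in>UNIV. \<Sum>b\<in>UNIV. chain.Rs $ (i, j) $ (a, b) *C (v a * v b)) = chain.qc *C (v i * v j)"
    by simp
  have "(\<Sum>a\<in>UNIV. \<Sum>b\<in>UNIV. chain.Xm $ (j, i) $ (a, b) *C (f a * v b)) = chain.qc powi (- 1) *C (v j * f i)"
    by (rule qpow_cancel[of _ "1 - iN" iN], subst coord_relations(3))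
      (simp_all add: braidings scaleC_vec_def scaleC_sum_right scaleC_scaleC scaleC_complex_def)
  then show "(\<Sum>a\<in>UNIV. \<Sum>b\<in>UNIV. chain.Xm $ (j, i) $ (a, b) *C (f a * v b)) = inverse chain.qc *C (v j * f i)"
    by (simp add: power_int_minus)
qed

sublocale coord: coord_algebra q "Suc r" pos f v
  by (rule coord)

end


section \<open>The calculus\<close>

lemma upt_4: "[0..<4] = [0, 1, 2, 3]"
  by (simp add: eval_nat_numeral)

lemma tr_4_prod: "tr 4 (leg_prod m 2 (leg2 x) (leg2 y)) = (\<lambda>\<phi>. m (x (\<phi> 0) (\<phi> 1)) (y (\<phi> 2) (\<phi> 3)))"
  by (simp add: fun_eq_iff tr_def upt_4 leg_prod_def leg2_def)

context quantum_projective_calculus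
begin

abbreviation "B \<equiv> proj_space f v"
abbreviation "relsp \<equiv> plus_relations q r s V wt free_act (pp f v) free_gen"
abbreviation "relsm \<equiv> minus_relations q r s V wt free_act (pp f v) free_gen"

lemma ev'_eq: "ev' q r wt i j = (if i = j then chain.wq i else 0)"
  by (simp add: ev'_def wq_wt)

lemma trace_relation: "leg_components 0 (leg_contract (ev' q r wt) 1 (leg2 free_gen)) =
    {\<Sum>a\<in>UNIV. chain.wq a *C (free_gen a a :: 'n \<Rightarrow> 'n \<Rightarrow> 'a)}"
  by (simp add: leg_components_def leg_contract_def leg2_def ev'_eq scaleC_if)

lemma plus_rels: "relsp = range (\<lambda>\<phi>. qpow q iN *C
    (chain.Lop chain.Rsi 2 0 (\<lambda>\<phi>. free_act (f (\<phi> 0) * v (\<phi> 1)) (free_gen (\<phi> 2) (\<phi> 3))) \<phi> -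
      inverse chain.qc *C free_act (f (\<phi> 0) * v (\<phi> 1)) (free_gen (\<phi> 2) (\<phi> 3)))) \<union>
    {\<Sum>a\<in>UNIV. chain.wq a *C free_gen a a}"
proof -
  let ?gp = "\<lambda>\<phi>. free_act (f (\<phi> 0) * v (\<phi> 1)) (free_gen (\<phi> 2) (\<phi> 3)) :: 'n \<Rightarrow> 'n \<Rightarrow> 'a"
  let ?pdp = "leg_prod free_act 2 (leg2 (pp f v)) (leg2 free_gen)"
  have 1: "tr 4 (St_op q r V 2 ?pdp) = qpow q iN *C chain.Lop chain.Rsi 2 0 ?gp"
  proof -
    have "tr 4 (St_op q r V (Suc 1) ?pdp) = qpow q iN *C chain.Stop 1 (tr 4 ?pdp)"
      by (rule tr_St_op) simp
    from this[unfolded Suc_1] show ?thesis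
      by (simp only: tr_4_prod pp_def One_nat_def chain.Stop_Lop)
  qed
  have 2: "qpow q (- (1 - iN)) = qpow q iN * inverse chain.qc"
    using qpow_mult[of iN "-1"] qpow_powi[of "-1"] by (simp add: power_int_minus add.commute)
  have "tr 4 (\<lambda>I. St_op q r V 2 ?pdp I - qpow q (- (1 - iN)) *C ?pdp I) \<phi> =
    tr 4 (St_op q r V 2 ?pdp) \<phi> - qpow q (- (1 - iN)) *C tr 4 ?pdp \<phi>" for \<phi>
    by (simp add: tr_def)
  then have "leg_components 4 (\<lambda>I. St_op q r V 2 ?pdp I - qpow q (- (1 - iN)) *C ?pdp I) =
    range (\<lambda>\<phi>. qpow q iN *C (chain.Lop chain.Rsi 2 0 ?gp \<phi> - inverse chain.qc *C ?gp \<phi>))"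
    unfolding leg_components_tr 1 2
    by (intro arg_cong[where f = range] ext) (simp add: tr_4_prod pp_def scaleC_diff_right scaleC_scaleC scaleC_fun_def[of _ "chain.Lop _ _ _ _"])
  then show ?thesis
    unfolding plus_relations_def Let_def omega_omega trace_relation by simp
qed

lemma minus_rels: "relsm = range (\<lambda>\<phi>. qpow q (- iN) *C
    (chain.Lop chain.Rm 0 0 (\<lambda>\<phi>. free_act (f (\<phi> 0) * v (\<phi> 1)) (free_gen (\<phi> 2) (\<phi> 3))) \<phi> -
      chain.qc *C free_act (f (\<phi> 0) * v (\<phi> 1)) (free_gen (\<phi> 2) (\<phi> 3)))) \<union>
    {\<Sum>a\<in>UNIV. chain.wq a *C free_gen a a}"
proof -
  let ?gp = "\<lambda>\<phi>. free_act (f (\<phi> 0) * v (\<phi> 1)) (free_gen (\<phi> 2) (\<phi> 3)) :: 'n \<Rightarrow> 'n \<Rightarrow> 'a"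
  let ?pdp = "leg_prod free_act 2 (leg2 (pp f v)) (leg2 free_gen)"
  have 1: "tr 4 (S_op q r V 1 ?pdp) = qpow q (- iN) *C chain.Lop chain.Rm 0 0 ?gp"
    using tr_S_op[of 0 4 ?pdp] by (simp add: tr_4_prod pp_def flip: chain.Sop_Lop)
  have 2: "qpow q (1 - iN) = qpow q (- iN) * chain.qc"
    using qpow_mult[of "- iN" 1] qpow_powi[of 1] by (simp add: add.commute)
  have "tr 4 (\<lambda>I. S_op q r V 1 ?pdp I - qpow q (1 - iN) *C ?pdp I) \<phi> =
    tr 4 (S_op q r V 1 ?pdp) \<phi> - qpow q (1 - iN) *C tr 4 ?pdp \<phi>" for \<phi>
    by (simp add: tr_def)
  then have "leg_components 4 (\<lambda>I. S_op q r V 1 ?pdp I - qpow q (1 - iN) *C ?pdp I) =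
    range (\<lambda>\<phi>. qpow q (- iN) *C (chain.Lop chain.Rm 0 0 ?gp \<phi> - chain.qc *C ?gp \<phi>))"
    unfolding leg_components_tr 1 2
    by (intro arg_cong[where f = range] ext) (simp add: tr_4_prod pp_def scaleC_diff_right scaleC_scaleC scaleC_fun_def[of _ "chain.Lop _ _ _ _"])
  then show ?thesis
    unfolding minus_relations_def Let_def omega_omega trace_relation by simp
qed

lemma qpow_2: "qpow q 2 = chain.qc * chain.qc" "qpow q (- 2) = inverse (chain.qc * chain.qc)"
  using qpow_powi[of 2] qpow_powi[of "-2"] by (simp_all add: power_int_minus power2_eq_square)

lemma right_fam:
  fixes M :: "('a, 'u::complex_vector) bimod"
  assumes "\<And>I. length I = 4 \<Longrightarrow> leg_prod (ract M) 2 (leg2 d) (leg2 (pp f v)) I =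
    c *C T_op q r V 1 (leg_prod (lact M) 2 (leg2 (pp f v)) (leg2 d)) I"
  shows "(\<lambda>\<phi>. ract M (d (\<phi> 0) (\<phi> 1)) (f (\<phi> 2) * v (\<phi> 3))) =
    c *C chain.Top 0 (\<lambda>\<phi>. lact M (f (\<phi> 0) * v (\<phi> 1)) (d (\<phi> 2) (\<phi> 3)))"
proof -
  have "tr 4 (leg_prod (ract M) 2 (leg2 d) (leg2 (pp f v))) =
    c *C tr 4 (T_op q r V 1 (leg_prod (lact M) 2 (leg2 (pp f v)) (leg2 d)))"
    by (simp add: fun_eq_iff tr_def assms scaleC_fun_def)
  then show ?thesis
    using tr_T_op[of 0 4 "leg_prod (lact M) 2 (leg2 (pp f v)) (leg2 d)"] by (simp add: tr_4_prod pp_def)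
qed

sublocale calc: flag_calculus q "Suc r" pos f v B Om_p "\<lambda>i j. del (pp f v i j)" relsp
  Om_m "\<lambda>i j. delbar (pp f v i j)" relsm
proof (rule flag_calculus.intro[OF coord flag_calculus_axioms.intro])
  have sub: "subalgebra B"
    by (rule proj_space_subalgebra)
  have pr: "presented_bimod B Om_p (\<lambda>i j. del (pp f v i j)) relsp" "presented_bimod B Om_m (\<lambda>i j. delbar (pp f v i j)) relsm"
    using sub bimodule presents_plus presents_minus
    by (simp_all add: presented_bimod_def presented_bimod_axioms_def bimod_over_def bimod_over_axioms_def)
  show "half_calculus q (Suc r) pos f v B Om_p (\<lambda>i j. del (pp f v i j)) relsp chain.Rsi 2 (inverse chain.qc) (chain.qc * chain.qc)"
    by (intro half_calculus.intro coord pr half_calculus_axioms.intro exI[of _ "qpow q iN"] conjI qpow_nz plus_rels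
        pp_closed right_fam[OF right_plus, unfolded alpha_alpha qpow_2])
      (simp_all, rule coord.proj_space_induct, blast+)
  show "half_calculus q (Suc r) pos f v B Om_m (\<lambda>i j. delbar (pp f v i j)) relsm chain.Rm 0 chain.qc (inverse (chain.qc * chain.qc))"
    by (intro half_calculus.intro coord pr half_calculus_axioms.intro exI[of _ "qpow q (- iN)"] conjI qpow_nz minus_rels
        pp_closed right_fam[OF right_minus, unfolded alpha_alpha qpow_2])
      (simp_all, rule coord.proj_space_induct, blast+)
qed

end

section \<open>The metric\<close>

lemma bimodule_direct_sum:
  assumes "bimodule B M" "bimodule B N"
  shows "bimodule B (direct_sum M N)"
  using assms unfolding bimodule_def direct_sum_def by (simp add: prod_eq_iff scaleC_prod_def)

lemma metric_part_eq:
  "metric_part q r wt tens x y = (\<Sum>a\<in>UNIV. \<Sum>c\<in>UNIV. qpow q (wform r (two_rho r) (wt a)) *C tens (x a c) (y c a))"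
  by (simp add: metric_part_def leg_contract_def leg_prod_def leg2_def ev'_def ev_def scaleC_if scaleC_one)
    (simp add: scaleC_sum_right)

lemma leg_prod_4: "length I = 4 \<Longrightarrow> leg_prod m 2 (leg2 x) (leg2 y) I = m (x (I ! 0) (I ! 1)) (y (I ! 2) (I ! 3))"
  using tr_nth[of I 4 "leg_prod m 2 (leg2 x) (leg2 y)"] by (simp add: tr_4_prod)

lemma fst_sum: "fst (sum g I) = (\<Sum>i\<in>I. fst (g i))" and snd_sum: "snd (sum g I) = (\<Sum>i\<in>I. snd (g i))"
  by (induction I rule: infinite_finite_induct) simp_all

locale quantum_projective_metric =
  quantum_projective_calculus q r s V wt f v Om_p del Om_m delbar +
  tensor_prod "proj_space f v" "direct_sum Om_p Om_m" "direct_sum Om_p Om_m" T tens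
  for q r s and V :: "'n::finite uq_rep" and wt and f v :: "'n \<Rightarrow> 'a::complex_algebra"
    and Om_p :: "('a, 'p::complex_vector) bimod" and del
    and Om_m :: "('a, 'm::complex_vector) bimod" and delbar
    and T :: "('a, 't::complex_vector) bimod" and tens
begin

abbreviation "Om \<equiv> direct_sum Om_p Om_m"
abbreviation "dp i j \<equiv> del (pp f v i j)"
abbreviation "dm i j \<equiv> delbar (pp f v i j)"

lemma subalgebra: "subalgebra B"
  by (rule proj_space_subalgebra)

sublocale Om: bimod_over B Om
  using subalgebra bimodule_direct_sum[OF bimodule] by (simp add: bimod_over_def bimod_over_axioms_def)

sublocale TB: bimod_over B T
  using subalgebra tensor_product unfolding tensor_product_def by (simp add: bimod_over_def bimod_over_axioms_def)

lemma tens_act: "b \<in> B \<Longrightarrow> lact T b (tens x y) = tens (lact Om b x) y"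
  "b \<in> B \<Longrightarrow> ract T (tens x y) b = tens x (ract Om y b)"
  using tensor_product unfolding tensor_product_def by blast+

lemma tens_linear:
  "tens (x + x') y = tens x y + tens x' y" "tens x (y + y') = tens x y + tens x y'"
  "b \<in> B \<Longrightarrow> tens (ract Om x b) y = tens x (lact Om b y)"
  using tens_balanced unfolding balanced_def by blast+

lemma act_pair: "lact Om b (x, y) = (lact Om_p b x, lact Om_m b y)" "ract Om (x, y) b = (ract Om_p x b, ract Om_m y b)"
  by (simp_all add: direct_sum_def)

definition bt :: "'p \<times> 'm \<Rightarrow> 'p \<times> 'm \<Rightarrow> 'a" where
  "bt x y = calc.pm.beta (fst x) (snd y) + calc.mp.beta (snd x) (fst y)"

lemma beta_zero: "calc.pm.beta 0 y = 0" "calc.pm.beta x 0 = 0" "calc.mp.beta 0 x = 0" "calc.mp.beta y 0 = 0"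
  using calc.pm.clinear_beta calc.mp.clinear_beta unfolding clinear_on_def by blast+

lemma bt_closed: "bt x y \<in> B"
  by (simp add: bt_def calc.P.add_closed calc.pm.beta_closed calc.mp.beta_closed)

lemma bt_add: "bt (x + x') y = bt x y + bt x' y" "bt x (y + y') = bt x y + bt x y'"
  by (simp_all add: bt_def calc.pm.beta_add_left calc.mp.beta_add_left calc.pm.beta_add_right calc.mp.beta_add_right)

lemma bt_scale: "bt (z *C x) y = z *C bt x y"
  using calc.pm.clinear_beta(1) calc.mp.clinear_beta(1) unfolding clinear_on_def
  by (simp add: bt_def scaleC_prod_def scaleC_add_right)

lemma bt_act: "b \<in> B \<Longrightarrow> bt (lact Om b x) y = b * bt x y" "b \<in> B \<Longrightarrow> bt x (ract Om y b) = bt x y * b"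
  "b \<in> B \<Longrightarrow> bt (ract Om x b) y = bt x (lact Om b y)"
  by (simp_all add: bt_def direct_sum_def calc.pm.beta_la calc.mp.beta_la distrib_left distrib_right
      calc.pm.beta_right_linear calc.mp.beta_right_linear calc.pm.beta_balanced calc.mp.beta_balanced)

lemma bt_balanced: "balanced B Om Om bt"
  unfolding balanced_def by (simp add: bt_add bt_scale bt_act)

lemma pairing_exists: "\<exists>\<phi>. bimodule_map_to B T \<phi> \<and> (\<forall>x y. \<phi> (tens x y) = bt x y)"
proof -
  obtain h where h: "\<And>s t. h (s + t) = h s + h t" "\<And>c t. h (c *C t) = c *C h t" "\<And>x y. h (tens x y) = bt x y"
    using tensor_lift[OF bt_balanced] by blast
  have h0: "h 0 = 0"
    using h(2)[of 0 0] by simp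
  have "h t \<in> B" for t
    by (rule tensor_induct[of "\<lambda>t. h t \<in> B"])
      (simp_all add: h h0 bt_closed calc.P.zero_closed calc.P.add_closed calc.P.scale_closed)
  moreover have "h (lact T b t) = b * h t" if b: "b \<in> B" for b t
    by (rule tensor_induct[of "\<lambda>t. h (lact T b t) = b * h t"])
      (simp_all add: b h h0 tens_act bt_act TB.la_zero TB.la_add TB.la_scaleC distrib_left mult_scaleC_right)
  moreover have "h (ract T t b) = h t * b" if b: "b \<in> B" for b t
    by (rule tensor_induct[of "\<lambda>t. h (ract T t b) = h t * b"])
      (simp_all add: b h h0 tens_act bt_act TB.ra_zero TB.ra_add TB.scaleC_ra distrib_right mult_scaleC_left)
  ultimately show ?thesis
    using h unfolding bimodule_map_to_def by blast
qed

lemma pairing_mp: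
  assumes "length I = 4"
  shows "leg_insert (coev' q r wt) 2 (leg2 (pp f v)) I -
      qpow q (- wform r (fund_weight r s) (two_rho r)) *C leg_prod (*) 2 (leg2 (pp f v)) (leg2 (pp f v)) I =
    calc.mp.beta (dm (I ! 0) (I ! 1)) (dp (I ! 2) (I ! 3))"
proof -
  obtain i j k l where I: "I = [i, j, k, l]"
    using assms by (auto simp: length_Suc_conv eval_nat_numeral)
  have "qpow q (- real r) = chain.qc powi (1 - int (Suc r))"
    using qpow_powi[of "1 - int (Suc r)"] by simp
  then show ?thesis
    unfolding leg_prod_4[OF assms] omega_rho calc.mp.beta_fam coord.beta_mp_eq
    unfolding I by (simp add: leg_insert_def leg2_def coev'_def wq_wt pp_def scaleC_if eval_nat_numeral)
qed

text \<open>Together with the factor q^(-1/N) of S, the coefficient of the first term has exponent 2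
  - (1 - 1/N + r) - 1/N = 2 - N, where N = r + 1; that of p p has exponent 2 - r = 3 - N.\<close>

lemma pairing_pm:
  assumes "length I = 4"
  shows "(qpow q (wform r (simple_root s) (simple_root s)) *
        qpow q (- wform r (fund_weight r s) (\<lambda>k. fund_weight r s k + two_rho r k))) *C
          S_op q r V 1 (leg_insert coev 3 (leg2 (pp f v))) I -
      (qpow q (wform r (simple_root s) (simple_root s)) * qpow q (- wform r (fund_weight r s) (two_rho r))) *C
        leg_prod (*) 2 (leg2 (pp f v)) (leg2 (pp f v)) I =
    calc.pm.beta (dp (I ! 0) (I ! 1)) (dm (I ! 2) (I ! 3))"
proof -
  have w: "wform r (fund_weight r s) (\<lambda>k. fund_weight r s k + two_rho r k) = 1 - iN + real r"
    unfolding omega_omega[symmetric] omega_rho[symmetric] by (simp add: wform_def distrib_left sum.distrib)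
  have X: "tr 4 (leg_insert coev 3 (leg2 (pp f v))) = pre f (pre v (ins (\<lambda>_. 1) 0 (\<lambda>_. 1)))"
    by (simp add: fun_eq_iff tr_def upt_4 leg_insert_def leg2_def coev_def pp_def coord.FWC_eq scaleC_if scaleC_one
        eval_nat_numeral)
  have "S_op q r V 1 (leg_insert coev 3 (leg2 (pp f v))) I =
    tr 4 (S_op q r V (Suc 0) (leg_insert coev 3 (leg2 (pp f v)))) ((!) I)"
    by (simp add: tr_nth assms)
  also have "\<dots> = qpow q (- iN) *C chain.Sop 0 (pre f (pre v (ins (\<lambda>_. 1) 0 (\<lambda>_. 1)))) ((!) I)"
    by (subst tr_S_op) (simp_all add: X scaleC_fun_def)
  finally have S: "S_op q r V 1 (leg_insert coev 3 (leg2 (pp f v))) I = \<dots>" .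
  have 1: "qpow q 2 * qpow q (- (1 - iN + real r)) * qpow q (- iN) = chain.qc powi (2 - int (Suc r))"
    unfolding qpow_mult using qpow_powi[of "2 - int (Suc r)"] by (simp add: algebra_simps)
  have 2: "qpow q 2 * qpow q (- real r) = chain.qc powi (3 - int (Suc r))"
    unfolding qpow_mult using qpow_powi[of "3 - int (Suc r)"] by (simp add: algebra_simps)
  show ?thesis
    unfolding leg_prod_4[OF assms] S w alpha_alpha omega_rho scaleC_scaleC 1 2 calc.pm.beta_fam coord.beta_pm_eq
    by (simp add: pp_def)
qed

text \<open>The conditions fix the values on generators. Left linearity spreads them over the first
  argument and balancing over the second, separately for the off-diagonal components
  \<open>\<gamma>\<close> and \<open>\<delta>\<close>; the diagonal components vanish on both
  sides.\<close>

lemma inverse_metric_iff: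
  "inverse_metric q r s V wt f v del delbar T tens \<phi> \<longleftrightarrow>
     bimodule_map_to B T \<phi> \<and> (\<forall>x y. \<phi> (tens x y) = bt x y)" (is "?L \<longleftrightarrow> ?R")
proof
  assume R: ?R
  then have \<phi>: "\<phi> (tens x y) = bt x y" for x y by blast
  have mp: "leg_prod (\<lambda>x y. \<phi> (tens x y)) 2 (leg2 (dp_minus f v delbar)) (leg2 (dp_plus f v del)) I =
      calc.mp.beta (dm (I ! 0) (I ! 1)) (dp (I ! 2) (I ! 3))"
    and pm: "leg_prod (\<lambda>x y. \<phi> (tens x y)) 2 (leg2 (dp_plus f v del)) (leg2 (dp_minus f v delbar)) I =
      calc.pm.beta (dp (I ! 0) (I ! 1)) (dm (I ! 2) (I ! 3))" if "length I = 4" for I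
    by (simp_all add: leg_prod_4[OF that] \<phi> bt_def beta_zero dp_plus_def dp_minus_def)
  show ?L
    unfolding inverse_metric_def Let_def
  proof (intro conjI allI impI)
    show "bimodule_map_to B T \<phi>" using R by blast
  qed (simp_all only: mp pm pairing_mp pairing_pm, simp_all add: \<phi> bt_def beta_zero)
next
  assume L: ?L
  note L = L[unfolded inverse_metric_def Let_def]
  from L have \<phi>: "bimodule_map_to B T \<phi>" by blast
  then have \<phi>_add: "\<phi> (x + y) = \<phi> x + \<phi> y" and \<phi>_closed: "\<phi> x \<in> B" and \<phi>_la: "b \<in> B \<Longrightarrow> \<phi> (lact T b x) = b * \<phi> x" for x y b
    unfolding bimodule_map_to_def by blast+
  have z: "\<phi> (tens (x, 0) (y, 0)) = 0" "\<phi> (tens (0, x') (0, y')) = 0" for x y x' y'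
    using L by blast+
  define \<gamma> where "\<gamma> x y = \<phi> (tens (x, 0) (0, y))" for x y
  define \<delta> where "\<delta> x y = \<phi> (tens (0, x) (y, 0))" for x y
  have add: "\<phi> (tens (x + x') y) = \<phi> (tens x y) + \<phi> (tens x' y)" "\<phi> (tens x (y + y')) = \<phi> (tens x y) + \<phi> (tens x y')" for x x' y y'
    by (simp_all add: tens_linear \<phi>_add)
  have \<gamma>_add: "\<gamma> (x + x') y = \<gamma> x y + \<gamma> x' y" "\<gamma> x (y + y') = \<gamma> x y + \<gamma> x y'" for x x' y y'
    using add(1)[of "(x, 0)" "(x', 0)"] add(2)[of "(x, 0)" "(0, y)" "(0, y')"] by (simp_all add: \<gamma>_def)
  have \<delta>_add: "\<delta> (x + x') y = \<delta> x y + \<delta> x' y" "\<delta> x (y + y') = \<delta> x y + \<delta> x y'" for x x' y y'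
    using add(1)[of "(0, x)" "(0, x')"] add(2)[of "(0, x)" "(y, 0)" "(y', 0)"] by (simp_all add: \<delta>_def)
  have \<gamma>_la: "left_linear B Om_p (\<lambda>x. \<gamma> x y)" for y
    unfolding left_linear_def
    using \<phi>_closed \<gamma>_add(1) \<phi>_la[OF _, of _ "tens (_, 0) (0, y)"]
    by (auto simp: \<gamma>_def tens_act act_pair calc.M.la_zero)
  have \<delta>_la: "left_linear B Om_m (\<lambda>x. \<delta> x y)" for y
    unfolding left_linear_def
    using \<phi>_closed \<delta>_add(1) \<phi>_la[OF _, of _ "tens (0, _) (y, 0)"]
    by (auto simp: \<delta>_def tens_act act_pair calc.P.la_zero)
  have \<gamma>_bal: "\<gamma> (ract Om_p x b) y = \<gamma> x (lact Om_m b y)" if "b \<in> B" for x y b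
    using tens_linear(3)[OF that, of "(x, 0)" "(0, y)"] that by (simp add: \<gamma>_def act_pair calc.M.ra_zero calc.P.la_zero)
  have \<delta>_bal: "\<delta> (ract Om_m x b) y = \<delta> x (lact Om_p b y)" if "b \<in> B" for x y b
    using tens_linear(3)[OF that, of "(0, x)" "(y, 0)"] that by (simp add: \<delta>_def act_pair calc.P.ra_zero calc.M.la_zero)
  have \<gamma>_gen: "\<gamma> (dp i j) (dm k l) = calc.pm.beta (dp i j) (dm k l)" for i j k l
  proof -
    have I: "length [i, j, k, l] = 4" by simp
    from L have "leg_prod (\<lambda>x y. \<phi> (tens x y)) 2 (leg2 (dp_plus f v del)) (leg2 (dp_minus f v delbar)) [i, j, k, l] =
      calc.pm.beta (dp i j) (dm k l)"
      using pairing_pm[OF I] by (simp add: eval_nat_numeral)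
    then show ?thesis
      unfolding leg_prod_4[OF I] by (simp add: \<gamma>_def dp_plus_def dp_minus_def eval_nat_numeral)
  qed
  have \<delta>_gen: "\<delta> (dm i j) (dp k l) = calc.mp.beta (dm i j) (dp k l)" for i j k l
  proof -
    have I: "length [i, j, k, l] = 4" by simp
    from L have "leg_prod (\<lambda>x y. \<phi> (tens x y)) 2 (leg2 (dp_minus f v delbar)) (leg2 (dp_plus f v del)) [i, j, k, l] =
      calc.mp.beta (dm i j) (dp k l)"
      using pairing_mp[OF I] by (simp add: eval_nat_numeral)
    then show ?thesis
      unfolding leg_prod_4[OF I] by (simp add: \<delta>_def dp_plus_def dp_minus_def eval_nat_numeral)
  qed
  have "\<forall>x. \<gamma> x y = calc.pm.beta x y" for y
  proof (rule calc.M.left_span[of "\<lambda>y. \<forall>x. \<gamma> x y = calc.pm.beta x y"])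
    show "\<forall>x. \<gamma> x (dm k l) = calc.pm.beta x (dm k l)" for k l
      using calc.P.left_linear_eqI[OF \<gamma>_la calc.pm.beta_left_linear \<gamma>_gen] by blast
  qed (simp_all add: \<gamma>_add calc.pm.beta_add_right calc.pm.beta_balanced flip: \<gamma>_bal)
  then have \<gamma>: "\<gamma> x y = calc.pm.beta x y" for x y by blast
  have "\<forall>x. \<delta> x y = calc.mp.beta x y" for y
  proof (rule calc.P.left_span[of "\<lambda>y. \<forall>x. \<delta> x y = calc.mp.beta x y"])
    show "\<forall>x. \<delta> x (dp k l) = calc.mp.beta x (dp k l)" for k l
      using calc.M.left_linear_eqI[OF \<delta>_la calc.mp.beta_left_linear \<delta>_gen] by blast
  qed (simp_all add: \<delta>_add calc.mp.beta_add_right calc.mp.beta_balanced flip: \<delta>_bal)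
  then have \<delta>: "\<delta> x y = calc.mp.beta x y" for x y by blast
  have "\<phi> (tens x y) = bt x y" for x y
  proof -
    have "\<phi> (tens ((fst x, 0) + (0, snd x)) ((fst y, 0) + (0, snd y))) = \<gamma> (fst x) (snd y) + \<delta> (snd x) (fst y)"
      unfolding add \<gamma>_def \<delta>_def z by simp
    then show ?thesis
      by (simp add: \<gamma> \<delta> bt_def)
  qed
  with \<phi> show ?R by blast
qed

lemma ex1_inverse_metric: "\<exists>!\<phi>. inverse_metric q r s V wt f v del delbar T tens \<phi>"
proof -
  obtain \<phi> where \<phi>: "bimodule_map_to B T \<phi>" "\<forall>x y. \<phi> (tens x y) = bt x y"
    using pairing_exists by blast
  have "\<phi>' = \<phi>" if \<phi>': "bimodule_map_to B T \<phi>' \<and> (\<forall>x y. \<phi>' (tens x y) = bt x y)" for \<phi>'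
  proof
    fix t
    have scale: "\<psi> (c *C t) = c *C \<psi> t" if "bimodule_map_to B T \<psi>" for \<psi> c t
    proof -
      have "\<psi> (lact T (c *C 1) t) = (c *C 1) * \<psi> t"
        using that calc.P.scalar_closed unfolding bimodule_map_to_def by blast
      then show ?thesis
        by (simp add: TB.scalar_la mult_scaleC_left)
    qed
    have add: "\<psi> (s + t) = \<psi> s + \<psi> t" if "bimodule_map_to B T \<psi>" for \<psi> s t
      using that unfolding bimodule_map_to_def by blast
    have "\<phi>' 0 = \<phi> 0"
      using scale[of \<phi> 0 0] scale[of \<phi>' 0 0] \<phi> \<phi>' by simp
    then show "\<phi>' t = \<phi> t"
    proof (rule tensor_induct[of "\<lambda>t. \<phi>' t = \<phi> t", rotated])
      show "\<phi>' (tens x y) = \<phi> (tens x y)" for x y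
        using \<phi>(2) \<phi>' by metis
    qed (simp_all only: scale[OF \<phi>(1)] scale[OF conjunct1[OF \<phi>']] add[OF \<phi>(1)] add[OF conjunct1[OF \<phi>']])
  qed
  then show ?thesis
    unfolding inverse_metric_iff using \<phi> by blast
qed

abbreviation "g \<equiv> metric_formula q r wt tens (dp_plus f v del) (dp_minus f v delbar)"

lemma g_eq: "g = (\<Sum>a\<in>UNIV. \<Sum>c\<in>UNIV. chain.wq a *C tens (dp a c, 0) (0, dm c a)) +
    (\<Sum>a\<in>UNIV. \<Sum>c\<in>UNIV. chain.wq a *C tens (0, dm a c) (dp c a, 0))"
  by (simp add: metric_formula_def metric_part_eq wq_wt dp_plus_def dp_minus_def)

lemma additive_g:
  assumes h: "\<And>s t. h (s + t) = h s + h t" "\<And>c t. h (c *C t) = c *C h t"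
  shows "h g = (\<Sum>a\<in>UNIV. \<Sum>c\<in>UNIV. chain.wq a *C h (tens (dp a c, 0) (0, dm c a))) +
    (\<Sum>a\<in>UNIV. \<Sum>c\<in>UNIV. chain.wq a *C h (tens (0, dm a c) (dp c a, 0)))"
proof -
  have "h 0 = 0" using h(2)[of 0 0] by simp
  then have "h (sum u I) = (\<Sum>i\<in>I. h (u i))" for u and I :: "'n set"
    by (induction I rule: infinite_finite_induct) (simp_all add: h)
  then show ?thesis
    unfolding g_eq by (simp add: h)
qed

lemma additive_list:
  assumes h: "\<And>s t. h (s + t) = h s + h t" "\<And>c t. h (c *C t) = c *C h t"
    and h': "\<And>x y. h (tens x y) = h' x y"
  shows "h (\<Sum>(x, y)\<leftarrow>gs. tens x y) = (\<Sum>(x, y)\<leftarrow>gs. h' x y)"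
proof -
  have "h 0 = 0" using h(2)[of 0 0] by simp
  then show ?thesis
    by (induction gs) (auto simp: h h')
qed

text \<open>The expressions x (y, \<omega>) and (\<omega>, x) y are balanced in x and y, so they
  factor through the tensor product. The sum therefore depends on g only and may be computed from
  its defining formula.\<close>

lemma inverts_g:
  assumes \<phi>: "\<And>x y. \<phi> (tens x y) = bt x y"
  shows "inverts Om tens \<phi> g"
  unfolding inverts_def
proof (intro allI impI conjI)
  fix \<omega> and gs :: "(('p \<times> 'm) \<times> ('p \<times> 'm)) list"
  assume g: "g = (\<Sum>(x, y)\<leftarrow>gs. tens x y)"
  have "balanced B Om Om (\<lambda>x y. ract Om x (bt y \<omega>))"
    unfolding balanced_def
    by (simp add: Om.ra_add Om.add_ra Om.scaleC_ra Om.mult_ra[symmetric] bt_closed bt_add bt_act)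
  from tensor_lift[OF this] obtain h where h: "\<And>s t. h (s + t) = h s + h t" "\<And>c t. h (c *C t) = c *C h t"
    "\<And>x y. h (tens x y) = ract Om x (bt y \<omega>)"
    by blast
  have "h g = (\<Sum>(x, y)\<leftarrow>gs. ract Om x (\<phi> (tens y \<omega>)))"
    unfolding g \<phi> by (rule additive_list) (rule h)+
  moreover have "h g = \<omega>"
    unfolding additive_g[OF h(1,2)] h(3)
    by (simp add: prod_eq_iff act_pair bt_def beta_zero fst_sum snd_sum scaleC_prod_def calc.P.ra_zero calc.M.ra_zero
        calc.mp.beta_closed calc.pm.beta_closed calc.inverse_plus_left calc.inverse_minus_left)
  ultimately show "(\<Sum>(x, y)\<leftarrow>gs. ract Om x (\<phi> (tens y \<omega>))) = \<omega>"
    by simp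
  have "balanced B Om Om (\<lambda>x y. lact Om (bt \<omega> x) y)"
    unfolding balanced_def
  proof (intro conjI allI ballI)
    show "lact Om (bt \<omega> (c *C x)) y = c *C lact Om (bt \<omega> x) y" for c x y
    proof -
      have "bt \<omega> (c *C x) = c *C bt \<omega> x"
        using bt_act(2)[OF calc.P.scalar_closed, of \<omega> x c] by (simp add: Om.scalar_ra mult_scaleC_right)
      then show ?thesis
        by (simp add: Om.scaleC_la bt_closed)
    qed
  qed (simp_all add: Om.la_add Om.add_la Om.mult_la bt_closed bt_add bt_act)
  from tensor_lift[OF this] obtain h where h: "\<And>s t. h (s + t) = h s + h t" "\<And>c t. h (c *C t) = c *C h t"
    "\<And>x y. h (tens x y) = lact Om (bt \<omega> x) y"
    by blast
  have "h g = (\<Sum>(x, y)\<leftarrow>gs. lact Om (\<phi> (tens \<omega> x)) y)"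
    unfolding g \<phi> by (rule additive_list) (rule h)+
  moreover have "h g = \<omega>"
    unfolding additive_g[OF h(1,2)] h(3)
    by (simp add: prod_eq_iff act_pair bt_def beta_zero fst_sum snd_sum scaleC_prod_def calc.P.la_zero calc.M.la_zero
        calc.mp.beta_closed calc.pm.beta_closed calc.inverse_plus_right calc.inverse_minus_right)
  ultimately show "(\<Sum>(x, y)\<leftarrow>gs. lact Om (\<phi> (tens \<omega> x)) y) = \<omega>"
    by simp
qed

lemma quantum_metric_g:
  "(\<exists>!\<phi>. inverse_metric q r s V wt f v del delbar T tens \<phi>) \<and>
   (\<forall>\<phi>. inverse_metric q r s V wt f v del delbar T tens \<phi> \<longrightarrow> inverts Om tens \<phi> g) \<and>
   quantum_metric B Om T tens g"
proof (intro conjI allI impI ex1_inverse_metric)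
  show "inverts Om tens \<phi> g" if "inverse_metric q r s V wt f v del delbar T tens \<phi>" for \<phi>
    using that unfolding inverse_metric_iff by (intro inverts_g) blast
  show "quantum_metric B Om T tens g"
    unfolding quantum_metric_def using pairing_exists inverts_g by blast
qed

end

section \<open>The classical limit\<close>

lemma sum_option: 
  assumes "bij (h :: 'k::finite option \<Rightarrow> 'n::finite)"
  shows "(\<Sum>i\<in>UNIV. G (inv h i)) = G None + (\<Sum>k\<in>UNIV. G (Some k))"
proof -
  have "(\<Sum>i\<in>UNIV. G (inv h i)) = (\<Sum>j\<in>UNIV. G (inv h (h j)))"
    by (rule sum.reindex_bij_betw[symmetric]) (use assms in simp)
  also have "\<dots> = (\<Sum>j\<in>UNIV. G j)"
    using assms by (simp add: bij_is_inj)
  also have "\<dots> = G None + (\<Sum>k\<in>UNIV. G (Some k))"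
    by (simp add: UNIV_option_conv sum.reindex)
  finally show ?thesis .
qed

definition hom_tangent :: "('k option \<Rightarrow> 'n) \<Rightarrow> complex^'k::finite \<Rightarrow> 'n \<Rightarrow> complex" where
  "hom_tangent h u i = (case inv h i of None \<Rightarrow> 0 | Some k \<Rightarrow> u $ k)"

lemma hom_tangent_ii: "hom_tangent h (\<i> *C u) i = \<i> * hom_tangent h u i"
  by (simp add: hom_tangent_def scaleC_vec_def scaleC_complex_def split: option.split)

lemma hom_coord_deriv: "((\<lambda>z. hom_coord h z i) has_derivative (\<lambda>u. hom_tangent h u i)) (at z)"
  unfolding hom_coord_def hom_tangent_def
  by (cases "inv h i") (auto intro!: derivative_eq_intros bounded_linear_imp_has_derivative bounded_linear_vec_nth)

context
  fixes h :: "'k::finite option \<Rightarrow> 'n::finite" and z :: "complex^'k"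
  assumes h: "bij h"
begin

abbreviation (input) "Z \<equiv> hom_coord h z"
abbreviation (input) "U \<equiv> hom_tangent h"
text \<open>The squared norm of the homogeneous coordinates; \<open>az u\<close> is the Hermitian
  product of the tangent vector with them. The derivatives of p are written in terms of these
  two.\<close>

definition "nz = (\<Sum>k\<in>UNIV. Z k * cnj (Z k))"
definition "az u = (\<Sum>k\<in>UNIV. U u k * cnj (Z k))"

lemma nz_eq: "nz = of_real (1 + (norm z)\<^sup>2)"
proof -
  have "nz = (\<Sum>i\<in>UNIV. (\<lambda>j. (case j of None \<Rightarrow> 1 | Some k \<Rightarrow> z $ k) * cnj (case j of None \<Rightarrow> 1 | Some k \<Rightarrow> z $ k)) (inv h i))"
    unfolding nz_def hom_coord_def ..
  also have "\<dots> = 1 + (\<Sum>k\<in>UNIV. z $ k * cnj (z $ k))"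
    by (subst sum_option[OF h]) simp
  also have "\<dots> = of_real (1 + (norm z)\<^sup>2)"
    by (simp add: norm_vec_def L2_set_def sum_nonneg complex_norm_square[symmetric])
  finally show ?thesis .
qed

lemma nz_nonzero: "nz \<noteq> 0"
proof -
  have "1 + (norm z)\<^sup>2 \<noteq> 0"
    by (smt (verit) zero_le_power2)
  then show ?thesis
    unfolding nz_eq by (metis of_real_eq_0_iff)
qed

lemma az_eq: "az u = (\<Sum>k\<in>UNIV. u $ k * cnj (z $ k))"
proof -
  have "az u = (\<Sum>i\<in>UNIV. (\<lambda>j. (case j of None \<Rightarrow> 0 | Some k \<Rightarrow> u $ k) * cnj (case j of None \<Rightarrow> 1 | Some k \<Rightarrow> z $ k)) (inv h i))"
    unfolding az_def hom_coord_def hom_tangent_def ..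
  then show ?thesis
    by (subst (asm) sum_option[OF h]) simp
qed

lemma tangent_sum: "(\<Sum>k\<in>UNIV. U u k * cnj (U w k)) = (\<Sum>k\<in>UNIV. u $ k * cnj (w $ k))"
proof -
  have "(\<Sum>k\<in>UNIV. U u k * cnj (U w k)) =
    (\<Sum>i\<in>UNIV. (\<lambda>j. (case j of None \<Rightarrow> 0 | Some k \<Rightarrow> u $ k) * cnj (case j of None \<Rightarrow> 0 | Some k \<Rightarrow> w $ k)) (inv h i))"
    unfolding hom_tangent_def ..
  then show ?thesis
    by (subst (asm) sum_option[OF h]) simp
qed

lemma az_ii: "az (\<i> *C u) = \<i> * az u"
  by (simp add: az_def hom_tangent_ii sum_distrib_left mult.assoc)

lemma cnj_az: "cnj (az u) = (\<Sum>k\<in>UNIV. Z k * cnj (U u k))"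
  by (simp add: az_def mult.commute)

lemma classical_p_deriv: "frechet_derivative (classical_p h i j) (at z) u =
    ((U u i * cnj (Z j) + Z i * cnj (U u j)) * nz - Z i * cnj (Z j) * (az u + cnj (az u))) / (nz * nz)"
proof -
  have p: "classical_p h i j = (\<lambda>z. hom_coord h z i * cnj (hom_coord h z j) /
      (\<Sum>k\<in>UNIV. hom_coord h z k * cnj (hom_coord h z k)))"
    by (simp add: fun_eq_iff classical_p_def complex_norm_square[symmetric])
  note c = has_derivative_cnj[OF hom_coord_deriv[of h _ z]]
  have d: "((\<lambda>z. \<Sum>k\<in>UNIV. hom_coord h z k * cnj (hom_coord h z k)) has_derivative
      (\<lambda>u. \<Sum>k\<in>UNIV. Z k * cnj (U u k) + U u k * cnj (Z k))) (at z)"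
    by (intro has_derivative_sum has_derivative_mult hom_coord_deriv c)
  have n: "(\<Sum>k\<in>UNIV. Z k * cnj (Z k)) \<noteq> 0"
    using nz_nonzero unfolding nz_def .
  have "(classical_p h i j has_derivative (\<lambda>u. ((Z i * cnj (U u j) + U u i * cnj (Z j)) * nz -
      Z i * cnj (Z j) * (\<Sum>k\<in>UNIV. Z k * cnj (U u k) + U u k * cnj (Z k))) / (nz * nz))) (at z)"
    unfolding p nz_def by (rule has_derivative_divide'[OF has_derivative_mult[OF hom_coord_deriv c] d n])
  from frechet_derivative_at[OF this, symmetric] show ?thesis
    by (simp add: cnj_az sum.distrib add.commute flip: az_def)
qed

lemma dolbeault_p: "dolbeault (classical_p h i j) z u = (U u i * cnj (Z j) * nz - Z i * cnj (Z j) * az u) / (nz * nz)"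
  unfolding dolbeault_def classical_p_deriv hom_tangent_ii az_ii
  using nz_nonzero by (simp add: field_simps)

lemma dolbeault_bar_p: "dolbeault_bar (classical_p h i j) z u =
    (Z i * cnj (U u j) * nz - Z i * cnj (Z j) * cnj (az u)) / (nz * nz)"
  unfolding dolbeault_bar_def classical_p_deriv hom_tangent_ii az_ii
  using nz_nonzero by (simp add: field_simps)

text \<open>Each product of differentials splits into four terms in which the sums over
  \<open>a\<close> and \<open>c\<close> separate. The sum over \<open>c\<close> is
  \<open>nz\<close>, and of the three terms with \<open>az\<close> two have a negative and one a
  positive sign, which leaves one.\<close>

lemma dolbeault_sum: "(\<Sum>a\<in>UNIV. \<Sum>c\<in>UNIV. dolbeault (classical_p h a c) z u * dolbeault_bar (classical_p h c a) z w) =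
    (\<Sum>k\<in>UNIV. U u k * cnj (U w k)) / nz - az u * cnj (az w) / (nz * nz)"
proof -
  define S where "S = (\<Sum>k\<in>UNIV. U u k * cnj (U w k))"
  have "dolbeault (classical_p h a c) z u * dolbeault_bar (classical_p h c a) z w =
    ((Z c * cnj (Z c)) * (nz * nz * (U u a * cnj (U w a)) - nz * cnj (az w) * (U u a * cnj (Z a))
      - nz * az u * (Z a * cnj (U w a)) + az u * cnj (az w) * (Z a * cnj (Z a)))) / (nz * nz * nz * nz)" for a c
    unfolding dolbeault_p dolbeault_bar_p by (simp add: algebra_simps)
  then have "(\<Sum>a\<in>UNIV. \<Sum>c\<in>UNIV. dolbeault (classical_p h a c) z u * dolbeault_bar (classical_p h c a) z w) =
    (nz * (nz * nz * S - nz * cnj (az w) * az u - nz * az u * cnj (az w) + az u * cnj (az w) * nz)) / (nz * nz * nz * nz)"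
    by (simp add: sum_divide_distrib[symmetric] sum_distrib_right[symmetric] sum_distrib_left[symmetric] sum.distrib
        sum_subtractf S_def cnj_az flip: nz_def az_def)
  also have "\<dots> = S / nz - az u * cnj (az w) / (nz * nz)"
    using nz_nonzero by (simp add: field_simps)
  finally show ?thesis
    unfolding S_def .
qed

text \<open>At q = 1 all weights of E' are 1. Interchanging the two sums identifies the second half
  of g with the first at exchanged tangent vectors, and this gives the symmetrised tensor of the
  Fubini-Study form.\<close>

lemma classical_limit:
  "metric_formula 1 r wt form_tensor
     (\<lambda>i j. dolbeault (classical_p h i j) z) (\<lambda>i j. dolbeault_bar (classical_p h i j) z) = fubini_study z"
proof (intro ext)
  fix u w
  let ?D = "\<lambda>a c. dolbeault (classical_p h a c) z" and ?D' = "\<lambda>a c. dolbeault_bar (classical_p h a c) z"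
  have fun_sum: "sum G I x = (\<Sum>i\<in>I. G i x)" for G :: "'n \<Rightarrow> 'y \<Rightarrow> 'u::comm_monoid_add" and I x
    by (induction I rule: infinite_finite_induct) simp_all
  have fun_sum': "sum G I x = (\<Sum>i\<in>I. G i x)" for G :: "'k \<Rightarrow> 'y \<Rightarrow> 'u::comm_monoid_add" and I x
    by (induction I rule: infinite_finite_induct) simp_all
  have part: "metric_part 1 r wt form_tensor X Y u w = (\<Sum>a\<in>UNIV. \<Sum>c\<in>UNIV. X a c u * Y c a w)"
    for X Y :: "'n \<Rightarrow> 'n \<Rightarrow> complex^'k \<Rightarrow> complex" and u w
    by (simp add: metric_part_eq qpow_def scaleC_one fun_sum form_tensor_def)
  have swap: "(\<Sum>a\<in>UNIV. \<Sum>c\<in>UNIV. ?D' a c u * ?D c a w) = (\<Sum>a\<in>UNIV. \<Sum>c\<in>UNIV. ?D a c w * ?D' c a u)"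
    by (subst sum.swap) (simp add: mult.commute)
  have fs: "(\<Sum>i\<in>UNIV. \<Sum>j\<in>UNIV. (nz * (if i = j then 1 else 0) - x i * y j) / (nz * nz) * (a i * b j)) =
    (\<Sum>k\<in>UNIV. a k * b k) / nz - (\<Sum>k\<in>UNIV. a k * x k) * (\<Sum>k\<in>UNIV. b k * y k) / (nz * nz)"
    for x y a b :: "'k \<Rightarrow> complex"
  proof -
    have "(nz * (if i = j then 1 else 0) - x i * y j) / (nz * nz) * (a i * b j) =
      (if i = j then a i * b j / nz else 0) - (a i * x i) * (b j * y j) / (nz * nz)" for i j
      using nz_nonzero by (simp add: field_simps)
    then show ?thesis
      by (simp add: sum_subtractf sum_divide_distrib sum_product)
  qed
  have f: "fubini_study z u w =
    (\<Sum>i\<in>UNIV. \<Sum>j\<in>UNIV. (nz * (if i = j then 1 else 0) - cnj (z $ i) * z $ j) / (nz * nz) * (u $ i * cnj (w $ j))) +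
    (\<Sum>i\<in>UNIV. \<Sum>j\<in>UNIV. (nz * (if i = j then 1 else 0) - cnj (z $ i) * z $ j) / (nz * nz) * (w $ i * cnj (u $ j)))"
    unfolding fubini_study_def nz_eq of_real_mult[symmetric] power2_eq_square[symmetric]
    by (simp add: fun_sum' scaleC_fun_def scaleC_complex_def form_tensor_def dz_def dzbar_def distrib_left sum.distrib
        mult.commute[of "cnj (u $ _)"])
  show "metric_formula 1 r wt form_tensor ?D ?D' u w = fubini_study z u w"
    unfolding metric_formula_def plus_fun_apply part swap dolbeault_sum tangent_sum az_eq f fs
    by (simp add: mult.commute)
qed

end

theorem theorem6p11:
  fixes q :: real and r s :: nat
    and V :: "'n::finite uq_rep" and wt :: "'n \<Rightarrow> weight"
    and f v :: "'n \<Rightarrow> 'a::complex_algebra"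
    and Om_p :: "('a, 'p::complex_vector) bimod" and del :: "'a \<Rightarrow> 'p"
    and Om_m :: "('a, 'm::complex_vector) bimod" and delbar :: "'a \<Rightarrow> 'm"
    and T :: "('a, 't::complex_vector) bimod" and tens :: "'p \<times> 'm \<Rightarrow> 'p \<times> 'm \<Rightarrow> 't"
  assumes "quantum_projective_calculus q r s V wt f v Om_p del Om_m delbar"
    and "tensor_product (proj_space f v) (direct_sum Om_p Om_m) (direct_sum Om_p Om_m) T tens"
  shows
    "(let Om = direct_sum Om_p Om_m;
          g = metric_formula q r wt tens (dp_plus f v del) (dp_minus f v delbar)
      in (\<exists>!\<phi>. inverse_metric q r s V wt f v del delbar T tens \<phi>) \<and>
         (\<forall>\<phi>. inverse_metric q r s V wt f v del delbar T tens \<phi> \<longrightarrow> inverts Om tens \<phi> g) \<and>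
         quantum_metric (proj_space f v) Om T tens g) \<and>
     (\<forall>(h :: 'k::finite option \<Rightarrow> 'n) z. bij h \<longrightarrow>
        metric_formula 1 r wt form_tensor
          (\<lambda>i j. dolbeault (classical_p h i j) z) (\<lambda>i j. dolbeault_bar (classical_p h i j) z)
        = fubini_study z)"
proof (intro conjI allI impI)
  have "quantum_projective_metric q r s V wt f v Om_p del Om_m delbar T tens"
    using assms by (intro quantum_projective_metric.intro tensor_prod.intro)
  then show "let Om = direct_sum Om_p Om_m;
      g = metric_formula q r wt tens (dp_plus f v del) (dp_minus f v delbar)
    in (\<exists>!\<phi>. inverse_metric q r s V wt f v del delbar T tens \<phi>) \<and>
       (\<forall>\<phi>. inverse_metric q r s V wt f v del delbar T tens \<phi> \<longrightarrow> inverts Om tens \<phi> g) \<and>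
       quantum_metric (proj_space f v) Om T tens g"
    unfolding Let_def by (rule quantum_projective_metric.quantum_metric_g)
qed (rule classical_limit)

end
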